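(* Let $E$ be a $W^*$-correspondence over a $W^*$-algebra $M$, let $\pi:M\to B(H)$ be a faithful normal representation, let $\rho_0=\rho_\pi$ be the induced representation of $H^\infty(E)$ on $\mathcal{F}(E)\otimes_\pi H$, and let $Q$ be the orthogonal projection of $\mathcal{F}(E)\otimes_\pi H$ onto the generalized symmetric subspace $\mathfrak{M}$. Then the compressed algebra $$Q\rho_0(H^{\infty}(E))|_{\mathfrak{M}}=\{Q\rho_0(X)|_{\mathfrak{M}}:X\in H^\infty(E)\}\subseteq B(\mathfrak{M})$$ is reflexive.
   Context: A Hilbert $W^*$-module over a $W^*$-algebra $M$ is a self-dual right Hilbert $C^*$-module $E$ over $M$ (the $M$-valued inner product is linear in the second variable); $\mathcal{L}(E)$ is the $W^*$-algebra of adjointable operators on $E$. $E$ is a dual Banach space; its weak$^*$-topology is called the $\sigma$-topology. A $W^*$-correspondence over $M$ is a Hilbert $W^*$-module $E$ over $M$ with a left action given by a normal $*$-homomorphism $\phi:M\to\mathcal{L}(E)$; it is always assumed essential: $\phi(M)E$ is dense in $E$ in the $\sigma$-topology. $E^{\otimes 0}=M$ with $\phi_0(a)b=ab$; for $n\ge1$, $E^{\otimes n}$ is the self-dual completion of the internal tensor power balanced over $\phi$ (inner product $\langle\xi_1\otimes\eta_1,\xi_2\otimes\eta_2\rangle=\langle\eta_1,\phi(\langle\xi_1,\xi_2\rangle)\eta_2\rangle$), with left action $\phi_n(a)(\xi_1\otimes\dots\otimes\xi_n)=(\phi(a)\xi_1)\otimes\xi_2\otimes\dots\otimes\xi_n$.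 The full Fock space $\mathcal{F}(E)=\sum^{\oplus}_{n\ge0}E^{\otimes n}$ is the ultraweak direct sum (self-dual completion of the Hilbert module direct sum), with left action $\phi_\infty(a)=\sum_{n\ge 0}\phi_n(a)$. For $\xi\in E$, $T_\xi\in\mathcal{L}(\mathcal{F}(E))$ is $T_\xi\eta=\xi\otimes\eta$. The Hardy algebra $H^\infty(E)$ is the weak$^*$ (ultraweak) closure in $\mathcal{L}(\mathcal{F}(E))$ of the algebra generated by all $T_\xi$ ($\xi\in E$) and all $\phi_\infty(a)$ ($a\in M$). For a normal (nondegenerate) representation $\pi:M\to B(H)$ and a Hilbert $W^*$-module $F$ over $M$, $F\otimes_\pi H$ is the Hilbert space completion of the algebraic tensor product with $\langle\xi_1\otimes h_1,\xi_2\otimes h_2\rangle=\langle h_1,\pi(\langle\xi_1,\xi_2\rangle)h_2\rangle$. $M\otimes_\pi H$ is identified with $H$ via $a\otimes h\mapsto\pi(a)h$, so $\mathcal{F}(E)\otimes_\pi H=\sum^\oplus_{n\ge0}E^{\otimes n}\otimes_\pi H$ has $H$ as its $0$-th summand. The induced representation $\rho_\pi$ of $H^\infty(E)$ on $\mathcal{F}(E)\otimes_\pi H$ is $\rho_\pi(X)=X\otimes I_H$. The $\pi$-dual of $E$ is $E^\pi=\{\eta\in B(H,E\otimes_\pi H):\eta\pi(a)=(\phi(a)\otimes I_H)\eta,\ a\in M\}$. For $\eta\in E^\pi$ put $\eta^{(0)}=I_H$ and, for $s\ge1$, $\eta^{(s)}=(I_{E^{\otimes s-1}}\otimes\eta)\cdots(I_E\otimes\eta)\eta:H\to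 E^{\otimes s}\otimes_\pi H$. Let $H(s)$ be the closed linear span of $\{\eta^{(s)}(h):\eta\in E^\pi,h\in H\}$ (so $H(0)=H$) and $\mathfrak{M}=\sum^{\oplus}_{s\ge0}H(s)\subseteq\mathcal{F}(E)\otimes_\pi H$. For a subalgebra $\mathcal{A}\subseteq B(K)$, $Lat\,\mathcal{A}$ is the lattice of closed $\mathcal{A}$-invariant subspaces of $K$, $Alg\,Lat\,\mathcal{A}=\{T\in B(K):T\mathcal{N}\subseteq\mathcal{N}\ \forall \mathcal{N}\in Lat\,\mathcal{A}\}$, and $\mathcal{A}$ is reflexive if $\mathcal{A}=Alg\,Lat\,\mathcal{A}$. *)

theory Defs
  imports "HOL-Analysis.Analysis"
begin

section \<open>Complex normed spaces, Hilbert spaces and C*-algebras\<close>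

class complex_vector = real_vector +
  fixes scaleC :: "complex \<Rightarrow> 'a \<Rightarrow> 'a"  (infixr \<open>*\<^sub>C\<close> 75)
  assumes scaleC_add_right: "c *\<^sub>C (x + y) = c *\<^sub>C x + c *\<^sub>C y"
    and scaleC_add_left: "(c + d) *\<^sub>C x = c *\<^sub>C x + d *\<^sub>C x"
    and scaleC_scaleC: "c *\<^sub>C (d *\<^sub>C x) = (c * d) *\<^sub>C x"
    and scaleR_scaleC: "r *\<^sub>R x = complex_of_real r *\<^sub>C x"

lemma scaleC_one: "1 *\<^sub>C x = (x :: 'a::complex_vector)"
  using scaleR_scaleC[of 1 x] by simp

global_interpretation complex_vector: vector_space "scaleC :: complex \<Rightarrow> 'a \<Rightarrow> 'a::complex_vector"
  defines csubspace = complex_vector.subspace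
    and cspan = complex_vector.span
  by unfold_locales (simp_all add: scaleC_add_right scaleC_add_left scaleC_scaleC scaleC_one)

class complex_normed_vector = complex_vector + real_normed_vector +
  assumes norm_scaleC: "norm (c *\<^sub>C x) = cmod c * norm x"

class cbanach = complex_normed_vector + complete_space

instantiation complex :: cbanach
begin
definition scaleC_complex :: "complex \<Rightarrow> complex \<Rightarrow> complex" where "scaleC_complex c x = c * x"
instance
  by standard (simp_all add: scaleC_complex_def algebra_simps norm_mult scaleR_conv_of_real)
end

definition bounded_clinear :: "('a::complex_normed_vector \<Rightarrow> 'b::complex_normed_vector) \<Rightarrow> bool" where
  "bounded_clinear f \<longleftrightarrow> bounded_linear f \<and> (\<forall>c x. f (c *\<^sub>C x) = c *\<^sub>C f x)"

text \<open>Inner products are linear in the second variable throughout.\<close>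

class chilbert_space = cbanach +
  fixes cinner :: "'a \<Rightarrow> 'a \<Rightarrow> complex"
  assumes cinner_add_right: "cinner x (y + z) = cinner x y + cinner x z"
    and cinner_scaleC_right: "cinner x (c *\<^sub>C y) = c * cinner x y"
    and cinner_commute: "cinner y x = cnj (cinner x y)"
    and cinner_self: "cinner x x = complex_of_real ((norm x)\<^sup>2)"

text \<open>Unital C*-algebras. The class does not contain \<open>0 \<noteq> 1\<close>, so that the zero algebra is allowed.\<close>

class cstar_algebra = cbanach + real_normed_algebra + monoid_mult +
  fixes star :: "'a \<Rightarrow> 'a"
  assumes scaleC_mult_left: "(c *\<^sub>C a) * b = c *\<^sub>C (a * b)"
    and scaleC_mult_right: "a * (c *\<^sub>C b) = c *\<^sub>C (a * b)"
    and star_add: "star (a + b) = star a + star b"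
    and star_scaleC: "star (c *\<^sub>C a) = cnj c *\<^sub>C star a"
    and star_mult: "star (a * b) = star b * star a"
    and star_star: "star (star a) = a"
    and cstar_identity: "norm (star a * a) = (norm a)\<^sup>2"

definition cstar_positive :: "'m::cstar_algebra \<Rightarrow> bool" where
  "cstar_positive a \<longleftrightarrow> (\<exists>b. a = star b * b)"


section \<open>W*-algebras and weak topologies\<close>

text \<open>
  The initial topology of a family of functionals. All families used below contain the
  zero functional, so the underlying set is the whole type.
\<close>

definition weak_topology :: "('a \<Rightarrow> complex) set \<Rightarrow> 'a topology" where
  "weak_topology \<Phi> = topology_generated_by {f -` U | f U. f \<in> \<Phi> \<and> open U}"

text \<open>
  A C*-algebra is a W*-algebra if it is a dual Banach space. A predual embeds canonically
  into the dual space, so it is represented by a norm closed space \<open>P\<close> of bounded functionals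
  such that evaluation is an isometric isomorphism from the algebra onto the dual of \<open>P\<close>.
  The operator norm of functionals is \<open>onorm\<close>. By Sakai's theorem \<open>P\<close> is unique;
  it consists of the normal functionals.
\<close>

locale wstar_algebra =
  fixes P :: "('m::cstar_algebra \<Rightarrow> complex) set"
  assumes predual_bounded: "f \<in> P \<Longrightarrow> bounded_clinear f"
    and predual_zero: "(\<lambda>_. 0) \<in> P"
    and predual_add: "f \<in> P \<Longrightarrow> g \<in> P \<Longrightarrow> (\<lambda>a. f a + g a) \<in> P"
    and predual_scale: "f \<in> P \<Longrightarrow> (\<lambda>a. c * f a) \<in> P"
    and predual_closed: "(\<And>n. u n \<in> P) \<Longrightarrow> bounded_clinear f \<Longrightarrow>
      (\<lambda>n::nat. onorm (\<lambda>a. u n a - f a)) \<longlonglongrightarrow> 0 \<Longrightarrow> f \<in> P"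
    and evaluation_isometric: "norm a = (SUP f\<in>{f \<in> P. onorm f \<le> 1}. cmod (f a))"
    and evaluation_onto: "\<lbrakk>\<And>f g. f \<in> P \<Longrightarrow> g \<in> P \<Longrightarrow> L (\<lambda>a. f a + g a) = L f + L g;
        \<And>c f. f \<in> P \<Longrightarrow> L (\<lambda>a. c * f a) = c * L f;
        \<exists>K. \<forall>f\<in>P. cmod (L f) \<le> K * onorm f\<rbrakk> \<Longrightarrow> \<exists>a. \<forall>f\<in>P. L f = f a"


section \<open>Hilbert W*-modules and W*-correspondences\<close>

text \<open>
  A module is given by a Banach space type \<open>'e\<close>, its algebra valued inner product \<open>ip\<close> and
  its right action \<open>act\<close>; the norm of the type has to be the norm of the Hilbert module.
\<close>

locale hilbert_wstar_module =
  fixes ip :: "'e::cbanach \<Rightarrow> 'e \<Rightarrow> 'm::cstar_algebra"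
    and act :: "'e \<Rightarrow> 'm \<Rightarrow> 'e"
  assumes act_add_left: "act (x + y) a = act x a + act y a"
    and act_add_right: "act x (a + b) = act x a + act x b"
    and act_mult: "act x (a * b) = act (act x a) b"
    and act_scaleC_left: "act (c *\<^sub>C x) a = c *\<^sub>C act x a"
    and act_scaleC_right: "act x (c *\<^sub>C a) = c *\<^sub>C act x a"
    and ip_add_right: "ip x (y + z) = ip x y + ip x z"
    and ip_scaleC_right: "ip x (c *\<^sub>C y) = c *\<^sub>C ip x y"
    and ip_act_right: "ip x (act y a) = ip x y * a"
    and ip_star: "star (ip x y) = ip y x"
    and ip_positive: "cstar_positive (ip x x)"
    and norm_ip: "norm x = sqrt (norm (ip x x))"
    and self_dual: "bounded_clinear f \<Longrightarrow> (\<And>x a. f (act x a) = f x * a) \<Longrightarrow> \<exists>y. \<forall>x. f x = ip y x"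

definition adjointable :: "('e \<Rightarrow> 'e \<Rightarrow> 'm) \<Rightarrow> ('e \<Rightarrow> 'e) set" where
  "adjointable ip = {T. \<exists>S. \<forall>x y. ip (T x) y = ip x (S y)}"

text \<open>
  The weak*-topologies of a Hilbert W*-module \<open>E\<close> (the \<open>\<sigma>\<close>-topology) and of the W*-algebra of
  its adjointable operators, in terms of their preduals as identified by Paschke: the functionals
  \<open>\<Sum>n. \<omega> n (ip (x n) \<cdot>)\<close> and \<open>T \<mapsto> \<Sum>n. \<omega> n (ip (x n) (T (y n)))\<close> respectively, where the
  \<open>\<omega> n\<close> are normal functionals of the algebra and the series converge absolutely in norm.
\<close>

definition sigma_functionals ::
  "('m::cstar_algebra \<Rightarrow> complex) set \<Rightarrow> ('e::cbanach \<Rightarrow> 'e \<Rightarrow> 'm) \<Rightarrow> ('e \<Rightarrow> complex) set" where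
  "sigma_functionals P ip = {\<lambda>z. \<Sum>n. \<omega> n (ip (x n) z) | \<omega> x.
     (\<forall>n. \<omega> n \<in> P) \<and> summable (\<lambda>n::nat. onorm (\<omega> n) * norm (x n))}"

definition sigma_topology ::
  "('m::cstar_algebra \<Rightarrow> complex) set \<Rightarrow> ('e::cbanach \<Rightarrow> 'e \<Rightarrow> 'm) \<Rightarrow> 'e topology" where
  "sigma_topology P ip = weak_topology (sigma_functionals P ip)"

definition adjointable_functionals ::
  "('m::cstar_algebra \<Rightarrow> complex) set \<Rightarrow> ('e::cbanach \<Rightarrow> 'e \<Rightarrow> 'm) \<Rightarrow> (('e \<Rightarrow> 'e) \<Rightarrow> complex) set" where
  "adjointable_functionals P ip = {\<lambda>T. \<Sum>n. \<omega> n (ip (x n) (T (y n))) | \<omega> x y.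
     (\<forall>n. \<omega> n \<in> P) \<and> summable (\<lambda>n::nat. onorm (\<omega> n) * norm (x n) * norm (y n))}"

definition ultraweak_topology ::
  "('m::cstar_algebra \<Rightarrow> complex) set \<Rightarrow> ('e::cbanach \<Rightarrow> 'e \<Rightarrow> 'm) \<Rightarrow> ('e \<Rightarrow> 'e) topology" where
  "ultraweak_topology P ip =
     subtopology (weak_topology (adjointable_functionals P ip)) (adjointable ip)"

locale wstar_correspondence = hilbert_wstar_module ip act
  for P :: "('m::cstar_algebra \<Rightarrow> complex) set"
    and ip :: "'e::cbanach \<Rightarrow> 'e \<Rightarrow> 'm"
    and act :: "'e \<Rightarrow> 'm \<Rightarrow> 'e"
    and \<phi> :: "'m \<Rightarrow> 'e \<Rightarrow> 'e" +
  assumes left_add: "\<phi> (a + b) x = \<phi> a x + \<phi> b x"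
    and left_scaleC: "\<phi> (c *\<^sub>C a) x = c *\<^sub>C \<phi> a x"
    and left_mult: "\<phi> (a * b) x = \<phi> a (\<phi> b x)"
    and left_star: "ip (\<phi> a x) y = ip x (\<phi> (star a) y)"
    and left_normal: "continuous_map (weak_topology P) (ultraweak_topology P ip) \<phi>"
    and essential: "sigma_topology P ip closure_of {\<phi> a x | a x. True} = UNIV"


section \<open>The Fock space and the Hardy algebra\<close>

text \<open>
  The elementary tensor \<open>\<xi>\<^sub>1 \<otimes> \<dots> \<otimes> \<xi>\<^sub>n a\<close> inside the Fock space, where \<open>ten \<xi> \<zeta>\<close> is
  \<open>\<xi> \<otimes> \<zeta>\<close> and \<open>vac\<close> is the inclusion of the zeroth summand \<open>M\<close>.
\<close>

definition elem_tensor :: "('e \<Rightarrow> 'f \<Rightarrow> 'f) \<Rightarrow> ('m \<Rightarrow> 'f) \<Rightarrow> 'e list \<Rightarrow> 'm \<Rightarrow> 'f" where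
  "elem_tensor ten vac xs a = foldr ten xs (vac a)"

text \<open>
  The full Fock space of \<open>(E, ipE, \<phi>)\<close>, given as a Hilbert W*-module \<open>(F, ip, act)\<close> with left
  action \<open>\<phi>F\<close>, the inclusion \<open>vac\<close> of \<open>M\<close> and the tensor map \<open>ten\<close> from \<open>E \<times> F\<close> to \<open>F\<close>. The inner
  products prescribed below make \<open>act\<close>, \<open>vac\<close> and \<open>ten\<close> compatible, \<open>ten\<close> balanced over \<open>\<phi>\<close>, and
  tensors of different lengths orthogonal. The \<open>\<sigma>\<close>-closed span of the elementary tensors of
  length \<open>n\<close> is then the self-dual completion of the internal tensor power \<open>E\<^bsup>\<otimes>n\<^esup>\<close>, and
  \<open>fock_dense\<close> says that \<open>F\<close> is the ultraweak direct sum of these summands. All of this determines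
  \<open>F\<close> together with \<open>\<phi>F\<close>, \<open>vac\<close> and \<open>ten\<close> up to a unique unitary isomorphism.
\<close>

locale fock_space = wstar_correspondence P ip act \<phi>F
  for P :: "('m::cstar_algebra \<Rightarrow> complex) set"
    and ipE :: "'e::cbanach \<Rightarrow> 'e \<Rightarrow> 'm"
    and \<phi> :: "'m \<Rightarrow> 'e \<Rightarrow> 'e"
    and ip :: "'f::cbanach \<Rightarrow> 'f \<Rightarrow> 'm"
    and act :: "'f \<Rightarrow> 'm \<Rightarrow> 'f"
    and \<phi>F :: "'m \<Rightarrow> 'f \<Rightarrow> 'f"
    and vac :: "'m \<Rightarrow> 'f"
    and ten :: "'e \<Rightarrow> 'f \<Rightarrow> 'f" +
  assumes ip_vac_vac: "ip (vac a) (vac b) = star a * b"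
    and ip_ten_ten: "ip (ten \<xi> \<zeta>) (ten \<xi>' \<zeta>') = ip \<zeta> (\<phi>F (ipE \<xi> \<xi>') \<zeta>')"
    and ip_vac_ten: "ip (vac a) (ten \<xi> \<zeta>) = 0"
    and left_vac: "\<phi>F a (vac b) = vac (a * b)"
    and left_ten: "\<phi>F a (ten \<xi> \<zeta>) = ten (\<phi> a \<xi>) \<zeta>"
    and fock_dense: "sigma_topology P ip closure_of
      cspan {elem_tensor ten vac xs a | xs a. True} = UNIV"

text \<open>The (not necessarily unital) algebra of operators generated by \<open>G\<close>.\<close>

inductive_set generated_algebra :: "('f \<Rightarrow> 'f::complex_vector) set \<Rightarrow> ('f \<Rightarrow> 'f) set"
  for G where
    generator: "T \<in> G \<Longrightarrow> T \<in> generated_algebra G"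
  | add: "S \<in> generated_algebra G \<Longrightarrow> T \<in> generated_algebra G \<Longrightarrow>
      (\<lambda>x. S x + T x) \<in> generated_algebra G"
  | scale: "T \<in> generated_algebra G \<Longrightarrow> (\<lambda>x. c *\<^sub>C T x) \<in> generated_algebra G"
  | mult: "S \<in> generated_algebra G \<Longrightarrow> T \<in> generated_algebra G \<Longrightarrow> S \<circ> T \<in> generated_algebra G"

text \<open>The creation operator \<open>T\<^sub>\<xi>\<close> is \<open>ten \<xi>\<close>.\<close>

definition hardy_algebra ::
  "('m::cstar_algebra \<Rightarrow> complex) set \<Rightarrow> ('f::cbanach \<Rightarrow> 'f \<Rightarrow> 'm) \<Rightarrow> ('m \<Rightarrow> 'f \<Rightarrow> 'f) \<Rightarrow>
    ('e \<Rightarrow> 'f \<Rightarrow> 'f) \<Rightarrow> ('f \<Rightarrow> 'f) set" where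
  "hardy_algebra P ip \<phi>F ten =
     ultraweak_topology P ip closure_of generated_algebra (range ten \<union> range \<phi>F)"


section \<open>Representations\<close>

definition hilbert_ultraweak_topology :: "('h::chilbert_space \<Rightarrow> 'h) topology" where
  "hilbert_ultraweak_topology = subtopology
     (weak_topology {\<lambda>T. \<Sum>n. cinner (x n) (T (y n)) | x y.
        summable (\<lambda>n::nat. (norm (x n))\<^sup>2) \<and> summable (\<lambda>n::nat. (norm (y n))\<^sup>2)})
     {T. bounded_clinear T}"

locale normal_representation =
  fixes P :: "('m::cstar_algebra \<Rightarrow> complex) set"
    and \<pi> :: "'m \<Rightarrow> 'h::chilbert_space \<Rightarrow> 'h"
  assumes rep_bounded: "bounded_clinear (\<pi> a)"
    and rep_add: "\<pi> (a + b) h = \<pi> a h + \<pi> b h"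
    and rep_scaleC: "\<pi> (c *\<^sub>C a) h = c *\<^sub>C \<pi> a h"
    and rep_mult: "\<pi> (a * b) h = \<pi> a (\<pi> b h)"
    and rep_star: "cinner (\<pi> a h) k = cinner h (\<pi> (star a) k)"
    and rep_normal: "continuous_map (weak_topology P) hilbert_ultraweak_topology \<pi>"
    and rep_nondegenerate: "closure (cspan {\<pi> a h | a h. True}) = UNIV"

text \<open>The type \<open>'k\<close> with \<open>t x h\<close> for \<open>x \<otimes> h\<close> is the Hilbert space \<open>F \<otimes>\<^sub>\<pi> H\<close>.\<close>

locale induced_space =
  fixes ip :: "'f \<Rightarrow> 'f \<Rightarrow> 'm"
    and \<pi> :: "'m \<Rightarrow> 'h::chilbert_space \<Rightarrow> 'h"
    and t :: "'f \<Rightarrow> 'h \<Rightarrow> 'k::chilbert_space"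
  assumes cinner_tensor: "cinner (t x h) (t y k) = cinner h (\<pi> (ip x y) k)"
    and tensor_dense: "closure (cspan {t x h | x h. True}) = UNIV"

text \<open>\<open>X \<otimes> I\<^sub>H\<close>\<close>

definition ampliation :: "('f \<Rightarrow> 'h \<Rightarrow> 'k::chilbert_space) \<Rightarrow> ('f \<Rightarrow> 'f) \<Rightarrow> 'k \<Rightarrow> 'k" where
  "ampliation t X = (THE R. bounded_clinear R \<and> (\<forall>x h. R (t x h) = t (X x) h))"


section \<open>The dual correspondence and the generalized symmetric subspace\<close>

definition pi_dual :: "('m \<Rightarrow> 'e \<Rightarrow> 'e) \<Rightarrow> ('m \<Rightarrow> 'h::chilbert_space \<Rightarrow> 'h) \<Rightarrow>
    ('e \<Rightarrow> 'h \<Rightarrow> 'p::chilbert_space) \<Rightarrow> ('h \<Rightarrow> 'p) set" where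
  "pi_dual \<phi> \<pi> tE = {\<eta>. bounded_clinear \<eta> \<and> (\<forall>a h. \<eta> (\<pi> a h) = ampliation tE (\<phi> a) (\<eta> h))}"

text \<open>
  The inclusion of \<open>E \<otimes>\<^sub>\<pi> H\<close> into \<open>F(E) \<otimes>\<^sub>\<pi> H\<close> as the first summand; \<open>\<xi> \<in> E\<close> corresponds to
  \<open>\<xi> \<otimes> 1 \<in> E\<^bsup>\<otimes>1\<^esup>\<close>.
\<close>

definition first_summand :: "('m::cstar_algebra \<Rightarrow> 'f) \<Rightarrow> ('e \<Rightarrow> 'f \<Rightarrow> 'f) \<Rightarrow>
    ('e \<Rightarrow> 'h \<Rightarrow> 'p::chilbert_space) \<Rightarrow> ('f \<Rightarrow> 'h \<Rightarrow> 'k::chilbert_space) \<Rightarrow> 'p \<Rightarrow> 'k" where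
  "first_summand vac ten tE tF =
     (THE J. bounded_clinear J \<and> (\<forall>\<xi> h. J (tE \<xi> h) = tF (ten \<xi> (vac 1)) h))"

text \<open>
  The operator on \<open>F(E) \<otimes>\<^sub>\<pi> H\<close> that restricts, for every \<open>s\<close>, to \<open>I \<otimes> \<eta>\<close> from \<open>E\<^bsup>\<otimes>s\<^esup> \<otimes>\<^sub>\<pi> H\<close> to
  \<open>E\<^bsup>\<otimes>s\<^esup> \<otimes> (E \<otimes>\<^sub>\<pi> H) = E\<^bsup>\<otimes>(s+1)\<^esup> \<otimes>\<^sub>\<pi> H\<close>. In this identification \<open>\<xi>\<^sub>1 \<otimes> \<dots> \<otimes> \<xi>\<^sub>s \<otimes> z\<close>, for
  \<open>z \<in> E \<otimes>\<^sub>\<pi> H\<close>, is the image of \<open>z\<close> under \<open>T\<^sub>\<xi>\<^sub>1 \<dots> T\<^sub>\<xi>\<^sub>s \<otimes> I\<^sub>H\<close>.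
\<close>

definition id_tensor :: "('m::cstar_algebra \<Rightarrow> 'h \<Rightarrow> 'h) \<Rightarrow> ('m \<Rightarrow> 'f) \<Rightarrow> ('e \<Rightarrow> 'f \<Rightarrow> 'f) \<Rightarrow>
    ('e \<Rightarrow> 'h \<Rightarrow> 'p::chilbert_space) \<Rightarrow> ('f \<Rightarrow> 'h \<Rightarrow> 'k::chilbert_space) \<Rightarrow>
    ('h \<Rightarrow> 'p) \<Rightarrow> 'k \<Rightarrow> 'k" where
  "id_tensor \<pi> vac ten tE tF \<eta> = (THE R. bounded_clinear R \<and>
     (\<forall>xs a h. R (tF (elem_tensor ten vac xs a) h) =
        foldr (\<lambda>\<xi>. ampliation tF (ten \<xi>)) xs (first_summand vac ten tE tF (\<eta> (\<pi> a h)))))"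

text \<open>
  \<open>\<eta>\<^bsup>(s)\<^esup>\<close>, with values in \<open>F(E) \<otimes>\<^sub>\<pi> H\<close>. The vector \<open>h \<in> H\<close> is identified with \<open>1 \<otimes> h\<close> in the
  zeroth summand \<open>M \<otimes>\<^sub>\<pi> H\<close>.
\<close>

definition dual_power :: "('m::cstar_algebra \<Rightarrow> 'h \<Rightarrow> 'h) \<Rightarrow> ('m \<Rightarrow> 'f) \<Rightarrow> ('e \<Rightarrow> 'f \<Rightarrow> 'f) \<Rightarrow>
    ('e \<Rightarrow> 'h \<Rightarrow> 'p::chilbert_space) \<Rightarrow> ('f \<Rightarrow> 'h \<Rightarrow> 'k::chilbert_space) \<Rightarrow>
    ('h \<Rightarrow> 'p) \<Rightarrow> nat \<Rightarrow> 'h \<Rightarrow> 'k" where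
  "dual_power \<pi> vac ten tE tF \<eta> s h = (id_tensor \<pi> vac ten tE tF \<eta> ^^ s) (tF (vac 1) h)"

definition symmetric_summand :: "('m::cstar_algebra \<Rightarrow> 'e \<Rightarrow> 'e) \<Rightarrow>
    ('m \<Rightarrow> 'h::chilbert_space \<Rightarrow> 'h) \<Rightarrow> ('m \<Rightarrow> 'f) \<Rightarrow> ('e \<Rightarrow> 'f \<Rightarrow> 'f) \<Rightarrow>
    ('e \<Rightarrow> 'h \<Rightarrow> 'p::chilbert_space) \<Rightarrow> ('f \<Rightarrow> 'h \<Rightarrow> 'k::chilbert_space) \<Rightarrow> nat \<Rightarrow> 'k set" where
  "symmetric_summand \<phi> \<pi> vac ten tE tF s =
     closure (cspan {dual_power \<pi> vac ten tE tF \<eta> s h | \<eta> h. \<eta> \<in> pi_dual \<phi> \<pi> tE})"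

definition symmetric_subspace :: "('m::cstar_algebra \<Rightarrow> 'e \<Rightarrow> 'e) \<Rightarrow>
    ('m \<Rightarrow> 'h::chilbert_space \<Rightarrow> 'h) \<Rightarrow> ('m \<Rightarrow> 'f) \<Rightarrow> ('e \<Rightarrow> 'f \<Rightarrow> 'f) \<Rightarrow>
    ('e \<Rightarrow> 'h \<Rightarrow> 'p::chilbert_space) \<Rightarrow> ('f \<Rightarrow> 'h \<Rightarrow> 'k::chilbert_space) \<Rightarrow> 'k set" where
  "symmetric_subspace \<phi> \<pi> vac ten tE tF =
     closure (cspan (\<Union>s. symmetric_summand \<phi> \<pi> vac ten tE tF s))"


section \<open>Reflexivity\<close>

text \<open>
  Operators on a closed subspace \<open>K\<close> of a Hilbert space are represented by functions that are
  \<open>undefined\<close> outside \<open>K\<close>.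
\<close>

definition bounded_operators_on :: "'k::chilbert_space set \<Rightarrow> ('k \<Rightarrow> 'k) set" where
  "bounded_operators_on K = {T. T \<in> extensional K \<and> T ` K \<subseteq> K \<and>
     (\<forall>x\<in>K. \<forall>y\<in>K. T (x + y) = T x + T y) \<and> (\<forall>c. \<forall>x\<in>K. T (c *\<^sub>C x) = c *\<^sub>C T x) \<and>
     (\<exists>B. \<forall>x\<in>K. norm (T x) \<le> B * norm x)}"

definition Lat_on :: "'k::chilbert_space set \<Rightarrow> ('k \<Rightarrow> 'k) set \<Rightarrow> 'k set set" where
  "Lat_on K A = {N. N \<subseteq> K \<and> csubspace N \<and> closed N \<and> (\<forall>T\<in>A. T ` N \<subseteq> N)}"

definition Alg_on :: "'k::chilbert_space set \<Rightarrow> 'k set set \<Rightarrow> ('k \<Rightarrow> 'k) set" where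
  "Alg_on K \<L> = {T \<in> bounded_operators_on K. \<forall>N\<in>\<L>. T ` N \<subseteq> N}"

definition reflexive_on :: "'k::chilbert_space set \<Rightarrow> ('k \<Rightarrow> 'k) set \<Rightarrow> bool" where
  "reflexive_on K A \<longleftrightarrow> A = Alg_on K (Lat_on K A)"

definition orthogonal_projection :: "'k::chilbert_space set \<Rightarrow> 'k \<Rightarrow> 'k" where
  "orthogonal_projection K x = (THE y. y \<in> K \<and> (\<forall>z\<in>K. cinner z (x - y) = 0))"

definition compression :: "'k::chilbert_space set \<Rightarrow> ('k \<Rightarrow> 'k) \<Rightarrow> 'k \<Rightarrow> 'k" where
  "compression K T = restrict (\<lambda>x. orthogonal_projection K (T x)) K"

end

theory Submission
  imports Defs
begin

text \<open>
  Let \<open>K = F \<otimes>\<^sub>\<pi> H\<close> and \<open>R\<^sub>w = I \<otimes> w\<close> on \<open>K\<close> for \<open>w\<close> in the \<open>\<pi>\<close>-dual. The operators \<open>X \<otimes> I\<close>, for \<open>X\<close> in the Hardy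
  algebra, are exactly those that commute with \<open>I \<otimes> \<pi>(M)'\<close> and with all \<open>R\<^sub>w\<close>: an operator in this commutant has a
  Fourier series, whose Cesaro means are bounded limits of polynomials in the creation operators.

  If \<open>T\<close> leaves the lattice of the compressed algebra invariant, then it commutes with \<open>I \<otimes> p\<close> for all projections \<open>p\<close>
  in \<open>\<pi>(M)'\<close>, hence with \<open>I \<otimes> \<pi>(M)'\<close>. For small \<open>\<eta>\<close> the space \<open>(1 - R\<^sub>\<eta>)\<^sup>-\<^sup>1 H\<close> consists of the joint eigenvectors,
  \<open>R\<^sub>\<zeta>\<^sup>* u = (I \<otimes> \<zeta>\<^sup>*\<eta>) u\<close>, and is contained in \<open>\<MM>\<close>; its complement in \<open>\<MM>\<close> belongs to the lattice. So \<open>Z = T\<^sup>*\<close>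
  leaves the eigenspaces invariant and therefore commutes with the \<open>R\<^sub>\<zeta>\<^sup>*\<close> on them; by expansion in powers of \<open>\<eta>\<close>
  they span \<open>\<MM>\<close>. Finally, \<open>Z\<close> extends from \<open>\<MM>\<close> to an operator on \<open>K\<close> which commutes with \<open>I \<otimes> \<pi>(M)'\<close> and the
  \<open>R\<^sub>\<zeta>\<^sup>*\<close>, by a lifting argument one level of the Fock space at a time. The adjoint of this extension is some
  \<open>X \<otimes> I\<close> with \<open>X\<close> in the Hardy algebra, and \<open>T\<close> is its compression.
\<close>

section \<open>Hilbert spaces\<close>

text \<open>Boundedness is what shapes the proof. The Hardy algebra is closed in the topology given
  by the predual of the module operators, while the commutation arguments take place on the Hilbert
  space; the two are linked through bounded nets, where weak operator convergence forces weak*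
  convergence because \<pi> is faithful. So every approximation has to carry a uniform norm bound:
  Kaplansky's argument for the double commutant, the polynomials near a Cesaro mean, the successive
  lifts. The Fourier coefficients of an operator in the commutant lie in self-dual completions of
  tensor powers and need not be finite sums of elementary tensors; they are cut down by bounded
  operators 1 - D instead of being truncated arbitrarily. The eigenspaces come from evaluation: (1 -
  R_\<eta>)^-1 H is the range of the Cauchy kernel at \<eta>, and pairing with it evaluates an
  element of the Hardy algebra at the point of the unit ball given by the adjoint of \<eta>. As only
  powers of one \<eta> enter a kernel, the kernels see the symmetric subspace and nothing more; this
  is why a lift from there to the whole space is required.\<close>

lemma bounded_linear_scaleC: "bounded_linear (\<lambda>x::'a::complex_normed_vector. c *\<^sub>C x)"
proof
  show "c *\<^sub>C (x + y) = c *\<^sub>C x + c *\<^sub>C y" for x y :: 'a by (rule scaleC_add_right)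
  show "c *\<^sub>C (r *\<^sub>R x) = r *\<^sub>R (c *\<^sub>C x)" for r and x :: 'a
    by (simp add: scaleR_scaleC scaleC_scaleC mult.commute)
  show "\<exists>K. \<forall>x::'a. norm (c *\<^sub>C x) \<le> norm x * K"
    by (rule exI[of _ "cmod c"]) (simp add: norm_scaleC mult.commute)
qed

lemmas tendsto_scaleC = bounded_linear.tendsto[OF bounded_linear_scaleC]
lemma bounded_clinearI:
  fixes f :: "'a::complex_normed_vector \<Rightarrow> 'b::complex_normed_vector"
  assumes "\<And>x y. f (x + y) = f x + f y" "\<And>c x. f (c *\<^sub>C x) = c *\<^sub>C f x" "\<And>x. norm (f x) \<le> K * norm x"
  shows "bounded_clinear f"
  unfolding bounded_clinear_def
proof (intro conjI allI)
  show "bounded_linear f"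
    by (rule bounded_linear_intro[where K = K]) (auto simp: assms scaleR_scaleC mult.commute)
qed (rule assms)

lemma bounded_clinearD:
  assumes "bounded_clinear f"
  shows "bounded_linear f" "f (x + y) = f x + f y" "f (c *\<^sub>C x) = c *\<^sub>C f x" "f 0 = 0"
    "f (x - y) = f x - f y" "f (- x) = - f x" "norm (f x) \<le> onorm f * norm x"
  using assms by (auto simp: bounded_clinear_def linear_simps onorm)

lemma bounded_clinear_sum:
  assumes "bounded_clinear f"
  shows "f (\<Sum>i\<in>A. g i) = (\<Sum>i\<in>A. f (g i))"
  using bounded_clinearD(1)[OF assms] by (simp add: linear_sum bounded_linear.linear)

lemma csubspace_real: "csubspace S \<Longrightarrow> subspace (S :: 'a::complex_vector set)"
  by (auto simp: complex_vector.subspace_def subspace_def scaleR_scaleC)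

lemma subspace_closure_real:
  fixes S :: "'a::real_normed_vector set"
  assumes S: "subspace S"
  shows "subspace (closure S)"
  unfolding subspace_def
proof (intro conjI allI ballI)
  show "0 \<in> closure S" using subspace_0[OF S] closure_subset by blast
  show "x + y \<in> closure S" if "x \<in> closure S" "y \<in> closure S" for x y
  proof -
    from that obtain u v where "\<And>n. u n \<in> S" "u \<longlonglongrightarrow> x" "\<And>n. v n \<in> S" "v \<longlonglongrightarrow> y"
      unfolding closure_sequential by blast
    then have "(\<lambda>n. u n + v n) \<longlonglongrightarrow> x + y" "u n + v n \<in> S" for n
      using S by (auto intro: tendsto_add simp: subspace_add)
    then show ?thesis unfolding closure_sequential by (intro exI[of _ "\<lambda>n. u n + v n"]) auto
  qed
  show "c *\<^sub>R x \<in> closure S" if "x \<in> closure S" for c x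
  proof -
    have "(\<lambda>x. c *\<^sub>R x) ` closure S \<subseteq> closure ((\<lambda>x. c *\<^sub>R x) ` S)"
      by (rule closure_bounded_linear_image_subset[OF bounded_linear_scaleR_right])
    also have "\<dots> \<subseteq> closure S" using S by (intro closure_mono) (auto simp: subspace_mul)
    finally show ?thesis using that by blast
  qed
qed

lemma csubspace_closure:
  fixes S :: "'a::complex_normed_vector set"
  assumes S: "csubspace S"
  shows "csubspace (closure S)"
proof -
  note R = subspace_closure_real[OF csubspace_real[OF S]]
  have "c *\<^sub>C x \<in> closure S" if x: "x \<in> closure S" for c x
  proof -
    have "(\<lambda>x. c *\<^sub>C x) ` closure S \<subseteq> closure ((\<lambda>x. c *\<^sub>C x) ` S)"
      by (rule closure_bounded_linear_image_subset[OF bounded_linear_scaleC])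
    also have "\<dots> \<subseteq> closure S"
      using S by (intro closure_mono) (auto simp: complex_vector.subspace_def)
    finally show ?thesis using x by blast
  qed
  then show ?thesis using subspace_0[OF R] subspace_add[OF R] by (auto simp: complex_vector.subspace_def)
qed

lemma csubspace_closure_cspan: "csubspace (closure (cspan (X :: 'a::complex_normed_vector set)))"
  by (simp add: csubspace_closure complex_vector.subspace_span)

lemma closure_cspan_subset:
  fixes S :: "'a::complex_normed_vector set"
  assumes "X \<subseteq> S" "csubspace S" "closed S"
  shows "closure (cspan X) \<subseteq> S"
  by (simp add: assms closure_minimal complex_vector.span_minimal)

lemma closure_cspan_superset: "x \<in> X \<Longrightarrow> x \<in> closure (cspan X)"
  using closure_subset complex_vector.span_base by blast

context
  fixes dummy :: "'a::chilbert_space itself"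
begin

lemma cinner_add_left: "cinner (x + y) (z::'a) = cinner x z + cinner y z"
  by (metis cinner_add_right cinner_commute complex_cnj_add)

lemma cinner_scaleC_left: "cinner (c *\<^sub>C x) (z::'a) = cnj c * cinner x z"
  by (metis cinner_commute cinner_scaleC_right complex_cnj_mult)

lemma cinner_zero_right [simp]: "cinner x (0::'a) = 0"
  using cinner_scaleC_right[of x 0 "0::'a"] by simp

lemma cinner_zero_left [simp]: "cinner (0::'a) x = 0"
  using cinner_scaleC_left[of 0 "0::'a" x] by simp

lemma cinner_minus_right [simp]: "cinner x (- y::'a) = - cinner x y"
  using cinner_add_right[of x y "- y"] by (simp add: eq_neg_iff_add_eq_0 add.commute)

lemma cinner_minus_left [simp]: "cinner (- x::'a) y = - cinner x y"
  using cinner_add_left[of x "- x" y] by (simp add: eq_neg_iff_add_eq_0 add.commute)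

lemma cinner_diff_right: "cinner x (y - z::'a) = cinner x y - cinner x z"
  using cinner_add_right[of x y "- z"] by simp

lemma cinner_diff_left: "cinner (x - y::'a) z = cinner x z - cinner y z"
  using cinner_add_left[of x "- y" z] by simp

lemma cinner_sum_right: "cinner (x::'a) (\<Sum>i\<in>A. f i) = (\<Sum>i\<in>A. cinner x (f i))"
  by (induction A rule: infinite_finite_induct) (simp_all add: cinner_add_right)

lemma cinner_sum_left: "cinner (\<Sum>i\<in>A. f i) (x::'a) = (\<Sum>i\<in>A. cinner (f i) x)"
  by (induction A rule: infinite_finite_induct) (simp_all add: cinner_add_left)

lemma Re_cinner_self: "Re (cinner x x) = (norm (x::'a))\<^sup>2"
  by (simp add: cinner_self)

lemma cinner_eq_zero_iff: "cinner x x = 0 \<longleftrightarrow> x = (0::'a)"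
  by (simp add: cinner_self)

lemma norm_cinner_le: "cmod (cinner x y) \<le> norm x * norm (y::'a)"
proof (cases "y = 0")
  case False
  define c where "c = cinner y x / of_real ((norm y)\<^sup>2)"
  have "cinner (x - c *\<^sub>C y) (x - c *\<^sub>C y)
      = cinner x x - c * cinner x y - cnj c * cinner y x + cnj c * c * cinner y y"
    by (simp add: cinner_diff_left cinner_diff_right cinner_scaleC_left cinner_scaleC_right algebra_simps)
  also have "cnj c * c * cinner y y = cnj c * cinner y x"
    unfolding cinner_self[of y] c_def cinner_commute[of y x] using False
    by (simp add: field_simps del: of_real_power)
  also have "c * cinner x y = of_real ((cmod (cinner x y))\<^sup>2 / (norm y)\<^sup>2)"
    unfolding c_def cinner_commute[of y x] by (simp add: complex_norm_square[symmetric] mult.commute)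
  finally have "cinner (x - c *\<^sub>C y) (x - c *\<^sub>C y) = cinner x x - of_real ((cmod (cinner x y))\<^sup>2 / (norm y)\<^sup>2)"
    by simp
  from arg_cong[OF this, of Re] have "0 \<le> (norm x)\<^sup>2 - (cmod (cinner x y))\<^sup>2 / (norm y)\<^sup>2"
    unfolding minus_complex.sel Re_cinner_self Re_complex_of_real by (metis zero_le_power2)
  then have "(cmod (cinner x y))\<^sup>2 \<le> (norm x * norm y)\<^sup>2"
    using False by (simp add: field_simps power_mult_distrib)
  then show ?thesis by (rule power2_le_imp_le) simp
qed simp

lemma bounded_clinear_cinner_right: "bounded_clinear (cinner (x::'a))"
  by (rule bounded_clinearI[where K = "norm x"])
     (auto simp: cinner_add_right cinner_scaleC_right scaleC_complex_def norm_cinner_le)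

lemma bounded_bilinear_cinner: "bounded_bilinear (cinner :: 'a \<Rightarrow> 'a \<Rightarrow> complex)"
proof
  show "\<exists>K. \<forall>a b::'a. norm (cinner a b) \<le> norm a * norm b * K"
    by (rule exI[of _ 1]) (simp add: norm_cinner_le)
qed (auto simp: cinner_add_right cinner_add_left scaleR_scaleC cinner_scaleC_left cinner_scaleC_right
      scaleC_complex_def)

lemma cinner_ext:
  assumes "\<And>z. cinner z x = cinner z (y::'a)"
  shows "x = y"
  using assms[of "x - y"] cinner_eq_zero_iff[of "x - y"] by (simp add: cinner_diff_right)

lemma norm_sq_add_orthogonal:
  assumes "cinner x y = 0"
  shows "(norm (x + y::'a))\<^sup>2 = (norm x)\<^sup>2 + (norm y)\<^sup>2"
proof -
  have "cinner y x = 0" using cinner_commute[of y x] assms by simp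
  then have "Re (cinner (x + y) (x + y)) = (norm x)\<^sup>2 + (norm y)\<^sup>2"
    using assms by (simp add: cinner_add_left cinner_add_right Re_cinner_self)
  then show ?thesis by (simp add: Re_cinner_self)
qed

lemma norm_bound_cinner:
  assumes "\<And>z. cmod (cinner z x) \<le> C * norm z" "C \<ge> 0"
  shows "norm (x::'a) \<le> C"
proof (cases "x = 0")
  case False
  have "(norm x)\<^sup>2 = cmod (cinner x x)" by (simp add: cinner_self norm_power)
  then have "norm x * norm x \<le> C * norm x" using assms(1)[of x] by (simp add: power2_eq_square)
  then show ?thesis using False by simp
qed (use assms in simp)

end

lemmas tendsto_cinner = bounded_bilinear.tendsto[OF bounded_bilinear_cinner]
lemmas continuous_on_cinner = bounded_bilinear.continuous_on[OF bounded_bilinear_cinner]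
lemma closed_cinner_zero: "closed {x. cinner (y::'a::chilbert_space) x = 0}"
  by (rule closed_Collect_eq) (auto intro!: continuous_on_cinner continuous_on_id continuous_on_const)

lemma csubspace_cinner_zero: "csubspace {x. \<forall>y\<in>S. cinner (y::'a::chilbert_space) x = 0}"
  by (auto simp: complex_vector.subspace_def cinner_add_right cinner_scaleC_right)

lemma closed_orthogonal: "closed {x. \<forall>y\<in>S. cinner (y::'a::chilbert_space) x = 0}"
proof -
  have "{x. \<forall>y\<in>S. cinner y x = 0} = (\<Inter>y\<in>S. {x. cinner y x = 0})" by auto
  then show ?thesis using closed_cinner_zero by (auto intro!: closed_INT)
qed

lemma cinner_zero_closure_cspan:
  fixes v :: "'a::chilbert_space"
  assumes "\<And>x. x \<in> X \<Longrightarrow> cinner x v = 0" "y \<in> closure (cspan X)"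
  shows "cinner y v = 0"
proof -
  have 1: "cinner v x = 0" if "x \<in> X" for x using assms(1)[OF that] cinner_commute[of v x] by simp
  have "closure (cspan X) \<subseteq> {x. \<forall>y\<in>{v}. cinner y x = 0}"
    by (rule closure_cspan_subset) (use 1 csubspace_cinner_zero[of "{v}"] closed_cinner_zero[of v] in auto)
  then have "cinner v y = 0" using assms(2) by blast
  then show ?thesis using cinner_commute[of y v] by simp
qed

text \<open>Minimizing \<open>q (u - v) (u - v)\<close> over \<open>v \<in> S\<close>.\<close>

lemma projection_bilinear_form:
  fixes q :: "'a::{real_normed_vector,complete_space} \<Rightarrow> 'a \<Rightarrow> real"
  assumes q: "bounded_bilinear q" and sym: "\<And>x y. q x y = q y x"
    and c: "c > 0" "\<And>x. c * (norm x)\<^sup>2 \<le> q x x"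
    and S: "subspace S" "closed S"
  shows "\<exists>v\<in>S. \<forall>w\<in>S. q w (u - v) = 0"
proof -
  interpret bounded_bilinear q by (rule q)
  note bil = add_left add_right diff_left diff_right minus_left minus_right scaleR_left scaleR_right
  have pos: "q x x \<ge> 0" for x using c(2)[of x] c(1) by (smt (verit) mult_nonneg_nonneg zero_le_power2)
  define Q where "Q v = q (u - v) (u - v)" for v
  define d where "d = (INF v\<in>S. Q v)"
  have bdd: "bdd_below (Q ` S)" by (rule bdd_belowI[of _ 0]) (auto simp: Q_def pos)
  have S0: "S \<noteq> {}" using S(1) subspace_0 by blast
  have dle: "d \<le> Q v" if "v \<in> S" for v unfolding d_def by (rule cINF_lower[OF bdd that])
  have "\<exists>v\<in>S. Q v < d + 1 / (real n + 1)" for n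
    using cINF_less_iff[OF S0 bdd, of "d + 1 / (real n + 1)"] unfolding d_def[symmetric] by simp
  then obtain v where v: "v n \<in> S" "Q (v n) < d + 1 / (real n + 1)" for n by metis
  \<comment> \<open>The parallelogram law for \<open>q\<close>, applied to \<open>a - u\<close> and
    \<open>b - u\<close>; the midpoint lies in \<open>S\<close> again, so its value is at least
    \<open>d\<close>.\<close>
  have par: "q (a - b) (a - b) = 2 * Q a + 2 * Q b - 4 * Q ((1/2) *\<^sub>R (a + b))" for a b
    unfolding Q_def by (simp add: bil algebra_simps sym[of a u] sym[of b u] sym[of b a])
  have est: "c * (norm (v n - v m))\<^sup>2 \<le> 2 / (real n + 1) + 2 / (real m + 1)" for n m
  proof -
    have "d \<le> Q ((1/2) *\<^sub>R (v n + v m))"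
      by (intro dle subspace_mul S subspace_add v)
    then show ?thesis using c(2)[of "v n - v m"] par[of "v n" "v m"] v(2)[of n] v(2)[of m] by simp
  qed
  have "Cauchy v"
  proof (rule metric_CauchyI)
    fix e :: real assume e: "e > 0"
    obtain N where N: "4 / (c * e\<^sup>2) < real N" using reals_Archimedean2 by blast
    have "dist (v m) (v n) < e" if "m \<ge> N" "n \<ge> N" for m n
    proof -
      have "c * (norm (v m - v n))\<^sup>2 \<le> 2 / (real N + 1) + 2 / (real N + 1)"
        using est[of m n] that frac_le[of 2 2 "real N + 1" "real m + 1"] frac_le[of 2 2 "real N + 1" "real n + 1"]
        by linarith
      also have "\<dots> = 4 / (real N + 1)" by simp
      also have "\<dots> < c * e\<^sup>2"
        using N c(1) e by (simp add: field_simps) (smt (verit) mult_nonneg_nonneg zero_le_power2)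
      finally have "(norm (v m - v n))\<^sup>2 < e\<^sup>2" using c(1) by simp
      then show ?thesis using e by (simp add: dist_norm power2_less_imp_less)
    qed
    then show "\<exists>M. \<forall>m\<ge>M. \<forall>n\<ge>M. dist (v m) (v n) < e" by blast
  qed
  then obtain l where l: "v \<longlonglongrightarrow> l" using Cauchy_convergent_iff convergent_def by blast
  have lS: "l \<in> S" using closed_sequentially[OF S(2)] v(1) l by blast
  have "(\<lambda>n. Q (v n)) \<longlonglongrightarrow> Q l"
    unfolding Q_def by (intro tendsto tendsto_diff tendsto_const l)
  moreover have "(\<lambda>n. d + 1 / (real n + 1)) \<longlonglongrightarrow> d + 0"
    by (intro tendsto_intros LIMSEQ_inverse_real_of_nat[THEN tendsto_cong[THEN iffD1, rotated]])
       (simp add: inverse_eq_divide add.commute)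
  ultimately have "Q l \<le> d"
    using v(2) by (intro LIMSEQ_le[of "\<lambda>n. Q (v n)" _ "\<lambda>n. d + 1 / (real n + 1)"]) (auto intro: less_imp_le)
  have "q w (u - l) = 0" if w: "w \<in> S" for w
  proof (rule ccontr)
    define a where "a = q w (u - l)"
    define b where "b = q w w"
    assume "q w (u - l) \<noteq> 0"
    then have a0: "a \<noteq> 0" by (simp add: a_def)
    have ineq: "2 * t * a \<le> t\<^sup>2 * b" for t
    proof -
      have "l + t *\<^sub>R w \<in> S" using S(1) lS w by (simp add: subspace_add subspace_mul)
      then have "Q l \<le> Q (l + t *\<^sub>R w)" using dle \<open>Q l \<le> d\<close> by force
      also have "Q (l + t *\<^sub>R w) = Q l - 2 * t * a + t\<^sup>2 * b"
        unfolding Q_def a_def b_def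
        by (simp add: bil algebra_simps power2_eq_square sym[of u w] sym[of l w])
      finally show ?thesis by simp
    qed
    have b0: "b \<ge> 0" by (simp add: b_def pos)
    \<comment> \<open>The quadratic is extremal at a / b; the denominator \<open>b + 1\<close>
      avoids the case \<open>b = 0\<close> and still contradicts \<open>ineq\<close>.\<close>
    define t where "t = a / (b + 1)"
    have at: "a = t * (b + 1)" "t \<noteq> 0" using a0 b0 by (auto simp: t_def)
    have "t\<^sup>2 * (b + 2) \<le> 0" using ineq[of t] unfolding at(1) by (simp add: power2_eq_square algebra_simps)
    moreover have "t\<^sup>2 * (b + 2) > 0" using at(2) b0 by simp
    ultimately show False by simp
  qed
  then show ?thesis using lS by blast
qed

lemma projection_sesquilinear_form:
  fixes q :: "'a::cbanach \<Rightarrow> 'a \<Rightarrow> complex"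
  assumes add: "\<And>x y z. q x (y + z) = q x y + q x z" and scale: "\<And>c x y. q x (c *\<^sub>C y) = c * q x y"
    and sym: "\<And>x y. q y x = cnj (q x y)"
    and bd: "\<And>x y. cmod (q x y) \<le> K * norm x * norm y"
    and c: "c > 0" "\<And>x. c * (norm x)\<^sup>2 \<le> Re (q x x)"
    and S: "csubspace S" "closed S"
  obtains e where "bounded_clinear e" "\<And>u. e u \<in> S" "\<And>u w. w \<in> S \<Longrightarrow> q w (u - e u) = 0"
    "\<And>u v. v \<in> S \<Longrightarrow> (\<And>w. w \<in> S \<Longrightarrow> q w (u - v) = 0) \<Longrightarrow> e u = v"
proof -
  have addl: "q (x + y) z = q x z + q y z" for x y z by (metis add sym complex_cnj_add)
  have scalel: "q (a *\<^sub>C x) z = cnj a * q x z" for a x z by (metis scale sym complex_cnj_mult)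
  have bil: "bounded_bilinear (\<lambda>x y. Re (q x y))"
  proof
    show "\<exists>K. \<forall>a b. norm (Re (q a b)) \<le> norm a * norm b * K"
    proof (intro exI allI)
      show "norm (Re (q a b)) \<le> norm a * norm b * K" for a b
        using order_trans[OF abs_Re_le_cmod bd[of a b]] by (simp add: mult_ac)
    qed
  qed (auto simp: add addl scaleR_scaleC scale scalel)
  have qR: "Re (q x y) = Re (q y x)" for x y using sym[of x y] by simp
  have ex: "\<exists>v\<in>S. \<forall>w\<in>S. q w (u - v) = 0" for u
  proof -
    obtain v where v: "v \<in> S" "\<And>w. w \<in> S \<Longrightarrow> Re (q w (u - v)) = 0"
      using projection_bilinear_form[OF bil qR c csubspace_real[OF S(1)] S(2)] by blast
    have "q w (u - v) = 0" if w: "w \<in> S" for w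
    proof (rule complex_eqI)
      have "\<i> *\<^sub>C w \<in> S" using S(1) w by (simp add: complex_vector.subspace_def)
      from v(2)[OF this] show "Im (q w (u - v)) = Im 0" by (simp add: scalel)
    qed (use v w in simp)
    then show ?thesis using v by blast
  qed
  have q0: "q x 0 = 0" for x using scale[of x 0 0] by simp
  have qm: "q x (- y) = - q x y" for x y
    using add[of x y "- y"] q0[of x] by (simp add: eq_neg_iff_add_eq_0 add.commute)
  have uniq: "v = v'" if "v \<in> S" "v' \<in> S" "\<And>w. w \<in> S \<Longrightarrow> q w (u - v) = 0" "\<And>w. w \<in> S \<Longrightarrow> q w (u - v') = 0" for u v v'
  proof -
    have vS: "v - v' \<in> S" using S(1) that by (simp add: complex_vector.subspace_diff)
    have "q (v - v') ((u - v') + (- (u - v))) = 0"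
      unfolding add qm using that(3,4)[OF vS] by simp
    then have "c * (norm (v - v'))\<^sup>2 \<le> 0" using c(2)[of "v - v'"] by simp
    then have "(norm (v - v'))\<^sup>2 \<le> 0" using c(1) by (simp add: mult_le_0_iff)
    then show ?thesis by simp
  qed
  define e where "e u = (SOME v. v \<in> S \<and> (\<forall>w\<in>S. q w (u - v) = 0))" for u
  have e: "e u \<in> S \<and> (\<forall>w\<in>S. q w (u - e u) = 0)" for u
    unfolding e_def by (rule someI_ex) (use ex in blast)
  have eu: "e u = v" if "v \<in> S" "\<And>w. w \<in> S \<Longrightarrow> q w (u - v) = 0" for u v
    using uniq[of "e u" v u] that e by blast
  have "bounded_clinear e"
  proof (rule bounded_clinearI)
    fix x y and a :: complex
    show "e (x + y) = e x + e y"
    proof (rule eu)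
      show "e x + e y \<in> S" using e S(1) by (simp add: complex_vector.subspace_def)
      fix w assume "w \<in> S"
      then have "q w ((x - e x) + (y - e y)) = 0" unfolding add using e by simp
      then show "q w (x + y - (e x + e y)) = 0" by (simp add: algebra_simps)
    qed
    show "e (a *\<^sub>C x) = a *\<^sub>C e x"
    proof (rule eu)
      show "a *\<^sub>C e x \<in> S" using e S(1) by (simp add: complex_vector.subspace_def)
      fix w assume "w \<in> S"
      then have "q w (a *\<^sub>C (x - e x)) = 0" unfolding scale using e by simp
      then show "q w (a *\<^sub>C x - a *\<^sub>C e x) = 0" by (simp add: complex_vector.scale_right_diff_distrib)
    qed
    show "norm (e x) \<le> (K / c) * norm x"
    proof (cases "e x = 0")
      case True
      have "0 \<le> K" if "norm x > 0"
        using order_trans[OF norm_ge_zero bd[of x x]] that by (simp add: zero_le_mult_iff)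
      then show ?thesis using True c(1) by (cases "x = 0") auto
    next
      case False
      have "q (e x) (x - e x) = 0" using e by blast
      then have "q (e x) x = q (e x) (e x)" using add[of "e x" "x - e x" "e x"] by simp
      then have "c * (norm (e x))\<^sup>2 \<le> K * norm (e x) * norm x"
        using c(2)[of "e x"] bd[of "e x" x] by (smt (verit) complex_Re_le_cmod)
      then show ?thesis using False c(1) by (simp add: power2_eq_square field_simps)
    qed
  qed
  then show ?thesis using that e eu by blast
qed

lemma hilbert_projection:
  fixes S :: "'a::chilbert_space set"
  assumes "csubspace S" "closed S"
  obtains e where "bounded_clinear e" "\<And>u. e u \<in> S" "\<And>u w. w \<in> S \<Longrightarrow> cinner w (u - e u) = 0"
    "\<And>u v. v \<in> S \<Longrightarrow> (\<And>w. w \<in> S \<Longrightarrow> cinner w (u - v) = 0) \<Longrightarrow> e u = v"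
proof (rule projection_sesquilinear_form[of "cinner :: 'a \<Rightarrow> _" 1 1 S])
  show "cmod (cinner x y) \<le> 1 * norm x * norm y" for x y :: 'a using norm_cinner_le[of x y] by simp
  show "1 * (norm x)\<^sup>2 \<le> Re (cinner x x)" for x :: 'a by (simp add: Re_cinner_self)
qed (use assms that in \<open>simp_all add: cinner_add_right cinner_scaleC_right cinner_commute[symmetric]\<close>)

text \<open>The double orthogonal complement: \<open>v\<close> minus its projection is orthogonal to
  \<open>X\<close>, hence by assumption to \<open>v\<close>, hence to itself.\<close>

lemma in_closure_cspanI:
  fixes v :: "'a::chilbert_space"
  assumes "\<And>z. (\<And>x. x \<in> X \<Longrightarrow> cinner x z = 0) \<Longrightarrow> cinner z v = 0"
  shows "v \<in> closure (cspan X)"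
proof -
  obtain e where e: "\<And>u. e u \<in> closure (cspan X)" "\<And>u w. w \<in> closure (cspan X) \<Longrightarrow> cinner w (u - e u) = 0"
    using hilbert_projection[OF csubspace_closure_cspan[of X] closed_closure] by metis
  have z: "cinner x (v - e v) = 0" if "x \<in> X" for x
    using e(2)[of x v] that by (simp add: closure_cspan_superset)
  have "cinner (v - e v) v = 0" by (rule assms) (rule z)
  moreover have "cinner (v - e v) (e v) = 0"
    using e(2)[OF e(1)[of v], of v] cinner_commute[of "v - e v" "e v"] by simp
  ultimately have "cinner (v - e v) (v - e v) = 0" by (simp add: cinner_diff_right)
  then have "v = e v" by (simp add: cinner_eq_zero_iff)
  then show ?thesis using e(1) by metis
qed

lemma closure_cspan_UNIV_I:
  fixes X :: "'a::chilbert_space set"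
  assumes "\<And>z. (\<And>x. x \<in> X \<Longrightarrow> cinner x z = 0) \<Longrightarrow> z = 0"
  shows "closure (cspan X) = UNIV"
proof -
  have "v \<in> closure (cspan X)" for v
    by (rule in_closure_cspanI) (metis assms cinner_zero_left)
  then show ?thesis by blast
qed

lemma total_cinner_zero:
  fixes z :: "'a::chilbert_space"
  assumes "closure (cspan X) = UNIV" "\<And>x. x \<in> X \<Longrightarrow> cinner x z = 0"
  shows "z = 0"
  using cinner_zero_closure_cspan[of X z z] assms cinner_eq_zero_iff by auto

lemma continuous_on_bounded_clinear: "bounded_clinear f \<Longrightarrow> continuous_on S f"
  by (intro linear_continuous_on bounded_clinearD(1))

lemma bounded_clinear_compose: "bounded_clinear f \<Longrightarrow> bounded_clinear g \<Longrightarrow> bounded_clinear (\<lambda>x. f (g x))"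
  unfolding bounded_clinear_def by (simp add: bounded_linear_compose)

lemma bounded_clinear_vimage:
  assumes f: "bounded_clinear f" and V: "csubspace V" "closed V"
  shows "csubspace {u. f u \<in> V}" "closed {u. f u \<in> V}"
  using V(1) closed_vimage[OF V(2) continuous_on_bounded_clinear[OF f, of UNIV]]
  by (auto simp: complex_vector.subspace_def bounded_clinearD(2-4)[OF f] vimage_def)

lemma bounded_clinear_eq_total:
  fixes f g :: "'a::complex_normed_vector \<Rightarrow> 'b::complex_normed_vector"
  assumes "closure (cspan X) = UNIV" "bounded_clinear f" "bounded_clinear g" "\<And>x. x \<in> X \<Longrightarrow> f x = g x"
  shows "f = g"
proof -
  have "closure (cspan X) \<subseteq> {x. f x = g x}"
  proof (rule closure_cspan_subset)
    show "csubspace {x. f x = g x}"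
      using assms(2,3)[THEN bounded_clinearD(2)] assms(2,3)[THEN bounded_clinearD(3)] assms(2,3)[THEN bounded_clinearD(4)]
      by (simp add: complex_vector.subspace_def)
    show "closed {x. f x = g x}" by (intro closed_Collect_eq continuous_on_bounded_clinear assms)
  qed (use assms in auto)
  then show ?thesis using assms(1) by blast
qed

section \<open>Riesz representation, adjoints, and operators given on generators\<close>

lemma riesz:
  fixes f :: "'a::chilbert_space \<Rightarrow> complex"
  assumes f: "bounded_clinear f"
  shows "\<exists>!y. \<forall>x. f x = cinner y x"
proof -
  define S where "S = {x. f x = 0}"
  have S: "csubspace S" "closed S"
    unfolding S_def using bounded_clinearD(2,3,4)[OF f]
    by (simp_all add: complex_vector.subspace_def scaleC_complex_def closed_Collect_eq continuous_on_bounded_clinear[OF f])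
  obtain e where e: "\<And>u. e u \<in> S" "\<And>u w. w \<in> S \<Longrightarrow> cinner w (u - e u) = 0"
    using hilbert_projection[OF S] by metis
  have "\<exists>y. \<forall>x. f x = cinner y x"
  proof (cases "\<forall>u. f u = 0")
    case True
    then show ?thesis by (intro exI[of _ 0]) simp
  next
    case False
    then obtain u where u: "f u \<noteq> 0" by blast
    define z where "z = u - e u"
    have fz: "f z = f u" using e(1)[of u] by (simp add: z_def bounded_clinearD[OF f] S_def)
    have z0: "norm z \<noteq> 0" using fz u bounded_clinearD(4)[OF f] by auto
    have "f x = cinner ((cnj (f z) / of_real ((norm z)\<^sup>2)) *\<^sub>C z) x" for x
    proof -
      have "x - (f x / f z) *\<^sub>C z \<in> S"
        using fz u by (simp add: S_def bounded_clinearD[OF f] scaleC_complex_def)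
      then have "cinner (x - (f x / f z) *\<^sub>C z) z = 0" unfolding z_def by (rule e(2))
      then have "cinner z (x - (f x / f z) *\<^sub>C z) = 0"
        using cinner_commute[of z "x - (f x / f z) *\<^sub>C z"] by simp
      then have "cinner z x = (f x / f z) * of_real ((norm z)\<^sup>2)"
        by (simp add: cinner_diff_right cinner_scaleC_right cinner_self)
      then show ?thesis using fz u z0 by (simp add: cinner_scaleC_left)
    qed
    then show ?thesis by blast
  qed
  moreover have "y = y'" if "\<forall>x. f x = cinner y x" "\<forall>x. f x = cinner y' x" for y y'
    using that by (intro cinner_ext) (metis cinner_commute)
  ultimately show ?thesis by blast
qed

text \<open>Adjoints between different spaces, needed for maps such as \<open>t x\<close>, the
  embedding of H and the inclusion of the first summand. On a single space the adjoint is
  \<open>star\<close> on \<open>bop\<close>.\<close>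

definition adj :: "('a::chilbert_space \<Rightarrow> 'b::chilbert_space) \<Rightarrow> 'b \<Rightarrow> 'a" where
  "adj f y = (THE z. \<forall>x. cinner y (f x) = cinner z x)"

lemma cinner_adj_left:
  assumes f: "bounded_clinear f"
  shows "cinner (adj f y) x = cinner y (f x)"
proof -
  have "bounded_clinear (\<lambda>x. cinner y (f x))"
  proof (rule bounded_clinearI[where K = "norm y * onorm f"])
    show "norm (cinner y (f x)) \<le> norm y * onorm f * norm x" for x
      using order_trans[OF norm_cinner_le mult_left_mono[OF bounded_clinearD(7)[OF f] norm_ge_zero]]
      by (simp add: mult.assoc)
  qed (auto simp: bounded_clinearD[OF f] cinner_add_right cinner_scaleC_right scaleC_complex_def)
  then have "\<exists>!z. \<forall>x. cinner y (f x) = cinner z x" by (rule riesz)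
  from theI'[OF this] have "\<forall>x. cinner y (f x) = cinner (adj f y) x" unfolding adj_def .
  then show ?thesis by metis
qed

lemma cinner_adj_right:
  assumes f: "bounded_clinear f"
  shows "cinner x (adj f y) = cinner (f x) y"
  by (metis assms cinner_adj_left cinner_commute)

lemma bounded_clinear_adj:
  assumes f: "bounded_clinear f"
  shows "bounded_clinear (adj f)"
proof (rule bounded_clinearI[where K = "onorm f"])
  show "norm (adj f x) \<le> onorm f * norm x" for x
  proof (rule norm_bound_cinner)
    show "cmod (cinner z (adj f x)) \<le> onorm f * norm x * norm z" for z
      unfolding cinner_adj_right[OF f]
      using norm_cinner_le[of "f z" x] bounded_clinearD(7)[OF f, of z]
        mult_right_mono[OF bounded_clinearD(7)[OF f, of z] norm_ge_zero[of x]] by (simp add: mult_ac)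
    show "0 \<le> onorm f * norm x" by (simp add: onorm_pos_le[OF bounded_clinearD(1)[OF f]])
  qed
  show "adj f (x + y) = adj f x + adj f y" for x y
    by (rule cinner_ext) (simp only: cinner_adj_right[OF f] cinner_add_right)
  show "adj f (c *\<^sub>C x) = c *\<^sub>C adj f x" for c x
    by (rule cinner_ext) (simp only: cinner_adj_right[OF f] cinner_scaleC_right)
qed

lemma norm_sq_sum_scaleC:
  "of_real ((norm (\<Sum>i\<in>A. c i *\<^sub>C (g i :: 'a::chilbert_space)))\<^sup>2)
    = (\<Sum>i\<in>A. \<Sum>j\<in>A. cnj (c i) * c j * cinner (g i) (g j))"
  unfolding cinner_self[symmetric]
  by (subst cinner_sum_left)
     (simp add: cinner_sum_right cinner_scaleC_left cinner_scaleC_right sum_distrib_left mult.assoc mult.left_commute)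

lemma scaleC_sum_union:
  fixes f :: "'i \<Rightarrow> 'z::complex_vector"
  assumes "finite A" "finite B"
  shows "(\<Sum>i\<in>A \<union> B. ((if i \<in> A then c i else 0) + (if i \<in> B then d i else 0)) *\<^sub>C f i)
    = (\<Sum>i\<in>A. c i *\<^sub>C f i) + (\<Sum>i\<in>B. d i *\<^sub>C f i)"
proof -
  have "(\<Sum>i\<in>A \<union> B. (if i \<in> A then c i else 0) *\<^sub>C f i) = (\<Sum>i\<in>A. c i *\<^sub>C f i)"
    by (rule sum.mono_neutral_cong_right) (use assms in auto)
  moreover have "(\<Sum>i\<in>A \<union> B. (if i \<in> B then d i else 0) *\<^sub>C f i) = (\<Sum>i\<in>B. d i *\<^sub>C f i)"
    by (rule sum.mono_neutral_cong_right) (use assms in auto)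
  ultimately show ?thesis by (simp add: scaleC_add_left sum.distrib)
qed

text \<open>The graph of the extension is the closure of the linear span of the pairs \<open>(g i, g' i)\<close>.\<close>

lemma extend_operator:
  fixes g :: "'i \<Rightarrow> 'k::chilbert_space" and g' :: "'i \<Rightarrow> 'l::cbanach"
  assumes bd: "\<And>A c. finite A \<Longrightarrow> A \<subseteq> I \<Longrightarrow> norm (\<Sum>i\<in>A. c i *\<^sub>C g' i) \<le> C * norm (\<Sum>i\<in>A. c i *\<^sub>C g i)"
  obtains W where "bounded_clinear W" "\<And>i. i \<in> I \<Longrightarrow> W (g i) = g' i" "\<And>x. norm (W x) \<le> \<bar>C\<bar> * norm x"
    "\<And>x. (\<And>i. i \<in> I \<Longrightarrow> cinner (g i) x = 0) \<Longrightarrow> W x = 0"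
proof -
  define D where "D = {(\<Sum>i\<in>A. c i *\<^sub>C g i, \<Sum>i\<in>A. c i *\<^sub>C g' i) | A c. finite A \<and> A \<subseteq> I}"
  have D_zero: "(0, 0) \<in> D" unfolding D_def by (rule CollectI, rule exI[of _ "{}"]) simp
  have D_gen: "(g i, g' i) \<in> D" if "i \<in> I" for i
    unfolding D_def by (rule CollectI, rule exI[of _ "{i}"], rule exI[of _ "\<lambda>_. 1"]) (use that in \<open>simp add: scaleC_one\<close>)
  have D_scale: "(a *\<^sub>C x, a *\<^sub>C y) \<in> D" if "(x, y) \<in> D" for a x y
  proof -
    from that obtain A c where "finite A" "A \<subseteq> I" "x = (\<Sum>i\<in>A. c i *\<^sub>C g i)" "y = (\<Sum>i\<in>A. c i *\<^sub>C g' i)"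
      unfolding D_def by blast
    then show ?thesis unfolding D_def
      by (intro CollectI exI[of _ A] exI[of _ "\<lambda>i. a * c i"])
         (auto simp: complex_vector.scale_sum_right scaleC_scaleC)
  qed
  have D_add: "(x + x', y + y') \<in> D" if xy: "(x, y) \<in> D" "(x', y') \<in> D" for x x' y y'
  proof -
    from xy obtain A c B d where h: "finite A" "A \<subseteq> I" "x = (\<Sum>i\<in>A. c i *\<^sub>C g i)" "y = (\<Sum>i\<in>A. c i *\<^sub>C g' i)"
      "finite B" "B \<subseteq> I" "x' = (\<Sum>i\<in>B. d i *\<^sub>C g i)" "y' = (\<Sum>i\<in>B. d i *\<^sub>C g' i)"
      unfolding D_def by blast
    define e where "e i = (if i \<in> A then c i else 0) + (if i \<in> B then d i else 0)" for i
    show ?thesis unfolding D_def h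
      by (intro CollectI exI[of _ "A \<union> B"] exI[of _ e] conjI)
         (use h in \<open>simp_all add: e_def scaleC_sum_union\<close>)
  qed
  have D_bd: "norm y \<le> \<bar>C\<bar> * norm x" if "(x, y) \<in> D" for x y
    using that bd unfolding D_def by (auto intro!: order_trans[OF bd] mult_right_mono)
  define E where "E = closure D"
  have E_bd: "norm y \<le> \<bar>C\<bar> * norm x" if "(x, y) \<in> E" for x y
  proof -
    have "closed {p :: 'k \<times> 'l. norm (snd p) \<le> \<bar>C\<bar> * norm (fst p)}"
      by (intro closed_Collect_le continuous_intros)
    then have "E \<subseteq> {p. norm (snd p) \<le> \<bar>C\<bar> * norm (fst p)}"
      unfolding E_def using D_bd by (intro closure_minimal) auto
    then show ?thesis using that by auto
  qed
  have "subspace D"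
    unfolding subspace_def
  proof (intro conjI allI ballI)
    show "0 \<in> D" using D_zero by (simp add: zero_prod_def)
    show "p + q \<in> D" if "p \<in> D" "q \<in> D" for p q
      using D_add[of "fst p" "snd p" "fst q" "snd q"] that by (simp add: plus_prod_def)
    show "r *\<^sub>R p \<in> D" if "p \<in> D" for r p
      using D_scale[of "fst p" "snd p" "of_real r"] that by (simp add: scaleR_prod_def scaleR_scaleC)
  qed
  then have E: "subspace E" unfolding E_def by (rule subspace_closure_real)
  have E_add: "(x + x', y + y') \<in> E" if "(x, y) \<in> E" "(x', y') \<in> E" for x x' y y'
    using subspace_add[OF E that] by simp
  have E_scale: "(a *\<^sub>C x, a *\<^sub>C y) \<in> E" if "(x, y) \<in> E" for a x y
  proof -
    from that obtain p where p: "\<forall>n. p n \<in> D" "p \<longlonglongrightarrow> (x, y)"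
      unfolding E_def closure_sequential by blast
    have "(\<lambda>n. (a *\<^sub>C fst (p n), a *\<^sub>C snd (p n))) \<longlonglongrightarrow> (a *\<^sub>C x, a *\<^sub>C y)"
      using tendsto_fst[OF p(2)] tendsto_snd[OF p(2)] by (intro tendsto_Pair tendsto_scaleC) simp_all
    moreover have "(a *\<^sub>C fst (p n), a *\<^sub>C snd (p n)) \<in> D" for n using p(1) D_scale by simp
    ultimately show ?thesis unfolding E_def closure_sequential
      by (intro exI[of _ "\<lambda>n. (a *\<^sub>C fst (p n), a *\<^sub>C snd (p n))"]) auto
  qed
  have E_D: "D \<subseteq> E" unfolding E_def by (rule closure_subset)
  have E_uniq: "y = y'" if "(x, y) \<in> E" "(x, y') \<in> E" for x y y'
  proof -
    have "(x + (-1) *\<^sub>C x, y + (-1) *\<^sub>C y') \<in> E" by (intro E_add E_scale that)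
    from E_bd[OF this] show ?thesis by simp
  qed
  define S where "S = fst ` E"
  have SE: "x \<in> S \<longleftrightarrow> (\<exists>y. (x, y) \<in> E)" for x unfolding S_def by force
  have S: "csubspace S"
    unfolding complex_vector.subspace_def
  proof (intro conjI allI ballI impI)
    show "0 \<in> S" using D_zero E_D SE by blast
    show "x + y \<in> S" if "x \<in> S" "y \<in> S" for x y using that unfolding SE by (blast intro: E_add)
    show "a *\<^sub>C x \<in> S" if "x \<in> S" for a x using that unfolding SE by (blast intro: E_scale)
  qed
  \<comment> \<open>By \<open>E_bd\<close> the projection of the closed graph to its first component
    is bounded below, so its image is closed. Hence there is an orthogonal projection
    \<open>e\<close> onto \<open>S\<close>, and composing the graph with \<open>e\<close> extends
    the operator by 0 on the complement.\<close>
  have Scl: "closed S"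
    unfolding S_def
  proof (intro complete_imp_closed complete_isometric_image[OF _ E bounded_linear_fst])
    show "\<forall>p\<in>E. 1 / (1 + \<bar>C\<bar>) * norm p \<le> norm (fst p)"
    proof
      fix p assume "p \<in> E"
      then have "norm p \<le> norm (fst p) + \<bar>C\<bar> * norm (fst p)"
        using norm_Pair_le[of "fst p" "snd p"] E_bd[of "fst p" "snd p"] by simp
      then show "1 / (1 + \<bar>C\<bar>) * norm p \<le> norm (fst p)" by (simp add: field_simps)
    qed
    show "complete E" unfolding E_def by (simp add: complete_eq_closed)
  qed simp
  obtain e where e: "bounded_clinear e" "\<And>u. e u \<in> S" "\<And>u w. w \<in> S \<Longrightarrow> cinner w (u - e u) = 0"
    "\<And>u v. v \<in> S \<Longrightarrow> (\<And>w. w \<in> S \<Longrightarrow> cinner w (u - v) = 0) \<Longrightarrow> e u = v"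
    using hilbert_projection[OF S Scl] by metis
  define W where "W u = (THE y. (e u, y) \<in> E)" for u
  have W: "(e u, W u) \<in> E" for u
  proof -
    obtain y where y: "(e u, y) \<in> E" using e(2)[of u] SE by blast
    show ?thesis unfolding W_def by (rule theI[of _ y]) (use y E_uniq in blast)+
  qed
  have e_le: "norm (e u) \<le> norm u" for u
  proof -
    have "cinner (e u) u = cinner (e u) (e u)" using e(3)[OF e(2)[of u], of u] by (simp add: cinner_diff_right)
    then have "norm (e u) * norm (e u) \<le> norm (e u) * norm u"
      using norm_cinner_le[of "e u" u] by (simp add: cinner_self power2_eq_square norm_mult)
    then show ?thesis by (cases "e u = 0") auto
  qed
  have Wb: "norm (W u) \<le> \<bar>C\<bar> * norm u" for u
    using E_bd[OF W[of u]] e_le[of u] by (meson abs_ge_zero mult_left_mono order_trans)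
  show ?thesis
  proof
    show "bounded_clinear W"
    proof (rule bounded_clinearI[OF _ _ Wb])
      show "W (x + y) = W x + W y" for x y
        by (rule E_uniq[of "e (x + y)"]) (use W[of "x + y"] E_add[OF W[of x] W[of y]] bounded_clinearD(2)[OF e(1)] in auto)
      show "W (a *\<^sub>C x) = a *\<^sub>C W x" for a x
        by (rule E_uniq[of "e (a *\<^sub>C x)"]) (use W[of "a *\<^sub>C x"] E_scale[OF W[of x], of a] bounded_clinearD(3)[OF e(1)] in auto)
    qed
    show "W (g i) = g' i" if i: "i \<in> I" for i
    proof -
      have gi: "(g i, g' i) \<in> E" using D_gen[OF i] E_D by blast
      then have "e (g i) = g i" using SE by (intro e(4)) auto
      then show ?thesis using W[of "g i"] gi by (intro E_uniq[of "g i"]) simp_all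
    qed
    show "W x = 0" if x: "\<And>i. i \<in> I \<Longrightarrow> cinner (g i) x = 0" for x
    proof -
      have xD: "cinner x (fst p) = 0" if "p \<in> D" for p
      proof -
        from that obtain A c where A: "finite A" "A \<subseteq> I" "fst p = (\<Sum>i\<in>A. c i *\<^sub>C g i)" unfolding D_def by auto
        have "cinner x (g i) = 0" if "i \<in> A" for i using x[of i] A that cinner_commute[of x "g i"] by auto
        then show ?thesis by (simp add: A(3) cinner_sum_right cinner_scaleC_right)
      qed
      have "closed {p :: 'k \<times> 'l. cinner x (fst p) = 0}"
        by (rule closed_Collect_eq) (auto intro!: continuous_on_cinner continuous_intros)
      then have "E \<subseteq> {p. cinner x (fst p) = 0}"
        unfolding E_def using xD by (intro closure_minimal) auto
      then have xS: "cinner x w = 0" if "w \<in> S" for w using that SE by fastforce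
      have "e x = 0"
      proof (rule e(4))
        show "0 \<in> S" using S complex_vector.subspace_0 by blast
        show "cinner w (x - 0) = 0" if "w \<in> S" for w using xS[OF that] cinner_commute[of w x] by simp
      qed
      then show ?thesis using E_bd[OF W[of x]] by simp
    qed
  qed (rule Wb)
qed

text \<open>
  If \<open>\<tau>\<close> and \<open>\<tau>s\<close> are formally adjoint on the generators, then \<open>\<parallel>v\<^sub>1\<parallel>\<^bsup>2^n\<^esup> \<le> \<parallel>v\<^sub>0\<parallel>\<^bsup>2^n-1\<^esup> \<parallel>v\<^bsub>2^n\<^esub>\<parallel>\<close>
  for the orbit \<open>v\<^sub>n\<close> of a vector under \<open>\<tau>s \<circ> \<tau>\<close>, so any exponential bound on generators
  is a bound on their span.
\<close>

lemma formal_adjoint_bound: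
  fixes g :: "'i \<Rightarrow> 'k::chilbert_space"
  assumes adj: "\<And>i j. i \<in> I \<Longrightarrow> j \<in> I \<Longrightarrow> cinner (g (\<tau>s i)) (g j) = cinner (g i) (g (\<tau> j))"
    and I: "\<And>i. i \<in> I \<Longrightarrow> \<tau> i \<in> I" "\<And>i. i \<in> I \<Longrightarrow> \<tau>s i \<in> I"
    and growth: "\<And>i. i \<in> I \<Longrightarrow> \<exists>K. \<forall>n. norm (g (((\<tau>s \<circ> \<tau>) ^^ n) i)) \<le> K * \<rho> ^ n"
    and \<rho>: "\<rho> \<ge> 0" and A: "finite A" "A \<subseteq> I"
  shows "(norm (\<Sum>i\<in>A. c i *\<^sub>C g (\<tau> i)))\<^sup>2 \<le> \<rho> * (norm (\<Sum>i\<in>A. c i *\<^sub>C g i))\<^sup>2"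
proof -
  define \<sigma> where "\<sigma> = \<tau>s \<circ> \<tau>"
  define v where "v n = (\<Sum>i\<in>A. c i *\<^sub>C g ((\<sigma> ^^ n) i))" for n
  define a where "a n = norm (v n)" for n
  have adj': "cinner (g (\<tau> i)) (g j) = cinner (g i) (g (\<tau>s j))" if "i \<in> I" "j \<in> I" for i j
    using adj[OF that(2,1)] by (metis cinner_commute)
  have \<sigma>I: "(\<sigma> ^^ n) i \<in> I" if "i \<in> I" for n i
    by (induction n) (use that I in \<open>auto simp: \<sigma>_def\<close>)
  have \<sigma>adj: "cinner (g (\<sigma> i)) (g j) = cinner (g i) (g (\<sigma> j))" if "i \<in> I" "j \<in> I" for i j
    using that I by (simp add: \<sigma>_def adj adj')
  have \<sigma>n: "cinner (g ((\<sigma> ^^ n) i)) (g j) = cinner (g i) (g ((\<sigma> ^^ n) j))" if "i \<in> I" "j \<in> I" for i j n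
    using that
  proof (induction n arbitrary: i j)
    case (Suc n)
    have "cinner (g ((\<sigma> ^^ Suc n) i)) (g j) = cinner (g (\<sigma> i)) (g ((\<sigma> ^^ n) j))"
      using Suc.IH[of "\<sigma> i" j] Suc.prems \<sigma>I[of i 1] by (simp add: funpow_swap1)
    also have "\<dots> = cinner (g i) (g ((\<sigma> ^^ Suc n) j))" using Suc.prems \<sigma>I by (simp add: \<sigma>adj)
    finally show ?case .
  qed simp
  have "cinner (v n) (v m) = cinner (v 0) (v (n + m))" for n m
    unfolding v_def
    by (subst (1 2) cinner_sum_left)
       (use A \<sigma>I \<sigma>n in \<open>auto simp: cinner_sum_right cinner_scaleC_left cinner_scaleC_right sum_distrib_left
           funpow_add subset_eq mult.assoc intro!: sum.cong\<close>)
  then have a2: "(a n)\<^sup>2 \<le> a 0 * a (2 * n)" for n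
    using norm_cinner_le[of "v 0" "v (2 * n)"] unfolding a_def
    by (metis cinner_self mult_2 norm_ge_zero norm_of_real abs_of_nonneg zero_le_power2)
  obtain K where K: "\<And>i n. i \<in> I \<Longrightarrow> norm (g ((\<sigma> ^^ n) i)) \<le> K i * \<rho> ^ n"
    using growth unfolding \<sigma>_def by metis
  define C where "C = (\<Sum>i\<in>A. cmod (c i) * K i)"
  have aC: "a n \<le> C * \<rho> ^ n" for n
  proof -
    have "a n \<le> (\<Sum>i\<in>A. norm (c i *\<^sub>C g ((\<sigma> ^^ n) i)))" unfolding a_def v_def by (rule norm_sum)
    also have "\<dots> \<le> (\<Sum>i\<in>A. cmod (c i) * (K i * \<rho> ^ n))"
      unfolding norm_scaleC by (intro sum_mono mult_left_mono) (use A K in auto)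
    finally show ?thesis by (simp add: C_def sum_distrib_right mult.assoc)
  qed
  \<comment> \<open>The additional factor \<open>a 0\<close> replaces the exponent 2^n - 1 and
    avoids dividing by a norm that may vanish.\<close>
  have a_pow: "a 1 ^ (2 ^ n) * a 0 \<le> a 0 ^ (2 ^ n) * a (2 ^ n)" for n
  proof (induction n)
    case (Suc n)
    show ?case
    proof (cases "a 0 = 0")
      case False
      have "(a 1 ^ (2 ^ n) * a 0)\<^sup>2 \<le> (a 0 ^ (2 ^ n) * a (2 ^ n))\<^sup>2"
        by (rule power_mono[OF Suc]) (simp add: a_def)
      also have "\<dots> \<le> (a 0 ^ (2 ^ n))\<^sup>2 * (a 0 * a (2 * 2 ^ n))"
        unfolding power_mult_distrib by (intro mult_left_mono a2) simp
      finally have "(a 1 ^ (2 ^ Suc n) * a 0) * a 0 \<le> (a 0 ^ (2 ^ Suc n) * a (2 ^ Suc n)) * a 0"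
        by (simp add: power2_eq_square power_add mult_2 mult_ac)
      then show ?thesis using False by (simp add: a_def)
    qed (use a2[of 1] in \<open>simp add: a_def\<close>)
  qed (simp add: mult_ac)
  have a1: "a 1 \<le> \<rho> * a 0"
  proof (rule ccontr)
    assume neg: "\<not> a 1 \<le> \<rho> * a 0"
    have a0: "a 0 > 0"
    proof (rule ccontr)
      assume "\<not> a 0 > 0"
      then have "a 0 = 0" by (simp add: a_def)
      then show False using a2[of 1] neg by simp
    qed
    define r where "r = \<rho> * a 0"
    have r: "0 \<le> r" "r < a 1" using neg \<rho> a0 by (auto simp: r_def)
    have "a 1 ^ (2 ^ n) * a 0 \<le> C * r ^ (2 ^ n)" for n
    proof -
      have "a 0 ^ (2 ^ n) * a (2 ^ n) \<le> a 0 ^ (2 ^ n) * (C * \<rho> ^ (2 ^ n))"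
        by (intro mult_left_mono aC) (use a0 in simp)
      then show ?thesis using a_pow[of n] by (simp add: r_def power_mult_distrib mult_ac)
    qed
    then have le: "a 0 \<le> C * (r / a 1) ^ (2 ^ n)" for n
      using r by (simp add: power_divide field_simps)
    have "(\<lambda>n. (r / a 1) ^ n) \<longlonglongrightarrow> 0" using r by (intro LIMSEQ_realpow_zero) auto
    then have "(\<lambda>n. (r / a 1) ^ (2 ^ n)) \<longlonglongrightarrow> 0"
      by (rule LIMSEQ_subseq_LIMSEQ[where f = "\<lambda>n. 2 ^ n", unfolded comp_def]) (simp add: strict_mono_def)
    then have "(\<lambda>n. C * (r / a 1) ^ (2 ^ n)) \<longlonglongrightarrow> C * 0" by (intro tendsto_intros)
    then have "a 0 \<le> C * 0" by (rule LIMSEQ_le_const) (use le in blast)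
    then show False using a0 by simp
  qed
  have "of_real ((norm (\<Sum>i\<in>A. c i *\<^sub>C g (\<tau> i)))\<^sup>2) = cinner (v 0) (v 1)"
    unfolding norm_sq_sum_scaleC v_def
    by (subst cinner_sum_left)
       (use A I adj' in \<open>auto simp: cinner_sum_right cinner_scaleC_left cinner_scaleC_right sum_distrib_left
           \<sigma>_def subset_eq mult.assoc intro!: sum.cong\<close>)
  then have "(norm (\<Sum>i\<in>A. c i *\<^sub>C g (\<tau> i)))\<^sup>2 \<le> a 0 * a 1"
    using norm_cinner_le[of "v 0" "v 1"] unfolding a_def
    by (metis norm_of_real abs_of_nonneg zero_le_power2)
  also have "\<dots> \<le> a 0 * (\<rho> * a 0)" by (intro mult_left_mono a1) (simp add: a_def)
  finally show ?thesis by (simp add: a_def v_def power2_eq_square mult_ac)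
qed

text \<open>A spectral radius estimate takes the place of positivity arguments for matrices over M:
  a formal adjoint and crude growth on single generators already give a bounded operator with the
  sharp constant. This produces X \<otimes> I, I \<otimes> b and the map R_w u \<mapsto> R_w Z
  u.\<close>

lemma extend_operator_formal_adjoint:
  fixes g :: "'i \<Rightarrow> 'k::chilbert_space"
  assumes adj: "\<And>i j. i \<in> I \<Longrightarrow> j \<in> I \<Longrightarrow> cinner (g (\<tau>s i)) (g j) = cinner (g i) (g (\<tau> j))"
    and I: "\<And>i. i \<in> I \<Longrightarrow> \<tau> i \<in> I" "\<And>i. i \<in> I \<Longrightarrow> \<tau>s i \<in> I"
    and growth: "\<And>i. i \<in> I \<Longrightarrow> \<exists>K. \<forall>n. norm (g (((\<tau>s \<circ> \<tau>) ^^ n) i)) \<le> K * (r\<^sup>2) ^ n"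
    and r: "r \<ge> 0"
  obtains W where "bounded_clinear W" "\<And>i. i \<in> I \<Longrightarrow> W (g i) = g (\<tau> i)" "\<And>x. norm (W x) \<le> r * norm x"
    "\<And>x. (\<And>i. i \<in> I \<Longrightarrow> cinner (g i) x = 0) \<Longrightarrow> W x = 0"
proof (rule extend_operator[of I "\<lambda>i. g (\<tau> i)" r g])
  show "norm (\<Sum>i\<in>A. c i *\<^sub>C g (\<tau> i)) \<le> r * norm (\<Sum>i\<in>A. c i *\<^sub>C g i)" if "finite A" "A \<subseteq> I" for A c
  proof -
    have "(norm (\<Sum>i\<in>A. c i *\<^sub>C g (\<tau> i)))\<^sup>2 \<le> r\<^sup>2 * (norm (\<Sum>i\<in>A. c i *\<^sub>C g i))\<^sup>2"
      using formal_adjoint_bound[of I g \<tau>s \<tau> "r\<^sup>2" A c] adj I growth that by simp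
    then have "(norm (\<Sum>i\<in>A. c i *\<^sub>C g (\<tau> i)))\<^sup>2 \<le> (r * norm (\<Sum>i\<in>A. c i *\<^sub>C g i))\<^sup>2"
      by (simp add: power_mult_distrib)
    then show ?thesis by (rule power2_le_imp_le) (simp add: r)
  qed
qed (use r in \<open>auto intro: that\<close>)

text \<open>The squared norm of a combination of the \<open>g' i\<close> is <v, B v> for the same
  combination \<open>v\<close> of the \<open>g i\<close>. This serves when the Gram matrix of the
  images is known through a bounded operator, as for isometries (\<open>B\<close> the identity) and
  for R_w.\<close>

lemma extend_operator_gram:
  fixes g :: "'i \<Rightarrow> 'k::chilbert_space" and g' :: "'i \<Rightarrow> 'l::chilbert_space"
  assumes gram: "\<And>i j. i \<in> I \<Longrightarrow> j \<in> I \<Longrightarrow> cinner (g' i) (g' j) = cinner (g i) (B (g j))"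
    and B: "bounded_clinear B" "\<And>x. norm (B x) \<le> r\<^sup>2 * norm x" and r: "r \<ge> 0"
  obtains W where "bounded_clinear W" "\<And>i. i \<in> I \<Longrightarrow> W (g i) = g' i" "\<And>x. norm (W x) \<le> r * norm x"
    "\<And>x. (\<And>i. i \<in> I \<Longrightarrow> cinner (g i) x = 0) \<Longrightarrow> W x = 0"
proof (rule extend_operator[of I g' r g])
  show "norm (\<Sum>i\<in>A. c i *\<^sub>C g' i) \<le> r * norm (\<Sum>i\<in>A. c i *\<^sub>C g i)" if A: "finite A" "A \<subseteq> I" for A c
  proof -
    define v where "v = (\<Sum>i\<in>A. c i *\<^sub>C g i)"
    have "of_real ((norm (\<Sum>i\<in>A. c i *\<^sub>C g' i))\<^sup>2) = cinner v (B v)"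
      unfolding norm_sq_sum_scaleC v_def bounded_clinear_sum[OF B(1)]
      by (subst cinner_sum_left)
         (use A gram in \<open>auto simp: cinner_sum_right cinner_scaleC_left cinner_scaleC_right sum_distrib_left
           bounded_clinearD(3)[OF B(1)] subset_eq mult.assoc intro!: sum.cong\<close>)
    then have "(norm (\<Sum>i\<in>A. c i *\<^sub>C g' i))\<^sup>2 \<le> norm v * norm (B v)"
      using norm_cinner_le[of v "B v"] by (metis norm_of_real abs_of_nonneg zero_le_power2)
    also have "\<dots> \<le> norm v * (r\<^sup>2 * norm v)" by (intro mult_left_mono B) simp
    also have "\<dots> = (r * norm v)\<^sup>2" by (simp add: power2_eq_square)
    finally show ?thesis unfolding v_def by (rule power2_le_imp_le) (simp add: r)
  qed
qed (use r in \<open>auto intro: that\<close>)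

section \<open>C*-algebras\<close>

instance cbanach \<subseteq> banach ..

context
  fixes dummy :: "'a::cstar_algebra itself"
begin

lemma star_zero [simp]: "star (0::'a) = 0"
  using star_scaleC[of 0 "0::'a"] by simp

lemma star_minus: "star (- a::'a) = - star a"
  using star_add[of a "- a"] by (simp add: eq_neg_iff_add_eq_0 add.commute)

lemma star_diff: "star (a - b::'a) = star a - star b"
  using star_add[of a "- b"] by (simp add: star_minus)

lemma star_one [simp]: "star (1::'a) = 1"
  using star_mult[of "star 1" "1::'a"] by (simp add: star_star)

lemma norm_star: "norm (star a) = norm (a::'a)"
proof -
  have le: "norm a \<le> norm (star a)" for a :: 'a
  proof (cases "norm a = 0")
    case False
    have "norm a * norm a \<le> norm (star a) * norm a"
      using norm_mult_ineq[of "star a" a] cstar_identity[of a] by (simp add: power2_eq_square)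
    then show ?thesis using False by (simp add: mult_le_cancel_right)
  qed simp
  show ?thesis using le[of a] le[of "star a"] by (simp add: star_star)
qed

text \<open>Only an inequality, because in the zero algebra the unit has norm 0.\<close>

lemma norm_one_le: "norm (1::'a) \<le> 1"
proof -
  have "norm (1::'a) * norm (1::'a) = norm (1::'a)" using cstar_identity[of "1::'a"] by (simp add: power2_eq_square)
  then show ?thesis by (metis mult_cancel_left2 norm_zero order_refl zero_le_one)
qed

lemma norm_power_le: "norm (a ^ n) \<le> norm (a::'a) ^ n"
proof (induction n)
  case (Suc n)
  have "norm (a ^ Suc n) \<le> norm a * norm (a ^ n)" by (simp add: norm_mult_ineq)
  also have "\<dots> \<le> norm a * norm a ^ n" by (intro mult_left_mono Suc) simp
  finally show ?case by simp
qed (simp add: norm_one_le)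

text \<open>Each use of the C*-identity doubles the exponent. Later this removes a constant from a
  norm estimate by taking roots.\<close>

lemma norm_selfadjoint_power:
  assumes "star a = (a::'a)"
  shows "norm (a ^ (2 ^ n)) = norm a ^ (2 ^ n)"
proof (induction n)
  case (Suc n)
  have "star (a ^ k) = a ^ k" for k
    by (induction k) (simp_all add: star_mult assms power_commutes)
  then have "norm (a ^ (2 ^ Suc n)) = (norm (a ^ (2 ^ n)))\<^sup>2"
    by (simp add: mult_2 power_add flip: cstar_identity)
  then show ?case using Suc by (simp add: power_mult[symmetric] mult.commute)
qed simp

section \<open>Inverses, resolvents and square roots without spectral theory\<close>

definition is_inverse :: "'a \<Rightarrow> 'a \<Rightarrow> bool" where
  "is_inverse a b \<longleftrightarrow> a * b = 1 \<and> b * a = 1"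

lemma is_inverse_unique: "is_inverse a b \<Longrightarrow> is_inverse a c \<Longrightarrow> b = c"
  unfolding is_inverse_def by (metis mult.assoc mult_1_left mult_1_right)

lemma is_inverse_mult:
  assumes "is_inverse a b" "is_inverse c d"
  shows "is_inverse (a * c) (d * b)"
proof -
  have "a * c * (d * b) = a * (c * d) * b" "d * b * (a * c) = d * (b * a) * c" by (simp_all only: mult.assoc)
  then show ?thesis using assms unfolding is_inverse_def by simp
qed

lemma is_inverse_star: "is_inverse a b \<Longrightarrow> is_inverse (star a) (star b)"
  unfolding is_inverse_def by (metis star_mult star_one)

lemma is_inverse_commute:
  assumes "is_inverse a b" "z * a = a * z"
  shows "z * b = b * z"
proof -
  have "z * b = b * a * (z * b)" using assms(1) by (simp add: is_inverse_def)
  also have "\<dots> = b * (z * a) * b" by (simp add: assms(2) mult.assoc)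
  also have "\<dots> = b * z * (a * b)" by (simp add: mult.assoc)
  finally show ?thesis using assms(1) by (simp add: is_inverse_def)
qed

lemma summable_power:
  assumes "norm (x::'a) < 1"
  shows "summable (\<lambda>n. norm (x ^ n))" "summable (\<lambda>n. x ^ n)"
proof -
  show 1: "summable (\<lambda>n. norm (x ^ n))"
    by (rule summable_comparison_test'[of "\<lambda>n. norm x ^ n" 0]) (use assms norm_power_le in auto)
  show "summable (\<lambda>n. x ^ n)" by (rule summable_norm_cancel[OF 1])
qed

lemma neumann:
  assumes x: "norm (x::'a) < 1"
  shows "is_inverse (1 - x) (\<Sum>n. x ^ n)"
proof -
  note s = summable_power(2)[OF x]
  have split: "(\<Sum>n. x ^ Suc n) = (\<Sum>n. x ^ n) - 1"
    using suminf_split_head[OF s] by simp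
  have "x * (\<Sum>n. x ^ n) = (\<Sum>n. x ^ n) - 1"
    unfolding split[symmetric] using suminf_mult[OF s, of x] by simp
  moreover have "(\<Sum>n. x ^ n) * x = (\<Sum>n. x ^ n) - 1"
    unfolding split[symmetric] using suminf_mult2[OF s, of x] by (simp add: power_commutes)
  ultimately show ?thesis by (simp add: is_inverse_def left_diff_distrib right_diff_distrib)
qed

lemma is_inverse_perturb:
  assumes "is_inverse a b" "norm (b * c) < 1"
  shows "\<exists>d. is_inverse (a + c) d"
proof -
  have "is_inverse (1 - (- (b * c))) (\<Sum>n. (- (b * c)) ^ n)" by (rule neumann) (use assms in simp)
  moreover have "a * (1 - (- (b * c))) = a + c"
    using assms(1) by (simp add: is_inverse_def distrib_left mult.assoc[symmetric])
  ultimately show ?thesis using is_inverse_mult[OF assms(1)] by metis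
qed

text \<open>
  The Cayley transform \<open>(s - \<i>a)(s + \<i>a)\<^sup>-\<^sup>1\<close> is unitary, which bounds the inverse of \<open>s + \<i>a\<close> by
  \<open>1/s\<close>; hence invertibility for one \<open>s > 0\<close> propagates to all smaller ones.
\<close>

lemma norm_inverse_resolvent:
  assumes a: "star a = (a::'a)" and s: "s > 0"
    and b: "is_inverse (of_real s *\<^sub>C 1 + \<i> *\<^sub>C a) b"
  shows "norm b \<le> 1 / s"
proof -
  define p where "p = of_real s *\<^sub>C 1 + \<i> *\<^sub>C a"
  define m where "m = of_real s *\<^sub>C 1 - \<i> *\<^sub>C a"
  have st: "star p = m" "star m = p"
    by (simp_all add: p_def m_def star_add star_diff star_scaleC a complex_vector.scale_minus_left)
  have pm: "p * m = m * p"
    by (simp add: p_def m_def distrib_left distrib_right left_diff_distrib right_diff_distrib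
        scaleC_mult_left scaleC_mult_right scaleC_scaleC scaleC_add_right complex_vector.scale_right_diff_distrib mult.commute)
  define U where "U = m * b"
  have "star U * U = star b * (p * m) * b" by (simp add: U_def star_mult st mult.assoc)
  also have "\<dots> = star (p * b) * (p * b)" unfolding pm by (simp add: star_mult st mult.assoc)
  also have "\<dots> = 1" using b by (simp add: p_def is_inverse_def)
  finally have "(norm U)\<^sup>2 \<le> 1" using cstar_identity[of U] norm_one_le by simp
  then have U1: "norm U \<le> 1" by (simp add: power_le_one_iff abs_square_le_1)
  have "p * b + U = (2 * of_real s) *\<^sub>C b"
    by (simp add: U_def p_def m_def distrib_right left_diff_distrib scaleC_mult_left flip: scaleC_add_left)
  then have "2 * s * norm b = norm (p * b + U)" using s by (simp add: norm_scaleC)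
  also have "\<dots> \<le> norm (p * b) + norm U" by (rule norm_triangle_ineq)
  also have "\<dots> \<le> 2" using U1 norm_one_le b by (simp add: p_def is_inverse_def)
  finally show ?thesis using s by (simp add: field_simps)
qed

lemma resolvent_exists:
  assumes a: "star a = (a::'a)" and s: "s > 0"
  shows "\<exists>b. is_inverse (of_real s *\<^sub>C 1 + \<i> *\<^sub>C a) b"
proof -
  define t where "t = s + norm a + 1"
  have t: "t > 0" "t > norm a" "s < t" using s norm_ge_zero[of a] unfolding t_def by linarith+
  define x where "x = (- \<i> / of_real t) *\<^sub>C a"
  have "norm x < 1" using t by (simp add: x_def norm_scaleC norm_divide)
  from neumann[OF this] obtain b0 where b0: "is_inverse (1 - x) b0" by blast
  have "is_inverse (of_real t *\<^sub>C 1) (of_real (1 / t) *\<^sub>C (1::'a))"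
    using t by (simp add: is_inverse_def scaleC_mult_left scaleC_mult_right scaleC_scaleC scaleC_one)
  from is_inverse_mult[OF this b0] obtain b1 where b1: "is_inverse (of_real t *\<^sub>C 1 * (1 - x)) b1" by blast
  have "of_real t *\<^sub>C 1 * (1 - x) = of_real t *\<^sub>C 1 + \<i> *\<^sub>C a"
    using t by (simp add: x_def scaleC_mult_left scaleC_add_right complex_vector.scale_right_diff_distrib scaleC_scaleC)
  then have b1: "is_inverse (of_real t *\<^sub>C 1 + \<i> *\<^sub>C a) b1" using b1 by simp
  have nb: "norm b1 \<le> 1 / t" by (rule norm_inverse_resolvent[OF a t(1) b1])
  \<comment> \<open>The step from \<open>t\<close> down to \<open>s\<close> is a perturbation by
    \<open>c\<close>; with the bound 1/t on the inverse its relative size is at most (t - s)/t < 1,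
    so one step suffices.\<close>
  define c where "c = of_real (s - t) *\<^sub>C (1::'a)"
  have "norm (b1 * c) \<le> (t - s) * norm b1"
    using t by (simp add: c_def scaleC_mult_right norm_scaleC abs_if del: of_real_diff)
  also have "\<dots> \<le> (t - s) * (1 / t)" using nb t by (intro mult_left_mono) auto
  also have "\<dots> < 1" using t s by (simp add: field_simps)
  finally obtain d where "is_inverse (of_real t *\<^sub>C 1 + \<i> *\<^sub>C a + c) d" using is_inverse_perturb[OF b1] by blast
  moreover have "of_real t *\<^sub>C 1 + \<i> *\<^sub>C a + c = of_real s *\<^sub>C 1 + \<i> *\<^sub>C a"
    by (simp add: c_def complex_vector.scale_left_diff_distrib)
  ultimately show ?thesis by auto
qed

text \<open>Functional calculus for 1/(1 + s^2) and s/(1 + s^2): factor 1 + a^2 = (1 + \<i>a)(1 -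
  \<i>a) with inverses \<open>b\<close> and \<open>b'\<close> of norm at most 1. Their product is
  \<open>d\<close>, and their difference is a multiple of \<open>a * d\<close> by a scalar of
  modulus 2.\<close>

lemma inverse_one_plus_square:
  assumes a: "star a = (a::'a)"
  obtains d where "is_inverse (1 + a * a) d" "norm d \<le> 1" "norm (a * d) \<le> 1" "star d = d"
proof -
  obtain b where b: "is_inverse (1 + \<i> *\<^sub>C a) b" "norm b \<le> 1"
    using resolvent_exists[OF a, of 1] norm_inverse_resolvent[OF a, of 1] by (auto simp: scaleC_one)
  obtain b' where b': "is_inverse (1 - \<i> *\<^sub>C a) b'" "norm b' \<le> 1"
    using resolvent_exists[of "- a" 1] norm_inverse_resolvent[of "- a" 1] a
    by (auto simp: scaleC_one star_minus)
  have eq: "(1 + \<i> *\<^sub>C a) * (1 - \<i> *\<^sub>C a) = 1 + a * a" "(1 - \<i> *\<^sub>C a) * (1 + \<i> *\<^sub>C a) = 1 + a * a"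
    by (simp_all add: distrib_right right_diff_distrib left_diff_distrib distrib_left scaleC_mult_left scaleC_mult_right
        scaleC_scaleC scaleC_one complex_vector.scale_minus_left scaleC_add_right complex_vector.scale_right_diff_distrib)
  have d: "is_inverse (1 + a * a) (b' * b)" using is_inverse_mult[OF b(1) b'(1)] eq by simp
  have d2: "is_inverse (1 + a * a) (b * b')" using is_inverse_mult[OF b'(1) b(1)] eq by simp
  have bb: "b' * b = b * b'" by (rule is_inverse_unique[OF d d2])
  have "b - b' = b * ((1 - \<i> *\<^sub>C a) * b') - (b * (1 + \<i> *\<^sub>C a)) * b'"
    using b b' by (simp add: is_inverse_def)
  also have "\<dots> = b * ((- 2 * \<i>) *\<^sub>C a) * b'"
  proof -
    have "(- 2 * \<i>) *\<^sub>C a = (1 - \<i> *\<^sub>C a) - (1 + \<i> *\<^sub>C a)"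
      using scaleC_add_left[of \<i> \<i> a] by simp
    then show ?thesis by (simp only: left_diff_distrib right_diff_distrib mult.assoc)
  qed
  also have "\<dots> = (- 2 * \<i>) *\<^sub>C (a * (b * b'))"
  proof -
    have "a * b = b * a"
      by (rule is_inverse_commute[OF b(1)])
         (simp add: distrib_left distrib_right scaleC_mult_left scaleC_mult_right)
    then show ?thesis by (simp add: scaleC_mult_left scaleC_mult_right mult.assoc[symmetric])
  qed
  finally have "norm (b - b') = 2 * norm (a * (b * b'))" by (simp add: norm_scaleC norm_mult)
  then have "norm (a * (b * b')) \<le> 1" using norm_triangle_ineq4[of b b'] b b' by simp
  moreover have "norm (b' * b) \<le> 1"
    using norm_mult_ineq[of b' b] b b' by (meson mult_le_one norm_ge_zero order_trans)
  moreover have "star (b' * b) = b' * b"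
    by (rule is_inverse_unique[OF _ d]) (use is_inverse_star[OF d] in \<open>simp add: star_add star_mult a\<close>)
  ultimately show ?thesis using that d bb by metis
qed

text \<open>
  The iteration for \<open>1 - sqrt (1 - A)\<close>; it is dominated by the scalar iteration for \<open>A = 1\<close>.
\<close>

lemma square_root_iteration:
  assumes A: "norm (A::'a) \<le> 1"
  obtains Y where "2 *\<^sub>C Y = A + Y * Y" "norm Y \<le> 1" "\<And>z. z * A = A * z \<Longrightarrow> z * Y = Y * z"
    "star A = A \<Longrightarrow> star Y = Y"
proof -
  define f where "f Z = (1/2) *\<^sub>C (A + Z * Z)" for Z :: 'a
  define g where "g z = (1 + z * z) / 2" for z :: real
  define Y where "Y n = (f ^^ n) 0" for n
  define y where "y n = (g ^^ n) 0" for n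
  have Y_Suc: "Y (Suc n) = (1/2) *\<^sub>C (A + Y n * Y n)" for n by (simp add: Y_def f_def)
  have y_Suc: "y (Suc n) = (1 + y n * y n) / 2" for n by (simp add: y_def g_def)
  have Y0: "Y 0 = 0" and y0: "y 0 = 0" by (simp_all add: Y_def y_def)
  have y01: "0 \<le> y n \<and> y n \<le> 1" for n
    by (induction n) (auto simp: y0 y_Suc mult_le_one)
  have comm: "z * Y n = Y n * z" if "z * A = A * z" for z n
  proof (induction n)
    case (Suc n)
    have "z * (Y n * Y n) = Y n * Y n * z" by (metis Suc mult.assoc)
    then show ?case using that by (simp add: Y_Suc scaleC_mult_left scaleC_mult_right distrib_left distrib_right)
  qed (simp add: Y0)
  have YY: "Y n * Y m = Y m * Y n" for n m by (rule comm) (metis comm)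
  have Yn: "norm (Y n) \<le> y n" for n
  proof (induction n)
    case (Suc n)
    have "norm (A + Y n * Y n) \<le> 1 + y n * y n"
      by (intro order_trans[OF norm_triangle_ineq] add_mono A order_trans[OF norm_mult_ineq] mult_mono Suc)
         (use y01 in auto)
    then show ?case by (simp add: Y_Suc y_Suc norm_scaleC)
  qed (simp add: Y0 y0)
  have step: "norm (Y (Suc n) - Y n) \<le> y (Suc n) - y n" for n
  proof (induction n)
    case 0
    show ?case using A by (simp add: Y_Suc y_Suc Y0 y0 norm_scaleC)
  next
    case (Suc n)
    have "Y (Suc n) * Y (Suc n) - Y n * Y n = (Y (Suc n) - Y n) * (Y (Suc n) + Y n)"
      by (simp add: distrib_left left_diff_distrib YY[of "Suc n" n])
    then have "Y (Suc (Suc n)) - Y (Suc n) = (1/2) *\<^sub>C ((Y (Suc n) - Y n) * (Y (Suc n) + Y n))"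
      unfolding Y_Suc[of "Suc n"] Y_Suc[of n, symmetric] by (simp add: Y_Suc[of n] complex_vector.scale_right_diff_distrib[symmetric])
    then have "norm (Y (Suc (Suc n)) - Y (Suc n)) \<le> (1/2) * (norm (Y (Suc n) - Y n) * norm (Y (Suc n) + Y n))"
      by (simp add: norm_scaleC norm_mult_ineq)
    also have "\<dots> \<le> (1/2) * ((y (Suc n) - y n) * (y (Suc n) + y n))"
      by (intro mult_left_mono mult_mono Suc order_trans[OF norm_triangle_ineq] add_mono Yn)
         (use y01 Suc order_trans[OF norm_ge_zero Suc] in auto)
    also have "\<dots> = y (Suc (Suc n)) - y (Suc n)"
      unfolding y_Suc[of "Suc n"] by (subst (5) y_Suc) (simp add: field_simps)
    finally show ?case .
  qed
  have tele: "norm (Y (n + k) - Y n) \<le> y (n + k) - y n" for n k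
  proof (induction k)
    case (Suc k)
    have "norm (Y (n + Suc k) - Y n) \<le> norm (Y (Suc (n + k)) - Y (n + k)) + norm (Y (n + k) - Y n)"
      using norm_triangle_ineq[of "Y (Suc (n + k)) - Y (n + k)" "Y (n + k) - Y n"] by simp
    then show ?case using Suc step[of "n + k"] by simp
  qed simp
  have ymono: "y n \<le> y (Suc n)" for n using order_trans[OF norm_ge_zero step[of n]] by simp
  have "convergent y"
    by (rule Bseq_monoseq_convergent)
       (use y01 ymono in \<open>auto intro!: BseqI'[of _ 1] incseq_imp_monoseq incseq_SucI\<close>)
  then have yC: "Cauchy y" by (simp add: convergent_Cauchy)
  have "Cauchy Y"
  proof (rule metric_CauchyI)
    fix e :: real assume "e > 0"
    from metric_CauchyD[OF yC this] obtain M where M: "\<And>m n. m \<ge> M \<Longrightarrow> n \<ge> M \<Longrightarrow> dist (y m) (y n) < e" by blast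
    have *: "dist (Y m) (Y n) < e" if "m \<ge> n" "n \<ge> M" for m n
      using tele[of n "m - n"] M[of m n] that by (simp add: dist_norm)
    show "\<exists>M. \<forall>m\<ge>M. \<forall>n\<ge>M. dist (Y m) (Y n) < e"
    proof (intro exI allI impI)
      fix m n assume "m \<ge> M" "n \<ge> M"
      then show "dist (Y m) (Y n) < e"
        using *[of n m] *[of m n] by (cases "n \<le> m") (simp_all add: dist_commute)
    qed
  qed
  then obtain L where L: "Y \<longlonglongrightarrow> L" using Cauchy_convergent_iff convergent_def by blast
  have "(\<lambda>n. Y (Suc n)) \<longlonglongrightarrow> (1/2) *\<^sub>C (A + L * L)"
    unfolding Y_Suc by (intro tendsto_scaleC tendsto_add tendsto_const tendsto_mult L)
  then have eqL: "L = (1/2) *\<^sub>C (A + L * L)" using LIMSEQ_unique LIMSEQ_Suc[OF L] by blast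
  show ?thesis
  proof
    have "2 *\<^sub>C L = 2 *\<^sub>C ((1/2) *\<^sub>C (A + L * L))" using eqL by simp
    then show "2 *\<^sub>C L = A + L * L" by (simp add: scaleC_scaleC scaleC_one)
    have "norm (Y n) \<le> 1" for n using Yn[of n] y01[of n] by linarith
    then show "norm L \<le> 1" by (intro LIMSEQ_le_const2[OF tendsto_norm[OF L]]) blast
    show "z * L = L * z" if "z * A = A * z" for z
    proof (rule LIMSEQ_unique)
      show "(\<lambda>n. z * Y n) \<longlonglongrightarrow> z * L" by (intro tendsto_mult tendsto_const L)
      show "(\<lambda>n. z * Y n) \<longlonglongrightarrow> L * z" unfolding comm[OF that] by (intro tendsto_mult tendsto_const L)
    qed
    show "star L = L" if sA: "star A = A"
    proof -
      have sY: "star (Y n) = Y n" for n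
        by (induction n) (simp_all add: Y0 Y_Suc star_scaleC star_add star_mult sA)
      have "(\<lambda>n. norm (star L - Y n)) \<longlonglongrightarrow> 0"
      proof -
        have "norm (star L - Y n) = norm (L - Y n)" for n by (metis sY norm_star star_diff)
        then show ?thesis using LIMSEQ_norm_0[of "\<lambda>n. L - Y n"] tendsto_diff[OF tendsto_const L, of L]
          by (simp add: tendsto_norm_zero)
      qed
      then have "(\<lambda>n. star L - Y n) \<longlonglongrightarrow> 0" by (rule tendsto_norm_zero_cancel)
      then have "(\<lambda>n. star L - (star L - Y n)) \<longlonglongrightarrow> star L - 0" by (intro tendsto_diff tendsto_const)
      then have "Y \<longlonglongrightarrow> star L" by simp
      from LIMSEQ_unique[OF this L] show ?thesis .
    qed
  qed
qed

end

section \<open>The algebra of bounded operators on a Hilbert space\<close>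

text \<open>As a type of its own the bounded operators become an instance of
  \<open>cstar_algebra\<close>, so that the inverses and square roots constructed for C*-algebras
  apply to them.\<close>

typedef (overloaded) 'a bop = "{f :: 'a::chilbert_space \<Rightarrow>\<^sub>L 'a. \<forall>c x. blinfun_apply f (c *\<^sub>C x) = c *\<^sub>C blinfun_apply f x}"
  by (rule exI[of _ 0]) simp

definition bop_apply :: "'a::chilbert_space bop \<Rightarrow> 'a \<Rightarrow> 'a"  (infixr \<open>*\<^sub>V\<close> 80) where
  "T *\<^sub>V x = blinfun_apply (Rep_bop T) x"

definition Bop :: "('a::chilbert_space \<Rightarrow> 'a) \<Rightarrow> 'a bop" where
  "Bop f = Abs_bop (Blinfun f)"

lemma bounded_clinear_bop: "bounded_clinear ((*\<^sub>V) T)"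
  unfolding bounded_clinear_def bop_apply_def using Rep_bop[of T]
  by (auto intro: blinfun.bounded_linear_right)

lemmas bop_simps = bounded_clinearD(2-6)[OF bounded_clinear_bop]

lemma Bop_apply: "bounded_clinear f \<Longrightarrow> Bop f *\<^sub>V x = f x"
  unfolding Bop_def bop_apply_def bounded_clinear_def
  by (subst Abs_bop_inverse) (auto simp: bounded_linear_Blinfun_apply)

lemma bop_ext: "(\<And>x. S *\<^sub>V x = T *\<^sub>V x) \<Longrightarrow> S = T"
  unfolding bop_apply_def by (metis Rep_bop_inject blinfun_eqI)

lemma bop_eq_total:
  assumes "closure (cspan X) = UNIV" "\<And>x. x \<in> X \<Longrightarrow> S *\<^sub>V x = T *\<^sub>V x"
  shows "S = T"
proof -
  have "(*\<^sub>V) S = (*\<^sub>V) T"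
    by (rule bounded_clinear_eq_total[OF assms(1) bounded_clinear_bop bounded_clinear_bop]) (rule assms(2))
  then show ?thesis by (intro bop_ext) (rule fun_cong)
qed

instantiation bop :: (chilbert_space) "{complex_normed_vector, real_normed_algebra, monoid_mult}"
begin

definition zero_bop :: "'a bop" where "0 = Abs_bop 0"
definition plus_bop :: "'a bop \<Rightarrow> 'a bop \<Rightarrow> 'a bop" where "S + T = Abs_bop (Rep_bop S + Rep_bop T)"
definition minus_bop :: "'a bop \<Rightarrow> 'a bop \<Rightarrow> 'a bop" where "S - T = Abs_bop (Rep_bop S - Rep_bop T)"
definition uminus_bop :: "'a bop \<Rightarrow> 'a bop" where "- T = Abs_bop (- Rep_bop T)"
definition scaleR_bop :: "real \<Rightarrow> 'a bop \<Rightarrow> 'a bop" where "r *\<^sub>R T = Abs_bop (r *\<^sub>R Rep_bop T)"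
definition scaleC_bop :: "complex \<Rightarrow> 'a bop \<Rightarrow> 'a bop" where "c *\<^sub>C T = Bop (\<lambda>x. c *\<^sub>C T *\<^sub>V x)"
definition norm_bop :: "'a bop \<Rightarrow> real" where "norm T = norm (Rep_bop T)"
definition sgn_bop :: "'a bop \<Rightarrow> 'a bop" where "sgn_bop T = inverse (norm T) *\<^sub>R T"
definition dist_bop :: "'a bop \<Rightarrow> 'a bop \<Rightarrow> real" where "dist_bop S T = norm (S - T)"
definition uniformity_bop :: "('a bop \<times> 'a bop) filter" where
  "uniformity_bop = (INF e\<in>{0 <..}. principal {(x, y). dist x y < e})"
definition open_bop :: "'a bop set \<Rightarrow> bool" where
  "open_bop U = (\<forall>x\<in>U. \<forall>\<^sub>F (x', y) in uniformity. x' = x \<longrightarrow> y \<in> U)"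
definition times_bop :: "'a bop \<Rightarrow> 'a bop \<Rightarrow> 'a bop" where "S * T = Abs_bop (Rep_bop S o\<^sub>L Rep_bop T)"
definition one_bop :: "'a bop" where "1 = Abs_bop id_blinfun"

lemma Rep_bop_simps:
  shows "Rep_bop (0::'a bop) = 0" "Rep_bop (S + T) = Rep_bop S + Rep_bop T"
    "Rep_bop (S - T) = Rep_bop S - Rep_bop T" "Rep_bop (- T) = - Rep_bop T"
    "Rep_bop (r *\<^sub>R T) = r *\<^sub>R Rep_bop T" "Rep_bop (S * T) = Rep_bop S o\<^sub>L Rep_bop T"
    "Rep_bop (1::'a bop) = id_blinfun"
  unfolding zero_bop_def plus_bop_def minus_bop_def uminus_bop_def scaleR_bop_def times_bop_def one_bop_def
  using Rep_bop[of S] Rep_bop[of T]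
  by (subst Abs_bop_inverse; simp add: blinfun.bilinear_simps scaleC_add_right scaleR_scaleC scaleC_scaleC mult.commute
      complex_vector.scale_right_diff_distrib)+

lemma bop_apply_simps:
  "(0::'a bop) *\<^sub>V x = 0" "(S + T) *\<^sub>V x = S *\<^sub>V x + T *\<^sub>V (x::'a)"
  "(S - T) *\<^sub>V x = S *\<^sub>V x - T *\<^sub>V x" "(- T) *\<^sub>V x = - (T *\<^sub>V x)"
  "(r *\<^sub>R T) *\<^sub>V x = r *\<^sub>R (T *\<^sub>V x)" "(S * T) *\<^sub>V x = S *\<^sub>V (T *\<^sub>V x)"
  "(1::'a bop) *\<^sub>V x = x"
  unfolding bop_apply_def by (simp_all add: Rep_bop_simps blinfun.bilinear_simps)

lemma scaleC_bop_apply: "(c *\<^sub>C T) *\<^sub>V x = c *\<^sub>C (T *\<^sub>V (x::'a))"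
  unfolding scaleC_bop_def
proof (rule Bop_apply, rule bounded_clinearI[where K = "cmod c * onorm ((*\<^sub>V) T)"])
  show "norm (c *\<^sub>C T *\<^sub>V x) \<le> cmod c * onorm ((*\<^sub>V) T) * norm x" for x
    using bounded_clinearD(7)[OF bounded_clinear_bop, of T x] by (simp add: norm_scaleC mult.assoc mult_left_mono)
qed (simp_all add: bop_simps scaleC_add_right scaleC_scaleC mult.commute)

lemma norm_bop_apply: "norm (T *\<^sub>V x) \<le> norm T * norm (x::'a)"
  unfolding bop_apply_def norm_bop_def by (rule norm_blinfun)

lemma norm_bop_bound: "(\<And>x. norm (T *\<^sub>V x) \<le> K * norm (x::'a)) \<Longrightarrow> K \<ge> 0 \<Longrightarrow> norm T \<le> K"
  unfolding bop_apply_def norm_bop_def by (rule norm_blinfun_bound)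

instance
proof
  fix S T U :: "'a bop" and c d :: complex and r s :: real and e :: real
  show "S + T + U = S + (T + U)" "S + T = T + S" "0 + S = S" "- S + S = 0" "S - T = S + - T"
    by (rule bop_ext, simp add: bop_apply_simps)+
  show "r *\<^sub>R (S + T) = r *\<^sub>R S + r *\<^sub>R T" "(r + s) *\<^sub>R S = r *\<^sub>R S + s *\<^sub>R S" "r *\<^sub>R s *\<^sub>R S = (r * s) *\<^sub>R S"
    "1 *\<^sub>R S = S"
    by (rule bop_ext, simp add: bop_apply_simps scaleR_add_right scaleR_add_left)+
  show "c *\<^sub>C (S + T) = c *\<^sub>C S + c *\<^sub>C T" "(c + d) *\<^sub>C S = c *\<^sub>C S + d *\<^sub>C S" "c *\<^sub>C d *\<^sub>C S = (c * d) *\<^sub>C S"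
    by (rule bop_ext, simp add: bop_apply_simps scaleC_bop_apply scaleC_add_right scaleC_add_left scaleC_scaleC)+
  show "r *\<^sub>R S = complex_of_real r *\<^sub>C S"
    by (rule bop_ext) (simp add: bop_apply_simps scaleC_bop_apply scaleR_scaleC)
  show "dist S T = norm (S - T)" by (rule dist_bop_def)
  show "sgn S = inverse (norm S) *\<^sub>R S" by (rule sgn_bop_def)
  show "uniformity = (INF e\<in>{0 <..}. principal {(x :: 'a bop, y). dist x y < e})" by (rule uniformity_bop_def)
  show "open V = (\<forall>x\<in>V. \<forall>\<^sub>F (x', y) in uniformity. x' = x \<longrightarrow> y \<in> V)" for V :: "'a bop set" by (rule open_bop_def)
  show "(norm S = 0) = (S = 0)"
    unfolding norm_bop_def by (metis Rep_bop_inject Rep_bop_simps(1) norm_eq_zero)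
  show "norm (S + T) \<le> norm S + norm T" by (simp add: norm_bop_def Rep_bop_simps norm_triangle_ineq)
  show "norm (r *\<^sub>R S) = \<bar>r\<bar> * norm S" by (simp add: norm_bop_def Rep_bop_simps)
  show "norm (c *\<^sub>C S) = cmod c * norm S"
  proof -
    have le: "norm (c *\<^sub>C S) \<le> cmod c * norm S" for c and S :: "'a bop"
    proof (rule norm_bop_bound)
      show "0 \<le> cmod c * norm S" by (simp add: norm_bop_def)
    qed (simp add: scaleC_bop_apply norm_scaleC norm_bop_apply mult.assoc mult_left_mono)
    show ?thesis
    proof (cases "c = 0")
      case True
      have "(0::complex) *\<^sub>C S = 0" by (rule bop_ext) (simp add: scaleC_bop_apply bop_apply_simps)
      then show ?thesis using True by (simp add: norm_bop_def Rep_bop_simps)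
    next
      case False
      have "inverse c *\<^sub>C (c *\<^sub>C S) = S"
        by (rule bop_ext) (use False in \<open>simp add: scaleC_bop_apply scaleC_scaleC scaleC_one\<close>)
      then have "norm S \<le> cmod (inverse c) * norm (c *\<^sub>C S)" using le[of "inverse c" "c *\<^sub>C S"] by simp
      then have "cmod c * norm S \<le> norm (c *\<^sub>C S)" using False by (simp add: norm_divide field_simps)
      then show ?thesis using le[of c S] by simp
    qed
  qed
  show "(S * T) * U = S * (T * U)" "(S + T) * U = S * U + T * U" "S * (T + U) = S * T + S * U"
    "1 * S = S" "S * 1 = S" "(r *\<^sub>R S) * T = r *\<^sub>R (S * T)" "S * (r *\<^sub>R T) = r *\<^sub>R (S * T)"
    by (rule bop_ext, simp add: bop_apply_simps scaleC_bop_apply bop_simps scaleR_scaleC)+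
  show nm: "norm (S * T) \<le> norm S * norm T" for S T :: "'a bop"
    by (simp add: norm_bop_def Rep_bop_simps norm_blinfun_compose)
qed

end

instantiation bop :: (chilbert_space) cstar_algebra
begin

definition star_bop :: "'a bop \<Rightarrow> 'a bop" where "star_bop T = Bop (adj ((*\<^sub>V) T))"

lemma cinner_star_bop: "cinner (star T *\<^sub>V x) y = cinner x (T *\<^sub>V (y::'a))"
  unfolding star_bop_def
  by (simp add: Bop_apply bounded_clinear_adj bounded_clinear_bop cinner_adj_left)

instance
proof
  fix S T U :: "'a bop" and c :: complex
  show "(c *\<^sub>C S) * T = c *\<^sub>C (S * T)" "S * (c *\<^sub>C T) = c *\<^sub>C (S * T)"
    by (rule bop_ext, simp add: bop_apply_simps scaleC_bop_apply bop_simps)+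
  have st: "cinner x (star T *\<^sub>V y) = cinner (T *\<^sub>V x) y" for x y and T :: "'a bop"
    by (metis cinner_commute cinner_star_bop)
  show "star (S + T) = star S + star T" "star (S * T) = star T * star S" "star (c *\<^sub>C S) = cnj c *\<^sub>C star S"
    "star (star S) = S"
    by (rule bop_ext, rule cinner_ext,
        simp add: st cinner_star_bop bop_apply_simps scaleC_bop_apply cinner_add_right cinner_add_left
          cinner_scaleC_left cinner_scaleC_right)+
  have ns: "norm (star T) \<le> norm T" for T :: "'a bop"
  proof (rule norm_bop_bound)
    show "norm (star T *\<^sub>V x) \<le> norm T * norm x" for x
    proof (rule norm_bound_cinner)
      show "cmod (cinner z (star T *\<^sub>V x)) \<le> norm T * norm x * norm z" for z
        unfolding st using norm_cinner_le[of "T *\<^sub>V z" x] mult_right_mono[OF norm_bop_apply[of T z] norm_ge_zero[of x]]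
        by (simp add: mult_ac)
    qed (simp add: norm_bop_def)
  qed (simp add: norm_bop_def)
  show "norm (star S * S) = (norm S)\<^sup>2"
  proof (rule antisym)
    show "norm (star S * S) \<le> (norm S)\<^sup>2"
      using norm_mult_ineq[of "star S" S] mult_right_mono[OF ns[of S], of "norm S"] by (simp add: power2_eq_square norm_bop_def)
    have "norm S \<le> sqrt (norm (star S * S))"
    proof (rule norm_bop_bound)
      show "norm (S *\<^sub>V x) \<le> sqrt (norm (star S * S)) * norm x" for x
      proof (rule power2_le_imp_le)
        have "(norm (S *\<^sub>V x))\<^sup>2 = cmod (cinner x ((star S * S) *\<^sub>V x))"
          by (simp add: bop_apply_simps st cinner_self norm_power)
        also have "\<dots> \<le> norm x * (norm (star S * S) * norm x)"
          by (intro order_trans[OF norm_cinner_le] mult_left_mono norm_bop_apply) simp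
        also have "\<dots> = (sqrt (norm (star S * S)) * norm x)\<^sup>2"
          by (simp add: power_mult_distrib power2_eq_square norm_bop_def)
        finally show "(norm (S *\<^sub>V x))\<^sup>2 \<le> (sqrt (norm (star S * S)) * norm x)\<^sup>2" .
      qed (simp add: norm_bop_def)
    qed (simp add: norm_bop_def)
    then have "(norm S)\<^sup>2 \<le> (sqrt (norm (star S * S)))\<^sup>2" by (rule power_mono) (simp add: norm_bop_def)
    then show "(norm S)\<^sup>2 \<le> norm (star S * S)" by (simp add: norm_bop_def)
  qed
  show "convergent X" if X: "Cauchy X" for X :: "nat \<Rightarrow> 'a bop"
  proof -
    have d: "dist (Rep_bop A) (Rep_bop B) = dist A B" for A B :: "'a bop"
      by (simp add: dist_bop_def dist_norm norm_bop_def Rep_bop_simps)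
    have "Cauchy (\<lambda>n. Rep_bop (X n))" using X by (simp add: Cauchy_def d)
    then obtain L where L: "(\<lambda>n. Rep_bop (X n)) \<longlonglongrightarrow> L" using Cauchy_convergent_iff convergent_def by blast
    have "blinfun_apply L (c *\<^sub>C x) = c *\<^sub>C blinfun_apply L x" for c x
    proof (rule LIMSEQ_unique)
      show "(\<lambda>n. blinfun_apply (Rep_bop (X n)) (c *\<^sub>C x)) \<longlonglongrightarrow> blinfun_apply L (c *\<^sub>C x)"
        by (intro tendsto_intros L)
      have "blinfun_apply (Rep_bop (X n)) (c *\<^sub>C x) = c *\<^sub>C blinfun_apply (Rep_bop (X n)) x" for n
        using Rep_bop[of "X n"] by simp
      then show "(\<lambda>n. blinfun_apply (Rep_bop (X n)) (c *\<^sub>C x)) \<longlonglongrightarrow> c *\<^sub>C blinfun_apply L x"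
        by (simp, intro tendsto_scaleC tendsto_intros L)
    qed
    then have RL: "Rep_bop (Abs_bop L) = L" by (simp add: Abs_bop_inverse)
    have "X \<longlonglongrightarrow> Abs_bop L"
      using L by (simp add: tendsto_iff RL flip: d)
    then show ?thesis by (auto simp: convergent_def)
  qed
qed

end

lemma cinner_star_bop_right: "cinner x (star T *\<^sub>V y) = cinner (T *\<^sub>V x) y"
  by (metis cinner_commute cinner_star_bop)

lemma bop_eqI_cinner: "(\<And>x y. cinner x (S *\<^sub>V y) = cinner x (T *\<^sub>V y)) \<Longrightarrow> S = T"
  by (intro bop_ext cinner_ext)

lemma bounded_linear_bop_left: "bounded_linear (\<lambda>T. T *\<^sub>V x)"
  by (rule bounded_linear_intro[where K = "norm x"])
     (simp_all add: bop_apply_simps norm_bop_apply mult.commute[of "norm x"])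

lemmas tendsto_bop_left = bounded_linear.tendsto[OF bounded_linear_bop_left]
text \<open>Baire's theorem. It is needed because adjointability is defined by the existence of an
  adjoint alone, and boundedness has to be derived.\<close>

theorem uniform_boundedness:
  fixes f :: "'i \<Rightarrow> 'a::banach \<Rightarrow> 'b::real_normed_vector"
  assumes lin: "\<And>i. bounded_linear (f i)" and pw: "\<And>x. \<exists>C. \<forall>i. norm (f i x) \<le> C"
  shows "\<exists>C. \<forall>i x. norm (f i x) \<le> C * norm x"
proof -
  define B where "B n = {x. \<forall>i. norm (f i x) \<le> real n}" for n
  have "\<exists>n. interior (B n) \<noteq> {}"
  proof (rule ccontr)
    assume no: "\<nexists>n. interior (B n) \<noteq> {}"
    have "closed (B n)" for n
    proof -
      have "B n = (\<Inter>i. {x. norm (f i x) \<le> real n})" unfolding B_def by blast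
      then show ?thesis
        by (simp add: closed_INT closed_Collect_le continuous_on_norm linear_continuous_on[OF lin] continuous_on_const)
    qed
    then have "interior (\<Union>(range B)) = {}"
      using Met_TC.metric_Baire_category_alt[of "range B"] no
      by (auto simp: interior_of_def interior_def mcomplete_iff_complete complete_UNIV simp flip: closed_closedin)
    moreover have "\<Union>(range B) = UNIV"
    proof -
      have "x \<in> \<Union>(range B)" for x
      proof -
        obtain C where "\<And>i. norm (f i x) \<le> C" using pw by blast
        moreover obtain n where "C \<le> real n" using real_arch_simple by blast
        ultimately show ?thesis unfolding B_def by (auto intro: order_trans)
      qed
      then show ?thesis by blast
    qed
    ultimately show False by simp
  qed
  then obtain n x e where e: "e > 0" "cball x e \<subseteq> B n" by (meson equals0I mem_interior_cball)
  have "norm (f i y) \<le> 2 * real n / e * norm y" for i y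
  proof (cases "y = 0")
    case False
    define z where "z = (e / norm y) *\<^sub>R y"
    have "x \<in> B n" "x + z \<in> B n" using e False by (auto simp: z_def dist_norm intro!: subsetD[OF e(2)])
    then have "norm (f i (x + z) - f i x) \<le> 2 * real n"
      unfolding B_def using norm_triangle_ineq4[of "f i (x + z)" "f i x"] by (simp add: add_mono order_trans) (metis add_mono mult_2 order_trans)
    then have "e / norm y * norm (f i y) \<le> 2 * real n"
      using e(1) by (simp add: linear_simps(1)[OF lin] z_def linear_simps(5)[OF lin])
    then show ?thesis using e(1) False by (simp add: field_simps)
  qed (simp add: linear_0[OF bounded_linear.linear[OF lin]])
  then show ?thesis by blast
qed

lemmas bop_image_closed = bounded_clinear_vimage[OF bounded_clinear_bop]

lemma bop_image_closure_cspan: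
  fixes A :: "'a::chilbert_space bop"
  assumes "csubspace V" "closed V" "\<And>x. x \<in> X \<Longrightarrow> A *\<^sub>V x \<in> V" "u \<in> closure (cspan X)"
  shows "A *\<^sub>V u \<in> V"
proof -
  have "closure (cspan X) \<subseteq> {u. A *\<^sub>V u \<in> V}"
    by (rule closure_cspan_subset[OF _ bop_image_closed[OF assms(1,2)]]) (use assms(3) in blast)
  then show ?thesis using assms(4) by blast
qed

section \<open>Projections and symmetries\<close>

lemma projection_bop:
  fixes S :: "'a::chilbert_space set"
  assumes S: "csubspace S" "closed S"
  obtains p where "p * p = p" "star p = p" "\<And>u. p *\<^sub>V u \<in> S" "\<And>u. u \<in> S \<Longrightarrow> p *\<^sub>V u = u"
    "\<And>u. (\<And>w. w \<in> S \<Longrightarrow> cinner w u = 0) \<Longrightarrow> p *\<^sub>V u = 0"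
    "\<And>u w. w \<in> S \<Longrightarrow> cinner w (u - p *\<^sub>V u) = 0"
    "\<And>z. (\<And>u. u \<in> S \<Longrightarrow> z *\<^sub>V u \<in> S) \<Longrightarrow> (\<And>u. u \<in> S \<Longrightarrow> star z *\<^sub>V u \<in> S) \<Longrightarrow> z * p = p * z"
proof -
  obtain e where e: "bounded_clinear e" "\<And>u. e u \<in> S" "\<And>u w. w \<in> S \<Longrightarrow> cinner w (u - e u) = 0"
    "\<And>u v. v \<in> S \<Longrightarrow> (\<And>w. w \<in> S \<Longrightarrow> cinner w (u - v) = 0) \<Longrightarrow> e u = v"
    using hilbert_projection[OF S] by metis
  define p where "p = Bop e"
  have p: "p *\<^sub>V u = e u" for u by (simp add: p_def Bop_apply e(1))
  have eS: "e u = u" if "u \<in> S" for u by (rule e(4)) (use that in auto)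
  have sym: "cinner (e u) v = cinner (e u) (e v)" for u v
    using e(3)[OF e(2)[of u], of v] by (simp add: cinner_diff_right)
  show ?thesis
  proof
    show "p * p = p" by (rule bop_ext) (simp add: bop_apply_simps p eS e(2))
    show "star p = p"
    proof (rule bop_eqI_cinner)
      fix x y
      have "cinner (e x) y = cinner x (e y)"
        using sym[of x y] sym[of y x] by (metis cinner_commute)
      then show "cinner x (star p *\<^sub>V y) = cinner x (p *\<^sub>V y)" by (simp add: cinner_star_bop_right p)
    qed
    show "p *\<^sub>V u = 0" if "\<And>w. w \<in> S \<Longrightarrow> cinner w u = 0" for u
      unfolding p by (rule e(4)) (use that S in \<open>auto simp: complex_vector.subspace_0\<close>)
    show "z * p = p * z" if z: "\<And>u. u \<in> S \<Longrightarrow> z *\<^sub>V u \<in> S" "\<And>u. u \<in> S \<Longrightarrow> star z *\<^sub>V u \<in> S" for z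
    proof (rule bop_ext)
      fix u
      have "e (z *\<^sub>V u) = z *\<^sub>V e u"
      proof (rule e(4))
        show "z *\<^sub>V e u \<in> S" by (intro z e)
        fix w assume "w \<in> S"
        then have "cinner (star z *\<^sub>V w) (u - e u) = 0" by (intro e z)
        then show "cinner w (z *\<^sub>V u - z *\<^sub>V e u) = 0" by (simp add: cinner_star_bop bop_simps)
      qed
      then show "(z * p) *\<^sub>V u = (p * z) *\<^sub>V u" by (simp add: bop_apply_simps p)
    qed
  qed (auto simp: p e eS)
qed

definition is_projection :: "'a::chilbert_space set \<Rightarrow> 'a bop \<Rightarrow> bool" where
  "is_projection S p \<longleftrightarrow> p * p = p \<and> star p = p \<and> (\<forall>u. p *\<^sub>V u \<in> S) \<and> (\<forall>u\<in>S. p *\<^sub>V u = u) \<and>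
    (\<forall>u. (\<forall>w\<in>S. cinner w u = 0) \<longrightarrow> p *\<^sub>V u = 0) \<and> (\<forall>u. \<forall>w\<in>S. cinner w (u - p *\<^sub>V u) = 0) \<and>
    (\<forall>z. (\<forall>u\<in>S. z *\<^sub>V u \<in> S) \<longrightarrow> (\<forall>u\<in>S. star z *\<^sub>V u \<in> S) \<longrightarrow> z * p = p * z)"

definition proj :: "'a::chilbert_space set \<Rightarrow> 'a bop" where
  "proj S = (SOME p. is_projection S p)"

lemma
  fixes S :: "'a::chilbert_space set"
  assumes S: "csubspace S" "closed S"
  shows proj_idem: "proj S * proj S = proj S" and star_proj: "star (proj S) = proj S"
    and proj_mem: "proj S *\<^sub>V u \<in> S" and proj_eq: "w \<in> S \<Longrightarrow> proj S *\<^sub>V w = w"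
    and proj_zero: "(\<And>w. w \<in> S \<Longrightarrow> cinner w u = 0) \<Longrightarrow> proj S *\<^sub>V u = 0"
    and proj_orthogonal: "w \<in> S \<Longrightarrow> cinner w (u - proj S *\<^sub>V u) = 0"
    and proj_commute: "(\<And>u. u \<in> S \<Longrightarrow> z *\<^sub>V u \<in> S) \<Longrightarrow> (\<And>u. u \<in> S \<Longrightarrow> star z *\<^sub>V u \<in> S) \<Longrightarrow> z * proj S = proj S * z"
proof -
  have "\<exists>p. is_projection S p"
  proof (rule projection_bop[OF S])
    fix p assume p: "p * p = p" "star p = p" "\<And>u. p *\<^sub>V u \<in> S" "\<And>u. u \<in> S \<Longrightarrow> p *\<^sub>V u = u"
      "\<And>u. (\<And>w. w \<in> S \<Longrightarrow> cinner w u = 0) \<Longrightarrow> p *\<^sub>V u = 0"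
      "\<And>u w. w \<in> S \<Longrightarrow> cinner w (u - p *\<^sub>V u) = 0"
      "\<And>z. (\<And>u. u \<in> S \<Longrightarrow> z *\<^sub>V u \<in> S) \<Longrightarrow> (\<And>u. u \<in> S \<Longrightarrow> star z *\<^sub>V u \<in> S) \<Longrightarrow> z * p = p * z"
    have "is_projection S p"
      unfolding is_projection_def
    proof (intro conjI allI impI ballI)
      show "p *\<^sub>V u = 0" if "\<forall>w\<in>S. cinner w u = 0" for u using p(5) that by blast
      show "z * p = p * z" if "\<forall>u\<in>S. z *\<^sub>V u \<in> S" "\<forall>u\<in>S. star z *\<^sub>V u \<in> S" for z using p(7) that by blast
    qed (use p in blast)+
    then show ?thesis by blast
  qed
  then have *: "is_projection S (proj S)" unfolding proj_def by (rule someI_ex)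
  note r1 = *[unfolded is_projection_def] note r2 = r1[THEN conjunct2] note r3 = r2[THEN conjunct2]
  note r4 = r3[THEN conjunct2] note r5 = r4[THEN conjunct2] note r6 = r5[THEN conjunct2] note r7 = r6[THEN conjunct2]
  show "proj S * proj S = proj S" by (rule r1[THEN conjunct1])
  show "star (proj S) = proj S" by (rule r2[THEN conjunct1])
  show "proj S *\<^sub>V u \<in> S" by (rule r3[THEN conjunct1, rule_format])
  show "proj S *\<^sub>V w = w" if "w \<in> S" by (rule r4[THEN conjunct1, rule_format, OF that])
  show "proj S *\<^sub>V u = 0" if "\<And>w. w \<in> S \<Longrightarrow> cinner w u = 0" by (rule r5[THEN conjunct1, rule_format, OF that])
  show "cinner w (u - proj S *\<^sub>V u) = 0" if "w \<in> S" by (rule r6[THEN conjunct1, rule_format, OF that])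
  show "z * proj S = proj S * z" if "\<And>u. u \<in> S \<Longrightarrow> z *\<^sub>V u \<in> S" "\<And>u. u \<in> S \<Longrightarrow> star z *\<^sub>V u \<in> S"
    by (rule r7[rule_format, OF that])
qed

lemma norm_proj_le: "csubspace S \<Longrightarrow> closed S \<Longrightarrow> norm (proj S) \<le> 1"
proof -
  assume S: "csubspace S" "closed S"
  have "norm (proj S) = norm (proj S) * norm (proj S)"
    using cstar_identity[of "proj S"] unfolding star_proj[OF S] proj_idem[OF S] power2_eq_square .
  then have "norm (proj S) = 0 \<or> norm (proj S) = 1" unfolding mult_cancel_right1 .
  then show ?thesis by auto
qed

text \<open>Polarization: with \<open>y\<close> the multiple of \<open>b x\<close> that has the norm
  of \<open>x\<close>, the number 4 <y, b x> is a difference of two values of the quadratic form,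
  and the parallelogram law bounds these by \<open>r\<close>.\<close>

lemma norm_selfadjoint_le:
  assumes b: "star b = (b :: 'a::chilbert_space bop)" and r: "\<And>x. \<bar>Re (cinner x (b *\<^sub>V x))\<bar> \<le> r * (norm x)\<^sup>2" "r \<ge> 0"
  shows "norm b \<le> r"
proof (rule norm_bop_bound)
  fix x
  define u where "u = b *\<^sub>V x"
  show "norm (b *\<^sub>V x) \<le> r * norm x"
  proof (cases "u = 0 \<or> x = 0")
    case True
    then show ?thesis using r(2) by (auto simp: u_def bop_simps)
  next
    case False
    define y where "y = of_real (norm x / norm u) *\<^sub>C u"
    have ny: "norm y = norm x" using False by (simp add: y_def norm_scaleC norm_divide)
    have "cinner y u = of_real (norm x * norm u)"
      using False by (simp add: y_def cinner_scaleC_left cinner_self power2_eq_square)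
    then have yu: "Re (cinner y (b *\<^sub>V x)) = norm x * norm u" by (simp add: u_def)
    have xy: "Re (cinner x (b *\<^sub>V y)) = Re (cinner y (b *\<^sub>V x))"
      using cinner_star_bop[of b x y] cinner_commute[of "b *\<^sub>V x" y] b by (metis complex_cnj_cnj cnj.sel(1))
    have "4 * (norm x * norm u) = Re (cinner (x + y) (b *\<^sub>V (x + y))) - Re (cinner (x - y) (b *\<^sub>V (x - y)))"
      by (simp add: bop_simps cinner_add_left cinner_add_right cinner_diff_left cinner_diff_right xy yu)
    also have "\<dots> \<le> r * (norm (x + y))\<^sup>2 + r * (norm (x - y))\<^sup>2"
      using r(1)[of "x + y"] r(1)[of "x - y"] by linarith
    also have "\<dots> = 4 * (r * (norm x)\<^sup>2)"
    proof -
      have "(norm (x + y))\<^sup>2 + (norm (x - y))\<^sup>2 = 2 * (norm x)\<^sup>2 + 2 * (norm y)\<^sup>2"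
        unfolding Re_cinner_self[symmetric]
        by (simp add: cinner_add_left cinner_add_right cinner_diff_left cinner_diff_right)
      then show ?thesis by (simp add: ny distrib_left[symmetric])
    qed
    finally have "norm x * norm u \<le> norm x * (r * norm x)" by (simp add: power2_eq_square mult_ac)
    then show ?thesis using False by (simp add: u_def)
  qed
qed (rule r)

text \<open>
  With \<open>\<bar>b\<bar>\<close> from the square root iteration, \<open>p\<close> projects onto the closed range of \<open>\<bar>b\<bar> + b\<close>,
  so that \<open>b\<close> is positive on the range of \<open>p\<close> and negative on its complement.
\<close>

lemma symmetry_approximation:
  assumes b: "star b = (b :: 'a::chilbert_space bop)" and r: "norm b \<le> r" "r > 0"
  obtains p where "p * p = p" "star p = p" "\<And>z. z * b = b * z \<Longrightarrow> z * p = p * z"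
    "norm (b - of_real (r / 2) *\<^sub>C (p + p - 1)) \<le> r / 2"
proof -
  define B where "B = of_real (1 / r) *\<^sub>C b"
  have B: "star B = B" "norm B \<le> 1" using b r by (auto simp: B_def star_scaleC norm_scaleC norm_divide)
  have bB: "b = of_real r *\<^sub>C B" using r by (simp add: B_def scaleC_scaleC scaleC_one)
  have Bx: "norm (B *\<^sub>V x) \<le> norm x" for x
    using norm_bop_apply[of B x] mult_right_mono[OF B(2) norm_ge_zero[of x]] by simp
  have Badj: "cinner (B *\<^sub>V x) y = cinner x (B *\<^sub>V y)" for x y using cinner_star_bop[of B x y] B by simp
  define A where "A = 1 - B * B"
  have A: "star A = A" by (simp add: A_def star_diff star_mult B)
  have "norm A \<le> 1"
  proof (rule norm_selfadjoint_le[OF A])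
    fix x
    have "cinner x (A *\<^sub>V x) = of_real ((norm x)\<^sup>2 - (norm (B *\<^sub>V x))\<^sup>2)"
      by (simp add: A_def bop_apply_simps cinner_diff_right cinner_self flip: Badj)
    moreover have "(norm (B *\<^sub>V x))\<^sup>2 \<le> (norm x)\<^sup>2" by (intro power_mono Bx) simp
    ultimately show "\<bar>Re (cinner x (A *\<^sub>V x))\<bar> \<le> 1 * (norm x)\<^sup>2" by simp
  qed simp
  then obtain Y where Y: "2 *\<^sub>C Y = A + Y * Y" "norm Y \<le> 1" "\<And>z. z * A = A * z \<Longrightarrow> z * Y = Y * z" "star Y = Y"
    using square_root_iteration[of A] A by metis
  \<comment> \<open>Since 2Y = A + Y^2, the square of 1 - Y is 1 - A = B^2; together with positivity
    this makes \<open>C\<close> the absolute value of \<open>B\<close>.\<close>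
  define C where "C = 1 - Y"
  have "C * C = 1 - 2 *\<^sub>C Y + Y * Y"
    using scaleC_add_left[of 1 1 Y] by (simp add: C_def left_diff_distrib right_diff_distrib scaleC_one)
  then have CC: "C * C = B * B" by (simp add: Y(1) A_def)
  have Ccomm: "z * C = C * z" if "z * B = B * z" for z
  proof -
    have "z * (B * B) = B * B * z" by (metis that mult.assoc)
    then have "z * A = A * z" by (simp add: A_def left_diff_distrib right_diff_distrib)
    then show ?thesis using Y(3) by (simp add: C_def left_diff_distrib right_diff_distrib)
  qed
  have BC: "B * C = C * B" by (rule Ccomm) simp
  have Cadj: "cinner (C *\<^sub>V x) y = cinner x (C *\<^sub>V y)" for x y
    using cinner_star_bop[of C x y] Y(4) by (simp add: C_def star_diff)
  have Cpos: "Re (cinner x (C *\<^sub>V x)) \<ge> 0" for x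
  proof -
    have "Re (cinner x (Y *\<^sub>V x)) \<le> norm x * norm (Y *\<^sub>V x)"
      using complex_Re_le_cmod norm_cinner_le order_trans by blast
    also have "\<dots> \<le> norm x * norm x"
      using norm_bop_apply[of Y x] mult_right_mono[OF Y(2) norm_ge_zero[of x]] by (intro mult_left_mono) auto
    finally show ?thesis by (simp add: C_def bop_apply_simps cinner_diff_right Re_cinner_self power2_eq_square)
  qed
  define S where "S = closure (cspan (range ((*\<^sub>V) (C + B))))"
  have S: "csubspace S" "closed S" by (simp_all add: S_def csubspace_closure_cspan)
  define p where "p = proj S"
  note p = proj_idem[OF S, folded p_def] star_proj[OF S, folded p_def] proj_mem[OF S, folded p_def]
    proj_eq[OF S, folded p_def] proj_orthogonal[OF S, folded p_def] proj_commute[OF S, folded p_def]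
  have Sinv: "z *\<^sub>V u \<in> S" if z: "z * B = B * z" and u: "u \<in> S" for z u
    using u unfolding S_def
  proof (rule bop_image_closure_cspan[OF S[unfolded S_def], rotated])
    have "z * (C + B) = (C + B) * z" using z Ccomm[OF z] by (simp add: distrib_left distrib_right)
    then have "z *\<^sub>V (C + B) *\<^sub>V x = (C + B) *\<^sub>V z *\<^sub>V x" for x by (metis bop_apply_simps(6))
    then show "z *\<^sub>V x \<in> closure (cspan (range ((*\<^sub>V) (C + B))))" if "x \<in> range ((*\<^sub>V) (C + B))" for x
      using that by (auto intro!: closure_cspan_superset)
  qed
  have pcomm: "z * p = p * z" if z: "z * B = B * z" for z
  proof (rule p(6))
    have "star z * B = B * star z" by (metis z star_mult B(1) star_star)
    then show "star z *\<^sub>V u \<in> S" if "u \<in> S" for u using Sinv that by blast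
  qed (use Sinv z in blast)
  have onS: "B *\<^sub>V u = C *\<^sub>V u" if "u \<in> S" for u
  proof -
    have "(B - C) *\<^sub>V u \<in> {0}"
      using that unfolding S_def
    proof (rule bop_image_closure_cspan[rotated 3])
      have "(B - C) * (C + B) = 0" by (simp add: distrib_left left_diff_distrib BC CC)
      then show "(B - C) *\<^sub>V x \<in> {0}" if "x \<in> range ((*\<^sub>V) (C + B))" for x
        using that by (auto simp flip: bop_apply_simps(6)) (simp add: bop_apply_simps)
    qed (simp_all add: complex_vector.subspace_single_0)
    then show ?thesis by (simp add: bop_apply_simps)
  qed
  have offS: "B *\<^sub>V w = - (C *\<^sub>V w)" if w: "p *\<^sub>V w = 0" for w
  proof -
    have "(C + B) *\<^sub>V w = 0"
    proof (rule cinner_ext)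
      fix z
      have "(C + B) *\<^sub>V z \<in> S" unfolding S_def by (rule closure_cspan_superset) simp
      from p(5)[OF this, of w] have "cinner ((C + B) *\<^sub>V z) w = 0" by (simp add: w)
      then show "cinner z ((C + B) *\<^sub>V w) = cinner z 0"
        by (simp add: bop_apply_simps cinner_add_left cinner_add_right Badj Cadj)
    qed
    then show ?thesis by (simp add: bop_apply_simps eq_neg_iff_add_eq_0 add.commute)
  qed
  \<comment> \<open>On \<open>S\<close> the form of \<open>B\<close> takes values in [0, 1] and 1/2
    is subtracted; on the complement it takes values in [-1, 0] and 1/2 is added. Either way what
    remains is at most 1/2.\<close>
  define D where "D = B - (1/2) *\<^sub>C (p + p - 1)"
  have Dsa: "star D = D" by (simp add: D_def star_diff star_scaleC star_add B p(2))
  have "norm D \<le> 1 / 2"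
  proof (rule norm_selfadjoint_le[OF Dsa])
    fix x
    define u where "u = p *\<^sub>V x"
    define w where "w = x - u"
    have pw: "p *\<^sub>V w = 0" "p *\<^sub>V u = u" using p(4)[OF p(3)] by (simp_all add: w_def u_def bop_simps)
    have uS: "u \<in> S" unfolding u_def by (rule p)
    have x: "x = u + w" by (simp add: w_def)
    have ortho: "cinner v w = 0" if "v \<in> S" for v using p(5)[OF that, of x] by (simp add: w_def u_def)
    have Bu: "B *\<^sub>V u \<in> S" using Sinv uS by blast
    have uw: "cinner u w = 0" "cinner w u = 0" "cinner (B *\<^sub>V u) w = 0" "cinner w (B *\<^sub>V u) = 0" "cinner u (B *\<^sub>V w) = 0"
      using ortho[OF uS] ortho[OF Bu] cinner_commute[of w u] cinner_commute[of w "B *\<^sub>V u"] by (simp_all flip: Badj)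
    have "(p + p - 1) *\<^sub>V x = u - w" by (simp add: bop_apply_simps u_def w_def)
    moreover have "B *\<^sub>V x = B *\<^sub>V u + B *\<^sub>V w" unfolding x by (simp add: bop_simps)
    ultimately have "D *\<^sub>V x = B *\<^sub>V u + B *\<^sub>V w - (1/2) *\<^sub>C (u - w)"
      by (simp add: D_def bop_apply_simps(3) scaleC_bop_apply)
    then have eD: "Re (cinner x (D *\<^sub>V x)) = (Re (cinner u (B *\<^sub>V u)) - (norm u)\<^sup>2 / 2) + (Re (cinner w (B *\<^sub>V w)) + (norm w)\<^sup>2 / 2)"
      unfolding x by (simp add: cinner_add_left cinner_add_right cinner_diff_right cinner_scaleC_right uw Re_cinner_self diff_divide_distrib)
    have b1: "0 \<le> Re (cinner u (B *\<^sub>V u))" using Cpos[of u] onS[OF uS] by simp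
    have b2: "Re (cinner w (B *\<^sub>V w)) \<le> 0" using Cpos[of w] offS[OF pw(1)] by simp
    have bd: "\<bar>Re (cinner v (B *\<^sub>V v))\<bar> \<le> (norm v)\<^sup>2" for v
    proof -
      have "\<bar>Re (cinner v (B *\<^sub>V v))\<bar> \<le> norm v * norm (B *\<^sub>V v)"
        using abs_Re_le_cmod norm_cinner_le order_trans by blast
      also have "\<dots> \<le> norm v * norm v" by (intro mult_left_mono Bx) simp
      finally show ?thesis by (simp add: power2_eq_square)
    qed
    have nx: "(norm x)\<^sup>2 = (norm u)\<^sup>2 + (norm w)\<^sup>2" unfolding x by (rule norm_sq_add_orthogonal[OF uw(1)])
    show "\<bar>Re (cinner x (D *\<^sub>V x))\<bar> \<le> 1 / 2 * (norm x)\<^sup>2"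
      using b1 b2 bd[of u] bd[of w] eD nx by arith
  qed simp
  moreover have "b - of_real (r / 2) *\<^sub>C (p + p - 1) = of_real r *\<^sub>C D"
    unfolding D_def bB complex_vector.scale_right_diff_distrib scaleC_scaleC by simp
  ultimately have n: "norm (b - of_real (r / 2) *\<^sub>C (p + p - 1)) \<le> r / 2"
    using r by (simp add: norm_scaleC del: of_real_divide)
  have "z * p = p * z" if "z * b = b * z" for z
    using that pcomm by (simp add: B_def scaleC_mult_left scaleC_mult_right)
  then show ?thesis using that p(1,2) n by blast
qed

section \<open>Square summable sequences\<close>

text \<open>The countable amplification of a Hilbert space. One vector here encodes finitely many
  vectors below, which turns approximation at one vector into strong approximation; the Cesaro means
  are also compressions of diagonal operators on such a space.\<close>

typedef (overloaded) 'a ell2 = "{f :: nat \<Rightarrow> 'a::chilbert_space. summable (\<lambda>n. (norm (f n))\<^sup>2)}"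
  morphisms ell2_nth Ell2
  by (rule exI[of _ "\<lambda>_. 0"]) simp

lemma summable_ell2: "summable (\<lambda>n. (norm (ell2_nth x n))\<^sup>2)"
  using ell2_nth[of x] by simp

lemma summable_sq_add:
  fixes f g :: "nat \<Rightarrow> 'a::real_normed_vector"
  assumes "summable (\<lambda>n. (norm (f n))\<^sup>2)" "summable (\<lambda>n. (norm (g n))\<^sup>2)"
  shows "summable (\<lambda>n. (norm (f n + g n))\<^sup>2)"
proof (rule summable_comparison_test'[of "\<lambda>n. 2 * (norm (f n))\<^sup>2 + 2 * (norm (g n))\<^sup>2" 0])
  show "summable (\<lambda>n. 2 * (norm (f n))\<^sup>2 + 2 * (norm (g n))\<^sup>2)" by (intro summable_add summable_mult assms)
  fix n
  have "(norm (f n + g n))\<^sup>2 \<le> (norm (f n) + norm (g n))\<^sup>2" by (intro power_mono norm_triangle_ineq) simp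
  also have "\<dots> \<le> 2 * (norm (f n))\<^sup>2 + 2 * (norm (g n))\<^sup>2"
    using sum_squares_bound[of "norm (f n)" "norm (g n)"] by (simp add: power2_sum)
  finally show "norm ((norm (f n + g n))\<^sup>2) \<le> 2 * (norm (f n))\<^sup>2 + 2 * (norm (g n))\<^sup>2" by simp
qed

lemma summable_cinner:
  fixes f g :: "nat \<Rightarrow> 'a::chilbert_space"
  assumes "summable (\<lambda>n. (norm (f n))\<^sup>2)" "summable (\<lambda>n. (norm (g n))\<^sup>2)"
  shows "summable (\<lambda>n. cinner (f n) (g n))"
proof (rule summable_comparison_test'[of "\<lambda>n. (norm (f n))\<^sup>2 + (norm (g n))\<^sup>2" 0])
  show "summable (\<lambda>n. (norm (f n))\<^sup>2 + (norm (g n))\<^sup>2)" by (intro summable_add assms)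
  fix n
  have "norm (cinner (f n) (g n)) \<le> norm (f n) * norm (g n)" by (rule norm_cinner_le)
  also have "\<dots> \<le> (norm (f n))\<^sup>2 + (norm (g n))\<^sup>2"
  proof -
    have "2 * (norm (f n) * norm (g n)) \<le> (norm (f n))\<^sup>2 + (norm (g n))\<^sup>2"
      using sum_squares_bound[of "norm (f n)" "norm (g n)"] by (simp add: mult.assoc)
    moreover have "0 \<le> norm (f n) * norm (g n)" by simp
    ultimately show ?thesis by linarith
  qed
  finally show "norm (cinner (f n) (g n)) \<le> (norm (f n))\<^sup>2 + (norm (g n))\<^sup>2" .
qed

instantiation ell2 :: (chilbert_space) complex_normed_vector
begin

definition zero_ell2 :: "'a ell2" where "0 = Ell2 (\<lambda>_. 0)"
definition plus_ell2 :: "'a ell2 \<Rightarrow> 'a ell2 \<Rightarrow> 'a ell2" where "x + y = Ell2 (\<lambda>n. ell2_nth x n + ell2_nth y n)"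
definition minus_ell2 :: "'a ell2 \<Rightarrow> 'a ell2 \<Rightarrow> 'a ell2" where "x - y = Ell2 (\<lambda>n. ell2_nth x n - ell2_nth y n)"
definition uminus_ell2 :: "'a ell2 \<Rightarrow> 'a ell2" where "- x = Ell2 (\<lambda>n. - ell2_nth x n)"
definition scaleR_ell2 :: "real \<Rightarrow> 'a ell2 \<Rightarrow> 'a ell2" where "r *\<^sub>R x = Ell2 (\<lambda>n. r *\<^sub>R ell2_nth x n)"
definition scaleC_ell2 :: "complex \<Rightarrow> 'a ell2 \<Rightarrow> 'a ell2" where "scaleC_ell2 c x = Ell2 (\<lambda>n. c *\<^sub>C ell2_nth x n)"
definition norm_ell2 :: "'a ell2 \<Rightarrow> real" where "norm x = sqrt (\<Sum>n. (norm (ell2_nth x n))\<^sup>2)"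
definition sgn_ell2 :: "'a ell2 \<Rightarrow> 'a ell2" where "sgn_ell2 x = inverse (norm x) *\<^sub>R x"
definition dist_ell2 :: "'a ell2 \<Rightarrow> 'a ell2 \<Rightarrow> real" where "dist_ell2 x y = norm (x - y)"
definition uniformity_ell2 :: "('a ell2 \<times> 'a ell2) filter" where
  "uniformity_ell2 = (INF e\<in>{0 <..}. principal {(x, y). dist x y < e})"
definition open_ell2 :: "'a ell2 set \<Rightarrow> bool" where
  "open_ell2 U = (\<forall>x\<in>U. \<forall>\<^sub>F (x', y) in uniformity. x' = x \<longrightarrow> y \<in> U)"

lemma ell2_nth_simps:
  "ell2_nth (0::'a ell2) n = 0" "ell2_nth (x + y) n = ell2_nth x n + ell2_nth (y::'a ell2) n"
  "ell2_nth (- x) n = - ell2_nth x n" "ell2_nth (x - y) n = ell2_nth x n - ell2_nth y n"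
  "ell2_nth (r *\<^sub>R x) n = r *\<^sub>R ell2_nth x n" "ell2_nth (c *\<^sub>C x) n = c *\<^sub>C ell2_nth x n"
proof -
  show "ell2_nth (0::'a ell2) n = 0" by (simp add: zero_ell2_def Ell2_inverse)
  show "ell2_nth (x + y) n = ell2_nth x n + ell2_nth y n"
    using summable_sq_add[OF summable_ell2[of x] summable_ell2[of y]] by (simp add: plus_ell2_def Ell2_inverse)
  show "ell2_nth (- x) n = - ell2_nth x n" by (simp add: uminus_ell2_def Ell2_inverse summable_ell2)
  show "ell2_nth (x - y) n = ell2_nth x n - ell2_nth y n"
    using summable_sq_add[of "ell2_nth x" "\<lambda>n. - ell2_nth y n"] by (simp add: minus_ell2_def Ell2_inverse summable_ell2)
  show "ell2_nth (r *\<^sub>R x) n = r *\<^sub>R ell2_nth x n"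
    by (simp add: scaleR_ell2_def Ell2_inverse summable_ell2 power_mult_distrib summable_mult)
  show "ell2_nth (c *\<^sub>C x) n = c *\<^sub>C ell2_nth x n"
    by (simp add: scaleC_ell2_def Ell2_inverse summable_ell2 power_mult_distrib summable_mult norm_scaleC)
qed

lemma ell2_ext: "(\<And>n. ell2_nth x n = ell2_nth y n) \<Longrightarrow> x = (y::'a ell2)"
  by (meson ell2_nth_inject ext)

lemma norm_ell2_sq: "(norm x)\<^sup>2 = (\<Sum>n. (norm (ell2_nth (x::'a ell2) n))\<^sup>2)"
  unfolding norm_ell2_def by (simp add: suminf_nonneg summable_ell2)

lemma norm_ell2_ge: "L2_set (\<lambda>n. norm (ell2_nth x n)) {..<N} \<le> norm (x::'a ell2)"
  unfolding norm_ell2_def L2_set_def by (intro real_sqrt_le_mono sum_le_suminf summable_ell2) auto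

lemma norm_ell2_le:
  assumes "\<And>N. L2_set (\<lambda>n. norm (ell2_nth x n)) {..<N} \<le> C"
  shows "norm (x::'a ell2) \<le> C"
proof -
  have C: "C \<ge> 0" using assms[of 0] by simp
  have "(\<Sum>n<N. (norm (ell2_nth x n))\<^sup>2) \<le> C\<^sup>2" for N
    using power_mono[OF assms[of N], of 2] by (simp add: L2_set_def sum_nonneg)
  then have "(\<Sum>n. (norm (ell2_nth x n))\<^sup>2) \<le> C\<^sup>2" by (intro suminf_le_const summable_ell2)
  then show ?thesis unfolding norm_ell2_def by (rule real_le_lsqrt[OF C])
qed

instance
proof
  fix x y z :: "'a ell2" and c d :: complex and r s :: real
  show "x + y + z = x + (y + z)" "x + y = y + x" "0 + x = x" "- x + x = 0" "x - y = x + - y"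
    by (rule ell2_ext, simp add: ell2_nth_simps)+
  show "r *\<^sub>R (x + y) = r *\<^sub>R x + r *\<^sub>R y" "(r + s) *\<^sub>R x = r *\<^sub>R x + s *\<^sub>R x" "r *\<^sub>R s *\<^sub>R x = (r * s) *\<^sub>R x"
    "1 *\<^sub>R x = x"
    by (rule ell2_ext, simp add: ell2_nth_simps scaleR_add_right scaleR_add_left)+
  show "c *\<^sub>C (x + y) = c *\<^sub>C x + c *\<^sub>C y" "(c + d) *\<^sub>C x = c *\<^sub>C x + d *\<^sub>C x" "c *\<^sub>C d *\<^sub>C x = (c * d) *\<^sub>C x"
    by (rule ell2_ext, simp add: ell2_nth_simps scaleC_add_right scaleC_add_left scaleC_scaleC)+
  show "r *\<^sub>R x = complex_of_real r *\<^sub>C x" by (rule ell2_ext) (simp add: ell2_nth_simps scaleR_scaleC)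
  show "dist x y = norm (x - y)" by (rule dist_ell2_def)
  show "sgn x = inverse (norm x) *\<^sub>R x" by (rule sgn_ell2_def)
  show "uniformity = (INF e\<in>{0 <..}. principal {(x :: 'a ell2, y). dist x y < e})" by (rule uniformity_ell2_def)
  show "open V = (\<forall>x\<in>V. \<forall>\<^sub>F (x', y) in uniformity. x' = x \<longrightarrow> y \<in> V)" for V :: "'a ell2 set" by (rule open_ell2_def)
  show "(norm x = 0) = (x = 0)"
  proof
    assume "norm x = 0"
    then have "(\<Sum>n. (norm (ell2_nth x n))\<^sup>2) = 0" by (simp add: norm_ell2_def)
    then have "\<forall>n. (norm (ell2_nth x n))\<^sup>2 = 0" by (subst (asm) suminf_eq_zero_iff) (auto simp: summable_ell2)
    then show "x = 0" by (intro ell2_ext) (simp add: ell2_nth_simps)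
  qed (simp add: norm_ell2_def ell2_nth_simps)
  show "norm (x + y) \<le> norm x + norm y"
  proof (rule norm_ell2_le)
    fix N
    have "L2_set (\<lambda>n. norm (ell2_nth (x + y) n)) {..<N} \<le> L2_set (\<lambda>n. norm (ell2_nth x n) + norm (ell2_nth y n)) {..<N}"
      by (rule L2_set_mono) (simp_all add: ell2_nth_simps norm_triangle_ineq)
    also have "\<dots> \<le> L2_set (\<lambda>n. norm (ell2_nth x n)) {..<N} + L2_set (\<lambda>n. norm (ell2_nth y n)) {..<N}"
      by (rule L2_set_triangle_ineq)
    finally show "L2_set (\<lambda>n. norm (ell2_nth (x + y) n)) {..<N} \<le> norm x + norm y"
      using norm_ell2_ge[of x N] norm_ell2_ge[of y N] by linarith
  qed
  show "norm (r *\<^sub>R x) = \<bar>r\<bar> * norm x"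
    by (simp add: norm_ell2_def ell2_nth_simps power_mult_distrib suminf_mult summable_ell2 real_sqrt_mult)
  show "norm (c *\<^sub>C x) = cmod c * norm x"
    by (simp add: norm_ell2_def ell2_nth_simps power_mult_distrib suminf_mult summable_ell2 real_sqrt_mult norm_scaleC)
qed

end

lemma norm_ell2_nth_le: "norm (ell2_nth x n) \<le> norm x"
proof -
  have "norm (ell2_nth x n) \<le> L2_set (\<lambda>n. norm (ell2_nth x n)) {..<Suc n}" by (rule member_le_L2_set) auto
  then show ?thesis using norm_ell2_ge[of x "Suc n"] by simp
qed

instantiation ell2 :: (chilbert_space) chilbert_space
begin

definition cinner_ell2 :: "'a ell2 \<Rightarrow> 'a ell2 \<Rightarrow> complex" where
  "cinner_ell2 x y = (\<Sum>n. cinner (ell2_nth x n) (ell2_nth y n))"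

instance
proof
  fix x y z :: "'a ell2" and c :: complex
  have s: "summable (\<lambda>n. cinner (ell2_nth x n) (ell2_nth y n))" for x y :: "'a ell2"
    by (intro summable_cinner summable_ell2)
  show "cinner x (y + z) = cinner x y + cinner x z"
    by (simp add: cinner_ell2_def ell2_nth_simps cinner_add_right suminf_add s)
  show "cinner x (c *\<^sub>C y) = c * cinner x y"
    by (simp add: cinner_ell2_def ell2_nth_simps cinner_scaleC_right suminf_mult s)
  show "cinner y x = cnj (cinner x y)"
  proof -
    have "(\<lambda>n. cnj (cinner (ell2_nth x n) (ell2_nth y n))) sums cnj (cinner x y)"
      unfolding sums_cnj cinner_ell2_def by (rule summable_sums[OF s])
    then have "(\<lambda>n. cinner (ell2_nth y n) (ell2_nth x n)) sums cnj (cinner x y)"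
      by (simp flip: cinner_commute)
    then show ?thesis unfolding cinner_ell2_def by (simp add: sums_iff)
  qed
  show "cinner x x = complex_of_real ((norm x)\<^sup>2)"
    by (simp add: cinner_ell2_def norm_ell2_sq cinner_self suminf_of_real summable_ell2)
  show "convergent X" if X: "Cauchy X" for X :: "nat \<Rightarrow> 'a ell2"
  proof -
    have "Cauchy (\<lambda>m. ell2_nth (X m) n)" for n
    proof (rule metric_CauchyI)
      fix e :: real assume "e > 0"
      from metric_CauchyD[OF X this] obtain M where M: "\<forall>m\<ge>M. \<forall>k\<ge>M. dist (X m) (X k) < e" by blast
      have "dist (ell2_nth (X m) n) (ell2_nth (X k) n) \<le> dist (X m) (X k)" for m k
        using norm_ell2_nth_le[of "X m - X k" n] by (simp add: dist_norm ell2_nth_simps)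
      then show "\<exists>M. \<forall>m\<ge>M. \<forall>k\<ge>M. dist (ell2_nth (X m) n) (ell2_nth (X k) n) < e"
        using M by (meson le_less_trans)
    qed
    then have "\<forall>n. \<exists>l. (\<lambda>m. ell2_nth (X m) n) \<longlonglongrightarrow> l" using Cauchy_convergent_iff convergent_def by blast
    then obtain f where f: "\<And>n. (\<lambda>m. ell2_nth (X m) n) \<longlonglongrightarrow> f n" by metis
    have part: "L2_set (\<lambda>n. norm (ell2_nth (X m) n - f n)) {..<N} \<le> e"
      if M: "\<forall>m\<ge>M. \<forall>k\<ge>M. dist (X m) (X k) < e" and m: "m \<ge> M" for M m e N
    proof (rule LIMSEQ_le_const2)
      show "(\<lambda>k. L2_set (\<lambda>n. norm (ell2_nth (X m) n - ell2_nth (X k) n)) {..<N})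
          \<longlonglongrightarrow> L2_set (\<lambda>n. norm (ell2_nth (X m) n - f n)) {..<N}"
        unfolding L2_set_def by (intro tendsto_intros f)
      have "L2_set (\<lambda>n. norm (ell2_nth (X m) n - ell2_nth (X k) n)) {..<N} \<le> e" if "k \<ge> M" for k
      proof -
        have "dist (X m) (X k) < e" using M m that by blast
        then show ?thesis using norm_ell2_ge[of "X m - X k" N] by (simp add: dist_norm ell2_nth_simps)
      qed
      then show "\<exists>K. \<forall>k\<ge>K. L2_set (\<lambda>n. norm (ell2_nth (X m) n - ell2_nth (X k) n)) {..<N} \<le> e" by blast
    qed
    have mem: "summable (\<lambda>n. (norm (ell2_nth (X m) n - f n))\<^sup>2)"
      if M: "\<forall>m\<ge>M. \<forall>k\<ge>M. dist (X m) (X k) < e" and m: "m \<ge> M" for M m e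
    proof (rule bounded_imp_summable[of _ "e\<^sup>2"])
      fix N
      show "(\<Sum>n\<le>N. (norm (ell2_nth (X m) n - f n))\<^sup>2) \<le> e\<^sup>2"
        using power_mono[OF part[OF M m, of "Suc N"], of 2]
        by (simp add: L2_set_def sum_nonneg lessThan_Suc_atMost)
    qed simp
    obtain M1 where M1: "\<forall>m\<ge>M1. \<forall>k\<ge>M1. dist (X m) (X k) < 1" using metric_CauchyD[OF X, of 1] by auto
    have "summable (\<lambda>n. (norm (f n))\<^sup>2)"
      using summable_sq_add[OF summable_ell2[of "X M1"], of "\<lambda>n. - (ell2_nth (X M1) n - f n)"] mem[OF M1, of M1]
      by (simp add: norm_minus_commute)
    then have f_nth: "ell2_nth (Ell2 f) = f" by (simp add: Ell2_inverse)
    have "X \<longlonglongrightarrow> Ell2 f"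
    proof (rule metric_LIMSEQ_I)
      fix e :: real assume "e > 0"
      then obtain M where M: "\<forall>m\<ge>M. \<forall>k\<ge>M. dist (X m) (X k) < e / 2" using metric_CauchyD[OF X, of "e / 2"] by auto
      have "dist (X m) (Ell2 f) \<le> e / 2" if "m \<ge> M" for m
        unfolding dist_norm by (rule norm_ell2_le) (use part[OF M that] in \<open>simp add: ell2_nth_simps f_nth\<close>)
      then have "dist (X m) (Ell2 f) < e" if "m \<ge> M" for m using \<open>e > 0\<close> that by fastforce
      then show "\<exists>no. \<forall>n\<ge>no. dist (X n) (Ell2 f) < e" by blast
    qed
    then show ?thesis by (auto simp: convergent_def)
  qed
qed

end

section \<open>Coordinate embeddings and diagonal operators\<close>

definition ell2_single :: "nat \<Rightarrow> 'a::chilbert_space \<Rightarrow> 'a ell2" where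
  "ell2_single j h = Ell2 (\<lambda>n. if n = j then h else 0)"

lemma ell2_nth_single: "ell2_nth (ell2_single j h) n = (if n = j then h else 0)"
proof -
  have "summable (\<lambda>n. (norm (if n = j then h else 0))\<^sup>2)"
    by (rule summable_finite[of "{j}"]) auto
  then show ?thesis by (simp add: ell2_single_def Ell2_inverse)
qed

lemma cinner_ell2_single: "cinner (ell2_single j h) x = cinner h (ell2_nth x j)"
proof -
  have "(\<lambda>n. cinner (ell2_nth (ell2_single j h) n) (ell2_nth x n)) = (\<lambda>n. if n = j then cinner h (ell2_nth x j) else 0)"
    by (auto simp: ell2_nth_single fun_eq_iff)
  then show ?thesis unfolding cinner_ell2_def using suminf_finite[of "{j}" "\<lambda>n. if n = j then cinner h (ell2_nth x j) else 0"] by simp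
qed

lemma bounded_clinear_ell2_single: "bounded_clinear (ell2_single j)"
proof (rule bounded_clinearI[where K = 1])
  show "norm (ell2_single j h) \<le> 1 * norm h" for h :: 'a
  proof -
    have "(norm (ell2_single j h))\<^sup>2 = (norm h)\<^sup>2"
      using cinner_ell2_single[of j h "ell2_single j h"] by (simp add: ell2_nth_single cinner_self flip: of_real_power)
    then show ?thesis by simp
  qed
qed (rule ell2_ext, simp add: ell2_nth_single ell2_nth_simps)+

lemma ell2_single_total: "closure (cspan {ell2_single j h | j h. True}) = (UNIV :: 'a::chilbert_space ell2 set)"
proof (rule closure_cspan_UNIV_I)
  fix z :: "'a ell2" assume z: "\<And>x. x \<in> {ell2_single j h | j h. True} \<Longrightarrow> cinner x z = 0"
  show "z = 0"
  proof (rule ell2_ext, rule cinner_ext)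
    fix j and h :: 'a
    have "cinner (ell2_single j h) z = 0" by (rule z) blast
    then show "cinner h (ell2_nth z j) = cinner h (ell2_nth 0 j)" by (simp add: cinner_ell2_single ell2_nth_simps)
  qed
qed

definition ell2_map :: "'a::chilbert_space bop \<Rightarrow> 'a ell2 bop" where
  "ell2_map T = Bop (\<lambda>x. Ell2 (\<lambda>n. T *\<^sub>V ell2_nth x n))"

lemma ell2_nth_map: "ell2_nth (ell2_map T *\<^sub>V x) n = T *\<^sub>V ell2_nth x n"
proof -
  have s: "summable (\<lambda>n. (norm (T *\<^sub>V ell2_nth x n))\<^sup>2)" for x
  proof (rule summable_comparison_test'[of "\<lambda>n. (norm T)\<^sup>2 * (norm (ell2_nth x n))\<^sup>2" 0])
    show "norm ((norm (T *\<^sub>V ell2_nth x n))\<^sup>2) \<le> (norm T)\<^sup>2 * (norm (ell2_nth x n))\<^sup>2" for n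
      using power_mono[OF norm_bop_apply[of T "ell2_nth x n"], of 2] by (simp add: power_mult_distrib)
  qed (intro summable_mult summable_ell2)
  have nth: "ell2_nth (Ell2 (\<lambda>n. T *\<^sub>V ell2_nth x n)) n = T *\<^sub>V ell2_nth x n" for x n
    by (simp add: Ell2_inverse s)
  have "bounded_clinear (\<lambda>x. Ell2 (\<lambda>n. T *\<^sub>V ell2_nth x n))"
  proof (rule bounded_clinearI[where K = "norm T"])
    show "norm (Ell2 (\<lambda>n. T *\<^sub>V ell2_nth x n)) \<le> norm T * norm x" for x
    proof (rule norm_ell2_le)
      fix N
      have "L2_set (\<lambda>n. norm (T *\<^sub>V ell2_nth x n)) {..<N} \<le> L2_set (\<lambda>n. norm T * norm (ell2_nth x n)) {..<N}"
        by (rule L2_set_mono) (simp_all add: norm_bop_apply)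
      also have "\<dots> \<le> norm T * norm x"
        unfolding L2_set_right_distrib[OF norm_ge_zero, symmetric] by (intro mult_left_mono norm_ell2_ge) simp
      finally show "L2_set (\<lambda>n. norm (ell2_nth (Ell2 (\<lambda>n. T *\<^sub>V ell2_nth x n)) n)) {..<N} \<le> norm T * norm x"
        by (simp add: nth)
    qed
    show "Ell2 (\<lambda>n. T *\<^sub>V ell2_nth (x + y) n) = Ell2 (\<lambda>n. T *\<^sub>V ell2_nth x n) + Ell2 (\<lambda>n. T *\<^sub>V ell2_nth y n)" for x y
      by (rule ell2_ext, subst ell2_nth_simps, (subst nth)+) (simp add: ell2_nth_simps bop_simps)
    show "Ell2 (\<lambda>n. T *\<^sub>V ell2_nth (c *\<^sub>C x) n) = c *\<^sub>C Ell2 (\<lambda>n. T *\<^sub>V ell2_nth x n)" for c x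
      by (rule ell2_ext, subst ell2_nth_simps, (subst nth)+) (simp add: ell2_nth_simps bop_simps)
  qed
  then show ?thesis by (simp add: ell2_map_def Bop_apply nth)
qed

section \<open>The density theorem\<close>

definition star_subalgebra :: "'a::cstar_algebra set \<Rightarrow> bool" where
  "star_subalgebra A \<longleftrightarrow> csubspace A \<and> 1 \<in> A \<and> (\<forall>a\<in>A. \<forall>b\<in>A. a * b \<in> A) \<and> (\<forall>a\<in>A. star a \<in> A)"

definition bicommutant :: "'a::cstar_algebra set \<Rightarrow> 'a set" where
  "bicommutant A = {T. \<forall>z. (\<forall>a\<in>A. z * a = a * z) \<longrightarrow> z * T = T * z}"

lemma bicommutantD: "T \<in> bicommutant A \<Longrightarrow> (\<And>a. a \<in> A \<Longrightarrow> z * a = a * z) \<Longrightarrow> z * T = T * z"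
  by (auto simp: bicommutant_def)

lemma bicommutantI: "(\<And>z. (\<And>a. a \<in> A \<Longrightarrow> z * a = a * z) \<Longrightarrow> z * T = T * z) \<Longrightarrow> T \<in> bicommutant A"
  by (auto simp: bicommutant_def)

lemma bicommutant_star:
  assumes A: "star_subalgebra A" and T: "T \<in> bicommutant A"
  shows "star T \<in> bicommutant A"
proof (rule bicommutantI)
  fix z assume z: "\<And>a. a \<in> A \<Longrightarrow> z * a = a * z"
  have "star z * T = T * star z"
  proof (rule bicommutantD[OF T])
    fix a assume "a \<in> A"
    then have "star a * z = z * star a" using z A by (simp add: star_subalgebra_def)
    then have "star (star a * z) = star (z * star a)" by simp
    then show "star z * a = a * star z" by (simp add: star_mult star_star)
  qed
  then have "star (star z * T) = star (T * star z)" by simp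
  then show "z * star T = star T * z" by (simp add: star_mult star_star)
qed

text \<open>Von Neumann's argument: the closure of A x is invariant under A and its adjoints, so its
  projection commutes with A and hence with \<open>T\<close>; as it fixes \<open>x\<close>, it fixes
  \<open>T x\<close>.\<close>

lemma bicommutant_dense_vector:
  fixes A :: "'a::chilbert_space bop set"
  assumes A: "star_subalgebra A" and T: "T \<in> bicommutant A"
  shows "T *\<^sub>V x \<in> closure ((\<lambda>a. a *\<^sub>V x) ` A)"
proof -
  define V where "V = (\<lambda>a. a *\<^sub>V x) ` A"
  have A': "csubspace A" "1 \<in> A" "\<And>a b. a \<in> A \<Longrightarrow> b \<in> A \<Longrightarrow> a * b \<in> A" "\<And>a. a \<in> A \<Longrightarrow> star a \<in> A"
    using A by (auto simp: star_subalgebra_def)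
  have V: "csubspace V"
    unfolding complex_vector.subspace_def
  proof (intro conjI allI ballI impI)
    show "0 \<in> V" unfolding V_def by (rule image_eqI[of _ _ 0]) (simp_all add: bop_apply_simps complex_vector.subspace_0 A')
    show "u + v \<in> V" if "u \<in> V" "v \<in> V" for u v
      using that A'(1) unfolding V_def by (auto simp flip: bop_apply_simps simp: complex_vector.subspace_add)
    show "c *\<^sub>C u \<in> V" if "u \<in> V" for c u
      using that A'(1) unfolding V_def by (auto simp flip: scaleC_bop_apply simp: complex_vector.subspace_scale)
  qed
  have cl: "csubspace (closure V)" "closed (closure V)" by (simp_all add: csubspace_closure V)
  define p where "p = proj (closure V)"
  note p = proj_mem[OF cl, folded p_def] proj_eq[OF cl, folded p_def] proj_commute[OF cl, folded p_def]
  have inv: "a *\<^sub>V u \<in> closure V" if a: "a \<in> A" and u: "u \<in> closure V" for a u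
  proof -
    have "(\<lambda>u. a *\<^sub>V u) ` closure V \<subseteq> closure ((\<lambda>u. a *\<^sub>V u) ` V)"
      by (rule closure_bounded_linear_image_subset[OF bounded_clinearD(1)[OF bounded_clinear_bop]])
    also have "\<dots> \<subseteq> closure V"
      unfolding V_def using A'(3)[OF a] by (intro closure_mono) (auto simp flip: bop_apply_simps)
    finally show ?thesis using u by blast
  qed
  have "p * a = a * p" if "a \<in> A" for a by (rule p(3)[symmetric]) (use inv A'(4) that in auto)
  then have pT: "p * T = T * p" by (rule bicommutantD[OF T])
  have "x \<in> V" unfolding V_def by (rule image_eqI[of _ _ 1]) (simp_all add: bop_apply_simps A')
  then have "p *\<^sub>V x = x" using p(2) closure_subset by blast
  then have "T *\<^sub>V x = p *\<^sub>V (T *\<^sub>V x)" using pT by (metis bop_apply_simps(6))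
  then show ?thesis using p(1) V_def by metis
qed

lemma ell2_map_simps:
  "ell2_map (S + T) = ell2_map S + ell2_map T" "ell2_map (c *\<^sub>C T) = c *\<^sub>C ell2_map T"
  "ell2_map 0 = 0" "ell2_map 1 = 1" "ell2_map (S * T) = ell2_map S * ell2_map T" "ell2_map (S - T) = ell2_map S - ell2_map T"
  by (rule bop_ext, rule ell2_ext, simp add: ell2_nth_map ell2_nth_simps bop_apply_simps scaleC_bop_apply)+

lemma ell2_map_single: "ell2_map T *\<^sub>V ell2_single j h = ell2_single j (T *\<^sub>V h)"
  by (rule ell2_ext) (simp add: ell2_nth_map ell2_nth_single bop_simps)

lemma ell2_map_star: "ell2_map (star T) = star (ell2_map T)"
proof (rule bop_eq_total[OF ell2_single_total])
  fix x :: "'a ell2" assume "x \<in> {ell2_single j h | j h. True}"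
  then obtain j h where x: "x = ell2_single j h" by blast
  show "ell2_map (star T) *\<^sub>V x = star (ell2_map T) *\<^sub>V x"
  proof (rule cinner_ext)
    fix z :: "'a ell2"
    have "cinner (star T *\<^sub>V h) (ell2_nth z j) = cinner h (T *\<^sub>V ell2_nth z j)" by (rule cinner_star_bop)
    then have "cinner (ell2_map (star T) *\<^sub>V x) z = cinner x (ell2_map T *\<^sub>V z)"
      by (simp add: x ell2_map_single cinner_ell2_single ell2_nth_map)
    then show "cinner z (ell2_map (star T) *\<^sub>V x) = cinner z (star (ell2_map T) *\<^sub>V x)"
      by (metis cinner_commute cinner_star_bop)
  qed
qed

lemma star_subalgebra_ell2:
  assumes A: "star_subalgebra A"
  shows "star_subalgebra (ell2_map ` A)"
  unfolding star_subalgebra_def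
proof (intro conjI ballI)
  note A' = A[unfolded star_subalgebra_def]
  show "csubspace (ell2_map ` A)"
    unfolding complex_vector.subspace_def
  proof (intro conjI allI ballI impI)
    show "0 \<in> ell2_map ` A" by (rule image_eqI[of _ _ 0]) (use A' in \<open>simp_all add: ell2_map_simps complex_vector.subspace_0\<close>)
    show "u + v \<in> ell2_map ` A" if "u \<in> ell2_map ` A" "v \<in> ell2_map ` A" for u v
      using that A' by (auto simp flip: ell2_map_simps simp: complex_vector.subspace_add)
    show "c *\<^sub>C u \<in> ell2_map ` A" if "u \<in> ell2_map ` A" for c u
      using that A' by (auto simp flip: ell2_map_simps simp: complex_vector.subspace_scale)
  qed
  show "1 \<in> ell2_map ` A" by (rule image_eqI[of _ _ 1]) (use A' in \<open>simp_all add: ell2_map_simps\<close>)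
  show "u * v \<in> ell2_map ` A" if "u \<in> ell2_map ` A" "v \<in> ell2_map ` A" for u v
    using that A' by (auto simp flip: ell2_map_simps)
  show "star u \<in> ell2_map ` A" if "u \<in> ell2_map ` A" for u
    using that A' by (auto simp flip: ell2_map_star)
qed

text \<open>The matrix entries of an operator commuting with \<open>ell2_map ` A\<close> commute with \<open>A\<close>.\<close>

lemma bicommutant_ell2:
  assumes T: "T \<in> bicommutant A"
  shows "ell2_map T \<in> bicommutant (ell2_map ` A)"
proof (rule bicommutantI)
  fix z assume z: "\<And>a. a \<in> ell2_map ` A \<Longrightarrow> z * a = a * z"
  define e where "e i j = Bop (\<lambda>h. ell2_nth (z *\<^sub>V ell2_single j h) i)" for i j
  have lin: "bounded_clinear (\<lambda>h. ell2_nth (z *\<^sub>V ell2_single j h) i)" for i j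
  proof (rule bounded_clinearI[where K = "norm z * onorm (ell2_single j :: 'a \<Rightarrow> _)"])
    show "norm (ell2_nth (z *\<^sub>V ell2_single j h) i) \<le> norm z * onorm (ell2_single j :: 'a \<Rightarrow> _) * norm h" for h
      using norm_ell2_nth_le[of "z *\<^sub>V ell2_single j h" i] norm_bop_apply[of z "ell2_single j h"]
        mult_left_mono[OF bounded_clinearD(7)[OF bounded_clinear_ell2_single, of j h] norm_ge_zero[of z]]
      by (simp add: mult.assoc)
  qed (simp_all add: bounded_clinearD(2,3)[OF bounded_clinear_ell2_single] bop_simps ell2_nth_simps)
  have e: "e i j *\<^sub>V h = ell2_nth (z *\<^sub>V ell2_single j h) i" for i j h
    by (simp add: e_def Bop_apply lin)
  have comm: "e i j * a = a * e i j" if a: "z * ell2_map a = ell2_map a * z" for i j a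
  proof (rule bop_ext)
    fix h
    have "z *\<^sub>V ell2_single j (a *\<^sub>V h) = ell2_map a *\<^sub>V z *\<^sub>V ell2_single j h"
      using a by (metis bop_apply_simps(6) ell2_map_single)
    then show "(e i j * a) *\<^sub>V h = (a * e i j) *\<^sub>V h" by (simp add: bop_apply_simps e ell2_nth_map)
  qed
  have eT: "e i j * T = T * e i j" for i j
    by (rule bicommutantD[OF T], rule comm, rule z) blast
  show "z * ell2_map T = ell2_map T * z"
  proof (rule bop_eq_total[OF ell2_single_total])
    fix x :: "'a ell2" assume "x \<in> {ell2_single j h | j h. True}"
    then obtain j h where x: "x = ell2_single j h" by blast
    have "ell2_nth (z *\<^sub>V ell2_single j (T *\<^sub>V h)) i = T *\<^sub>V ell2_nth (z *\<^sub>V ell2_single j h) i" for i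
      using eT[of i j] by (metis bop_apply_simps(6) e)
    then show "(z * ell2_map T) *\<^sub>V x = (ell2_map T * z) *\<^sub>V x"
      by (intro ell2_ext) (simp add: x bop_apply_simps ell2_map_single ell2_nth_map)
  qed
qed

text \<open>
  If \<open>k\<close> is orthogonal, in the real inner product, to \<open>a x\<close> for all selfadjoint \<open>a \<in> A\<close>, then
  \<open>\<langle>k, a x\<rangle> + \<langle>x, a k\<rangle>\<close> vanishes for these \<open>a\<close>, hence for all \<open>a \<in> A\<close>, hence for \<open>a = T\<close>.
\<close>

lemma bicommutant_dense_selfadjoint:
  fixes A :: "'a::chilbert_space bop set"
  assumes A: "star_subalgebra A" and T: "T \<in> bicommutant A" "star T = T" and e: "e > 0"
  obtains a where "a \<in> A" "star a = a" "norm (a *\<^sub>V x - T *\<^sub>V x) < e"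
proof -
  define R where "R = {a *\<^sub>V x | a. a \<in> A \<and> star a = a}"
  have A': "csubspace A" "\<And>a b. a \<in> A \<Longrightarrow> b \<in> A \<Longrightarrow> a + b \<in> A" "\<And>a c. a \<in> A \<Longrightarrow> c *\<^sub>C a \<in> A" "\<And>a. a \<in> A \<Longrightarrow> star a \<in> A"
      "\<And>a b. a \<in> A \<Longrightarrow> b \<in> A \<Longrightarrow> a - b \<in> A"
    using A by (auto simp: star_subalgebra_def complex_vector.subspace_add complex_vector.subspace_scale complex_vector.subspace_diff)
  have "subspace R"
    unfolding subspace_def
  proof (intro conjI allI ballI)
    show "0 \<in> R" unfolding R_def
      by (rule CollectI, rule exI[of _ 0]) (simp add: bop_apply_simps complex_vector.subspace_0 A')
    show "u + v \<in> R" if uv: "u \<in> R" "v \<in> R" for u v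
    proof -
      from uv obtain a b where "a \<in> A" "star a = a" "u = a *\<^sub>V x" "b \<in> A" "star b = b" "v = b *\<^sub>V x"
        unfolding R_def by blast
      then show ?thesis unfolding R_def
        by (intro CollectI exI[of _ "a + b"]) (simp add: bop_apply_simps A' star_add)
    qed
    show "r *\<^sub>R u \<in> R" if u: "u \<in> R" for r u
    proof -
      from u obtain a where "a \<in> A" "star a = a" "u = a *\<^sub>V x" unfolding R_def by blast
      then show ?thesis unfolding R_def
        by (intro CollectI exI[of _ "r *\<^sub>R a"]) (simp add: scaleR_scaleC scaleC_bop_apply A' star_scaleC)
    qed
  qed
  then have R: "subspace (closure R)" "closed (closure R)" by (simp_all add: subspace_closure_real)
  have bil: "bounded_bilinear (\<lambda>u v :: 'a. Re (cinner u v))"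
  proof
    show "\<exists>K. \<forall>a b::'a. norm (Re (cinner a b)) \<le> norm a * norm b * K"
    proof (intro exI allI)
      show "norm (Re (cinner a b)) \<le> norm a * norm b * 1" for a b :: 'a
        using order_trans[OF abs_Re_le_cmod norm_cinner_le[of a b]] by simp
    qed
  qed (auto simp: cinner_add_left cinner_add_right scaleR_scaleC cinner_scaleC_left cinner_scaleC_right)
  have sym: "Re (cinner u v) = Re (cinner v u)" for u v :: 'a
    using cinner_commute[of u v] by simp
  have "\<exists>v\<in>closure R. \<forall>w\<in>closure R. Re (cinner w (T *\<^sub>V x - v)) = 0"
    by (rule projection_bilinear_form[OF bil sym _ _ R, of 1]) (simp_all add: Re_cinner_self)
  then obtain v where v: "v \<in> closure R" "\<And>w. w \<in> closure R \<Longrightarrow> Re (cinner w (T *\<^sub>V x - v)) = 0" by blast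
  define k where "k = T *\<^sub>V x - v"
  define \<kappa> where "\<kappa> a = cinner k (a *\<^sub>V x) + cinner x (a *\<^sub>V k)" for a
  have \<kappa>sa: "\<kappa> a = of_real (2 * Re (cinner k (a *\<^sub>V x)))" if "star a = a" for a
  proof -
    have "cinner x (a *\<^sub>V k) = cnj (cinner k (a *\<^sub>V x))"
      using cinner_star_bop[of a x k] that cinner_commute[of "a *\<^sub>V x" k] by simp
    then show ?thesis by (simp add: \<kappa>_def complex_add_cnj)
  qed
  have \<kappa>0: "\<kappa> a = 0" if "a \<in> A" "star a = a" for a
  proof -
    have "a *\<^sub>V x \<in> closure R" using that closure_subset[of R] unfolding R_def by blast
    then have "Re (cinner (a *\<^sub>V x) k) = 0" using v(2) k_def by blast
    then show ?thesis using \<kappa>sa[OF that(2)] sym[of k "a *\<^sub>V x"] by simp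
  qed
  have \<kappa>lin: "\<kappa> (a + b) = \<kappa> a + \<kappa> b" "\<kappa> (c *\<^sub>C a) = c * \<kappa> a" for a b c
    by (simp_all add: \<kappa>_def bop_apply_simps scaleC_bop_apply cinner_add_right cinner_scaleC_right algebra_simps)
  have \<kappa>A: "\<kappa> a = 0" if a: "a \<in> A" for a
  proof -
    define b where "b = (1/2) *\<^sub>C (a + star a)"
    define d where "d = (- \<i> / 2) *\<^sub>C (a - star a)"
    have "b \<in> A" "star b = b" "d \<in> A" "star d = d"
      using a A' by (simp_all add: b_def d_def star_scaleC star_add star_diff star_minus star_star add.commute
          complex_vector.scale_right_diff_distrib)
    moreover have "a = b + \<i> *\<^sub>C d"
    proof -
      have "b + \<i> *\<^sub>C d = (1/2) *\<^sub>C ((a + star a) + (a - star a))"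
        unfolding b_def d_def scaleC_add_right[of "1/2" "a + star a"] by (simp add: scaleC_scaleC)
      also have "\<dots> = (1/2) *\<^sub>C (a + a)" by simp
      also have "\<dots> = a" by (simp add: scaleC_add_right scaleC_one flip: scaleC_add_left)
      finally show ?thesis ..
    qed
    ultimately show ?thesis using \<kappa>lin \<kappa>0 by simp
  qed
  \<comment> \<open>Both terms of \<open>\<kappa>\<close> are collected into one matrix coefficient
    of the amplified operator. A vanishing coefficient survives in the closure, whence
    \<open>\<kappa> T = 0\<close> follows from density at the single vector
    \<open>y\<close>.\<close>
  define y where "y = ell2_single 0 x + ell2_single 1 k"
  define z where "z = ell2_single 0 k + ell2_single 1 x"
  have zy: "cinner z (ell2_map a *\<^sub>V y) = \<kappa> a" for a
    by (simp add: z_def y_def \<kappa>_def bop_simps ell2_map_single cinner_add_left cinner_add_right cinner_ell2_single ell2_nth_single)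
  have "ell2_map T *\<^sub>V y \<in> closure ((\<lambda>a. a *\<^sub>V y) ` ell2_map ` A)"
    by (rule bicommutant_dense_vector[OF star_subalgebra_ell2[OF A] bicommutant_ell2[OF T(1)]])
  also have "closure ((\<lambda>a. a *\<^sub>V y) ` ell2_map ` A) \<subseteq> {u. cinner z u = 0}"
    by (rule closure_minimal[OF _ closed_cinner_zero]) (auto simp: zy \<kappa>A)
  finally have "\<kappa> T = 0" by (simp add: zy)
  then have "Re (cinner k (T *\<^sub>V x)) = 0" using \<kappa>sa[OF T(2)] by simp
  moreover have "Re (cinner k v) = 0" using v(2)[OF v(1)] sym[of k v] by (simp add: k_def)
  moreover have "cinner k k = cinner k (T *\<^sub>V x) - cinner k v" by (subst (2) k_def) (rule cinner_diff_right)
  ultimately have "Re (cinner k k) = 0" by simp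
  then have "k = 0" by (simp add: Re_cinner_self)
  then have "T *\<^sub>V x \<in> closure R" using v(1) by (simp add: k_def)
  then obtain w where "w \<in> R" "dist w (T *\<^sub>V x) < e" using closure_approachable e by blast
  then show ?thesis using that unfolding R_def dist_norm by blast
qed

text \<open>The finitely many vectors are the coordinates of one vector of the amplification.
  Selfadjointness descends because \<open>ell2_map\<close> is injective, as the coordinate 0
  shows.\<close>

lemma bicommutant_dense_selfadjoint_finite:
  fixes A :: "'a::chilbert_space bop set"
  assumes A: "star_subalgebra A" and T: "T \<in> bicommutant A" "star T = T" and e: "e > 0" and W: "finite W"
  obtains a where "a \<in> A" "star a = a" "\<And>w. w \<in> W \<Longrightarrow> norm (a *\<^sub>V w - T *\<^sub>V w) < e"
proof -
  obtain ws where ws: "set ws = W" using finite_list[OF W] by blast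
  have "summable (\<lambda>n. (norm (if n < length ws then ws ! n else 0))\<^sup>2)"
    by (rule summable_finite[of "{..<length ws}"]) auto
  then have nth: "ell2_nth (Ell2 (\<lambda>n. if n < length ws then ws ! n else 0)) n = (if n < length ws then ws ! n else 0)" for n
    by (simp add: Ell2_inverse)
  define x where "x = Ell2 (\<lambda>n. if n < length ws then ws ! n else 0)"
  have sT: "star (ell2_map T) = ell2_map T" by (simp add: T flip: ell2_map_star)
  obtain b where b: "b \<in> ell2_map ` A" "star b = b" "norm (b *\<^sub>V x - ell2_map T *\<^sub>V x) < e"
    using bicommutant_dense_selfadjoint[OF star_subalgebra_ell2[OF A] bicommutant_ell2[OF T(1)] sT e] .
  then obtain a where a: "a \<in> A" "b = ell2_map a" by blast
  have "star a = a"
  proof (rule bop_ext)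
    fix h
    have "ell2_map (star a) *\<^sub>V ell2_single 0 h = ell2_map a *\<^sub>V ell2_single 0 h" using b(2) by (simp add: a(2) ell2_map_star)
    then have "ell2_single 0 (star a *\<^sub>V h) = ell2_single 0 (a *\<^sub>V h)" by (simp add: ell2_map_single)
    then have "ell2_nth (ell2_single 0 (star a *\<^sub>V h)) 0 = ell2_nth (ell2_single 0 (a *\<^sub>V h)) 0" by simp
    then show "star a *\<^sub>V h = a *\<^sub>V h" by (simp add: ell2_nth_single)
  qed
  moreover have "norm (a *\<^sub>V w - T *\<^sub>V w) < e" if "w \<in> W" for w
  proof -
    from that obtain n where n: "n < length ws" "ws ! n = w" using ws by (metis in_set_conv_nth)
    have "norm (ell2_nth (b *\<^sub>V x - ell2_map T *\<^sub>V x) n) \<le> norm (b *\<^sub>V x - ell2_map T *\<^sub>V x)" by (rule norm_ell2_nth_le)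
    then show ?thesis using b(3) n nth[of n] by (simp add: a(2) ell2_nth_simps ell2_nth_map x_def)
  qed
  ultimately show ?thesis using that a(1) by blast
qed

section \<open>Weak topologies and preduals\<close>

lemma openin_weak_topology_basis:
  assumes "openin (weak_topology \<Phi>) U" "x \<in> U"
  shows "\<exists>G e. finite G \<and> G \<subseteq> \<Phi> \<and> e > 0 \<and> {y. \<forall>g\<in>G. cmod (g y - g x) < e} \<subseteq> U"
proof -
  have "generate_topology_on {f -` U | f U. f \<in> \<Phi> \<and> open U} U"
    using assms(1) unfolding weak_topology_def by (rule openin_topology_generated_by)
  then show ?thesis using assms(2)
  proof (induction rule: generate_topology_on.induct)
    case (Int a b)
    have xa: "x \<in> a" "x \<in> b" using Int.prems by auto
    from Int.IH(1)[OF xa(1)] obtain G e where h: "finite G" "G \<subseteq> \<Phi>" "e > 0" "{y. \<forall>g\<in>G. cmod (g y - g x) < e} \<subseteq> a"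
      by blast
    from Int.IH(2)[OF xa(2)] obtain G' e' where h': "finite G'" "G' \<subseteq> \<Phi>" "e' > 0" "{y. \<forall>g\<in>G'. cmod (g y - g x) < e'} \<subseteq> b"
      by blast
    note h = h h'
    have "{y. \<forall>g\<in>G \<union> G'. cmod (g y - g x) < min e e'} \<subseteq> a \<inter> b"
    proof
      fix y assume "y \<in> {y. \<forall>g\<in>G \<union> G'. cmod (g y - g x) < min e e'}"
      then have "\<forall>g\<in>G. cmod (g y - g x) < e" "\<forall>g\<in>G'. cmod (g y - g x) < e'" by auto
      then show "y \<in> a \<inter> b" using h(4,8) by blast
    qed
    then show ?case using h by (intro exI[of _ "G \<union> G'"] exI[of _ "min e e'"]) auto
  next
    case (UN K)
    then obtain k where "k \<in> K" "x \<in> k" by blast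
    then show ?case using UN.IH[of k] by blast
  next
    case (Basis s)
    then obtain f V where s: "s = f -` V" "f \<in> \<Phi>" "open V" by blast
    then obtain e where "e > 0" "\<And>z. dist z (f x) < e \<Longrightarrow> z \<in> V" using Basis.prems by (auto simp: open_dist)
    then show ?case using s by (intro exI[of _ "{f}"] exI[of _ e]) (auto simp: dist_norm)
  qed simp
qed

lemma topspace_weak_topology: "\<Phi> \<noteq> {} \<Longrightarrow> topspace (weak_topology \<Phi>) = UNIV"
  unfolding weak_topology_def topology_generated_by_topspace by blast

lemma continuous_map_weak_topology:
  assumes "g \<in> \<Phi>"
  shows "continuous_map (weak_topology \<Phi>) euclidean g"
proof -
  have "openin (weak_topology \<Phi>) (g -` U)" if "open U" for U
    unfolding weak_topology_def by (rule topology_generated_by_Basis) (use that assms in blast)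
  moreover have "topspace (weak_topology \<Phi>) = UNIV" using assms topspace_weak_topology[of \<Phi>] by blast
  ultimately show ?thesis by (simp add: continuous_map_def vimage_def)
qed

lemma limitin_weak_topology:
  assumes "\<Phi> \<noteq> {}" "\<And>g. g \<in> \<Phi> \<Longrightarrow> ((\<lambda>i. g (f i)) \<longlongrightarrow> g l) F"
  shows "limitin (weak_topology \<Phi>) f l F"
  unfolding limitin_def
proof (intro conjI allI impI)
  show "l \<in> topspace (weak_topology \<Phi>)" using topspace_weak_topology[OF assms(1)] by simp
  fix U assume "openin (weak_topology \<Phi>) U \<and> l \<in> U"
  then obtain G e where G: "finite G" "G \<subseteq> \<Phi>" "e > 0" "{y. \<forall>g\<in>G. cmod (g y - g l) < e} \<subseteq> U"
    using openin_weak_topology_basis[of \<Phi> U l] by blast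
  have "\<forall>\<^sub>F i in F. \<forall>g\<in>G. cmod (g (f i) - g l) < e"
    using G(1)
  proof (rule eventually_ball_finite, intro ballI)
    fix g assume "g \<in> G"
    then have "((\<lambda>i. g (f i)) \<longlongrightarrow> g l) F" using G(2) assms(2) by blast
    from tendstoD[OF this G(3)] show "\<forall>\<^sub>F i in F. cmod (g (f i) - g l) < e" by (simp add: dist_norm)
  qed
  then show "\<forall>\<^sub>F i in F. f i \<in> U" by eventually_elim (use G(4) in blast)
qed

section \<open>The predual: weak* continuity and weak* compactness\<close>

context wstar_algebra
begin

lemma predual_linear:
  assumes "f \<in> P"
  shows "f (a + b) = f a + f b" "f (c *\<^sub>C a) = c * f a" "cmod (f a) \<le> onorm f * norm a" "onorm f \<ge> 0"
proof -
  note f = predual_bounded[OF assms]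
  show "f (a + b) = f a + f b" "f (c *\<^sub>C a) = c * f a" "cmod (f a) \<le> onorm f * norm a" "onorm f \<ge> 0"
    using bounded_clinearD(2,3,7)[OF f] onorm_pos_le[OF bounded_clinearD(1)[OF f]] by (auto simp: scaleC_complex_def)
qed

lemma predual_separates:
  assumes "\<And>f. f \<in> P \<Longrightarrow> f a = f b"
  shows "a = b"
proof -
  have "f (a - b) = 0" if "f \<in> P" for f
    using bounded_clinearD(5)[OF predual_bounded[OF that]] assms[OF that] by simp
  then have "norm (a - b) = (SUP f\<in>{f \<in> P. onorm f \<le> 1}. 0)"
    unfolding evaluation_isometric by (intro SUP_cong) auto
  also have "\<dots> = 0"
  proof -
    have "(\<lambda>_. 0) \<in> {f \<in> P. onorm f \<le> 1}" using predual_zero by (simp add: onorm_zero)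
    then have "{f \<in> P. onorm f \<le> 1} \<noteq> {}" by blast
    then show ?thesis by simp
  qed
  finally show ?thesis by simp
qed

lemma norm_le_predual:
  assumes "\<And>f. f \<in> P \<Longrightarrow> onorm f \<le> 1 \<Longrightarrow> cmod (f a) \<le> r"
  shows "norm a \<le> r"
proof -
  have "(\<lambda>_. 0) \<in> {f \<in> P. onorm f \<le> 1}" using predual_zero by (simp add: onorm_zero)
  then show ?thesis unfolding evaluation_isometric by (intro cSUP_least) (use assms in auto)
qed

text \<open>Such an \<open>f\<close> is a linear combination of \<open>G\<close>. In the induction,
  \<open>b\<close> is chosen with \<open>g b = 1\<close> and annihilated by the other functionals,
  so that \<open>f - f b * g\<close> falls under the hypothesis for the smaller set.\<close>

lemma predual_kernel:
  assumes "finite G" "G \<subseteq> P" and add: "\<And>a b. f (a + b) = f a + f b" and scale: "\<And>c a. f (c *\<^sub>C a) = c * f a"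
    and ker: "\<And>a. (\<And>g. g \<in> G \<Longrightarrow> g a = 0) \<Longrightarrow> f a = 0"
  shows "f \<in> P"
  using assms
proof (induction G arbitrary: f rule: finite_induct)
  case empty
  then have "f = (\<lambda>_. 0)" by auto
  then show ?case using predual_zero by simp
next
  case (insert g G)
  have gP: "g \<in> P" using insert by simp
  show ?case
  proof (cases "\<forall>a. (\<forall>h\<in>G. h a = 0) \<longrightarrow> g a = 0")
    case True
    show ?thesis
    proof (rule insert.IH[OF _ insert.prems(2,3)])
      fix a assume a: "\<And>h. h \<in> G \<Longrightarrow> h a = 0"
      then have "g a = 0" using True by blast
      then show "f a = 0" using a by (intro insert.prems(4)) auto
    qed (use insert.prems in simp)
  next
    case False
    then obtain b0 where b0: "\<And>h. h \<in> G \<Longrightarrow> h b0 = 0" "g b0 \<noteq> 0" by blast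
    define b where "b = (1 / g b0) *\<^sub>C b0"
    have b: "\<And>h. h \<in> G \<Longrightarrow> h b = 0" "g b = 1"
      using b0 insert.prems(1) gP by (auto simp: b_def predual_linear(2))
    have "(\<lambda>a. f a - f b * g a) \<in> P"
    proof (rule insert.IH)
      show "f (a + a') - f b * g (a + a') = f a - f b * g a + (f a' - f b * g a')" for a a'
        by (simp add: insert.prems(2) predual_linear[OF gP] algebra_simps)
      show "f (c *\<^sub>C a) - f b * g (c *\<^sub>C a) = c * (f a - f b * g a)" for c a
        by (simp add: insert.prems(3) predual_linear[OF gP] algebra_simps)
      fix a assume a: "\<And>h. h \<in> G \<Longrightarrow> h a = 0"
      have "f (a + (- g a) *\<^sub>C b) = 0"
      proof (rule insert.prems(4))
        fix h assume "h \<in> insert g G"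
        then have "h \<in> P" using insert.prems(1) by auto
        then have "h (a + (- g a) *\<^sub>C b) = h a + (- g a) * h b" by (simp only: predual_linear)
        then show "h (a + (- g a) *\<^sub>C b) = 0"
          using a[of h] b(1)[of h] b(2) \<open>h \<in> insert g G\<close> by (cases "h = g") simp_all
      qed
      then show "f a - f b * g a = 0" unfolding insert.prems(2,3) by (simp add: mult.commute)
    qed (use insert.prems in auto)
    from predual_add[OF this predual_scale[OF gP, of "f b"]] show ?thesis by simp
  qed
qed

text \<open>By continuity \<open>f\<close> has modulus below 1 on a basic neighbourhood of 0, which
  contains the common kernel of finitely many functionals in \<open>P\<close>. On that linear
  subspace a bounded functional has to vanish.\<close>

lemma continuous_in_predual:
  assumes cont: "continuous_map (weak_topology P) euclidean f"
    and add: "\<And>a b. f (a + b) = f a + f b" and scale: "\<And>c a. f (c *\<^sub>C a) = c * (f a :: complex)"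
  shows "f \<in> P"
proof -
  have top: "topspace (weak_topology P) = UNIV" using topspace_weak_topology predual_zero by blast
  have f0: "f 0 = 0" using scale[of 0 0] by simp
  have "openin (weak_topology P) {x \<in> topspace (weak_topology P). f x \<in> ball 0 1}"
    using cont by (rule openin_continuous_map_preimage) simp
  then have "openin (weak_topology P) {x. cmod (f x) < 1}" by (simp add: top)
  then obtain G e where G: "finite G" "G \<subseteq> P" "e > 0" "{y. \<forall>g\<in>G. cmod (g y - g 0) < e} \<subseteq> {x. cmod (f x) < 1}"
    using openin_weak_topology_basis[of P "{x. cmod (f x) < 1}" 0] f0 by auto
  show ?thesis
  proof (rule predual_kernel[OF G(1,2) add scale])
    fix a assume a: "\<And>g. g \<in> G \<Longrightarrow> g a = 0"
    show "f a = 0"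
    proof (rule ccontr)
      assume "f a \<noteq> 0"
      define b where "b = (1 / f a) *\<^sub>C a"
      have "b \<in> {y. \<forall>g\<in>G. cmod (g y - g 0) < e}"
      proof (rule CollectI, rule ballI)
        fix g assume g: "g \<in> G"
        then have "g \<in> P" using G by blast
        then have "g b - g 0 = 0" using a[OF g] predual_linear(2)[of g 0 0] by (simp add: b_def predual_linear(2))
        then show "cmod (g b - g 0) < e" using G(3) by simp
      qed
      then have "cmod (f b) < 1" using G(4) by blast
      then show False using \<open>f a \<noteq> 0\<close> by (simp add: b_def scale)
    qed
  qed
qed

text \<open>Banach--Alaoglu, by Tychonoff's theorem in the space of functions on the predual.\<close>

lemma cluster_point:
  assumes F: "F \<noteq> bot" and bd: "\<forall>\<^sub>F i in F. norm (c i) \<le> r"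
  obtains a where "norm a \<le> r" "\<And>f A. f \<in> P \<Longrightarrow> closed A \<Longrightarrow> \<forall>\<^sub>F i in F. f (c i) \<in> A \<Longrightarrow> f a \<in> A"
proof -
  \<comment> \<open>Coordinates outside \<open>P\<close> are set to 0, where the ball in the product
    shrinks to a point; so the product can run over the whole function type.\<close>
  define E where "E i f = (if f \<in> P then f (c i) else 0)" for i f
  define B where "B f = (if f \<in> P then onorm f * r else 0)" for f
  define K where "K = PiE UNIV (\<lambda>f. cball (0::complex) (B f))"
  have "compactin (product_topology (\<lambda>_::'m \<Rightarrow> complex. euclidean) UNIV) K"
    unfolding K_def compactin_PiE by simp
  then have K: "compact K" by (simp add: euclidean_product_topology)
  have EK: "\<forall>\<^sub>F i in F. E i \<in> K"
    using bd
  proof eventually_elim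
    case (elim i)
    have "cmod (E i f) \<le> B f" for f
      using predual_linear(3)[of f "c i"] predual_linear(4)[of f] mult_left_mono[OF elim, of "onorm f"]
      by (auto simp: E_def B_def intro: order_trans)
    then show ?case by (auto simp: K_def)
  qed
  have "filtermap E F \<noteq> bot" using F by (simp add: filtermap_bot_iff)
  moreover have "\<forall>\<^sub>F x in filtermap E F. x \<in> K" using EK by (simp add: eventually_filtermap)
  ultimately obtain L where L: "L \<in> K" "inf (nhds L) (filtermap E F) \<noteq> bot"
    using K unfolding compact_filter by blast
  \<comment> \<open>Every closed condition that eventually holds along the net holds at the cluster
    point. Linearity of the limit, its bound and the final claim are all conditions of this
    kind.\<close>
  have L_closed: "L \<in> C" if C: "closed C" "\<forall>\<^sub>F i in F. E i \<in> C" for C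
  proof (rule ccontr)
    assume "L \<notin> C"
    then have "\<forall>\<^sub>F x in nhds L. x \<in> - C" using C(1) by (intro eventually_nhds_in_open) (auto simp: open_Compl)
    then have "\<forall>\<^sub>F x in inf (nhds L) (filtermap E F). x \<in> - C \<and> x \<in> C"
      unfolding eventually_inf using C(2)
      by (intro exI[of _ "\<lambda>x. x \<in> - C"] exI[of _ "\<lambda>x. x \<in> C"]) (simp add: eventually_filtermap)
    then have "\<forall>\<^sub>F x in inf (nhds L) (filtermap E F). False" by (rule eventually_mono) simp
    then show False using L(2) by (simp add: eventually_False)
  qed
  have coord: "continuous_on UNIV (\<lambda>L :: ('m \<Rightarrow> complex) \<Rightarrow> complex. L f)" for f by simp
  have Ladd: "L (\<lambda>a. f a + g a) = L f + L g" if fg: "f \<in> P" "g \<in> P" for f g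
  proof -
    have "L \<in> {L. L (\<lambda>a. f a + g a) = L f + L g}"
      by (rule L_closed, rule closed_Collect_eq)
         (auto intro!: continuous_intros always_eventually simp: E_def fg predual_add coord)
    then show ?thesis by simp
  qed
  have Lscale: "L (\<lambda>a. k * f a) = k * L f" if f: "f \<in> P" for k f
  proof -
    have "L \<in> {L. L (\<lambda>a. k * f a) = k * L f}"
      by (rule L_closed, rule closed_Collect_eq)
         (auto intro!: continuous_intros always_eventually simp: E_def f predual_scale coord)
    then show ?thesis by simp
  qed
  have Lbd: "cmod (L f) \<le> r * onorm f" if "f \<in> P" for f
  proof -
    have "cmod (L f) \<le> B f" using L(1) by (auto simp: K_def PiE_def Pi_def)
    then show ?thesis using that by (simp add: B_def mult.commute)
  qed
  obtain a where a: "\<And>f. f \<in> P \<Longrightarrow> L f = f a"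
  proof -
    have "\<exists>a. \<forall>f\<in>P. L f = f a"
    proof (rule evaluation_onto)
      show "\<exists>K. \<forall>f\<in>P. cmod (L f) \<le> K * onorm f" using Lbd by blast
    qed (rule Ladd Lscale; assumption)+
    then show ?thesis using that by blast
  qed
  have r0: "r \<ge> 0"
    using eventually_happens'[OF F bd] by (meson norm_ge_zero order_trans)
  show ?thesis
  proof
    show "norm a \<le> r"
    proof (rule norm_le_predual)
      fix f assume f: "f \<in> P" "onorm f \<le> 1"
      have "cmod (f a) \<le> r * onorm f" using Lbd[OF f(1)] a[OF f(1)] by simp
      also have "\<dots> \<le> r * 1" using f(2) r0 by (rule mult_left_mono)
      finally show "cmod (f a) \<le> r" by simp
    qed
    show "f a \<in> A" if "f \<in> P" "closed A" "\<forall>\<^sub>F i in F. f (c i) \<in> A" for f A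
    proof -
      have "closed {L :: ('m \<Rightarrow> complex) \<Rightarrow> complex. L f \<in> A}"
        using closed_vimage[OF that(2) coord[of f]] by (simp add: vimage_def)
      then have "L f \<in> A" using L_closed[of "{L. L f \<in> A}"] that by (simp add: E_def)
      then show ?thesis using a[OF that(1)] by simp
    qed
  qed
qed

end

section \<open>Normal representations\<close>

text \<open>Uniqueness of inverses carries the norm bounds over to an inverse found by other means,
  namely the image under a representation of an inverse in M.\<close>

lemma bop_inverse_one_plus_square_unique:
  assumes "star A = (A :: 'a::chilbert_space bop)" "is_inverse (1 + A * A) d"
  shows "norm d \<le> 1" "norm (A * d) \<le> 1"
proof -
  obtain d' where d': "is_inverse (1 + A * A) d'" "norm d' \<le> 1" "norm (A * d') \<le> 1"
    by (rule inverse_one_plus_square[OF assms(1)])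
  have "d = d'" by (rule is_inverse_unique[OF assms(2) d'(1)])
  then show "norm d \<le> 1" "norm (A * d) \<le> 1" using d' by simp_all
qed

locale star_rep =
  fixes \<psi> :: "'m::cstar_algebra \<Rightarrow> 'g::chilbert_space bop"
  assumes psi_add: "\<psi> (a + b) = \<psi> a + \<psi> b"
    and psi_scaleC: "\<psi> (c *\<^sub>C a) = c *\<^sub>C \<psi> a"
    and psi_mult: "\<psi> (a * b) = \<psi> a * \<psi> b"
    and psi_star: "\<psi> (star a) = star (\<psi> a)"
    and psi_one: "\<psi> 1 = 1"
begin

lemma psi_zero: "\<psi> 0 = 0"
  using psi_scaleC[of 0 0] by simp

lemma psi_minus: "\<psi> (- a) = - \<psi> a"
  using psi_scaleC[of "-1" a] by (simp add: scaleC_one)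

text \<open>If \<open>\<parallel>a\<parallel> \<le> 1\<close> and \<open>1 - a\<^sup>* a = (1 - Y)\<^sup>2\<close> with \<open>Y\<close> selfadjoint, then \<open>\<parallel>h\<parallel>\<^sup>2 - \<parallel>\<psi>(a) h\<parallel>\<^sup>2 = \<parallel>\<psi>(1 - Y) h\<parallel>\<^sup>2\<close>.\<close>

lemma norm_psi_le: "norm (\<psi> a) \<le> norm a"
proof (cases "a = 0")
  case False
  define c where "c = (1 / complex_of_real (norm a)) *\<^sub>C a"
  have "norm c = 1" using False by (simp add: c_def norm_scaleC norm_divide)
  then have c: "norm (star c * c) \<le> 1" by (simp add: cstar_identity)
  obtain Y where Y: "2 *\<^sub>C Y = star c * c + Y * Y" "star Y = Y"
    using square_root_iteration[OF c] by (metis star_mult star_star)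
  have "(1 - Y) * (1 - Y) = 1 - 2 *\<^sub>C Y + Y * Y"
    using scaleC_add_left[of 1 1 Y] by (simp add: left_diff_distrib right_diff_distrib scaleC_one)
  then have "star (1 - Y) * (1 - Y) = 1 - star c * c" by (simp add: Y star_diff)
  moreover have "\<psi> (1 - star c * c) = 1 - star (\<psi> c) * \<psi> c"
    using psi_add[of 1 "- (star c * c)"] by (simp add: psi_minus psi_mult psi_star psi_one)
  ultimately have eq: "star (\<psi> (1 - Y)) * \<psi> (1 - Y) = 1 - star (\<psi> c) * \<psi> c" by (metis psi_mult psi_star)
  have "norm (\<psi> c) \<le> 1"
  proof (rule norm_bop_bound)
    fix h
    have "cinner (\<psi> (1 - Y) *\<^sub>V h) (\<psi> (1 - Y) *\<^sub>V h) = cinner h h - cinner (\<psi> c *\<^sub>V h) (\<psi> c *\<^sub>V h)"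
      using arg_cong[where f = "\<lambda>A. cinner h (A *\<^sub>V h)", OF eq]
      by (simp add: bop_apply_simps cinner_diff_right cinner_star_bop_right)
    from arg_cong[where f = Re, OF this] have "(norm (\<psi> c *\<^sub>V h))\<^sup>2 \<le> (norm h)\<^sup>2"
      using zero_le_power2[of "norm (\<psi> (1 - Y) *\<^sub>V h)"] by (simp add: Re_cinner_self del: zero_le_power2)
    then show "norm (\<psi> c *\<^sub>V h) \<le> 1 * norm h" by simp
  qed simp
  moreover have "\<psi> a = of_real (norm a) *\<^sub>C \<psi> c" using False by (simp add: c_def psi_scaleC scaleC_scaleC scaleC_one)
  ultimately show ?thesis by (simp add: norm_scaleC mult_left_le)
qed (simp add: psi_zero)

end

locale normal_star_rep = wstar_algebra P + star_rep \<psi>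
  for P :: "('m::cstar_algebra \<Rightarrow> complex) set" and \<psi> :: "'m \<Rightarrow> 'g::chilbert_space bop" +
  assumes psi_normal: "(\<lambda>a. cinner h (\<psi> a *\<^sub>V k)) \<in> P"
begin

lemma star_subalgebra_range: "star_subalgebra (range \<psi>)"
  unfolding star_subalgebra_def complex_vector.subspace_def
  by (auto simp flip: psi_add psi_scaleC psi_mult psi_star)
     (metis psi_zero rangeI, metis psi_one rangeI)

text \<open>
  Kaplansky's argument: \<open>T = f(S)\<close> for \<open>f(s) = 2s/(1 + s\<^sup>2)\<close> and \<open>S = T/(1 + sqrt (1 - T\<^sup>2))\<close>. If the
  selfadjoint \<open>\<psi> a\<close> are strongly close to \<open>S\<close>, then the \<open>\<psi> (f a)\<close> are strongly close to \<open>T\<close>, and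
  the \<open>f a\<close> are bounded, hence have a weak* cluster point.
\<close>

lemma bicommutant_selfadjoint_range:
  assumes T: "T \<in> bicommutant (range \<psi>)" "star T = T" "norm T \<le> 1"
  obtains a where "\<psi> a = T" "norm a \<le> 2"
proof -
  have "norm (T * T) \<le> 1"
    using norm_mult_ineq[of T T] mult_mono[OF T(3) T(3)] by simp
  then obtain Y where Y: "2 *\<^sub>C Y = T * T + Y * Y" "norm Y \<le> 1" "\<And>z. z * (T * T) = T * T * z \<Longrightarrow> z * Y = Y * z"
    and Ysa: "star Y = Y"
    using square_root_iteration[of "T * T"] by (metis T(2) star_mult)
  \<comment> \<open>\<open>C\<close> squares to 1 - T^2; it is the square root in the formula for
    \<open>S\<close>.\<close>
  define C where "C = 1 - Y"
  have "C * C = 1 - 2 *\<^sub>C Y + Y * Y"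
    using scaleC_add_left[of 1 1 Y] by (simp add: C_def left_diff_distrib right_diff_distrib scaleC_one)
  then have CC: "T * T = (1 - C) * (1 + C)" by (simp add: Y(1) left_diff_distrib distrib_left)
  \<comment> \<open>1 + C = 2 - Y = 2(1 - Y/2), so the Neumann series for Y/2 inverts it.\<close>
  have Ysc: "norm ((1/2) *\<^sub>C Y) < 1" using Y(2) by (simp add: norm_scaleC)
  define G where "G = (1/2) *\<^sub>C (\<Sum>n. ((1/2) *\<^sub>C Y) ^ n)"
  have "is_inverse (2 *\<^sub>C 1) ((1/2) *\<^sub>C (1 :: 'g bop))"
    by (simp add: is_inverse_def scaleC_mult_left scaleC_mult_right scaleC_scaleC scaleC_one)
  from is_inverse_mult[OF neumann[OF Ysc] this]
  have "is_inverse ((1 - (1/2) *\<^sub>C Y) * 2 *\<^sub>C 1) ((1/2) *\<^sub>C 1 * (\<Sum>n. ((1/2) *\<^sub>C Y) ^ n))" .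
  moreover have "(1 - (1/2) *\<^sub>C Y) * 2 *\<^sub>C 1 = 1 + C"
  proof -
    have h: "(1/2) *\<^sub>C Y + (1/2) *\<^sub>C Y = Y" by (simp add: scaleC_one flip: scaleC_add_left)
    have "(1 - (1/2) *\<^sub>C Y) * 2 *\<^sub>C 1 = 2 *\<^sub>C (1 - (1/2) *\<^sub>C Y)" by (simp add: scaleC_mult_right)
    also have "\<dots> = (1 - (1/2) *\<^sub>C Y) + (1 - (1/2) *\<^sub>C Y)"
      using scaleC_add_left[of 1 1 "1 - (1/2) *\<^sub>C Y"] by (simp add: scaleC_one)
    also have "\<dots> = 1 + (1 - ((1/2) *\<^sub>C Y + (1/2) *\<^sub>C Y))" by (simp only: algebra_simps)
    finally show ?thesis unfolding h C_def .
  qed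
  moreover have "(1/2) *\<^sub>C 1 * (\<Sum>n. ((1/2) *\<^sub>C Y) ^ n) = G" by (simp add: G_def scaleC_mult_left)
  ultimately have G: "is_inverse (1 + C) G" by simp
  have Gcomm: "z * G = G * z" if z: "z * T = T * z" for z
  proof (rule is_inverse_commute[OF G])
    have "z * (T * T) = T * T * z" by (metis z mult.assoc)
    then have "z * Y = Y * z" by (rule Y(3))
    then show "z * (1 + C) = (1 + C) * z" by (simp add: C_def distrib_left distrib_right left_diff_distrib right_diff_distrib)
  qed
  have Gsa: "star G = G"
    by (rule is_inverse_unique[OF _ G]) (use is_inverse_star[OF G] in \<open>simp add: C_def star_add star_diff Ysa\<close>)
  have TG: "T * G = G * T" by (rule Gcomm) simp
  define S where "S = T * G"
  have Ssa: "star S = S" by (simp add: S_def star_mult T(2) Gsa TG)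
  have Sbic: "S \<in> bicommutant (range \<psi>)"
  proof (rule bicommutantI)
    fix z assume "\<And>a. a \<in> range \<psi> \<Longrightarrow> z * a = a * z"
    then have z: "z * T = T * z" by (rule bicommutantD[OF T(1)])
    show "z * S = S * z" unfolding S_def by (metis z Gcomm[OF z] mult.assoc)
  qed
  \<comment> \<open>In scalar terms S^2 = (1 - C)/(1 + C), hence 1 + S^2 = 2/(1 + C) and T = 2S/(1 +
    S^2).\<close>
  have "S * S = T * T * G * G" unfolding S_def by (metis TG mult.assoc)
  also have "\<dots> = (1 - C) * ((1 + C) * G) * G" by (simp add: CC mult.assoc)
  also have "\<dots> = (1 - C) * G" using G by (simp add: is_inverse_def)
  finally have "1 + S * S = (1 + C) * G + (1 - C) * G" using G by (simp add: is_inverse_def)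
  also have "\<dots> = G + G" by (simp add: distrib_right left_diff_distrib)
  finally have TS: "T * (1 + S * S) = S + S" by (simp add: S_def distrib_left)
  obtain d where d: "is_inverse (1 + S * S) d" "norm d \<le> 1" "norm (S * d) \<le> 1" "star d = d"
    by (rule inverse_one_plus_square[OF Ssa])
  have Td: "T = S * d + S * d"
  proof -
    have "T = T * (1 + S * S) * d" using d(1) by (simp add: is_inverse_def mult.assoc)
    then show ?thesis unfolding TS by (simp add: distrib_right)
  qed
  have "\<exists>c. norm c \<le> 2 \<and> (\<forall>v\<in>V. norm (\<psi> c *\<^sub>V v - T *\<^sub>V v) \<le> 4 / (real n + 1))" if V: "finite V" for V and n :: nat
  proof -
    \<comment> \<open>The identity \<open>diff\<close> applies A - S only to the vectors d v and S d
      v, with bounded factors to its left; closeness at these vectors is what has to be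
      arranged.\<close>
    define W where "W = (\<lambda>v. d *\<^sub>V v) ` V \<union> (\<lambda>v. S *\<^sub>V d *\<^sub>V v) ` V"
    have W: "finite W" and e: "1 / (real n + 1) > 0" using V by (auto simp: W_def)
    obtain A where A: "A \<in> range \<psi>" "star A = A" "\<And>w. w \<in> W \<Longrightarrow> norm (A *\<^sub>V w - S *\<^sub>V w) < 1 / (real n + 1)"
      by (rule bicommutant_dense_selfadjoint_finite[OF star_subalgebra_range Sbic Ssa e W]) blast
    then obtain a0 where a0: "A = \<psi> a0" by blast
    \<comment> \<open>A selfadjoint image need not come from a selfadjoint preimage when \<psi> has
      a kernel, so the preimage is symmetrized.\<close>
    define a where "a = (1/2) *\<^sub>C (a0 + star a0)"
    have a: "star a = a" by (simp add: a_def star_scaleC star_add star_star add.commute)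
    have Aa: "A = \<psi> a"
      using A(2) scaleC_add_left[of "1/2" "1/2" A]
      by (simp add: a_def psi_scaleC psi_add psi_star a0[symmetric] scaleC_add_right scaleC_one)
    obtain da where da: "is_inverse (1 + a * a) da" "norm da \<le> 1" "norm (a * da) \<le> 1" "star da = da"
      by (rule inverse_one_plus_square[OF a])
    define D where "D = \<psi> da"
    have Dinv: "is_inverse (1 + A * A) D"
      using da(1) unfolding is_inverse_def Aa D_def
      by (simp flip: psi_mult psi_add psi_one)
    note Dn = bop_inverse_one_plus_square_unique[OF A(2) Dinv]
    have AD: "A * D = D * A"
      by (rule is_inverse_commute[OF Dinv]) (simp add: distrib_left distrib_right mult.assoc)
    \<comment> \<open>A resolvent identity: the difference of the two values of s/(1 + s^2) is
      expressed through A - S, which appears linearly.\<close>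
    have "A * D - S * d = D * (A * (1 + S * S) - (1 + A * A) * S) * d"
    proof -
      have "D * (A * (1 + S * S) - (1 + A * A) * S) * d = D * A * ((1 + S * S) * d) - (D * (1 + A * A)) * S * d"
        by (simp only: left_diff_distrib right_diff_distrib mult.assoc)
      then show ?thesis using d(1) Dinv AD by (simp add: is_inverse_def)
    qed
    also have "A * (1 + S * S) - (1 + A * A) * S = (A - S) - A * (A - S) * S"
      by (simp add: distrib_left distrib_right left_diff_distrib right_diff_distrib mult.assoc)
    finally have diff: "A * D - S * d = D * (A - S) * d - (A * D) * (A - S) * (S * d)"
      by (simp add: left_diff_distrib right_diff_distrib mult.assoc AD)
    have est: "norm ((A * D - S * d) *\<^sub>V v) \<le> 2 / (real n + 1)" if v: "v \<in> V" for v
    proof -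
      have "(A * D - S * d) *\<^sub>V v = D *\<^sub>V (A *\<^sub>V (d *\<^sub>V v) - S *\<^sub>V (d *\<^sub>V v))
          - (A * D) *\<^sub>V (A *\<^sub>V (S *\<^sub>V d *\<^sub>V v) - S *\<^sub>V (S *\<^sub>V d *\<^sub>V v))"
        unfolding diff by (simp add: bop_apply_simps)
      moreover have "norm (D *\<^sub>V (A *\<^sub>V (d *\<^sub>V v) - S *\<^sub>V (d *\<^sub>V v))) \<le> 1 * (1 / (real n + 1))"
        by (intro order_trans[OF norm_bop_apply] mult_mono Dn less_imp_le[OF A(3)]) (use v in \<open>auto simp: W_def\<close>)
      moreover have "norm ((A * D) *\<^sub>V (A *\<^sub>V (S *\<^sub>V d *\<^sub>V v) - S *\<^sub>V (S *\<^sub>V d *\<^sub>V v))) \<le> 1 * (1 / (real n + 1))"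
        by (intro order_trans[OF norm_bop_apply] mult_mono Dn less_imp_le[OF A(3)]) (use v in \<open>auto simp: W_def\<close>)
      ultimately show ?thesis
        using norm_triangle_ineq4[of "D *\<^sub>V (A *\<^sub>V (d *\<^sub>V v) - S *\<^sub>V (d *\<^sub>V v))"
            "(A * D) *\<^sub>V (A *\<^sub>V (S *\<^sub>V d *\<^sub>V v) - S *\<^sub>V (S *\<^sub>V d *\<^sub>V v))"] by simp
    qed
    show ?thesis
    proof (intro exI[of _ "a * da + a * da"] conjI ballI)
      show "norm (a * da + a * da) \<le> 2" using norm_triangle_ineq[of "a * da" "a * da"] da(3) by simp
      fix v assume v: "v \<in> V"
      have "\<psi> (a * da + a * da) - T = (A * D - S * d) + (A * D - S * d)"
        by (simp add: psi_add psi_mult Aa[symmetric] D_def[symmetric] Td)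
      then have "\<psi> (a * da + a * da) *\<^sub>V v - T *\<^sub>V v = (A * D - S * d) *\<^sub>V v + (A * D - S * d) *\<^sub>V v"
        by (metis bop_apply_simps(2,3))
      then show "norm (\<psi> (a * da + a * da) *\<^sub>V v - T *\<^sub>V v) \<le> 4 / (real n + 1)"
        using norm_triangle_ineq[of "(A * D - S * d) *\<^sub>V v" "(A * D - S * d) *\<^sub>V v"] est[OF v] by simp
    qed
  qed
  then obtain c where c: "\<And>V n. finite V \<Longrightarrow> norm (c V n) \<le> 2"
    "\<And>V n v. finite V \<Longrightarrow> v \<in> V \<Longrightarrow> norm (\<psi> (c V n) *\<^sub>V v - T *\<^sub>V v) \<le> 4 / (real n + 1)" by metis
  \<comment> \<open>The index is a finite set of test vectors together with an accuracy.\<close>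
  define F where "F = finite_subsets_at_top (UNIV :: 'g set) \<times>\<^sub>F sequentially"
  have F: "F \<noteq> bot" by (simp add: F_def prod_filter_eq_bot)
  have evV: "\<forall>\<^sub>F i in F. finite (fst i) \<and> v \<in> fst i" for v
  proof -
    have "\<forall>\<^sub>F V in finite_subsets_at_top (UNIV :: 'g set). finite V \<and> v \<in> V"
      unfolding eventually_finite_subsets_at_top by (rule exI[of _ "{v}"]) auto
    from eventually_compose_filterlim[OF this filterlim_fst] show ?thesis unfolding F_def .
  qed
  have bd: "\<forall>\<^sub>F i in F. norm (c (fst i) (snd i)) \<le> 2"
    using evV[of 0] by eventually_elim (simp add: c)
  obtain a where a: "norm a \<le> 2" "\<And>f A. f \<in> P \<Longrightarrow> closed A \<Longrightarrow> \<forall>\<^sub>F i in F. f (c (fst i) (snd i)) \<in> A \<Longrightarrow> f a \<in> A"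
    by (rule cluster_point[OF F bd]) blast
  have "cinner h (\<psi> a *\<^sub>V k) = cinner h (T *\<^sub>V k)" for h k
  proof (rule ccontr)
    assume neq: "cinner h (\<psi> a *\<^sub>V k) \<noteq> cinner h (T *\<^sub>V k)"
    define \<delta> where "\<delta> = dist (cinner h (\<psi> a *\<^sub>V k)) (cinner h (T *\<^sub>V k)) / 2"
    have \<delta>: "\<delta> > 0" using neq by (simp add: \<delta>_def)
    obtain N where N: "norm h * 4 / \<delta> < real N" using reals_Archimedean2 by blast
    have "\<forall>\<^sub>F i in F. snd i \<ge> N"
      unfolding F_def by (rule eventually_compose_filterlim[OF eventually_ge_at_top[of N] filterlim_snd])
    then have "\<forall>\<^sub>F i in F. cinner h (\<psi> (c (fst i) (snd i)) *\<^sub>V k) \<in> cball (cinner h (T *\<^sub>V k)) \<delta>"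
      using evV[of k]
    proof eventually_elim
      case (elim i)
      have "norm h * 4 < \<delta> * real N" using N \<delta> by (simp add: field_simps)
      also have "\<dots> \<le> \<delta> * (real (snd i) + 1)" using elim(1) \<delta> by (intro mult_left_mono) auto
      finally have le: "norm h * (4 / (real (snd i) + 1)) \<le> \<delta>" by (simp add: field_simps)
      have "cmod (cinner h (\<psi> (c (fst i) (snd i)) *\<^sub>V k) - cinner h (T *\<^sub>V k))
          \<le> norm h * norm (\<psi> (c (fst i) (snd i)) *\<^sub>V k - T *\<^sub>V k)"
        unfolding cinner_diff_right[symmetric] by (rule norm_cinner_le)
      also have "\<dots> \<le> norm h * (4 / (real (snd i) + 1))" using elim(2) by (intro mult_left_mono c) auto
      finally show ?case using le by (simp add: dist_norm norm_minus_commute)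
    qed
    from a(2)[OF psi_normal closed_cball this] show False
      using \<delta> by (simp add: \<delta>_def dist_commute)
  qed
  then have "\<psi> a = T" by (rule bop_eqI_cinner)
  then show ?thesis using that a(1) by blast
qed

text \<open>The double commutant theorem, in the form that the image of a W*-algebra under a normal
  unital representation is its own bicommutant. Scaling and splitting into real and imaginary parts
  reduce it to selfadjoint contractions.\<close>

theorem bicommutant_range:
  assumes T: "T \<in> bicommutant (range \<psi>)"
  obtains a where "\<psi> a = T"
proof -
  have sa: "\<exists>a. \<psi> a = S" if S: "S \<in> bicommutant (range \<psi>)" "star S = S" for S
  proof -
    define r where "r = norm S + 1"
    have r: "r > 0" "norm S \<le> r" by (auto simp: r_def add_nonneg_pos)
    define S' where "S' = of_real (1 / r) *\<^sub>C S"
    have "S' \<in> bicommutant (range \<psi>)"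
      using S(1) by (auto simp: bicommutant_def S'_def scaleC_mult_left scaleC_mult_right)
    moreover have "star S' = S'" by (simp add: S'_def star_scaleC S(2))
    moreover have "norm S' \<le> 1" using r by (simp add: S'_def norm_scaleC norm_divide)
    ultimately obtain a where "\<psi> a = S'" by (rule bicommutant_selfadjoint_range)
    then have "\<psi> (of_real r *\<^sub>C a) = S" using r by (simp add: psi_scaleC S'_def scaleC_scaleC scaleC_one)
    then show ?thesis by blast
  qed
  define T1 where "T1 = (1/2) *\<^sub>C (T + star T)"
  define T2 where "T2 = (- \<i> / 2) *\<^sub>C (T - star T)"
  have Ts: "star T \<in> bicommutant (range \<psi>)" by (rule bicommutant_star[OF star_subalgebra_range T])
  have "T1 \<in> bicommutant (range \<psi>)" "T2 \<in> bicommutant (range \<psi>)"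
    unfolding T1_def T2_def
    by (rule bicommutantI, use bicommutantD[OF T] bicommutantD[OF Ts] in
      \<open>simp add: scaleC_mult_left scaleC_mult_right distrib_left distrib_right left_diff_distrib right_diff_distrib\<close>)+
  moreover have "star T1 = T1" "star T2 = T2"
    by (simp_all add: T1_def T2_def star_scaleC star_add star_diff star_minus star_star add.commute
        complex_vector.scale_right_diff_distrib)
  ultimately obtain a b where ab: "\<psi> a = T1" "\<psi> b = T2" using sa[of T1] sa[of T2] by blast
  have "T1 + \<i> *\<^sub>C T2 = T"
  proof -
    have "T1 + \<i> *\<^sub>C T2 = (1/2) *\<^sub>C ((T + star T) + (T - star T))"
      unfolding T1_def T2_def scaleC_add_right[of "1/2" "T + star T"] by (simp add: scaleC_scaleC)
    also have "\<dots> = (1/2) *\<^sub>C (T + T)" by simp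
    also have "\<dots> = T" by (simp add: scaleC_add_right scaleC_one flip: scaleC_add_left)
    finally show ?thesis .
  qed
  then have "\<psi> (a + \<i> *\<^sub>C b) = T" by (simp add: psi_add psi_scaleC ab)
  then show ?thesis by (rule that)
qed

end

section \<open>Faithful representations: isometry and bounded weak* convergence\<close>

locale faithful_normal_star_rep = normal_star_rep +
  assumes psi_inj: "inj \<psi>"
begin

text \<open>Selfadjoint contractions in the range have preimages of norm at most 2, and by
  injectivity this bounds the given preimage, so the inverse has norm at most 2 on selfadjoint
  elements. Applied to the powers b^(2^n), the constant 2 disappears in the limit.\<close>

lemma norm_psi: "norm (\<psi> a) = norm a"
proof -
  have sa: "norm b \<le> norm (\<psi> b)" if b: "star b = b" for b
  proof -
    have two: "norm x \<le> 2 * norm (\<psi> x)" if x: "star x = x" for x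
    proof (cases "\<psi> x = 0")
      case True
      then have "x = 0" using psi_inj psi_zero by (metis injD)
      then show ?thesis by simp
    next
      case False
      define r where "r = norm (\<psi> x)"
      have r: "r > 0" using False by (simp add: r_def)
      define y where "y = of_real (1 / r) *\<^sub>C x"
      have "\<psi> y \<in> bicommutant (range \<psi>)" by (rule bicommutantI) simp
      moreover have "star (\<psi> y) = \<psi> y" by (simp add: y_def star_scaleC x flip: psi_star)
      moreover have "norm (\<psi> y) \<le> 1" using r by (simp add: y_def psi_scaleC norm_scaleC norm_divide r_def)
      ultimately obtain a where a: "\<psi> a = \<psi> y" "norm a \<le> 2" by (rule bicommutant_selfadjoint_range)
      have "a = y" using psi_inj a(1) by (rule injD)
      then have "norm x / r \<le> 2" using a(2) r by (simp add: y_def norm_scaleC norm_divide)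
      then show ?thesis using r by (simp add: r_def field_simps)
    qed
    have pw: "norm b ^ (2 ^ n) \<le> 2 * norm (\<psi> b) ^ (2 ^ n)" for n
    proof -
      have "star (b ^ k) = b ^ k" for k by (induction k) (simp_all add: star_mult b power_commutes)
      then have "norm (b ^ (2 ^ n)) \<le> 2 * norm (\<psi> (b ^ (2 ^ n)))" by (rule two)
      also have "\<psi> (b ^ k) = \<psi> b ^ k" for k by (induction k) (simp_all add: psi_one psi_mult)
      finally show ?thesis
        using norm_selfadjoint_power[OF b, of n] norm_power_le[of "\<psi> b" "2 ^ n"] by linarith
    qed
    show ?thesis
    proof (rule ccontr)
      assume "\<not> norm b \<le> norm (\<psi> b)"
      then have lt: "norm (\<psi> b) < norm b" by simp
      then have b0: "norm b > 0" using norm_ge_zero[of "\<psi> b"] by linarith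
      define q where "q = norm (\<psi> b) / norm b"
      have q: "0 \<le> q" "q < 1" using lt b0 by (auto simp: q_def)
      have "1 \<le> 2 * q ^ (2 ^ n)" for n
        using pw[of n] b0 by (simp add: q_def power_divide field_simps)
      moreover obtain m where m: "q ^ m < 1/2" using real_arch_pow_inv[of "1/2" q] q by auto
      moreover have "q ^ (2 ^ m) \<le> q ^ m" using q by (intro power_decreasing) (auto simp: less_imp_le less_exp)
      ultimately show False by (smt (verit) field_sum_of_halves)
    qed
  qed
  have "star (star a * a) = star a * a" by (simp add: star_mult star_star)
  from sa[OF this] have "(norm a)\<^sup>2 \<le> (norm (\<psi> a))\<^sup>2"
    by (simp add: psi_mult psi_star cstar_identity)
  then have "norm a \<le> norm (\<psi> a)" by (rule power2_le_imp_le) simp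
  then show ?thesis using norm_psi_le[of a] by simp
qed

text \<open>On bounded nets the weak operator topology determines the weak* topology: any cluster
  point has the same matrix coefficients as \<open>a\<close>, hence equals \<open>a\<close> by
  injectivity, and by compactness the net cannot stay away from it.\<close>

lemma predual_tendsto:
  assumes bd: "\<And>i. norm (c i) \<le> r" and lim: "\<And>h k. ((\<lambda>i. cinner h (\<psi> (c i) *\<^sub>V k)) \<longlongrightarrow> cinner h (\<psi> a *\<^sub>V k)) F"
    and f: "f \<in> P"
  shows "((\<lambda>i. f (c i)) \<longlongrightarrow> f a) F"
proof (rule ccontr)
  assume "\<not> ?thesis"
  then obtain U where U: "open U" "f a \<in> U" "\<not> (\<forall>\<^sub>F i in F. f (c i) \<in> U)" unfolding tendsto_def by blast
  \<comment> \<open>The subnet of indices at which \<open>f (c i)\<close> avoids \<open>U\<close>;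
    it is nontrivial since \<open>f (c i)\<close> is not eventually in \<open>U\<close>.\<close>
  define G where "G = inf F (principal {i. f (c i) \<notin> U})"
  have G: "G \<noteq> bot"
    unfolding G_def trivial_limit_def eventually_inf_principal using U(3) by (simp add: not_eventually)
  have GF: "G \<le> F" by (simp add: G_def)
  have evb: "\<forall>\<^sub>F i in G. norm (c i) \<le> r" using bd by simp
  have "\<exists>b. \<forall>f\<in>P. \<forall>A. closed A \<longrightarrow> (\<forall>\<^sub>F i in G. f (c i) \<in> A) \<longrightarrow> f b \<in> A"
    by (rule cluster_point[OF G evb]) blast
  then obtain b where b: "\<And>f A. f \<in> P \<Longrightarrow> closed A \<Longrightarrow> \<forall>\<^sub>F i in G. f (c i) \<in> A \<Longrightarrow> f b \<in> A"
    by blast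
  have "cinner h (\<psi> b *\<^sub>V k) = cinner h (\<psi> a *\<^sub>V k)" for h k
  proof (rule ccontr)
    assume neq: "cinner h (\<psi> b *\<^sub>V k) \<noteq> cinner h (\<psi> a *\<^sub>V k)"
    define \<delta> where "\<delta> = dist (cinner h (\<psi> b *\<^sub>V k)) (cinner h (\<psi> a *\<^sub>V k)) / 2"
    have \<delta>: "\<delta> > 0" using neq by (simp add: \<delta>_def)
    have "\<forall>\<^sub>F i in G. dist (cinner h (\<psi> (c i) *\<^sub>V k)) (cinner h (\<psi> a *\<^sub>V k)) < \<delta>"
      by (rule filter_leD[OF GF tendstoD[OF lim \<delta>]])
    then have "\<forall>\<^sub>F i in G. cinner h (\<psi> (c i) *\<^sub>V k) \<in> cball (cinner h (\<psi> a *\<^sub>V k)) \<delta>"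
      by eventually_elim (simp add: dist_commute less_imp_le)
    from b[OF psi_normal closed_cball this] show False using \<delta> by (simp add: \<delta>_def dist_commute)
  qed
  then have "\<psi> b = \<psi> a" by (rule bop_eqI_cinner)
  then have ba: "b = a" using psi_inj by (rule injD[rotated])
  have "\<forall>\<^sub>F i in G. f (c i) \<in> - U" unfolding G_def eventually_inf_principal by simp
  then have "f b \<in> - U" using b[OF f, of "- U"] U(1) by (simp add: closed_Compl)
  then show False using U(2) ba by simp
qed

end

section \<open>Hilbert W*-modules and induced spaces\<close>

locale faithful_representation = wstar_algebra P + normal_representation P \<pi>
  for P :: "('m::cstar_algebra \<Rightarrow> complex) set" and \<pi> :: "'m \<Rightarrow> 'h::chilbert_space \<Rightarrow> 'h" +
  assumes inj_rep: "inj \<pi>"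
begin

definition Rep :: "'m \<Rightarrow> 'h bop" where "Rep a = Bop (\<pi> a)"

lemma Rep_apply: "Rep a *\<^sub>V h = \<pi> a h"
  unfolding Rep_def by (rule Bop_apply[OF rep_bounded])

lemma rep_one: "\<pi> 1 h = h"
proof -
  have "bounded_clinear (\<lambda>h::'h. h)" by (rule bounded_clinearI[where K = 1]) auto
  then have "\<pi> 1 = (\<lambda>h. h)"
    by (rule bounded_clinear_eq_total[OF rep_nondegenerate rep_bounded]) (auto simp flip: rep_mult)
  then show ?thesis by simp
qed

lemma vector_functional_in_predual: "(\<lambda>a. cinner h (\<pi> a k)) \<in> P"
proof (rule continuous_in_predual)
  define \<Phi> where "\<Phi> = {\<lambda>T. \<Sum>n. cinner (x n) (T (y n)) | x y.
    summable (\<lambda>n::nat. (norm (x n :: 'h))\<^sup>2) \<and> summable (\<lambda>n::nat. (norm (y n :: 'h))\<^sup>2)}"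
  \<comment> \<open>Sequences supported at 0 turn the series that define the ultraweak topology into
    single vector functionals.\<close>
  define u :: "'h \<Rightarrow> nat \<Rightarrow> 'h" where "u x n = (if n = 0 then x else 0)" for x n
  have su: "summable (\<lambda>n. (norm (u x n))\<^sup>2)" for x by (rule summable_finite[of "{0}"]) (auto simp: u_def)
  have "(\<lambda>T. \<Sum>n. cinner (u h n) (T (u k n))) \<in> \<Phi>" unfolding \<Phi>_def using su by blast
  moreover have "(\<Sum>n. cinner (u h n) (T (u k n))) = cinner h (T k)" for T
    by (subst suminf_finite[of "{0}"]) (auto simp: u_def)
  ultimately have in\<Phi>: "(\<lambda>T. cinner h (T k)) \<in> \<Phi>" by simp
  have "continuous_map (weak_topology P) (weak_topology \<Phi>) \<pi>"
    using rep_normal unfolding hilbert_ultraweak_topology_def \<Phi>_def by (simp add: continuous_map_in_subtopology)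
  from continuous_map_compose[OF this continuous_map_weak_topology[OF in\<Phi>]]
  show "continuous_map (weak_topology P) euclidean (\<lambda>a. cinner h (\<pi> a k))" by (simp add: comp_def)
qed (simp_all add: rep_add rep_scaleC cinner_add_right cinner_scaleC_right)

sublocale R: faithful_normal_star_rep P Rep
proof
  show "Rep (star a) = star (Rep a)" for a
    by (rule bop_eqI_cinner) (simp add: cinner_star_bop_right Rep_apply rep_star)
  show "(\<lambda>a. cinner h (Rep a *\<^sub>V k)) \<in> P" for h k
    by (simp add: Rep_apply vector_functional_in_predual)
  show "inj Rep"
  proof (rule injI)
    fix a b assume "Rep a = Rep b"
    then have "\<pi> a = \<pi> b" by (intro ext) (metis Rep_apply)
    then show "a = b" using inj_rep by (rule injD[rotated])
  qed
qed (rule bop_ext, simp add: bop_apply_simps scaleC_bop_apply Rep_apply rep_add rep_scaleC rep_mult rep_one)+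

lemma rep_eqI: "(\<And>h k. cinner h (\<pi> a k) = cinner h (\<pi> b k)) \<Longrightarrow> a = b"
  using bop_eqI_cinner[of "Rep a" "Rep b"] R.psi_inj by (simp add: Rep_apply inj_eq)

lemma norm_rep_apply: "norm (\<pi> a h) \<le> norm a * norm h"
  using norm_bop_apply[of "Rep a" h] by (simp add: Rep_apply R.norm_psi)

definition RC :: "'h bop set" where "RC = {b. \<forall>a. b * Rep a = Rep a * b}"

lemma RC_D: "b \<in> RC \<Longrightarrow> b *\<^sub>V \<pi> a h = \<pi> a (b *\<^sub>V h)"
  unfolding RC_def by (metis (mono_tags, lifting) Rep_apply bop_apply_simps(6) mem_Collect_eq)

lemma RC_I: "(\<And>a h. b *\<^sub>V \<pi> a h = \<pi> a (b *\<^sub>V h)) \<Longrightarrow> b \<in> RC"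
  unfolding RC_def by (auto intro!: bop_ext simp: bop_apply_simps Rep_apply)

lemma RC_star: "b \<in> RC \<Longrightarrow> star b \<in> RC"
proof -
  assume b: "b \<in> RC"
  have "star b * Rep a = Rep a * star b" for a
  proof -
    have "star (b * Rep (star a)) = star (Rep (star a) * b)" using b by (simp add: RC_def)
    then show ?thesis by (simp add: star_mult star_star R.psi_star)
  qed
  then show ?thesis by (simp add: RC_def)
qed

lemma RC_mult: "b \<in> RC \<Longrightarrow> c \<in> RC \<Longrightarrow> b * c \<in> RC"
  by (rule RC_I) (simp add: bop_apply_simps RC_D)

lemma RC_add: "b \<in> RC \<Longrightarrow> c \<in> RC \<Longrightarrow> b + c \<in> RC"
  by (simp add: RC_def distrib_left distrib_right)

lemma RC_diff: "b \<in> RC \<Longrightarrow> c \<in> RC \<Longrightarrow> b - c \<in> RC"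
  by (simp add: RC_def left_diff_distrib right_diff_distrib)

lemma RC_scaleC: "b \<in> RC \<Longrightarrow> c *\<^sub>C b \<in> RC"
  by (simp add: RC_def scaleC_mult_left scaleC_mult_right)

lemma RC_one: "1 \<in> RC"
  by (simp add: RC_def)

lemma bicommutant_rep:
  assumes "\<And>z. z \<in> RC \<Longrightarrow> z * T = T * z"
  obtains a where "\<And>h. T *\<^sub>V h = \<pi> a h"
proof -
  have "T \<in> bicommutant (range Rep)"
    by (rule bicommutantI, rule assms) (auto simp: RC_def)
  then obtain a where "Rep a = T" by (rule R.bicommutant_range)
  then show ?thesis using that Rep_apply by metis
qed

end

section \<open>Operators X \<otimes> I and I \<otimes> b on the induced space\<close>

locale rep_module = faithful_representation P \<pi> + hilbert_wstar_module ip act + induced_space ip \<pi> t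
  for P :: "('m::cstar_algebra \<Rightarrow> complex) set" and \<pi> :: "'m \<Rightarrow> 'h::chilbert_space \<Rightarrow> 'h"
    and ip :: "'f::cbanach \<Rightarrow> 'f \<Rightarrow> 'm" and act :: "'f \<Rightarrow> 'm \<Rightarrow> 'f" and t :: "'f \<Rightarrow> 'h \<Rightarrow> 'k::chilbert_space"
begin

lemma ip_add_left: "ip (x + y) z = ip x z + ip y z"
  by (metis ip_add_right ip_star star_add)

lemma ip_scaleC_left: "ip (c *\<^sub>C x) z = cnj c *\<^sub>C ip x z"
  by (metis ip_scaleC_right ip_star star_scaleC)

lemma ip_act_left: "ip (act x a) z = star a * ip x z"
  by (metis ip_act_right ip_star star_mult)

text \<open>\<open>induced_space\<close> prescribes inner products only. Bilinearity of
  \<open>t\<close> and balancing over M follow by testing against the total set of elementary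
  tensors.\<close>

lemma tensor_eqI: "(\<And>y k. cinner (t y k) u = cinner (t y k) v) \<Longrightarrow> u = v"
  using total_cinner_zero[OF tensor_dense, of "u - v"] by (auto simp: cinner_diff_right)

lemma tensor_add_left: "t (x + y) h = t x h + t y h"
  by (rule tensor_eqI) (simp add: cinner_tensor cinner_add_right ip_add_right rep_add)

lemma tensor_scaleC_left: "t (c *\<^sub>C x) h = c *\<^sub>C t x h"
  by (rule tensor_eqI) (simp add: cinner_tensor cinner_scaleC_right ip_scaleC_right rep_scaleC)

lemma tensor_add_right: "t x (h + k) = t x h + t x k"
  by (rule tensor_eqI) (simp add: cinner_tensor cinner_add_right bounded_clinearD(2)[OF rep_bounded])

lemma tensor_scaleC_right: "t x (c *\<^sub>C h) = c *\<^sub>C t x h"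
  by (rule tensor_eqI) (simp add: cinner_tensor cinner_scaleC_right bounded_clinearD(3)[OF rep_bounded])

lemma tensor_act: "t (act x a) h = t x (\<pi> a h)"
  by (rule tensor_eqI) (simp add: cinner_tensor ip_act_right rep_mult)

lemma norm_ip_self: "norm (ip x x) = (norm x)\<^sup>2"
  using norm_ip[of x] by simp

lemma norm_tensor_le: "norm (t x h) \<le> norm x * norm h"
proof (rule power2_le_imp_le)
  have "(norm (t x h))\<^sup>2 = cmod (cinner h (\<pi> (ip x x) h))"
    by (simp flip: cinner_tensor add: cinner_self norm_power)
  also have "\<dots> \<le> norm h * (norm (ip x x) * norm h)"
    by (intro order_trans[OF norm_cinner_le] mult_left_mono norm_rep_apply) simp
  finally show "(norm (t x h))\<^sup>2 \<le> (norm x * norm h)\<^sup>2"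
    by (simp add: norm_ip_self power_mult_distrib power2_eq_square mult_ac)
qed simp

lemma bounded_clinear_tensor: "bounded_clinear (t x)"
  by (rule bounded_clinearI[OF tensor_add_right tensor_scaleC_right norm_tensor_le])

lemma norm_adj_tensor_le: "norm (adj (t x) u) \<le> norm x * norm u"
proof (rule norm_bound_cinner)
  show "cmod (cinner z (adj (t x) u)) \<le> norm x * norm u * norm z" for z
    using order_trans[OF norm_cinner_le mult_right_mono[OF norm_tensor_le[of x z] norm_ge_zero[of u]]]
    by (simp add: cinner_adj_right[OF bounded_clinear_tensor] mult_ac)
qed simp

lemma norm_le_rep:
  assumes "\<And>h k. cmod (cinner h (\<pi> a k)) \<le> C * norm h * norm k" "C \<ge> 0"
  shows "norm a \<le> C"
  unfolding R.norm_psi[symmetric]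
proof (rule norm_bop_bound)
  show "norm (Rep a *\<^sub>V k) \<le> C * norm k" for k
    unfolding Rep_apply by (rule norm_bound_cinner) (use assms in \<open>simp_all add: mult_ac\<close>)
qed (rule assms)

text \<open>As \<pi> is isometric, the norm of the module element \<open>x\<close> is that of the
  operator h \<mapsto> x \<otimes> h, which makes module norms computable in Hilbert spaces.\<close>

lemma norm_le_tensor:
  assumes x: "\<And>h. norm (t x h) \<le> C * norm h" and C: "C \<ge> 0"
  shows "norm x \<le> C"
proof (rule power2_le_imp_le[OF _ C])
  have "norm (ip x x) \<le> C * C"
  proof (rule norm_le_rep)
    show "cmod (cinner h (\<pi> (ip x x) k)) \<le> C * C * norm h * norm k" for h k
      unfolding cinner_tensor[symmetric]
      using order_trans[OF norm_cinner_le mult_mono[OF x[of h] x[of k]]] C by (simp add: mult_ac)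
  qed (use C in simp)
  then show "(norm x)\<^sup>2 \<le> C\<^sup>2" by (simp add: norm_ip_self power2_eq_square)
qed

lemma norm_ip_le: "norm (ip x y) \<le> norm x * norm y"
proof (rule norm_le_rep)
  show "cmod (cinner h (\<pi> (ip x y) k)) \<le> norm x * norm y * norm h * norm k" for h k
    unfolding cinner_tensor[symmetric]
    using order_trans[OF norm_cinner_le mult_mono[OF norm_tensor_le[of x h] norm_tensor_le[of y k]]]
    by (simp add: mult_ac)
qed simp

lemma ip_ext:
  assumes "\<And>z. ip z x = ip z y"
  shows "x = y"
proof -
  have "ip (x - y) (x + (-1) *\<^sub>C y) = 0"
    unfolding ip_add_right ip_scaleC_right assms by (simp add: scaleC_one)
  then have "norm (ip (x - y) (x - y)) = 0" by (simp add: scaleC_one)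
  then show ?thesis by (simp add: norm_ip_self)
qed

lemma tensor_inject: "(\<And>h. t x h = t y h) \<Longrightarrow> x = y"
  by (rule ip_ext, rule rep_eqI) (simp flip: cinner_tensor)

lemma adjointable_linear:
  assumes "T \<in> adjointable ip"
  shows "T (x + y) = T x + T y" "T (c *\<^sub>C x) = c *\<^sub>C T x" "T (act x a) = act (T x) a"
proof -
  obtain S where "\<forall>x y. ip (T x) y = ip x (S y)" using assms unfolding adjointable_def by blast
  then have S: "ip z (T x) = ip (S z) x" for x z by (metis ip_star)
  show "T (x + y) = T x + T y" by (rule ip_ext) (simp add: S ip_add_right)
  show "T (c *\<^sub>C x) = c *\<^sub>C T x" by (rule ip_ext) (simp add: S ip_scaleC_right)
  show "T (act x a) = act (T x) a" by (rule ip_ext) (simp add: S ip_act_right)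
qed

lemma bounded_linear_ip_right: "bounded_linear (ip x)"
proof (rule bounded_linear_intro[where K = "norm x"])
  show "ip x (r *\<^sub>R y) = r *\<^sub>R ip x y" for r y by (simp add: scaleR_scaleC ip_scaleC_right)
  show "norm (ip x y) \<le> norm y * norm x" for y using norm_ip_le[of x y] by (simp add: mult.commute)
qed (rule ip_add_right)

text \<open>For each \<open>x\<close> the elements \<open>ip y (T x)\<close> with \<open>y\<close>
  in the unit ball are bounded, and each of them is a bounded linear function of \<open>x\<close>
  because of the adjoint; uniform boundedness then applies.\<close>

lemma adjointable_bounded:
  assumes "T \<in> adjointable ip"
  obtains C where "C \<ge> 0" "\<And>x. norm (T x) \<le> C * norm x"
proof -
  obtain S where "\<forall>x y. ip (T x) y = ip x (S y)" using assms unfolding adjointable_def by blast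
  then have S: "ip z (T x) = ip (S z) x" for x z by (metis ip_star)
  \<comment> \<open>Functions for \<open>y\<close> outside the unit ball are replaced by 0, so that
    the family is indexed by the whole type.\<close>
  define f where "f y x = (if norm y \<le> 1 then ip y (T x) else 0)" for x y
  have "\<exists>C. \<forall>y x. norm (f y x) \<le> C * norm x"
  proof (rule uniform_boundedness)
    show "bounded_linear (f y)" for y
    proof (cases "norm y \<le> 1")
      case True
      then have "f y = ip (S y)" by (auto simp: f_def S)
      then show ?thesis using bounded_linear_ip_right by simp
    next
      case False
      then have "f y = (\<lambda>x. 0)" by (auto simp: f_def)
      then show ?thesis by simp
    qed
    show "\<exists>C. \<forall>y. norm (f y x) \<le> C" for x
    proof (intro exI allI)
      show "norm (f y x) \<le> norm (T x)" for y
        using norm_ip_le[of y "T x"] mult_right_mono[of "norm y" 1 "norm (T x)"] by (auto simp: f_def)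
    qed
  qed
  then obtain C where C: "\<And>x y. norm (f y x) \<le> C * norm x" by blast
  have "norm (T x) \<le> \<bar>C\<bar> * norm x" for x
  proof (cases "T x = 0")
    case False
    define y where "y = of_real (1 / norm (T x)) *\<^sub>C T x"
    have y: "norm y = 1" using False by (simp add: y_def norm_scaleC norm_divide)
    have "norm (f y x) = norm (T x)"
      using False y by (simp add: f_def) (simp add: y_def ip_scaleC_left norm_scaleC norm_divide norm_ip_self power2_eq_square)
    then have "norm (T x) \<le> C * norm x" using C[of y x] by simp
    also have "\<dots> \<le> \<bar>C\<bar> * norm x" by (intro mult_right_mono) auto
    finally show ?thesis .
  qed simp
  then show ?thesis using that[of "\<bar>C\<bar>"] by simp
qed

lemma formal_tensor_operator:
  assumes adj: "\<And>x y h k. cinner h (\<pi> (ip (S x) y) k) = cinner h (\<pi> (ip x (T y)) k)"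
    and growth: "\<And>x h. \<exists>K. \<forall>n. norm (t (((S \<circ> T) ^^ n) x) h) \<le> K * (r\<^sup>2) ^ n" and r: "r \<ge> 0"
  obtains W where "bounded_clinear W" "\<And>x h. W (t x h) = t (T x) h" "\<And>x. norm (W x) \<le> r * norm x"
proof -
  define g where "g = (\<lambda>(x, h). t x h)"
  define \<tau> where "\<tau> = (\<lambda>(x, h :: 'h). (T x, h))"
  define \<tau>s where "\<tau>s = (\<lambda>(x, h :: 'h). (S x, h))"
  have it: "((\<tau>s \<circ> \<tau>) ^^ n) (x, h) = (((S \<circ> T) ^^ n) x, h)" for n x h
    by (induction n) (simp_all add: \<tau>_def \<tau>s_def)
  show ?thesis
  proof (rule extend_operator_formal_adjoint[of UNIV g \<tau>s \<tau> r])
    show "cinner (g (\<tau>s i)) (g j) = cinner (g i) (g (\<tau> j))" for i j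
      by (cases i; cases j) (simp add: g_def \<tau>_def \<tau>s_def cinner_tensor adj)
    show "\<exists>K. \<forall>n. norm (g (((\<tau>s \<circ> \<tau>) ^^ n) i)) \<le> K * (r\<^sup>2) ^ n" for i
    proof -
      obtain x h where i: "i = (x, h)" by (cases i)
      show ?thesis unfolding i it using growth[of x h] by (simp add: g_def)
    qed
    fix W assume W: "bounded_clinear W" "\<And>i. i \<in> UNIV \<Longrightarrow> W (g i) = g (\<tau> i)" "\<And>x. norm (W x) \<le> r * norm x"
    have "W (t x h) = t (T x) h" for x h using W(2)[of "(x, h)"] by (simp add: g_def \<tau>_def)
    then show ?thesis using that W(1,3) by blast
  qed (use r in auto)
qed

definition amp :: "('f \<Rightarrow> 'f) \<Rightarrow> 'k bop" where "amp T = Bop (ampliation t T)"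

lemma ampliation_unique:
  assumes W: "bounded_clinear W" "\<And>x h. W (t x h) = t (T x) h"
  shows "ampliation t T = W"
  unfolding ampliation_def
proof (rule the_equality)
  show "bounded_clinear W \<and> (\<forall>x h. W (t x h) = t (T x) h)" using W by blast
  fix V assume V: "bounded_clinear V \<and> (\<forall>x h. V (t x h) = t (T x) h)"
  show "V = W" by (rule bounded_clinear_eq_total[OF tensor_dense]) (use V W in auto)
qed

lemma adjointable_ampliation:
  assumes T: "T \<in> adjointable ip"
  shows amp_tensor: "amp T *\<^sub>V t x h = t (T x) h" and ampliation_eq: "ampliation t T = (*\<^sub>V) (amp T)"
proof -
  obtain S where S: "\<And>x y. ip (T x) y = ip x (S y)" using T unfolding adjointable_def by blast
  have S': "ip (S x) y = ip x (T y)" for x y by (metis S ip_star)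
  have "S \<in> adjointable ip" unfolding adjointable_def using S' by blast
  then obtain C2 where C2: "C2 \<ge> 0" "\<And>x. norm (S x) \<le> C2 * norm x" using adjointable_bounded by blast
  obtain C1 where C1: "C1 \<ge> 0" "\<And>x. norm (T x) \<le> C1 * norm x" using adjointable_bounded[OF T] by blast
  have pow: "norm (((S \<circ> T) ^^ n) x) \<le> (C2 * C1) ^ n * norm x" for n x
  proof (induction n)
    case (Suc n)
    have "norm (((S \<circ> T) ^^ Suc n) x) \<le> C2 * norm (T (((S \<circ> T) ^^ n) x))" using C2(2) by simp
    also have "\<dots> \<le> C2 * (C1 * norm (((S \<circ> T) ^^ n) x))" by (intro mult_left_mono C1 C2)
    also have "\<dots> \<le> C2 * (C1 * ((C2 * C1) ^ n * norm x))" by (intro mult_left_mono C1 C2 Suc)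
    finally show ?case by (simp only: power_Suc mult_ac)
  qed simp
  \<comment> \<open>The constant is dictated by the growth of the powers of
    \<open>S \<circ> T\<close>, which is at most that of the powers of
    \<open>C2 * C1\<close>.\<close>
  obtain W where W: "bounded_clinear W" "\<And>x h. W (t x h) = t (T x) h"
  proof (rule formal_tensor_operator[of S T "sqrt (C2 * C1)"])
    show "\<exists>K. \<forall>n. norm (t (((S \<circ> T) ^^ n) x) h) \<le> K * ((sqrt (C2 * C1))\<^sup>2) ^ n" for x h
    proof (intro exI allI)
      fix n
      have "norm (t (((S \<circ> T) ^^ n) x) h) \<le> (C2 * C1) ^ n * norm x * norm h"
        by (intro order_trans[OF norm_tensor_le] mult_right_mono pow) simp
      then show "norm (t (((S \<circ> T) ^^ n) x) h) \<le> (norm x * norm h) * ((sqrt (C2 * C1))\<^sup>2) ^ n"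
        using C1(1) C2(1) by (simp add: mult_ac)
    qed
  qed (use C1 C2 S' that in auto)
  have aW: "ampliation t T = W" by (rule ampliation_unique[OF W])
  show "amp T *\<^sub>V t x h = t (T x) h" by (simp add: amp_def aW Bop_apply[OF W(1)] W(2))
  show "ampliation t T = (*\<^sub>V) (amp T)" by (rule ext) (simp add: amp_def aW Bop_apply[OF W(1)])
qed

lemma amp_eqI: "(\<And>x h. X *\<^sub>V t x h = Y *\<^sub>V t x h) \<Longrightarrow> X = (Y :: 'k bop)"
  by (rule bop_eq_total[OF tensor_dense]) auto

lemma adjointable_add: "S \<in> adjointable ip \<Longrightarrow> T \<in> adjointable ip \<Longrightarrow> (\<lambda>x. S x + T x) \<in> adjointable ip"
  and adjointable_scaleC: "S \<in> adjointable ip \<Longrightarrow> (\<lambda>x. c *\<^sub>C S x) \<in> adjointable ip"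
  and adjointable_comp: "S \<in> adjointable ip \<Longrightarrow> T \<in> adjointable ip \<Longrightarrow> S \<circ> T \<in> adjointable ip"
proof -
  show "(\<lambda>x. S x + T x) \<in> adjointable ip" if ST: "S \<in> adjointable ip" "T \<in> adjointable ip"
  proof -
    obtain S' T' where "\<forall>x y. ip (S x) y = ip x (S' y)" "\<forall>x y. ip (T x) y = ip x (T' y)"
      using ST unfolding adjointable_def by blast
    then show ?thesis unfolding adjointable_def
      by (intro CollectI exI[of _ "\<lambda>y. S' y + T' y"]) (simp add: ip_add_left ip_add_right)
  qed
  show "(\<lambda>x. c *\<^sub>C S x) \<in> adjointable ip" if S: "S \<in> adjointable ip"
  proof -
    obtain S' where "\<forall>x y. ip (S x) y = ip x (S' y)" using S unfolding adjointable_def by blast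
    then show ?thesis unfolding adjointable_def
      by (intro CollectI exI[of _ "\<lambda>y. cnj c *\<^sub>C S' y"]) (simp add: ip_scaleC_left ip_scaleC_right)
  qed
  show "S \<circ> T \<in> adjointable ip" if ST: "S \<in> adjointable ip" "T \<in> adjointable ip"
  proof -
    obtain S' T' where "\<forall>x y. ip (S x) y = ip x (S' y)" "\<forall>x y. ip (T x) y = ip x (T' y)"
      using ST unfolding adjointable_def by blast
    then show ?thesis unfolding adjointable_def by (intro CollectI exI[of _ "T' \<circ> S'"]) simp
  qed
qed

lemma amp_add: "S \<in> adjointable ip \<Longrightarrow> T \<in> adjointable ip \<Longrightarrow> amp (\<lambda>x. S x + T x) = amp S + amp T"
  and amp_scaleC: "S \<in> adjointable ip \<Longrightarrow> amp (\<lambda>x. c *\<^sub>C S x) = c *\<^sub>C amp S"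
  and amp_comp: "S \<in> adjointable ip \<Longrightarrow> T \<in> adjointable ip \<Longrightarrow> amp (S \<circ> T) = amp S * amp T"
  by (rule amp_eqI, simp add: amp_tensor adjointable_add adjointable_scaleC adjointable_comp bop_apply_simps
      scaleC_bop_apply tensor_add_left tensor_scaleC_left)+

text \<open>
  \<open>cB b\<close> is \<open>I \<otimes> b\<close>; as a representation of the commutant it determines the operators \<open>X \<otimes> I\<close> by commutation.
\<close>

definition cB :: "'h bop \<Rightarrow> 'k bop" where
  "cB b = Bop (SOME W. bounded_clinear W \<and> (\<forall>x h. W (t x h) = t x (b *\<^sub>V h)) \<and> (\<forall>u. norm (W u) \<le> norm b * norm u))"

lemma
  assumes b: "b \<in> RC"
  shows cB_tensor: "cB b *\<^sub>V t x h = t x (b *\<^sub>V h)" and norm_cB_le: "norm (cB b) \<le> norm b"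
proof -
  define g where "g = (\<lambda>(x, h). t x h)"
  define \<tau> where "\<tau> = (\<lambda>(x :: 'f, h). (x, b *\<^sub>V h))"
  define \<tau>s where "\<tau>s = (\<lambda>(x :: 'f, h). (x, star b *\<^sub>V h))"
  have it: "((\<tau>s \<circ> \<tau>) ^^ n) (x, h) = (x, ((star b * b) ^ n) *\<^sub>V h)" for n x h
    by (induction n) (simp_all add: \<tau>_def \<tau>s_def bop_apply_simps)
  have "\<exists>W. bounded_clinear W \<and> (\<forall>x h. W (t x h) = t x (b *\<^sub>V h)) \<and> (\<forall>u. norm (W u) \<le> norm b * norm u)"
  proof (rule extend_operator_formal_adjoint[of UNIV g \<tau>s \<tau> "norm b"])
    show "cinner (g (\<tau>s i)) (g j) = cinner (g i) (g (\<tau> j))" for i j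
      by (cases i; cases j) (simp add: g_def \<tau>_def \<tau>s_def cinner_tensor cinner_star_bop RC_D[OF b])
    show "\<exists>K. \<forall>n. norm (g (((\<tau>s \<circ> \<tau>) ^^ n) i)) \<le> K * ((norm b)\<^sup>2) ^ n" for i
    proof -
      obtain x h where i: "i = (x, h)" by (cases i)
      have "norm (t x (((star b * b) ^ n) *\<^sub>V h)) \<le> (norm x * norm h) * ((norm b)\<^sup>2) ^ n" for n
      proof -
        have "norm (t x (((star b * b) ^ n) *\<^sub>V h)) \<le> norm x * (norm ((star b * b) ^ n) * norm h)"
          by (intro order_trans[OF norm_tensor_le] mult_left_mono norm_bop_apply) simp
        also have "\<dots> \<le> norm x * (((norm b)\<^sup>2) ^ n * norm h)"
          using norm_power_le[of "star b * b" n] by (intro mult_left_mono mult_right_mono) (simp_all add: cstar_identity)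
        finally show ?thesis by (simp add: mult_ac)
      qed
      then show ?thesis unfolding i it by (auto simp: g_def)
    qed
    fix W assume W: "bounded_clinear W" "\<And>i. i \<in> UNIV \<Longrightarrow> W (g i) = g (\<tau> i)" "\<And>x. norm (W x) \<le> norm b * norm x"
    have "W (t x h) = t x (b *\<^sub>V h)" for x h using W(2)[of "(x, h)"] by (simp add: g_def \<tau>_def)
    then show ?thesis using W(1,3) by blast
  qed auto
  from someI_ex[OF this] obtain W where W: "cB b = Bop W" "bounded_clinear W" "\<And>x h. W (t x h) = t x (b *\<^sub>V h)"
      "\<And>u. norm (W u) \<le> norm b * norm u" unfolding cB_def by blast
  show "cB b *\<^sub>V t x h = t x (b *\<^sub>V h)" using W by (simp add: Bop_apply)
  show "norm (cB b) \<le> norm b" by (rule norm_bop_bound) (use W in \<open>simp_all add: Bop_apply\<close>)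
qed

lemma cB_mult: "b \<in> RC \<Longrightarrow> c \<in> RC \<Longrightarrow> cB (b * c) = cB b * cB c"
  and cB_add: "b \<in> RC \<Longrightarrow> c \<in> RC \<Longrightarrow> cB (b + c) = cB b + cB c"
  and cB_diff: "b \<in> RC \<Longrightarrow> c \<in> RC \<Longrightarrow> cB (b - c) = cB b - cB c"
  and cB_scaleC: "b \<in> RC \<Longrightarrow> cB (d *\<^sub>C b) = d *\<^sub>C cB b"
  and cB_one: "cB 1 = 1"
  by (rule amp_eqI, simp add: cB_tensor RC_mult RC_add RC_diff RC_scaleC RC_one bop_apply_simps scaleC_bop_apply
      tensor_add_right tensor_scaleC_right bounded_clinearD(5)[OF bounded_clinear_tensor])+

lemma cB_star:
  assumes b: "b \<in> RC"
  shows "cB (star b) = star (cB b)"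
proof (rule amp_eqI, rule tensor_eqI)
  fix x y h k
  have "cinner k (star b *\<^sub>V \<pi> (ip y x) h) = cinner (b *\<^sub>V k) (\<pi> (ip y x) h)" by (rule cinner_star_bop_right)
  then show "cinner (t y k) (cB (star b) *\<^sub>V t x h) = cinner (t y k) (star (cB b) *\<^sub>V t x h)"
    by (simp add: cinner_star_bop_right cB_tensor RC_star b cinner_tensor flip: RC_D[OF RC_star[OF b]])
qed

lemma amp_cB: "T \<in> adjointable ip \<Longrightarrow> b \<in> RC \<Longrightarrow> amp T * cB b = cB b * amp T"
  by (rule amp_eqI) (simp add: bop_apply_simps amp_tensor cB_tensor)

text \<open>
  Rieffel's theorem: for \<open>X\<close> in the commutant of \<open>I \<otimes> \<pi>(M)'\<close> the operators \<open>L\<^sub>\<zeta>\<^sup>* X L\<^sub>\<xi>\<close> lie in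
  \<open>\<pi>(M)'' = \<pi>(M)\<close>, and self-duality turns \<open>\<zeta> \<mapsto> (L\<^sub>\<zeta>\<^sup>* X L\<^sub>\<xi>)\<^sup>*\<close> into an element of the module.
\<close>

lemma commutant_cB_pointwise:
  assumes X: "\<And>b. b \<in> RC \<Longrightarrow> X * cB b = cB b * X"
  shows "\<exists>y. \<forall>z h k. cinner (t z h) (X *\<^sub>V t x k) = cinner h (\<pi> (ip z y) k)"
proof -
  have "\<exists>a. \<forall>h k. cinner (t z h) (X *\<^sub>V t x k) = cinner h (\<pi> a k)" for z
  proof -
    have lin: "bounded_clinear (\<lambda>k. adj (t z) (X *\<^sub>V t x k))"
    proof (rule bounded_clinearI[where K = "norm z * (norm X * norm x)"])
      show "norm (adj (t z) (X *\<^sub>V t x k)) \<le> norm z * (norm X * norm x) * norm k" for k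
      proof -
        have "norm (adj (t z) (X *\<^sub>V t x k)) \<le> norm z * (norm X * (norm x * norm k))"
          by (intro order_trans[OF norm_adj_tensor_le] mult_left_mono order_trans[OF norm_bop_apply] norm_tensor_le) auto
        then show ?thesis by (simp add: mult_ac)
      qed
    qed (simp_all add: tensor_add_right tensor_scaleC_right bop_simps
        bounded_clinearD(2,3)[OF bounded_clinear_adj[OF bounded_clinear_tensor]])
    define m where "m = Bop (\<lambda>k. adj (t z) (X *\<^sub>V t x k))"
    have m: "cinner h (m *\<^sub>V k) = cinner (t z h) (X *\<^sub>V t x k)" for h k
      by (simp add: m_def Bop_apply[OF lin] cinner_adj_right[OF bounded_clinear_tensor])
    have "b * m = m * b" if b: "b \<in> RC" for b
    proof (rule bop_eqI_cinner)
      fix h k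
      have "cinner h ((m * b) *\<^sub>V k) = cinner (t z h) (X *\<^sub>V cB b *\<^sub>V t x k)"
        by (simp add: bop_apply_simps m cB_tensor[OF b])
      also have "X *\<^sub>V cB b *\<^sub>V t x k = cB b *\<^sub>V X *\<^sub>V t x k" using X[OF b] by (metis bop_apply_simps(6))
      also have "cinner (t z h) (cB b *\<^sub>V X *\<^sub>V t x k) = cinner (cB (star b) *\<^sub>V t z h) (X *\<^sub>V t x k)"
        by (simp add: cB_star[OF b] cinner_star_bop)
      also have "\<dots> = cinner h ((b * m) *\<^sub>V k)"
        by (simp add: cB_tensor[OF RC_star[OF b]] bop_apply_simps cinner_star_bop flip: m)
      finally show "cinner h ((b * m) *\<^sub>V k) = cinner h ((m * b) *\<^sub>V k)" ..
    qed
    then obtain a where "\<And>h. m *\<^sub>V h = \<pi> a h" using bicommutant_rep[of m] by blast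
    then show ?thesis using m by metis
  qed
  then obtain a where a: "\<And>z h k. cinner (t z h) (X *\<^sub>V t x k) = cinner h (\<pi> (a z) k)" by metis
  have sa: "cinner h (\<pi> (star (a z)) k) = cinner (X *\<^sub>V t x h) (t z k)" for z h k
    using a[of z k h] cinner_commute[of "X *\<^sub>V t x h" "t z k"] rep_star[of "a z" h k] cinner_commute[of "\<pi> (a z) h" k]
    by simp
  have "\<exists>y. \<forall>z. star (a z) = ip y z"
  proof (rule self_dual)
    show "bounded_clinear (\<lambda>z. star (a z))"
    proof (rule bounded_clinearI[where K = "norm X * norm x"])
      show "star (a (z + w)) = star (a z) + star (a w)" for z w
        by (rule rep_eqI) (simp add: sa rep_add cinner_add_right tensor_add_left)
      show "star (a (c *\<^sub>C z)) = c *\<^sub>C star (a z)" for c z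
        by (rule rep_eqI) (simp add: sa rep_scaleC cinner_scaleC_right tensor_scaleC_left)
      show "norm (star (a z)) \<le> norm X * norm x * norm z" for z
        unfolding norm_star
      proof (rule norm_le_rep)
        show "cmod (cinner h (\<pi> (a z) k)) \<le> norm X * norm x * norm z * norm h * norm k" for h k
        proof -
          have "cmod (cinner (t z h) (X *\<^sub>V t x k)) \<le> (norm z * norm h) * (norm X * (norm x * norm k))"
            by (intro order_trans[OF norm_cinner_le] mult_mono norm_tensor_le order_trans[OF norm_bop_apply] mult_left_mono) auto
          then show ?thesis by (simp add: a mult_ac)
        qed
      qed simp
    qed
    show "star (a (act z c)) = star (a z) * c" for z c
      by (rule rep_eqI) (simp add: sa rep_mult tensor_act)
  qed
  then obtain y where "\<And>z. star (a z) = ip y z" by blast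
  then have "a z = ip z y" for z by (metis ip_star star_star)
  then show ?thesis using a by auto
qed

text \<open>The pointwise lemma for \<open>X\<close> gives \<open>T\<close>, and for
  \<open>star X\<close> it gives the module adjoint of \<open>T\<close>. This is how operators found
  on the Hilbert space are brought back to the module.\<close>

theorem commutant_cB:
  assumes X: "\<And>b. b \<in> RC \<Longrightarrow> X * cB b = cB b * X"
  obtains T where "T \<in> adjointable ip" "amp T = X"
proof -
  have X': "star X * cB b = cB b * star X" if b: "b \<in> RC" for b
  proof -
    have "star (X * cB (star b)) = star (cB (star b) * X)" using X[OF RC_star[OF b]] by simp
    then show ?thesis by (simp add: star_mult cB_star[OF b] star_star)
  qed
  obtain T where T: "\<And>x z h k. cinner (t z h) (X *\<^sub>V t x k) = cinner h (\<pi> (ip z (T x)) k)"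
    using commutant_cB_pointwise[OF X] by metis
  obtain S where S: "\<And>x z h k. cinner (t z h) (star X *\<^sub>V t x k) = cinner h (\<pi> (ip z (S x)) k)"
    using commutant_cB_pointwise[OF X'] by metis
  have XT: "X *\<^sub>V t x k = t (T x) k" for x k
    by (rule tensor_eqI) (simp add: T cinner_tensor)
  have "ip (T x) y = ip x (S y)" for x y
  proof (rule rep_eqI)
    fix h k
    have "cinner h (\<pi> (ip (T x) y) k) = cinner (X *\<^sub>V t x h) (t y k)" by (simp add: XT cinner_tensor)
    also have "\<dots> = cinner (t x h) (star X *\<^sub>V t y k)" by (simp add: cinner_star_bop_right)
    finally show "cinner h (\<pi> (ip (T x) y) k) = cinner h (\<pi> (ip x (S y)) k)" by (simp add: S)
  qed
  then have adj: "T \<in> adjointable ip" unfolding adjointable_def by blast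
  moreover have "amp T = X" by (rule amp_eqI) (simp add: amp_tensor[OF adj] XT)
  ultimately show ?thesis by (rule that)
qed

lemma sigma_functional_single:
  assumes "\<omega> \<in> P"
  shows "(\<lambda>z. \<omega> (ip x z)) \<in> sigma_functionals P ip"
proof -
  define w where "w n = (if n = (0::nat) then \<omega> else (\<lambda>_. 0))" for n
  have "(\<lambda>z. \<Sum>n. w n (ip x z)) \<in> sigma_functionals P ip"
    unfolding sigma_functionals_def
  proof (rule CollectI, rule exI[of _ w], rule exI[of _ "\<lambda>_. x"], intro conjI allI refl)
    show "w n \<in> P" for n using assms predual_zero by (simp add: w_def)
    show "summable (\<lambda>n. onorm (w n) * norm x)" by (rule summable_finite[of "{0}"]) (auto simp: w_def onorm_zero)
  qed
  moreover have "(\<Sum>n. w n (ip x z)) = \<omega> (ip x z)" for z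
    by (subst suminf_finite[of "{0}"]) (auto simp: w_def)
  ultimately show ?thesis by simp
qed

lemma sigma_dense_zero:
  assumes dense: "sigma_topology P ip closure_of S = UNIV" and \<omega>: "\<omega> \<in> P" and z: "\<And>y. y \<in> S \<Longrightarrow> \<omega> (ip x y) = 0"
  shows "\<omega> (ip x y) = 0"
proof -
  have "closedin (sigma_topology P ip) {y \<in> topspace (sigma_topology P ip). \<omega> (ip x y) \<in> {0}}"
    unfolding sigma_topology_def
    by (rule closedin_continuous_map_preimage[OF continuous_map_weak_topology[OF sigma_functional_single[OF \<omega>]]]) simp
  moreover have "topspace (sigma_topology P ip) = UNIV"
    unfolding sigma_topology_def using topspace_weak_topology sigma_functional_single[OF \<omega>] by blast
  ultimately have "sigma_topology P ip closure_of S \<subseteq> {y. \<omega> (ip x y) = 0}"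
    using z by (intro closure_of_minimal) auto
  then show ?thesis using dense by blast
qed

text \<open>
  The projection onto the closed span of the \<open>e \<otimes> h\<close> commutes with \<open>I \<otimes> \<pi>(M)'\<close>, so it is induced
  by an adjointable operator, which fixes all \<open>e\<close> and hence everything by \<open>\<sigma>\<close>-continuity.
\<close>

lemma sigma_dense_tensor:
  assumes dense: "sigma_topology P ip closure_of cspan D = UNIV"
  shows "closure (cspan {t e h | e h. e \<in> D}) = UNIV"
proof -
  define V where "V = closure (cspan {t e h | e h. e \<in> D})"
  have V: "csubspace V" "closed V" by (simp_all add: V_def csubspace_closure_cspan)
  have inv: "cB b *\<^sub>V u \<in> V" if b: "b \<in> RC" and u: "u \<in> V" for b u
    using u unfolding V_def
  proof (rule bop_image_closure_cspan[OF V[unfolded V_def], rotated])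
    show "cB b *\<^sub>V x \<in> closure (cspan {t e h | e h. e \<in> D})" if "x \<in> {t e h | e h. e \<in> D}" for x
      using that by (clarsimp simp: cB_tensor[OF b]) (rule closure_cspan_superset, blast)
  qed
  have "proj V * cB b = cB b * proj V" if b: "b \<in> RC" for b
    by (rule proj_commute[OF V, symmetric]) (use inv[OF b] inv[OF RC_star[OF b]] in \<open>simp_all add: cB_star[OF b]\<close>)
  then obtain T where T: "T \<in> adjointable ip" "amp T = proj V" by (rule commutant_cB)
  obtain S where S: "\<And>x y. ip (T x) y = ip x (S y)" using T(1) unfolding adjointable_def by blast
  have fix_D: "T e = e" if "e \<in> D" for e
  proof (rule tensor_inject)
    fix h
    have "t e h \<in> V" unfolding V_def by (rule closure_cspan_superset) (use that in blast)
    then have "proj V *\<^sub>V t e h = t e h" by (rule proj_eq[OF V])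
    then show "t (T e) h = t e h" using amp_tensor[OF T(1), of e h] by (simp add: T(2))
  qed
  have fix_span: "T y = y" if "y \<in> cspan D" for y
  proof -
    have "cspan D \<subseteq> {y. T y = y}"
    proof (rule complex_vector.span_minimal)
      have "T 0 = 0" using adjointable_linear(2)[OF T(1), of 0 0] by simp
      then show "csubspace {y. T y = y}"
        by (simp add: complex_vector.subspace_def adjointable_linear(1,2)[OF T(1)])
    qed (use fix_D in blast)
    then show ?thesis using that by blast
  qed
  have "T y = y" for y
  proof (rule ip_ext)
    fix z
    have "ip (S z - z) y = 0"
    proof (rule predual_separates)
      fix f assume f: "f \<in> P"
      have "f (ip (S z - z) y) = 0"
      proof (rule sigma_dense_zero[OF dense f])
        fix y assume y: "y \<in> cspan D"
        have "ip (S z) y = ip z (T y)" using S by (metis ip_star)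
        then have "ip (S z + (-1) *\<^sub>C z) y = 0"
          unfolding ip_add_left ip_scaleC_left by (simp add: fix_span[OF y] scaleC_one)
        then show "f (ip (S z - z) y) = 0" using predual_linear(2)[OF f, of 0 0] by (simp add: scaleC_one)
      qed
      then show "f (ip (S z - z) y) = f 0" using predual_linear(2)[OF f, of 0 0] by simp
    qed
    then have "ip (S z + (-1) *\<^sub>C z) y = 0" by (simp add: scaleC_one)
    then have "ip (S z) y = ip z y" unfolding ip_add_left ip_scaleC_left by (simp add: scaleC_one)
    then show "ip z (T y) = ip z y" using S by (metis ip_star)
  qed
  then have "proj V = 1" by (intro amp_eqI) (simp add: amp_tensor[OF T(1)] bop_apply_simps flip: T(2))
  then have "u \<in> V" for u using proj_mem[OF V, of u] by (simp add: bop_apply_simps)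
  then show ?thesis unfolding V_def by blast
qed

lemma adjointable_functional_single:
  assumes "\<omega> \<in> P"
  shows "(\<lambda>T. \<omega> (ip x (T y))) \<in> adjointable_functionals P ip"
proof -
  define w where "w n = (if n = (0::nat) then \<omega> else (\<lambda>_. 0))" for n
  have "(\<lambda>T. \<Sum>n. w n (ip x (T y))) \<in> adjointable_functionals P ip"
    unfolding adjointable_functionals_def
  proof (rule CollectI, rule exI[of _ w], rule exI[of _ "\<lambda>_. x"], rule exI[of _ "\<lambda>_. y"], intro conjI allI refl)
    show "w n \<in> P" for n using assms predual_zero by (simp add: w_def)
    show "summable (\<lambda>n. onorm (w n) * norm x * norm y)" by (rule summable_finite[of "{0}"]) (auto simp: w_def onorm_zero)
  qed
  moreover have "(\<Sum>n. w n (ip x (T y))) = \<omega> (ip x (T y))" for T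
    by (subst suminf_finite[of "{0}"]) (auto simp: w_def)
  ultimately show ?thesis by simp
qed

end

section \<open>The left action as a normal representation on the induced space\<close>

locale rep_correspondence = rep_module P \<pi> ip act t + wstar_correspondence P ip act \<phi>
  for P :: "('m::cstar_algebra \<Rightarrow> complex) set" and \<pi> :: "'m \<Rightarrow> 'h::chilbert_space \<Rightarrow> 'h"
    and ip :: "'f::cbanach \<Rightarrow> 'f \<Rightarrow> 'm" and act :: "'f \<Rightarrow> 'm \<Rightarrow> 'f" and t :: "'f \<Rightarrow> 'h \<Rightarrow> 'k::chilbert_space"
    and \<phi> :: "'m \<Rightarrow> 'f \<Rightarrow> 'f"
begin

lemma adjointable_left: "\<phi> a \<in> adjointable ip"
  unfolding adjointable_def using left_star by blast

text \<open>The unit acts as the identity on the range of the left action, which is \<sigma>-dense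
  by essentiality, and inner products with a fixed element are \<sigma>-continuous.\<close>

lemma left_one: "\<phi> 1 x = x"
proof (rule ip_ext)
  fix z
  have "ip (\<phi> 1 z - z) x = 0"
  proof (rule predual_separates)
    fix f assume f: "f \<in> P"
    have "f (ip (\<phi> 1 z - z) x) = 0"
    proof (rule sigma_dense_zero[OF essential f])
      fix y assume "y \<in> {\<phi> a x | a x. True}"
      then have "\<phi> 1 y = y" by (auto simp flip: left_mult)
      then have "ip (\<phi> 1 z + (-1) *\<^sub>C z) y = 0"
        unfolding ip_add_left ip_scaleC_left by (simp add: left_star scaleC_one)
      then show "f (ip (\<phi> 1 z - z) y) = 0" using predual_linear(2)[OF f, of 0 0] by (simp add: scaleC_one)
    qed
    then show "f (ip (\<phi> 1 z - z) x) = f 0" using predual_linear(2)[OF f, of 0 0] by simp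
  qed
  then have "ip (\<phi> 1 z + (-1) *\<^sub>C z) x = 0" by (simp add: scaleC_one)
  then have "ip (\<phi> 1 z) x = ip z x" unfolding ip_add_left ip_scaleC_left by (simp add: scaleC_one)
  then show "ip z (\<phi> 1 x) = ip z x" by (simp add: left_star)
qed

lemma left_functional_in_predual:
  assumes \<omega>: "\<omega> \<in> P"
  shows "(\<lambda>a. \<omega> (ip x (\<phi> a y))) \<in> P"
proof (rule continuous_in_predual)
  have "continuous_map (weak_topology P) (weak_topology (adjointable_functionals P ip)) \<phi>"
    using left_normal unfolding ultraweak_topology_def by (simp add: continuous_map_in_subtopology)
  from continuous_map_compose[OF this continuous_map_weak_topology[OF adjointable_functional_single[OF \<omega>]]]
  show "continuous_map (weak_topology P) euclidean (\<lambda>a. \<omega> (ip x (\<phi> a y)))" by (simp add: comp_def)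
qed (simp_all add: left_add left_scaleC ip_add_right ip_scaleC_right predual_linear[OF \<omega>])

definition Left :: "'m \<Rightarrow> 'k bop" where "Left a = amp (\<phi> a)"

lemma Left_tensor: "Left a *\<^sub>V t x h = t (\<phi> a x) h"
  unfolding Left_def by (rule amp_tensor[OF adjointable_left])

sublocale L: star_rep Left
proof
  show "Left (star a) = star (Left a)" for a
  proof (rule amp_eqI, rule tensor_eqI)
    fix x y h k
    have "cinner (Left a *\<^sub>V t y k) (t x h) = cinner (t y k) (Left (star a) *\<^sub>V t x h)"
      by (simp add: Left_tensor cinner_tensor left_star)
    then show "cinner (t y k) (Left (star a) *\<^sub>V t x h) = cinner (t y k) (star (Left a) *\<^sub>V t x h)"
      by (simp add: cinner_star_bop_right)
  qed
qed (rule amp_eqI, simp add: Left_tensor bop_apply_simps scaleC_bop_apply left_add left_scaleC left_mult left_one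
      tensor_add_left tensor_scaleC_left)+

lemma cmod_cinner_Left_le: "cmod (cinner x (Left a *\<^sub>V y)) \<le> norm x * norm y * norm a"
proof -
  have "cmod (cinner x (Left a *\<^sub>V y)) \<le> norm x * (norm a * norm y)"
    by (intro order_trans[OF norm_cinner_le] mult_left_mono order_trans[OF norm_bop_apply] mult_right_mono L.norm_psi_le) auto
  then show ?thesis by (simp add: mult_ac)
qed

text \<open>On elementary tensors this is normality of the left action. The general case follows in
  one variable at a time, since \<open>P\<close> is norm closed and the functionals depend
  continuously in norm on the vectors.\<close>

lemma Left_functional_in_predual: "(\<lambda>a. cinner u (Left a *\<^sub>V v)) \<in> P"
proof -
  have bcl: "bounded_clinear (\<lambda>a. cinner u (Left a *\<^sub>V v))" for u v
    by (rule bounded_clinearI[OF _ _ cmod_cinner_Left_le])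
       (simp_all add: L.psi_add L.psi_scaleC bop_apply_simps scaleC_bop_apply cinner_add_right cinner_scaleC_right scaleC_complex_def)
  have lim: "(\<lambda>a. cinner u (Left a *\<^sub>V v)) \<in> P"
    if P: "\<And>n. (\<lambda>a. cinner (un n) (Left a *\<^sub>V vn n)) \<in> P" and un: "un \<longlonglongrightarrow> u" and vn: "vn \<longlonglongrightarrow> v"
      and const: "(\<forall>n. un n = u) \<or> (\<forall>n. vn n = v)" for un vn u v
  proof (rule predual_closed[OF P bcl])
    have le: "onorm (\<lambda>a. cinner (un n) (Left a *\<^sub>V vn n) - cinner u (Left a *\<^sub>V v))
        \<le> norm (un n - u) * norm (vn n) + norm u * norm (vn n - v)" for n
    proof (rule onorm_bound)
      fix a
      have eq: "cinner (un n) (Left a *\<^sub>V vn n) - cinner u (Left a *\<^sub>V v)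
          = cinner (un n - u) (Left a *\<^sub>V vn n) + cinner u (Left a *\<^sub>V (vn n - v))"
        by (simp add: cinner_diff_left cinner_diff_right bop_simps)
      show "norm (cinner (un n) (Left a *\<^sub>V vn n) - cinner u (Left a *\<^sub>V v))
          \<le> (norm (un n - u) * norm (vn n) + norm u * norm (vn n - v)) * norm a"
        unfolding eq distrib_right by (intro order_trans[OF norm_triangle_ineq] add_mono cmod_cinner_Left_le)
    qed simp
    have "(\<lambda>n. norm (un n - u) * norm (vn n) + norm u * norm (vn n - v)) \<longlonglongrightarrow> norm (u - u) * norm v + norm u * norm (v - v)"
      by (intro tendsto_intros un vn)
    then have lim0: "(\<lambda>n. norm (un n - u) * norm (vn n) + norm u * norm (vn n - v)) \<longlonglongrightarrow> 0" by simp
    show "(\<lambda>n. onorm (\<lambda>a. cinner (un n) (Left a *\<^sub>V vn n) - cinner u (Left a *\<^sub>V v))) \<longlonglongrightarrow> 0"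
    proof (rule tendsto_sandwich[OF always_eventually always_eventually tendsto_const lim0]; intro allI)
      show "0 \<le> onorm (\<lambda>a. cinner (un n) (Left a *\<^sub>V vn n) - cinner u (Left a *\<^sub>V v))" for n
        using bcl by (intro onorm_pos_le bounded_linear_sub) (auto simp: bounded_clinear_def)
    qed (rule le)
  qed
  have closed: "closed {u. (\<lambda>a. cinner u (Left a *\<^sub>V v)) \<in> P}" for v
    unfolding closed_sequential_limits using lim[of _ "\<lambda>_. v" _ v] by auto
  have closed': "closed {v. (\<lambda>a. cinner u (Left a *\<^sub>V v)) \<in> P}" for u
    unfolding closed_sequential_limits using lim[of "\<lambda>_. u" _ u] by auto
  have sub: "csubspace {u. (\<lambda>a. cinner u (Left a *\<^sub>V v)) \<in> P}" for v
    by (auto simp: complex_vector.subspace_def cinner_add_left cinner_scaleC_left predual_add predual_scale predual_zero)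
  have sub': "csubspace {v. (\<lambda>a. cinner u (Left a *\<^sub>V v)) \<in> P}" for u
    by (auto simp: complex_vector.subspace_def bop_simps cinner_add_right cinner_scaleC_right predual_add predual_scale predual_zero)
  have "closure (cspan {t x h | x h. True}) \<subseteq> {u. (\<lambda>a. cinner u (Left a *\<^sub>V t y k)) \<in> P}" for y k
  proof (rule closure_cspan_subset[OF _ sub closed], safe)
    fix x h
    show "(\<lambda>a. cinner (t x h) (Left a *\<^sub>V t y k)) \<in> P"
      unfolding Left_tensor cinner_tensor by (rule left_functional_in_predual[OF vector_functional_in_predual])
  qed
  then have "(\<lambda>a. cinner u (Left a *\<^sub>V t y k)) \<in> P" for u y k unfolding tensor_dense by blast
  then have "closure (cspan {t x h | x h. True}) \<subseteq> {v. (\<lambda>a. cinner u (Left a *\<^sub>V v)) \<in> P}"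
    by (intro closure_cspan_subset[OF _ sub' closed']) auto
  then show ?thesis unfolding tensor_dense by blast
qed

sublocale L: normal_star_rep P Left
  by unfold_locales (rule Left_functional_in_predual)

end

section \<open>The induced Fock representation\<close>

locale rep_fock = faithful_representation P \<pi> + F: rep_correspondence P \<pi> ipF actF tF \<phi>F
    + E: rep_correspondence P \<pi> ipE actE tE \<phi> + fock_space P ipE \<phi> ipF actF \<phi>F vac ten
  for P :: "('m::cstar_algebra \<Rightarrow> complex) set" and \<pi> :: "'m \<Rightarrow> 'h::chilbert_space \<Rightarrow> 'h"
    and ipE :: "'e::cbanach \<Rightarrow> 'e \<Rightarrow> 'm" and actE :: "'e \<Rightarrow> 'm \<Rightarrow> 'e" and \<phi> :: "'m \<Rightarrow> 'e \<Rightarrow> 'e"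
    and ipF :: "'f::cbanach \<Rightarrow> 'f \<Rightarrow> 'm" and actF :: "'f \<Rightarrow> 'm \<Rightarrow> 'f" and \<phi>F :: "'m \<Rightarrow> 'f \<Rightarrow> 'f"
    and vac :: "'m \<Rightarrow> 'f" and ten :: "'e \<Rightarrow> 'f \<Rightarrow> 'f"
    and tE :: "'e \<Rightarrow> 'h \<Rightarrow> 'p::chilbert_space" and tF :: "'f \<Rightarrow> 'h \<Rightarrow> 'k::chilbert_space"
begin

abbreviation Gen :: "('f \<Rightarrow> 'f) set" where "Gen \<equiv> generated_algebra (range ten \<union> range \<phi>F)"
abbreviation Hardy :: "('f \<Rightarrow> 'f) set" where "Hardy \<equiv> hardy_algebra P ipF \<phi>F ten"

lemma ipF_eqI:
  assumes "ipF x x = ipF x y" "ipF y x = ipF y y"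
  shows "x = y"
proof -
  have "ipF (x + (-1) *\<^sub>C y) (x + (-1) *\<^sub>C y) = 0"
    unfolding F.ip_add_left F.ip_add_right F.ip_scaleC_left F.ip_scaleC_right assms by (simp add: scaleC_one)
  then have "norm (ipF (x - y) (x - y)) = 0" by (simp add: scaleC_one)
  then show ?thesis by (simp add: F.norm_ip_self)
qed

lemma ip_ten_vac: "ipF (ten \<xi> \<zeta>) (vac a) = 0"
  by (metis F.ip_star ip_vac_ten star_zero)

lemma vac_act: "vac a = actF (vac 1) a"
  by (rule ipF_eqI) (simp_all add: ip_vac_vac F.ip_act_right F.ip_act_left)

lemma ten_add_right: "ten \<xi> (\<zeta> + \<zeta>') = ten \<xi> \<zeta> + ten \<xi> \<zeta>'"
  by (rule ipF_eqI)
     (simp_all add: ip_ten_ten F.ip_add_left F.ip_add_right F.adjointable_linear(1)[OF F.adjointable_left])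

lemma ten_scaleC_right: "ten \<xi> (c *\<^sub>C \<zeta>) = c *\<^sub>C ten \<xi> \<zeta>"
  by (rule ipF_eqI)
     (simp_all add: ip_ten_ten F.ip_scaleC_left F.ip_scaleC_right F.adjointable_linear(2)[OF F.adjointable_left])

lemma ten_act: "ten \<xi> (actF \<zeta> a) = actF (ten \<xi> \<zeta>) a"
  by (rule ipF_eqI)
     (simp_all add: ip_ten_ten F.ip_act_left F.ip_act_right F.adjointable_linear(3)[OF F.adjointable_left] mult.assoc)

lemma norm_leftF_le: "norm (\<phi>F a x) \<le> norm a * norm x"
proof (rule F.norm_le_tensor)
  show "norm (tF (\<phi>F a x) h) \<le> norm a * norm x * norm h" for h
    unfolding F.Left_tensor[symmetric] mult.assoc
    by (intro order_trans[OF norm_bop_apply] mult_mono F.L.norm_psi_le F.norm_tensor_le) auto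
qed simp

lemma norm_ten_le: "norm (ten \<xi> \<zeta>) \<le> norm \<xi> * norm \<zeta>"
proof (rule power2_le_imp_le)
  have "(norm (ten \<xi> \<zeta>))\<^sup>2 = norm (ipF \<zeta> (\<phi>F (ipE \<xi> \<xi>) \<zeta>))"
    by (simp flip: F.norm_ip_self add: ip_ten_ten)
  also have "\<dots> \<le> norm \<zeta> * (norm (ipE \<xi> \<xi>) * norm \<zeta>)"
    by (intro order_trans[OF F.norm_ip_le] mult_left_mono norm_leftF_le) simp
  finally show "(norm (ten \<xi> \<zeta>))\<^sup>2 \<le> (norm \<xi> * norm \<zeta>)\<^sup>2"
    by (simp add: E.norm_ip_self power2_eq_square mult_ac)
qed simp

text \<open>The annihilation operator is not given; self-duality of the Fock module turns each
  functional \<zeta> \<mapsto> <y, \<xi> \<otimes> \<zeta>> into an inner product.\<close>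

lemma adjointable_ten: "ten \<xi> \<in> adjointable ipF"
proof -
  have "\<exists>y'. \<forall>\<zeta>. ipF y (ten \<xi> \<zeta>) = ipF y' \<zeta>" for y
  proof (rule F.self_dual)
    show "bounded_clinear (\<lambda>\<zeta>. ipF y (ten \<xi> \<zeta>))"
    proof (rule bounded_clinearI[where K = "norm y * norm \<xi>"])
      show "norm (ipF y (ten \<xi> \<zeta>)) \<le> norm y * norm \<xi> * norm \<zeta>" for \<zeta>
        using order_trans[OF F.norm_ip_le mult_left_mono[OF norm_ten_le norm_ge_zero]] by (simp add: mult.assoc)
    qed (simp_all add: ten_add_right ten_scaleC_right F.ip_add_right F.ip_scaleC_right)
  qed (simp add: ten_act F.ip_act_right)
  then obtain S where S: "\<And>y \<zeta>. ipF y (ten \<xi> \<zeta>) = ipF (S y) \<zeta>" by metis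
  have "ipF (ten \<xi> \<zeta>) y = ipF \<zeta> (S y)" for \<zeta> y by (metis S F.ip_star)
  then show ?thesis unfolding adjointable_def by blast
qed

section \<open>Creation operators and the grading\<close>

definition T :: "'e \<Rightarrow> 'k bop" where "T \<xi> = F.amp (ten \<xi>)"
definition L0 :: "'h \<Rightarrow> 'k" where "L0 h = tF (vac 1) h"
definition Tl :: "'e list \<Rightarrow> 'k bop" where "Tl xs = foldr (\<lambda>\<xi> A. T \<xi> * A) xs 1"

lemma T_tensor: "T \<xi> *\<^sub>V tF \<zeta> h = tF (ten \<xi> \<zeta>) h"
  unfolding T_def by (rule F.amp_tensor[OF adjointable_ten])

lemma T_ampliation: "ampliation tF (ten \<xi>) = (*\<^sub>V) (T \<xi>)"
  unfolding T_def by (rule F.ampliation_eq[OF adjointable_ten])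

lemma Tl_simps: "Tl [] = 1" "Tl (x # xs) = T x * Tl xs"
  by (simp_all add: Tl_def)

lemma Tl_append: "Tl (xs @ ys) = Tl xs * Tl ys"
  by (induction xs) (simp_all add: Tl_simps mult.assoc)

lemma bounded_clinear_L0: "bounded_clinear L0"
  unfolding L0_def by (rule F.bounded_clinear_tensor)

lemma cinner_L0: "cinner (L0 h) (L0 k) = cinner h k"
  by (simp add: L0_def F.cinner_tensor ip_vac_vac rep_one)

lemma adj_L0: "adj L0 (L0 h) = h"
  by (rule cinner_ext) (simp add: cinner_adj_right[OF bounded_clinear_L0] cinner_L0)

lemma tensor_vac: "tF (vac a) h = L0 (\<pi> a h)"
  unfolding L0_def vac_act[of a] by (rule F.tensor_act)

lemma Left_L0: "F.Left a *\<^sub>V L0 h = L0 (\<pi> a h)"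
  using F.Left_tensor[of a "vac 1" h] by (simp add: left_vac tensor_vac rep_one)

lemma cB_L0: "b \<in> RC \<Longrightarrow> F.cB b *\<^sub>V L0 h = L0 (b *\<^sub>V h)"
  unfolding L0_def by (rule F.cB_tensor)

lemma star_T_T: "star (T \<xi>) * T \<xi>' = F.Left (ipE \<xi> \<xi>')"
proof (rule F.amp_eqI, rule F.tensor_eqI)
  fix x y h k
  show "cinner (tF y k) ((star (T \<xi>) * T \<xi>') *\<^sub>V tF x h) = cinner (tF y k) (F.Left (ipE \<xi> \<xi>') *\<^sub>V tF x h)"
    by (simp add: bop_apply_simps cinner_star_bop_right T_tensor F.cinner_tensor ip_ten_ten F.Left_tensor)
qed

lemma Left_T: "F.Left a * T \<xi> = T (\<phi> a \<xi>)"
  by (rule F.amp_eqI) (simp add: bop_apply_simps T_tensor F.Left_tensor left_ten)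

lemma cB_T: "b \<in> RC \<Longrightarrow> F.cB b * T \<xi> = T \<xi> * F.cB b"
  unfolding T_def by (rule F.amp_cB[OF adjointable_ten, symmetric])

lemma cB_Left: "b \<in> RC \<Longrightarrow> F.cB b * F.Left a = F.Left a * F.cB b"
  unfolding F.Left_def by (rule F.amp_cB[OF F.adjointable_left, symmetric])

lemma bop_commute_apply: "A * B = B * A \<Longrightarrow> A *\<^sub>V B *\<^sub>V (u::'k) = B *\<^sub>V A *\<^sub>V u"
  by (simp flip: bop_apply_simps(6))

lemma cB_Tl: "b \<in> RC \<Longrightarrow> F.cB b * Tl xs = Tl xs * F.cB b"
proof (induction xs)
  case (Cons x xs)
  have "F.cB b * Tl (x # xs) = (F.cB b * T x) * Tl xs" by (simp only: Tl_simps mult.assoc)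
  also have "\<dots> = T x * (F.cB b * Tl xs)" by (simp only: cB_T[OF Cons.prems] mult.assoc)
  also have "\<dots> = Tl (x # xs) * F.cB b" by (simp only: Cons.IH[OF Cons.prems] Tl_simps mult.assoc)
  finally show ?case .
qed (simp add: Tl_simps)

lemma star_T_L0: "star (T \<xi>) *\<^sub>V L0 h = 0"
  by (rule F.tensor_eqI)
     (simp add: cinner_star_bop_right T_tensor L0_def F.cinner_tensor ip_ten_vac
        bounded_clinearD(4)[OF rep_bounded] R.psi_zero bop_apply_simps flip: Rep_apply)

lemma elem_tensor_tensor: "tF (elem_tensor ten vac xs a) h = Tl xs *\<^sub>V L0 (\<pi> a h)"
proof (induction xs)
  case Nil
  then show ?case by (simp add: elem_tensor_def Tl_simps bop_apply_simps tensor_vac)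
next
  case (Cons x xs)
  then show ?case by (simp add: elem_tensor_def Tl_simps bop_apply_simps flip: T_tensor)
qed

lemma Tl_total: "closure (cspan {Tl xs *\<^sub>V L0 h | xs h. True}) = UNIV"
proof -
  have "{tF e h | e h. e \<in> {elem_tensor ten vac xs a | xs a. True}} \<subseteq> {Tl xs *\<^sub>V L0 h | xs h. True}"
    by (clarsimp simp: elem_tensor_tensor) blast
  then show ?thesis
    using F.sigma_dense_tensor[OF fock_dense] closure_mono[OF complex_vector.span_mono] by blast
qed

lemma Left_Tl: "xs \<noteq> [] \<Longrightarrow> \<exists>ys. length ys = length xs \<and> F.Left a * Tl xs = Tl ys"
  by (cases xs) (auto simp: Tl_simps Left_T mult.assoc[symmetric] intro!: exI[of _ "\<phi> a _ # _"])

lemma Left_Tl_L0: "\<exists>ys k. length ys = length xs \<and> F.Left a *\<^sub>V Tl xs *\<^sub>V L0 h = Tl ys *\<^sub>V L0 k"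
proof (cases "xs = []")
  case True
  then show ?thesis by (intro exI[of _ "[]"] exI[of _ "\<pi> a h"]) (simp add: Tl_simps bop_apply_simps Left_L0)
next
  case False
  then obtain ys where "length ys = length xs" "F.Left a * Tl xs = Tl ys" using Left_Tl by blast
  then have "F.Left a *\<^sub>V Tl xs *\<^sub>V L0 h = Tl ys *\<^sub>V L0 h" by (simp flip: bop_apply_simps(6))
  then show ?thesis using \<open>length ys = length xs\<close> by blast
qed

text \<open>Letters cancel from the left: \<open>star (T x) * T y\<close> is the left action of an
  element of M, and the next letter absorbs it.\<close>

lemma star_Tl_Tl: "length xs = length ys \<Longrightarrow> \<exists>c. star (Tl xs) * Tl ys = F.Left c"
proof (induction xs arbitrary: ys)
  case Nil
  then show ?case by (intro exI[of _ 1]) (simp add: Tl_simps F.L.psi_one)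
next
  case (Cons x xs)
  then obtain y ys' where ys: "ys = y # ys'" "length xs = length ys'" by (cases ys) auto
  have eq: "star (Tl (x # xs)) * Tl ys = star (Tl xs) * (F.Left (ipE x y) * Tl ys')"
    by (simp add: ys Tl_simps star_mult mult.assoc flip: star_T_T)
  show ?case
  proof (cases "ys' = []")
    case True
    then show ?thesis unfolding eq using ys by (auto simp: Tl_simps)
  next
    case False
    from Left_Tl[OF this] obtain zs where zs: "length zs = length ys'" "F.Left (ipE x y) * Tl ys' = Tl zs" by blast
    show ?thesis unfolding eq zs(2) using Cons.IH[of zs] zs(1) ys(2) by simp
  qed
qed

text \<open>The summand of degree \<open>n\<close> of the Fock space tensored with H, realized as a
  subspace of the whole induced space.\<close>

definition KS :: "nat \<Rightarrow> 'k set" where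
  "KS n = closure (cspan {Tl xs *\<^sub>V L0 h | xs h. length xs = n})"

lemma KS: "csubspace (KS n)" "closed (KS n)"
  by (simp_all add: KS_def csubspace_closure_cspan)

lemma KS_I: "length xs = n \<Longrightarrow> Tl xs *\<^sub>V L0 h \<in> KS n"
  unfolding KS_def by (rule closure_cspan_superset) blast

lemma L0_KS: "L0 h \<in> KS 0"
  using KS_I[of "[]" 0 h] by (simp add: Tl_simps bop_apply_simps)

lemma KS_image:
  fixes A :: "'k bop"
  assumes "\<And>xs h. length xs = n \<Longrightarrow> A *\<^sub>V Tl xs *\<^sub>V L0 h \<in> KS m" "u \<in> KS n"
  shows "A *\<^sub>V u \<in> KS m"
  using assms(2) unfolding KS_def[of n]
  by (rule bop_image_closure_cspan[OF KS, rotated]) (use assms(1) in blast)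

lemma KS_eqI:
  fixes A B :: "'k bop"
  assumes "\<And>xs h. length xs = n \<Longrightarrow> A *\<^sub>V Tl xs *\<^sub>V L0 h = B *\<^sub>V Tl xs *\<^sub>V L0 h" "u \<in> KS n"
  shows "A *\<^sub>V u = B *\<^sub>V u"
proof -
  have "(A - B) *\<^sub>V u \<in> {0}"
    using assms(2) unfolding KS_def
    by (rule bop_image_closure_cspan[rotated 3])
       (use assms(1) in \<open>auto simp: bop_apply_simps complex_vector.subspace_def\<close>)
  then show ?thesis by (simp add: bop_apply_simps)
qed

lemma T_KS: "u \<in> KS n \<Longrightarrow> T \<xi> *\<^sub>V u \<in> KS (Suc n)"
proof (rule KS_image)
  fix xs :: "'e list" and h assume "length xs = n"
  then show "T \<xi> *\<^sub>V Tl xs *\<^sub>V L0 h \<in> KS (Suc n)"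
    using KS_I[of "\<xi> # xs" "Suc n" h] by (simp add: Tl_simps bop_apply_simps)
qed

lemma Tl_KS: "u \<in> KS n \<Longrightarrow> Tl xs *\<^sub>V u \<in> KS (length xs + n)"
  by (induction xs) (simp_all add: Tl_simps bop_apply_simps T_KS)

lemma Left_KS: "u \<in> KS n \<Longrightarrow> F.Left a *\<^sub>V u \<in> KS n"
proof (rule KS_image)
  fix xs :: "'e list" and h assume "length xs = n"
  then show "F.Left a *\<^sub>V Tl xs *\<^sub>V L0 h \<in> KS n" using Left_Tl_L0[of xs a h] KS_I[where n = n] by force
qed

lemma cB_KS: "b \<in> RC \<Longrightarrow> u \<in> KS n \<Longrightarrow> F.cB b *\<^sub>V u \<in> KS n"
proof (rule KS_image)
  fix xs :: "'e list" and h assume b: "b \<in> RC" and n: "length xs = n"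
  have "F.cB b *\<^sub>V Tl xs *\<^sub>V L0 h = Tl xs *\<^sub>V L0 (b *\<^sub>V h)"
    by (simp add: bop_commute_apply[OF cB_Tl[OF b]] cB_L0[OF b])
  then show "F.cB b *\<^sub>V Tl xs *\<^sub>V L0 h \<in> KS n" using KS_I[OF n] by simp
qed

lemma star_T_KS: "u \<in> KS (Suc n) \<Longrightarrow> star (T \<xi>) *\<^sub>V u \<in> KS n"
proof (rule KS_image)
  fix xs :: "'e list" and h assume "length xs = Suc n"
  then obtain y ys where ys: "xs = y # ys" "length ys = n" by (cases xs) auto
  have "star (T \<xi>) *\<^sub>V Tl xs *\<^sub>V L0 h = (star (T \<xi>) * T y) *\<^sub>V Tl ys *\<^sub>V L0 h"
    by (simp add: ys Tl_simps bop_apply_simps)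
  then show "star (T \<xi>) *\<^sub>V Tl xs *\<^sub>V L0 h \<in> KS n"
    unfolding star_T_T using Left_KS[OF KS_I[OF ys(2)]] by simp
qed

lemma star_Tl_KS: "u \<in> KS (length xs + n) \<Longrightarrow> star (Tl xs) *\<^sub>V u \<in> KS n"
proof (induction xs arbitrary: u)
  case (Cons x xs)
  then have "star (T x) *\<^sub>V u \<in> KS (length xs + n)" by (intro star_T_KS) simp
  then show ?case using Cons.IH by (simp add: Tl_simps star_mult bop_apply_simps)
qed (simp add: Tl_simps bop_apply_simps)

lemma KS_0_L0: "u \<in> KS 0 \<Longrightarrow> u = L0 (adj L0 u)"
proof -
  assume u: "u \<in> KS 0"
  have bc: "bounded_clinear (\<lambda>u. L0 (adj L0 u))"
    by (rule bounded_clinear_compose[OF bounded_clinear_L0 bounded_clinear_adj[OF bounded_clinear_L0]])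
  then have "Bop (\<lambda>u. L0 (adj L0 u)) *\<^sub>V u = 1 *\<^sub>V u"
    by (intro KS_eqI[OF _ u]) (simp add: Tl_simps bop_apply_simps Bop_apply adj_L0)
  then show ?thesis by (simp add: Bop_apply[OF bc] bop_apply_simps)
qed

lemma KS_orthogonal_less:
  assumes "length xs < n" "v \<in> KS n"
  shows "cinner (Tl xs *\<^sub>V L0 h) v = 0"
proof -
  obtain m where n: "n = length xs + Suc m" using less_imp_Suc_add[OF assms(1)] by auto
  have "star (Tl xs) *\<^sub>V v \<in> KS (Suc m)" using star_Tl_KS assms(2) n by simp
  moreover have "cinner (L0 h) u = 0" if "u \<in> KS (Suc m)" for u
  proof (rule cinner_ext[of "L0 h" "L0 h", THEN ssubst])
    show "cinner (L0 h) u = 0"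
    proof -
      have *: "cinner x (L0 h) = 0" if "x \<in> {Tl xs *\<^sub>V L0 h | xs h. length xs = Suc m}" for x
      proof -
        from that obtain y ys k where "x = Tl (y # ys) *\<^sub>V L0 k" by (auto simp: length_Suc_conv)
        then show ?thesis by (simp add: Tl_simps bop_apply_simps star_T_L0 flip: cinner_star_bop_right)
      qed
      have "cinner u (L0 h) = 0" using cinner_zero_closure_cspan[OF * that[unfolded KS_def]] .
      then show ?thesis using cinner_commute[of "L0 h" u] by simp
    qed
  qed simp
  ultimately have "cinner (L0 h) (star (Tl xs) *\<^sub>V v) = 0" by blast
  then show ?thesis by (simp add: cinner_star_bop_right)
qed

lemma KS_orthogonal:
  assumes "u \<in> KS m" "v \<in> KS n" "m \<noteq> n"
  shows "cinner u v = 0"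
proof -
  have *: "cinner u v = 0" if mn: "m < n" and u: "u \<in> KS m" and v: "v \<in> KS n" for u v m n
    using u unfolding KS_def
    by (rule cinner_zero_closure_cspan[rotated]) (use KS_orthogonal_less v mn in auto)
  show ?thesis
  proof (cases "m < n")
    case False
    then have "cinner v u = 0" using *[of n m v u] assms by simp
    then show ?thesis using cinner_commute[of u v] by simp
  qed (use * assms in blast)
qed

lemma KS_total: "closure (cspan (\<Union>n. KS n)) = UNIV"
proof -
  have "{Tl xs *\<^sub>V L0 h | xs h. True} \<subseteq> (\<Union>n. KS n)" using KS_I by blast
  then show ?thesis using Tl_total closure_mono[OF complex_vector.span_mono] by blast
qed

lemma KS_zeroI: "(\<And>n u. u \<in> KS n \<Longrightarrow> cinner u v = 0) \<Longrightarrow> v = 0"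
  by (rule total_cinner_zero[OF KS_total]) blast

lemma KS_ext: "(\<And>n u. u \<in> KS n \<Longrightarrow> cinner u x = cinner u y) \<Longrightarrow> x = y"
  using KS_zeroI[of "x - y"] by (simp add: cinner_diff_right)

lemma KS_bop_eqI: "(\<And>n u. u \<in> KS n \<Longrightarrow> A *\<^sub>V u = B *\<^sub>V u) \<Longrightarrow> A = B"
  by (rule bop_eq_total[OF KS_total]) blast

subsection \<open>The dual correspondence\<close>

abbreviation J :: "'p \<Rightarrow> 'k" where "J \<equiv> first_summand vac ten tE tF"

lemma
  shows bounded_clinear_J: "bounded_clinear J" and J_tensor: "J (tE \<xi> h) = T \<xi> *\<^sub>V L0 h"
proof -
  have idb: "bounded_clinear (\<lambda>u :: 'p. u)" by (rule bounded_clinearI[where K = 1]) auto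
  obtain W where W: "bounded_clinear W" "\<And>\<xi> h. W (tE \<xi> h) = T \<xi> *\<^sub>V L0 h"
  proof (rule extend_operator_gram[of UNIV "\<lambda>(\<xi>, h). T \<xi> *\<^sub>V L0 h" "\<lambda>(\<xi>, h). tE \<xi> h" "\<lambda>u. u" 1])
    show "cinner (case i of (\<xi>, h) \<Rightarrow> T \<xi> *\<^sub>V L0 h) (case j of (\<xi>, h) \<Rightarrow> T \<xi> *\<^sub>V L0 h)
        = cinner (case i of (\<xi>, h) \<Rightarrow> tE \<xi> h) (case j of (\<xi>, h) \<Rightarrow> tE \<xi> h)" for i j
    proof (cases i; cases j)
      fix \<xi> h \<xi>' h' assume ij: "i = (\<xi>, h)" "j = (\<xi>', h')"
      have "cinner (T \<xi> *\<^sub>V L0 h) (T \<xi>' *\<^sub>V L0 h') = cinner (L0 h) ((star (T \<xi>) * T \<xi>') *\<^sub>V L0 h')"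
        by (simp add: bop_apply_simps cinner_star_bop_right)
      then show ?thesis by (simp add: ij star_T_T Left_L0 cinner_L0 E.cinner_tensor)
    qed
    fix W assume W: "bounded_clinear W" "\<And>i. i \<in> UNIV \<Longrightarrow> W (case i of (\<xi>, h) \<Rightarrow> tE \<xi> h) = (case i of (\<xi>, h) \<Rightarrow> T \<xi> *\<^sub>V L0 h)"
    have "W (tE \<xi> h) = T \<xi> *\<^sub>V L0 h" for \<xi> h using W(2)[of "(\<xi>, h)"] by simp
    then show ?thesis using that W(1) by blast
  qed (use idb in auto)
  have TL: "T \<xi> *\<^sub>V L0 h = tF (ten \<xi> (vac 1)) h" for \<xi> h by (simp add: L0_def T_tensor)
  have "J = W"
    unfolding first_summand_def
  proof (rule the_equality)
    fix V assume "bounded_clinear V \<and> (\<forall>\<xi> h. V (tE \<xi> h) = tF (ten \<xi> (vac 1)) h)"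
    then show "V = W" by (intro bounded_clinear_eq_total[OF E.tensor_dense]) (auto simp: W TL)
  qed (use W TL in auto)
  then show "bounded_clinear J" "J (tE \<xi> h) = T \<xi> *\<^sub>V L0 h" using W by auto
qed

lemma cinner_J: "cinner (J u) (J v) = cinner u v"
proof -
  have 1: "adj J (J v) = v" for v
  proof -
    have bc: "bounded_clinear (\<lambda>v. adj J (J v))"
      by (rule bounded_clinear_compose[OF bounded_clinear_adj[OF bounded_clinear_J] bounded_clinear_J])
    have idb: "bounded_clinear (\<lambda>u :: 'p. u)" by (rule bounded_clinearI[where K = 1]) auto
    have "(\<lambda>v. adj J (J v)) = (\<lambda>v. v)"
    proof (rule bounded_clinear_eq_total[OF E.tensor_dense bc idb])
      fix x assume "x \<in> {tE x h | x h. True}"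
      then obtain \<xi> h where x: "x = tE \<xi> h" by blast
      show "adj J (J x) = x"
      proof (rule E.tensor_eqI)
        fix \<xi>' h'
        have "cinner (T \<xi>' *\<^sub>V L0 h') (T \<xi> *\<^sub>V L0 h) = cinner (L0 h') ((star (T \<xi>') * T \<xi>) *\<^sub>V L0 h)"
          by (simp add: bop_apply_simps cinner_star_bop_right)
        then show "cinner (tE \<xi>' h') (adj J (J x)) = cinner (tE \<xi>' h') x"
          by (simp add: cinner_adj_right[OF bounded_clinear_J] x J_tensor star_T_T Left_L0 cinner_L0 E.cinner_tensor)
      qed
    qed
    then show ?thesis by (rule fun_cong)
  qed
  show ?thesis using cinner_adj_right[OF bounded_clinear_J, of u "J v"] by (simp add: 1)
qed

lemma J_KS: "J u \<in> KS 1"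
proof -
  have "closure (cspan {tE x h | x h. True}) \<subseteq> {u. J u \<in> KS 1}"
  proof (rule closure_cspan_subset)
    show "{tE x h | x h. True} \<subseteq> {u. J u \<in> KS 1}"
      using KS_I[of "[_]" 1] by (auto simp: J_tensor Tl_simps)
  qed (rule bounded_clinear_vimage[OF bounded_clinear_J KS])+
  then show ?thesis using E.tensor_dense by blast
qed

text \<open>\<open>J\<close> is an isometry onto \<open>KS 1\<close>: the difference lies in
  \<open>KS 1\<close> and is orthogonal to its generators. Hence intertwiners into the abstract
  space may be replaced by intertwiners into \<open>KS 1\<close>.\<close>

lemma J_adj_J: "v \<in> KS 1 \<Longrightarrow> J (adj J v) = v"
proof -
  assume v: "v \<in> KS 1"
  have "cinner x (v - J (adj J v)) = 0" if "x \<in> {Tl xs *\<^sub>V L0 h | xs h. length xs = 1}" for x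
  proof -
    from that obtain \<xi> h where "x = J (tE \<xi> h)" by (auto simp: length_Suc_conv Tl_simps J_tensor)
    then show ?thesis by (simp add: cinner_diff_right cinner_J cinner_adj_right[OF bounded_clinear_J])
  qed
  moreover have "v - J (adj J v) \<in> KS 1" using KS(1) v J_KS by (simp add: complex_vector.subspace_diff)
  ultimately have "cinner (v - J (adj J v)) (v - J (adj J v)) = 0"
    unfolding KS_def by (rule cinner_zero_closure_cspan)
  then show ?thesis by (simp add: cinner_eq_zero_iff)
qed

lemma J_Left: "J (E.Left a *\<^sub>V u) = F.Left a *\<^sub>V J u"
proof -
  have "(\<lambda>u. J (E.Left a *\<^sub>V u)) = (\<lambda>u. F.Left a *\<^sub>V J u)"
  proof (rule bounded_clinear_eq_total[OF E.tensor_dense])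
    show "bounded_clinear (\<lambda>u. J (E.Left a *\<^sub>V u))" "bounded_clinear (\<lambda>u. F.Left a *\<^sub>V J u)"
      by (rule bounded_clinear_compose[OF bounded_clinear_J bounded_clinear_bop])
         (rule bounded_clinear_compose[OF bounded_clinear_bop bounded_clinear_J])
    fix x assume "x \<in> {tE x h | x h. True}"
    then obtain \<xi> h where x: "x = tE \<xi> h" by blast
    show "J (E.Left a *\<^sub>V x) = F.Left a *\<^sub>V J x"
      unfolding x E.Left_tensor J_tensor Left_T[symmetric] by (simp add: bop_apply_simps)
  qed
  then show ?thesis by (rule fun_cong)
qed

lemma adj_J_Left: "adj J (F.Left a *\<^sub>V v) = E.Left a *\<^sub>V adj J v"
proof (rule cinner_ext)
  fix z
  have "cinner z (adj J (F.Left a *\<^sub>V v)) = cinner (J z) (F.Left a *\<^sub>V v)"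
    by (rule cinner_adj_right[OF bounded_clinear_J])
  also have "\<dots> = cinner (J (E.Left (star a) *\<^sub>V z)) v"
    unfolding J_Left by (simp add: F.L.psi_star cinner_star_bop)
  also have "\<dots> = cinner (E.Left (star a) *\<^sub>V z) (adj J v)"
    by (rule cinner_adj_right[OF bounded_clinear_J, symmetric])
  also have "\<dots> = cinner z (E.Left a *\<^sub>V adj J v)" by (simp add: E.L.psi_star cinner_star_bop)
  finally show "cinner z (adj J (F.Left a *\<^sub>V v)) = cinner z (E.Left a *\<^sub>V adj J v)" .
qed

text \<open>The elements of the \<open>\<pi>\<close>-dual, as operators with values in the first summand.\<close>

definition dual :: "('h \<Rightarrow> 'k) set" where
  "dual = {w. bounded_clinear w \<and> (\<forall>h. w h \<in> KS 1) \<and> (\<forall>a h. w (\<pi> a h) = F.Left a *\<^sub>V w h)}"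

lemma dualD:
  assumes "w \<in> dual"
  shows "bounded_clinear w" "w h \<in> KS 1" "w (\<pi> a h) = F.Left a *\<^sub>V w h"
  using assms by (auto simp: dual_def)

lemma dual_eq: "dual = (\<lambda>\<eta> h. J (\<eta> h)) ` pi_dual \<phi> \<pi> tE"
proof (intro equalityI subsetI)
  fix w assume w: "w \<in> dual"
  have "(\<lambda>h. adj J (w h)) \<in> pi_dual \<phi> \<pi> tE"
    unfolding pi_dual_def
  proof (intro CollectI conjI allI)
    show "bounded_clinear (\<lambda>h. adj J (w h))"
      by (rule bounded_clinear_compose[OF bounded_clinear_adj[OF bounded_clinear_J] dualD(1)[OF w]])
    show "adj J (w (\<pi> a h)) = ampliation tE (\<phi> a) (adj J (w h))" for a h
      unfolding E.ampliation_eq[OF E.adjointable_left] E.Left_def[symmetric]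
      by (simp add: dualD(3)[OF w] adj_J_Left)
  qed
  moreover have "w = (\<lambda>h. J (adj J (w h)))" by (simp add: J_adj_J[OF dualD(2)[OF w]])
  ultimately show "w \<in> (\<lambda>\<eta> h. J (\<eta> h)) ` pi_dual \<phi> \<pi> tE"
    by (intro image_eqI[where x = "\<lambda>h. adj J (w h)"]) simp_all
next
  fix w assume "w \<in> (\<lambda>\<eta> h. J (\<eta> h)) ` pi_dual \<phi> \<pi> tE"
  then obtain \<eta> where \<eta>: "bounded_clinear \<eta>" "\<And>a h. \<eta> (\<pi> a h) = ampliation tE (\<phi> a) (\<eta> h)" "w = (\<lambda>h. J (\<eta> h))"
    unfolding pi_dual_def by blast
  have "bounded_clinear w"
    unfolding \<eta>(3) by (rule bounded_clinear_compose[OF bounded_clinear_J \<eta>(1)])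
  moreover have "w (\<pi> a h) = F.Left a *\<^sub>V w h" for a h
    unfolding \<eta>(3) \<eta>(2) E.ampliation_eq[OF E.adjointable_left] E.Left_def[symmetric] by (rule J_Left)
  ultimately show "w \<in> dual" unfolding dual_def using \<eta>(3) J_KS by blast
qed

text \<open>\<open>dip w v\<close> is the \<open>\<pi>(M)'\<close>-valued inner product \<open>w\<^sup>* v\<close> of the dual correspondence.\<close>

definition dip :: "('h \<Rightarrow> 'k) \<Rightarrow> ('h \<Rightarrow> 'k) \<Rightarrow> 'h bop" where "dip w v = Bop (\<lambda>h. adj w (v h))"

lemma dip:
  assumes w: "w \<in> dual" and v: "v \<in> dual"
  shows cinner_dip: "cinner h (dip w v *\<^sub>V k) = cinner (w h) (v k)" and dip_RC: "dip w v \<in> RC"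
proof -
  have "bounded_clinear (\<lambda>h. adj w (v h))"
    by (rule bounded_clinear_compose[OF bounded_clinear_adj[OF dualD(1)[OF w]] dualD(1)[OF v]])
  then show c: "cinner h (dip w v *\<^sub>V k) = cinner (w h) (v k)" for h k
    unfolding dip_def by (simp add: Bop_apply cinner_adj_right[OF dualD(1)[OF w]])
  show "dip w v \<in> RC"
  proof (rule RC_I, rule cinner_ext)
    fix a h z
    have "cinner z (dip w v *\<^sub>V \<pi> a h) = cinner (F.Left (star a) *\<^sub>V w z) (v h)"
      by (simp add: c dualD(3)[OF v] F.L.psi_star cinner_star_bop)
    also have "\<dots> = cinner (\<pi> (star a) z) (dip w v *\<^sub>V h)" by (simp add: c flip: dualD(3)[OF w])
    finally show "cinner z (dip w v *\<^sub>V \<pi> a h) = cinner z (\<pi> a (dip w v *\<^sub>V h))" by (simp add: rep_star star_star)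
  qed
qed

text \<open>For words of equal length the product \<open>star (Tl xs) * Tl ys\<close> is a left
  action, which passes through \<open>v\<close> by the intertwining property; for different lengths
  both sides vanish. This Gram identity is what makes I \<otimes> w bounded.\<close>

lemma dual_gram:
  assumes w: "w \<in> dual" and v: "v \<in> dual"
  shows "cinner (Tl xs *\<^sub>V w h) (Tl ys *\<^sub>V v k) = cinner (Tl xs *\<^sub>V L0 h) (F.cB (dip w v) *\<^sub>V Tl ys *\<^sub>V L0 k)"
proof -
  have r: "F.cB (dip w v) *\<^sub>V Tl ys *\<^sub>V L0 k = Tl ys *\<^sub>V L0 (dip w v *\<^sub>V k)"
    by (simp add: bop_commute_apply[OF cB_Tl[OF dip_RC[OF w v]]] cB_L0[OF dip_RC[OF w v]])
  show ?thesis
  proof (cases "length xs = length ys")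
    case True
    then obtain c where c: "star (Tl xs) * Tl ys = F.Left c" using star_Tl_Tl by blast
    have *: "cinner (Tl xs *\<^sub>V u) (Tl ys *\<^sub>V z) = cinner u (F.Left c *\<^sub>V z)" for u z
      by (simp add: bop_apply_simps cinner_star_bop_right flip: c)
    show ?thesis
      unfolding r * by (simp add: Left_L0 cinner_L0 RC_D[OF dip_RC[OF w v], symmetric] cinner_dip[OF w v] dualD(3)[OF v])
  next
    case False
    then show ?thesis
      unfolding r using KS_orthogonal[OF Tl_KS[OF dualD(2)[OF w]] Tl_KS[OF dualD(2)[OF v]]]
        KS_orthogonal[OF KS_I KS_I, of xs "length xs" ys "length ys"] by simp
  qed
qed

text \<open>
  \<open>Rd w\<close> is \<open>R\<^sub>w = I \<otimes> w\<close>.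
\<close>

definition Rd :: "('h \<Rightarrow> 'k) \<Rightarrow> 'k bop" where
  "Rd w = Bop (SOME W. bounded_clinear W \<and> (\<forall>xs h. W (Tl xs *\<^sub>V L0 h) = Tl xs *\<^sub>V w h))"

lemma Rd_Tl:
  assumes w: "w \<in> dual"
  shows "Rd w *\<^sub>V Tl xs *\<^sub>V L0 h = Tl xs *\<^sub>V w h"
proof -
  have "\<exists>W. bounded_clinear W \<and> (\<forall>xs h. W (Tl xs *\<^sub>V L0 h) = Tl xs *\<^sub>V w h)"
  proof (rule extend_operator_gram[of UNIV "\<lambda>(xs, h). Tl xs *\<^sub>V w h" "\<lambda>(xs, h). Tl xs *\<^sub>V L0 h" "(*\<^sub>V) (F.cB (dip w w))" "sqrt (norm (dip w w))"])
    show "cinner (case i of (xs, h) \<Rightarrow> Tl xs *\<^sub>V w h) (case j of (xs, h) \<Rightarrow> Tl xs *\<^sub>V w h)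
        = cinner (case i of (xs, h) \<Rightarrow> Tl xs *\<^sub>V L0 h) (F.cB (dip w w) *\<^sub>V (case j of (xs, h) \<Rightarrow> Tl xs *\<^sub>V L0 h))" for i j
      by (cases i; cases j) (simp add: dual_gram[OF w w])
    show "norm (F.cB (dip w w) *\<^sub>V x) \<le> (sqrt (norm (dip w w)))\<^sup>2 * norm x" for x
      using order_trans[OF norm_bop_apply mult_right_mono[OF F.norm_cB_le[OF dip_RC[OF w w]] norm_ge_zero]] by simp
    fix W assume W: "bounded_clinear W" "\<And>i. i \<in> UNIV \<Longrightarrow> W (case i of (xs, h) \<Rightarrow> Tl xs *\<^sub>V L0 h) = (case i of (xs, h) \<Rightarrow> Tl xs *\<^sub>V w h)"
    have "W (Tl xs *\<^sub>V L0 h) = Tl xs *\<^sub>V w h" for xs h using W(2)[of "(xs, h)"] by simp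
    then show ?thesis using W(1) by blast
  qed (use bounded_clinear_bop in auto)
  from someI_ex[OF this] obtain W where W: "Rd w = Bop W" "bounded_clinear W" "\<And>xs h. W (Tl xs *\<^sub>V L0 h) = Tl xs *\<^sub>V w h"
    unfolding Rd_def by blast
  show ?thesis by (simp add: W(1) Bop_apply[OF W(2)] W(3))
qed

lemma Rd_L0: "w \<in> dual \<Longrightarrow> Rd w *\<^sub>V L0 h = w h"
  using Rd_Tl[of w "[]" h] by (simp add: Tl_simps bop_apply_simps)

lemma Tl_bop_eqI: "(\<And>xs h. A *\<^sub>V Tl xs *\<^sub>V L0 h = B *\<^sub>V Tl xs *\<^sub>V L0 h) \<Longrightarrow> A = B"
  by (rule bop_eq_total[OF Tl_total]) blast

lemma Rd_T: "w \<in> dual \<Longrightarrow> Rd w * T \<xi> = T \<xi> * Rd w"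
proof (rule Tl_bop_eqI)
  fix xs h assume w: "w \<in> dual"
  show "(Rd w * T \<xi>) *\<^sub>V Tl xs *\<^sub>V L0 h = (T \<xi> * Rd w) *\<^sub>V Tl xs *\<^sub>V L0 h"
    using Rd_Tl[OF w, of "\<xi> # xs" h] Rd_Tl[OF w, of xs h] by (simp add: bop_apply_simps Tl_simps)
qed

lemma Rd_Left: "w \<in> dual \<Longrightarrow> Rd w * F.Left a = F.Left a * Rd w"
proof (rule Tl_bop_eqI)
  fix xs h assume w: "w \<in> dual"
  show "(Rd w * F.Left a) *\<^sub>V Tl xs *\<^sub>V L0 h = (F.Left a * Rd w) *\<^sub>V Tl xs *\<^sub>V L0 h"
  proof (cases "xs = []")
    case True
    then show ?thesis by (simp add: Tl_simps bop_apply_simps Left_L0 Rd_L0[OF w] dualD(3)[OF w])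
  next
    case False
    then obtain ys where ys: "F.Left a * Tl xs = Tl ys" using Left_Tl by blast
    have "F.Left a *\<^sub>V Tl xs *\<^sub>V u = Tl ys *\<^sub>V u" for u by (simp flip: ys bop_apply_simps)
    then show ?thesis by (simp add: bop_apply_simps Rd_Tl[OF w])
  qed
qed

lemma dual_cB: "w \<in> dual \<Longrightarrow> b \<in> RC \<Longrightarrow> (\<lambda>h. F.cB b *\<^sub>V w h) \<in> dual"
proof -
  assume w: "w \<in> dual" and b: "b \<in> RC"
  have "bounded_clinear (\<lambda>h. F.cB b *\<^sub>V w h)"
    by (rule bounded_clinear_compose[OF bounded_clinear_bop dualD(1)[OF w]])
  moreover have "F.cB b *\<^sub>V F.Left a *\<^sub>V u = F.Left a *\<^sub>V F.cB b *\<^sub>V u" for a u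
    by (rule bop_commute_apply[OF cB_Left[OF b]])
  ultimately show ?thesis unfolding dual_def using cB_KS[OF b dualD(2)[OF w]] by (simp add: dualD(3)[OF w])
qed

lemma cB_Rd: "w \<in> dual \<Longrightarrow> b \<in> RC \<Longrightarrow> F.cB b * Rd w = Rd (\<lambda>h. F.cB b *\<^sub>V w h)"
proof (rule Tl_bop_eqI)
  fix xs h assume w: "w \<in> dual" and b: "b \<in> RC"
  have "F.cB b *\<^sub>V Tl xs *\<^sub>V w h = Tl xs *\<^sub>V F.cB b *\<^sub>V w h" by (rule bop_commute_apply[OF cB_Tl[OF b]])
  then show "(F.cB b * Rd w) *\<^sub>V Tl xs *\<^sub>V L0 h = Rd (\<lambda>h. F.cB b *\<^sub>V w h) *\<^sub>V Tl xs *\<^sub>V L0 h"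
    by (simp add: bop_apply_simps Rd_Tl[OF w] Rd_Tl[OF dual_cB[OF w b]])
qed

lemma dual_RC: "w \<in> dual \<Longrightarrow> b \<in> RC \<Longrightarrow> (\<lambda>h. w (b *\<^sub>V h)) \<in> dual"
proof -
  assume w: "w \<in> dual" and b: "b \<in> RC"
  have "bounded_clinear (\<lambda>h. w (b *\<^sub>V h))"
    by (rule bounded_clinear_compose[OF dualD(1)[OF w] bounded_clinear_bop])
  then show ?thesis unfolding dual_def using dualD(2,3)[OF w] by (simp add: RC_D[OF b])
qed

lemma Rd_cB: "w \<in> dual \<Longrightarrow> b \<in> RC \<Longrightarrow> Rd w * F.cB b = Rd (\<lambda>h. w (b *\<^sub>V h))"
proof (rule Tl_bop_eqI)
  fix xs h assume w: "w \<in> dual" and b: "b \<in> RC"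
  have "F.cB b *\<^sub>V Tl xs *\<^sub>V L0 h = Tl xs *\<^sub>V L0 (b *\<^sub>V h)"
    by (simp add: bop_commute_apply[OF cB_Tl[OF b]] cB_L0[OF b])
  then show "(Rd w * F.cB b) *\<^sub>V Tl xs *\<^sub>V L0 h = Rd (\<lambda>h. w (b *\<^sub>V h)) *\<^sub>V Tl xs *\<^sub>V L0 h"
    by (simp add: bop_apply_simps Rd_Tl[OF w] Rd_Tl[OF dual_RC[OF w b]])
qed

lemma dual_scaleC: "w \<in> dual \<Longrightarrow> (\<lambda>h. c *\<^sub>C w h) \<in> dual"
proof -
  assume w: "w \<in> dual"
  have "bounded_clinear (\<lambda>h. c *\<^sub>C w h)"
  proof (rule bounded_clinearI[where K = "cmod c * onorm w"])
    show "norm (c *\<^sub>C w x) \<le> cmod c * onorm w * norm x" for x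
      using bounded_clinearD(7)[OF dualD(1)[OF w], of x] by (simp add: norm_scaleC mult.assoc mult_left_mono)
  qed (simp_all add: bounded_clinearD(2,3)[OF dualD(1)[OF w]] scaleC_add_right scaleC_scaleC mult.commute)
  then show ?thesis unfolding dual_def using dualD(2,3)[OF w] KS(1)
    by (simp add: bop_simps complex_vector.subspace_scale)
qed

lemma Rd_scaleC: "w \<in> dual \<Longrightarrow> Rd (\<lambda>h. c *\<^sub>C w h) = c *\<^sub>C Rd w"
  by (rule Tl_bop_eqI) (simp add: Rd_Tl dual_scaleC scaleC_bop_apply bop_simps)

text \<open>The Fock relation of the dual correspondence: with \<pi>(M)' in the role of M, the
  operators \<open>Rd w\<close> are creation operators acting from the right.\<close>

lemma star_Rd_Rd: "w \<in> dual \<Longrightarrow> v \<in> dual \<Longrightarrow> star (Rd w) * Rd v = F.cB (dip w v)"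
proof (rule Tl_bop_eqI)
  fix xs h assume w: "w \<in> dual" and v: "v \<in> dual"
  have "cinner x ((star (Rd w) * Rd v) *\<^sub>V Tl xs *\<^sub>V L0 h - F.cB (dip w v) *\<^sub>V Tl xs *\<^sub>V L0 h) = 0"
    if "x \<in> {Tl xs *\<^sub>V L0 h | xs h. True}" for x
    using that by (auto simp: cinner_diff_right bop_apply_simps cinner_star_bop_right Rd_Tl w v dual_gram)
  from total_cinner_zero[OF Tl_total this]
  show "(star (Rd w) * Rd v) *\<^sub>V Tl xs *\<^sub>V L0 h = F.cB (dip w v) *\<^sub>V Tl xs *\<^sub>V L0 h" by simp
qed

lemma Rd_KS: "w \<in> dual \<Longrightarrow> u \<in> KS n \<Longrightarrow> Rd w *\<^sub>V u \<in> KS (Suc n)"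
proof (rule KS_image)
  fix xs :: "'e list" and h assume w: "w \<in> dual" and n: "length xs = n"
  show "Rd w *\<^sub>V Tl xs *\<^sub>V L0 h \<in> KS (Suc n)"
    using Tl_KS[OF dualD(2)[OF w], of xs h] n by (simp add: Rd_Tl[OF w])
qed

lemma star_Rd_KS_0: "w \<in> dual \<Longrightarrow> u \<in> KS 0 \<Longrightarrow> star (Rd w) *\<^sub>V u = 0"
  by (rule KS_zeroI) (use KS_orthogonal[OF Rd_KS] in \<open>force simp: cinner_star_bop_right\<close>)

text \<open>
  The projection onto the closed span of the vectors \<open>c h\<close>, for \<open>c\<close> in the commutant of the left action
  and \<open>h \<in> H\<close>, lies in the bicommutant of the left action, so it is given by some \<open>a \<in> M\<close>; as it fixes
  \<open>H\<close> and \<open>\<pi>\<close> is faithful, \<open>a = 1\<close>. Hence there are many elements of the \<open>\<pi>\<close>-dual.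
\<close>

lemma commutant_Left_total:
  "closure (cspan {c *\<^sub>V L0 h | c h. \<forall>a. c * F.Left a = F.Left a * c}) = UNIV"
proof -
  define V where "V = closure (cspan {c *\<^sub>V L0 h | c h. \<forall>a. c * F.Left a = F.Left a * c})"
  have V: "csubspace V" "closed V" by (simp_all add: V_def csubspace_closure_cspan)
  have inv: "z *\<^sub>V u \<in> V" if z: "\<And>a. z * F.Left a = F.Left a * z" and u: "u \<in> V" for z u
    using u unfolding V_def
  proof (rule bop_image_closure_cspan[OF V[unfolded V_def], rotated])
    fix x assume "x \<in> {c *\<^sub>V L0 h | c h. \<forall>a. c * F.Left a = F.Left a * c}"
    then obtain c h where x: "x = c *\<^sub>V L0 h" "\<And>a. c * F.Left a = F.Left a * c" by blast
    have "(z * c) * F.Left a = F.Left a * (z * c)" for a by (simp only: mult.assoc x(2)) (simp only: mult.assoc[symmetric] z)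
    moreover have "z *\<^sub>V x = (z * c) *\<^sub>V L0 h" by (simp add: x bop_apply_simps)
    ultimately show "z *\<^sub>V x \<in> closure (cspan {c *\<^sub>V L0 h | c h. \<forall>a. c * F.Left a = F.Left a * c})"
      by (intro closure_cspan_superset) blast
  qed
  have "proj V \<in> bicommutant (range F.Left)"
  proof (rule bicommutantI)
    fix z assume "\<And>A. A \<in> range F.Left \<Longrightarrow> z * A = A * z"
    then have z: "z * F.Left a = F.Left a * z" for a by blast
    have zs: "star z * F.Left a = F.Left a * star z" for a
    proof -
      have "star (z * F.Left (star a)) = star (F.Left (star a) * z)" using z by simp
      then show ?thesis by (simp add: star_mult F.L.psi_star star_star)
    qed
    show "z * proj V = proj V * z"
      by (rule proj_commute[OF V]) (use inv[OF z] inv[OF zs] in auto)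
  qed
  then obtain a where a: "F.Left a = proj V" by (rule F.L.bicommutant_range)
  have "\<pi> a h = h" for h
  proof -
    have "L0 h \<in> V"
      unfolding V_def by (rule closure_cspan_superset) (auto intro!: exI[of _ 1] exI[of _ h] simp: bop_apply_simps)
    then have "L0 (\<pi> a h) = L0 h" using proj_eq[OF V] by (simp flip: Left_L0 a)
    then have "adj L0 (L0 (\<pi> a h)) = adj L0 (L0 h)" by simp
    then show ?thesis by (simp add: adj_L0)
  qed
  then have "a = 1" by (intro rep_eqI) (simp add: rep_one)
  then have "proj V = 1" using a F.L.psi_one by simp
  then have "u \<in> V" for u using proj_mem[OF V, of u] by (simp add: bop_apply_simps)
  then show ?thesis unfolding V_def by blast
qed

section \<open>Generation of the Fock space from the right\<close>

lemma dual_separates: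
  assumes u: "u \<in> KS 1" and z: "\<And>w h. w \<in> dual \<Longrightarrow> cinner (w h) u = 0"
  shows "u = 0"
proof (rule total_cinner_zero[OF commutant_Left_total])
  fix x assume "x \<in> {c *\<^sub>V L0 h | c h. \<forall>a. c * F.Left a = F.Left a * c}"
  then obtain c h where x: "x = c *\<^sub>V L0 h" "\<And>a. c * F.Left a = F.Left a * c" by blast
  define w where "w h = J (adj J (c *\<^sub>V L0 h))" for h
  have "w \<in> dual"
    unfolding dual_def
  proof (intro CollectI conjI allI)
    show "bounded_clinear w"
      unfolding w_def
      by (rule bounded_clinear_compose[OF bounded_clinear_J bounded_clinear_compose[OF bounded_clinear_adj[OF bounded_clinear_J]
            bounded_clinear_compose[OF bounded_clinear_bop bounded_clinear_L0]]])
    show "w h \<in> KS 1" for h unfolding w_def by (rule J_KS)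
    show "w (\<pi> a h) = F.Left a *\<^sub>V w h" for a h
    proof -
      have "c *\<^sub>V F.Left a *\<^sub>V L0 h = F.Left a *\<^sub>V c *\<^sub>V L0 h" by (rule bop_commute_apply[OF x(2)])
      then show ?thesis by (simp add: w_def adj_J_Left J_Left flip: Left_L0)
    qed
  qed
  then have "cinner (w h) u = 0" by (rule z)
  moreover have "cinner (w h) u = cinner (c *\<^sub>V L0 h) (J (adj J u))"
    unfolding w_def
    by (simp add: cinner_adj_left[OF bounded_clinear_J] flip: cinner_adj_right[OF bounded_clinear_J])
  ultimately show "cinner x u = 0" by (simp add: x J_adj_J[OF u])
qed

text \<open>Removing the first \<open>n\<close> letters by \<open>star (Tl xs)\<close> leaves a
  vector of \<open>KS 1\<close>, to which the separation property of the dual applies;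
  \<open>Rd w\<close> acts on that last factor only.\<close>

lemma Rd_separates:
  assumes v: "v \<in> KS (Suc n)" and z: "\<And>w u. w \<in> dual \<Longrightarrow> u \<in> KS n \<Longrightarrow> cinner (Rd w *\<^sub>V u) v = 0"
  shows "v = 0"
proof -
  have 0: "star (Tl xs) *\<^sub>V v = 0" if xs: "length xs = n" for xs
  proof (rule dual_separates)
    show "star (Tl xs) *\<^sub>V v \<in> KS 1" using star_Tl_KS[of v xs 1] v xs by simp
    fix w h assume w: "w \<in> dual"
    show "cinner (w h) (star (Tl xs) *\<^sub>V v) = 0"
      using z[OF w KS_I[OF xs]] by (simp add: cinner_star_bop_right Rd_Tl[OF w])
  qed
  have "cinner x v = 0" if "x \<in> {Tl xs *\<^sub>V L0 h | xs h. length xs = Suc n}" for x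
  proof -
    from that obtain xs h where x: "x = Tl xs *\<^sub>V L0 h" "length xs = Suc n" by blast
    then obtain ys y where ys: "xs = ys @ [y]" "length ys = n" by (cases xs rule: rev_cases) auto
    have "x = Tl ys *\<^sub>V Tl [y] *\<^sub>V L0 h" by (simp add: x(1) ys(1) Tl_append bop_apply_simps)
    then show ?thesis using 0[OF ys(2)] by (simp flip: cinner_star_bop_right)
  qed
  then have "cinner v v = 0" using v unfolding KS_def by (rule cinner_zero_closure_cspan)
  then show ?thesis by (simp add: cinner_eq_zero_iff)
qed

text \<open>Each level arises from the preceding one by adding a last factor. Hence statements about
  operators commuting with the \<open>Rd w\<close> reduce to their action on H.\<close>

lemma KS_Suc: "KS (Suc n) = closure (cspan {Rd w *\<^sub>V u | w u. w \<in> dual \<and> u \<in> KS n})"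
proof
  show "closure (cspan {Rd w *\<^sub>V u | w u. w \<in> dual \<and> u \<in> KS n}) \<subseteq> KS (Suc n)"
    by (rule closure_cspan_subset[OF _ KS]) (auto intro: Rd_KS)
  show "KS (Suc n) \<subseteq> closure (cspan {Rd w *\<^sub>V u | w u. w \<in> dual \<and> u \<in> KS n})"
  proof
    fix v assume v: "v \<in> KS (Suc n)"
    define p where "p = proj (KS (Suc n))"
    show "v \<in> closure (cspan {Rd w *\<^sub>V u | w u. w \<in> dual \<and> u \<in> KS n})"
    proof (rule in_closure_cspanI)
      fix z assume z: "\<And>x. x \<in> {Rd w *\<^sub>V u | w u. w \<in> dual \<and> u \<in> KS n} \<Longrightarrow> cinner x z = 0"
      have "p *\<^sub>V z = 0"
      proof (rule Rd_separates)
        show "p *\<^sub>V z \<in> KS (Suc n)" unfolding p_def by (rule proj_mem[OF KS])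
        fix w u assume wu: "w \<in> dual" "u \<in> KS n"
        have "cinner (Rd w *\<^sub>V u) (z - p *\<^sub>V z) = 0"
          unfolding p_def by (rule proj_orthogonal[OF KS]) (rule Rd_KS[OF wu])
        moreover have "cinner (Rd w *\<^sub>V u) z = 0" by (rule z) (use wu in blast)
        ultimately show "cinner (Rd w *\<^sub>V u) (p *\<^sub>V z) = 0" by (simp add: cinner_diff_right)
      qed
      moreover have "cinner v (z - p *\<^sub>V z) = 0" unfolding p_def by (rule proj_orthogonal[OF KS v])
      ultimately have "cinner v z = 0" by simp
      then show "cinner z v = 0" using cinner_commute[of z v] by simp
    qed
  qed
qed

lemma star_Rd_KS: "w \<in> dual \<Longrightarrow> u \<in> KS (Suc n) \<Longrightarrow> star (Rd w) *\<^sub>V u \<in> KS n"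
  unfolding KS_Suc
proof (rule bop_image_closure_cspan[OF KS])
  fix x assume w: "w \<in> dual" and "x \<in> {Rd w *\<^sub>V u | w u. w \<in> dual \<and> u \<in> KS n}"
  then obtain v u where x: "x = Rd v *\<^sub>V u" "v \<in> dual" "u \<in> KS n" by blast
  have "star (Rd w) *\<^sub>V x = F.cB (dip w v) *\<^sub>V u" by (simp add: x(1) flip: bop_apply_simps(6) star_Rd_Rd[OF w x(2)])
  then show "star (Rd w) *\<^sub>V x \<in> KS n" using cB_KS[OF dip_RC[OF w x(2)] x(3)] by simp
qed auto

text \<open>Removing the last factor commutes with adding a first factor as long as they are
  different factors. On \<open>KS 0\<close> they coincide, therefore \<open>u\<close> has positive
  degree.\<close>

lemma star_Rd_T:
  assumes w: "w \<in> dual" and u: "u \<in> KS (Suc n)"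
  shows "star (Rd w) *\<^sub>V T \<xi> *\<^sub>V u = T \<xi> *\<^sub>V star (Rd w) *\<^sub>V u"
proof -
  have "(star (Rd w) * T \<xi> - T \<xi> * star (Rd w)) *\<^sub>V u \<in> {0}"
    using u unfolding KS_Suc
  proof (rule bop_image_closure_cspan[rotated 3])
    fix x assume "x \<in> {Rd w *\<^sub>V u | w u. w \<in> dual \<and> u \<in> KS n}"
    then obtain v u where x: "x = Rd v *\<^sub>V u" "v \<in> dual" by blast
    have "star (Rd w) * T \<xi> * Rd v = (star (Rd w) * Rd v) * T \<xi>" by (simp only: mult.assoc Rd_T[OF x(2)])
    also have "\<dots> = T \<xi> * (star (Rd w) * Rd v)" by (simp only: star_Rd_Rd[OF w x(2)] cB_T[OF dip_RC[OF w x(2)]])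
    also have "\<dots> = T \<xi> * star (Rd w) * Rd v" by (simp only: mult.assoc)
    finally have "(star (Rd w) * T \<xi> - T \<xi> * star (Rd w)) * Rd v = 0" by (simp add: left_diff_distrib)
    then show "(star (Rd w) * T \<xi> - T \<xi> * star (Rd w)) *\<^sub>V x \<in> {0}"
      unfolding x(1) by (simp flip: bop_apply_simps(6) add: bop_apply_simps(1))
  qed (auto simp: complex_vector.subspace_def)
  then show ?thesis by (simp add: bop_apply_simps)
qed

definition Rl :: "('h \<Rightarrow> 'k) list \<Rightarrow> 'k bop" where "Rl ws = foldr (\<lambda>w A. Rd w * A) ws 1"

lemma Rl_simps: "Rl [] = 1" "Rl (w # ws) = Rd w * Rl ws"
  by (simp_all add: Rl_def)

lemma Rl_KS: "set ws \<subseteq> dual \<Longrightarrow> u \<in> KS n \<Longrightarrow> Rl ws *\<^sub>V u \<in> KS (length ws + n)"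
  by (induction ws) (simp_all add: Rl_simps bop_apply_simps Rd_KS)

lemma KS_Rl: "KS n = closure (cspan {Rl ws *\<^sub>V L0 h | ws h. set ws \<subseteq> dual \<and> length ws = n})"
proof (induction n)
  case 0
  show ?case unfolding KS_def by (simp add: Tl_simps Rl_simps)
next
  case (Suc n)
  define V where "V = closure (cspan {Rl ws *\<^sub>V L0 h | ws h. set ws \<subseteq> dual \<and> length ws = Suc n})"
  have V: "csubspace V" "closed V" by (simp_all add: V_def csubspace_closure_cspan)
  have "Rd w *\<^sub>V u \<in> V" if w: "w \<in> dual" and u: "u \<in> KS n" for w u
    using u unfolding Suc.IH
  proof (rule bop_image_closure_cspan[OF V, rotated])
    fix x assume "x \<in> {Rl ws *\<^sub>V L0 h | ws h. set ws \<subseteq> dual \<and> length ws = n}"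
    then obtain ws h where x: "x = Rl ws *\<^sub>V L0 h" "set ws \<subseteq> dual" "length ws = n" by blast
    have "Rd w *\<^sub>V x = Rl (w # ws) *\<^sub>V L0 h" by (simp add: x(1) Rl_simps bop_apply_simps)
    moreover have "set (w # ws) \<subseteq> dual" "length (w # ws) = Suc n" using w x by auto
    ultimately show "Rd w *\<^sub>V x \<in> V" unfolding V_def by (intro closure_cspan_superset) blast
  qed
  then have "KS (Suc n) \<subseteq> V" unfolding KS_Suc by (intro closure_cspan_subset[OF _ V]) blast
  moreover have "V \<subseteq> KS (Suc n)"
    unfolding V_def using Rl_KS[OF _ L0_KS] by (intro closure_cspan_subset[OF _ KS]) fastforce
  ultimately show ?case unfolding V_def by blast
qed

lemma Rl_total: "closure (cspan {Rl ws *\<^sub>V L0 h | ws h. set ws \<subseteq> dual}) = UNIV"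
proof (rule closure_cspan_UNIV_I)
  fix z assume z: "\<And>x. x \<in> {Rl ws *\<^sub>V L0 h | ws h. set ws \<subseteq> dual} \<Longrightarrow> cinner x z = 0"
  show "z = 0"
  proof (rule KS_zeroI)
    show "cinner u z = 0" if "u \<in> KS n" for n u
      using that unfolding KS_Rl by (rule cinner_zero_closure_cspan[rotated]) (use z in blast)
  qed
qed

lemma star_Rd_Tl:
  assumes "w \<in> dual" "u \<in> KS (Suc n)"
  shows "star (Rd w) *\<^sub>V Tl xs *\<^sub>V u = Tl xs *\<^sub>V star (Rd w) *\<^sub>V u"
proof (induction xs)
  case (Cons x xs)
  have "Tl xs *\<^sub>V u \<in> KS (Suc (length xs + n))" using Tl_KS[OF assms(2), of xs] by simp
  then show ?case using Cons star_Rd_T[OF assms(1), of "Tl xs *\<^sub>V u"] by (simp add: Tl_simps bop_apply_simps)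
qed (simp add: Tl_simps bop_apply_simps)

lemma star_Rl_Tl:
  assumes "set ws \<subseteq> dual" "u \<in> KS (length ws)"
  shows "star (Rl ws) *\<^sub>V Tl xs *\<^sub>V u = Tl xs *\<^sub>V star (Rl ws) *\<^sub>V u" "star (Rl ws) *\<^sub>V u \<in> KS 0"
proof -
  have "star (Rl ws) *\<^sub>V Tl xs *\<^sub>V u = Tl xs *\<^sub>V star (Rl ws) *\<^sub>V u \<and> star (Rl ws) *\<^sub>V u \<in> KS 0"
    using assms
  proof (induction ws arbitrary: u)
    case (Cons w ws)
    have w: "w \<in> dual" "set ws \<subseteq> dual" "u \<in> KS (Suc (length ws))" using Cons.prems by auto
    have "star (Rd w) *\<^sub>V u \<in> KS (length ws)" by (rule star_Rd_KS[OF w(1,3)])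
    from Cons.IH[OF w(2) this] show ?case
      by (simp add: Rl_simps star_mult bop_apply_simps star_Rd_Tl[OF w(1,3)])
  qed (simp add: Rl_simps bop_apply_simps)
  then show "star (Rl ws) *\<^sub>V Tl xs *\<^sub>V u = Tl xs *\<^sub>V star (Rl ws) *\<^sub>V u" "star (Rl ws) *\<^sub>V u \<in> KS 0" by auto
qed

text \<open>All levels above 0 are spanned by the ranges of the \<open>Rd w\<close>, so the joint
  kernel of the adjoints is H.\<close>

lemma star_Rd_all_zero:
  assumes "\<And>w. w \<in> dual \<Longrightarrow> star (Rd w) *\<^sub>V v = 0"
  shows "v \<in> KS 0"
proof -
  define u where "u = v - proj (KS 0) *\<^sub>V v"
  have "u = 0"
  proof (rule KS_zeroI)
    fix n x assume x: "x \<in> KS n"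
    show "cinner x u = 0"
    proof (cases n)
      case 0
      then show ?thesis unfolding u_def using proj_orthogonal[OF KS, of x 0 v] x by simp
    next
      case (Suc m)
      have "cinner x v = 0"
        using x unfolding Suc KS_Suc
        by (rule cinner_zero_closure_cspan[rotated]) (auto simp: assms simp flip: cinner_star_bop_right)
      moreover have "cinner x (proj (KS 0) *\<^sub>V v) = 0"
        by (rule KS_orthogonal[OF x proj_mem[OF KS]]) (simp add: Suc)
      ultimately show ?thesis by (simp add: u_def cinner_diff_right)
    qed
  qed
  then show ?thesis using proj_mem[OF KS, of 0 v] by (simp add: u_def)
qed

lemma id_tensor_eq:
  assumes \<eta>: "\<eta> \<in> pi_dual \<phi> \<pi> tE"
  shows "id_tensor \<pi> vac ten tE tF \<eta> = (*\<^sub>V) (Rd (\<lambda>h. J (\<eta> h)))"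
proof -
  have w: "(\<lambda>h. J (\<eta> h)) \<in> dual" unfolding dual_eq using \<eta> by blast
  have fold: "foldr (\<lambda>\<xi>. ampliation tF (ten \<xi>)) xs u = Tl xs *\<^sub>V u" for xs u
    by (induction xs) (simp_all add: Tl_simps bop_apply_simps T_ampliation)
  show ?thesis
    unfolding id_tensor_def fold elem_tensor_tensor
  proof (rule the_equality)
    show "bounded_clinear ((*\<^sub>V) (Rd (\<lambda>h. J (\<eta> h)))) \<and>
      (\<forall>xs a h. Rd (\<lambda>h. J (\<eta> h)) *\<^sub>V Tl xs *\<^sub>V L0 (\<pi> a h) = Tl xs *\<^sub>V J (\<eta> (\<pi> a h)))"
      by (simp add: bounded_clinear_bop Rd_Tl[OF w])
    fix V assume V: "bounded_clinear V \<and> (\<forall>xs a h. V (Tl xs *\<^sub>V L0 (\<pi> a h)) = Tl xs *\<^sub>V J (\<eta> (\<pi> a h)))"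
    show "V = (*\<^sub>V) (Rd (\<lambda>h. J (\<eta> h)))"
    proof (rule bounded_clinear_eq_total[OF Tl_total _ bounded_clinear_bop])
      fix x assume "x \<in> {Tl xs *\<^sub>V L0 h | xs h. True}"
      then obtain xs h where "x = Tl xs *\<^sub>V L0 (\<pi> 1 h)" by (auto simp: rep_one)
      then show "V x = Rd (\<lambda>h. J (\<eta> h)) *\<^sub>V x" using V by (simp add: Rd_Tl[OF w])
    qed (use V in blast)
  qed
qed

lemma dual_power_eq:
  assumes "\<eta> \<in> pi_dual \<phi> \<pi> tE"
  shows "dual_power \<pi> vac ten tE tF \<eta> s h = (Rd (\<lambda>h. J (\<eta> h)) ^ s) *\<^sub>V L0 h"
  unfolding dual_power_def id_tensor_eq[OF assms] L0_def
  by (induction s) (simp_all add: bop_apply_simps)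

end

context rep_fock
begin

section \<open>The Hardy algebra as a commutant\<close>

text \<open>One of the two commutation conditions that characterize the Hardy algebra on the induced
  space; the other, commutation with \<open>F.cB b\<close>, says that the operator comes from the
  module.\<close>

definition analytic :: "'k bop \<Rightarrow> bool" where
  "analytic X \<longleftrightarrow> (\<forall>w\<in>dual. X * Rd w = Rd w * X)"

lemma analyticD: "analytic X \<Longrightarrow> w \<in> dual \<Longrightarrow> X * Rd w = Rd w * X"
  by (simp add: analytic_def)

lemma analytic_Rl: "analytic X \<Longrightarrow> set ws \<subseteq> dual \<Longrightarrow> X * Rl ws = Rl ws * X"
proof (induction ws)
  case (Cons w ws)
  have "X * (Rd w * Rl ws) = (Rd w * X) * Rl ws"
    using analyticD[OF Cons.prems(1)] Cons.prems(2) by (simp flip: mult.assoc)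
  also have "\<dots> = Rd w * (Rl ws * X)" using Cons by (simp add: mult.assoc)
  finally show ?case by (simp add: Rl_simps mult.assoc)
qed (simp add: Rl_simps)

lemma analytic_T: "analytic (T \<xi>)"
  unfolding analytic_def using Rd_T by simp

lemma analytic_Left: "analytic (F.Left a)"
  unfolding analytic_def using Rd_Left by simp

lemma analytic_add: "analytic X \<Longrightarrow> analytic Y \<Longrightarrow> analytic (X + Y)"
  unfolding analytic_def by (simp add: distrib_left distrib_right)

lemma analytic_scaleC: "analytic X \<Longrightarrow> analytic (c *\<^sub>C X)"
  unfolding analytic_def by (simp add: scaleC_mult_left scaleC_mult_right)

lemma analytic_mult: "analytic X \<Longrightarrow> analytic Y \<Longrightarrow> analytic (X * Y)"
  unfolding analytic_def by (metis mult.assoc)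

lemma generated_adjointable:
  assumes "Y \<in> Gen"
  shows "Y \<in> adjointable ipF \<and> analytic (F.amp Y)"
  using assms
proof (induction rule: generated_algebra.induct)
  case (generator Y)
  then consider \<xi> where "Y = ten \<xi>" | a where "Y = \<phi>F a" by blast
  then show ?case
  proof cases
    case 1
    then show ?thesis using adjointable_ten analytic_T unfolding T_def by simp
  next
    case 2
    then show ?thesis using F.adjointable_left analytic_Left unfolding F.Left_def by simp
  qed
next
  case (add S T)
  then show ?case by (simp add: F.adjointable_add F.amp_add analytic_add)
next
  case (scale T c)
  then show ?case by (simp add: F.adjointable_scaleC F.amp_scaleC analytic_scaleC)
next
  case (mult S T)
  then have "S \<in> adjointable ipF" "T \<in> adjointable ipF" "analytic (F.amp S * F.amp T)"
    by (simp_all add: analytic_mult)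
  then show ?case by (metis F.adjointable_comp F.amp_comp)
qed

lemma star_Rl_KS_zero: "set ws \<subseteq> dual \<Longrightarrow> u \<in> KS m \<Longrightarrow> m < length ws \<Longrightarrow> star (Rl ws) *\<^sub>V u = 0"
proof (induction ws arbitrary: u m)
  case (Cons w ws)
  have w: "w \<in> dual" "set ws \<subseteq> dual" using Cons.prems by auto
  have "star (Rl ws) *\<^sub>V star (Rd w) *\<^sub>V u = 0"
  proof (cases m)
    case 0
    then show ?thesis using star_Rd_KS_0[OF w(1)] Cons.prems(2) by (simp add: bop_simps)
  next
    case (Suc k)
    then show ?thesis using Cons.IH[OF w(2) star_Rd_KS[OF w(1)]] Cons.prems by simp
  qed
  then show ?case by (simp add: Rl_simps star_mult bop_apply_simps)
qed simp

text \<open>Degrees are not lowered: a vector of degree \<open>n\<close> is generated by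
  \<open>Rl ws\<close> with \<open>n\<close> factors, which \<open>X\<close> commutes with, and the
  adjoint of \<open>Rl ws\<close> annihilates all levels below \<open>n\<close>.\<close>

lemma analytic_upper:
  assumes X: "analytic X" and u: "u \<in> KS m" and v: "v \<in> KS n" and mn: "m < n"
  shows "cinner u (X *\<^sub>V v) = 0"
proof -
  have "cinner v (star X *\<^sub>V u) = 0"
    using v unfolding KS_Rl[of n]
  proof (rule cinner_zero_closure_cspan[rotated])
    fix x assume "x \<in> {Rl ws *\<^sub>V L0 h | ws h. set ws \<subseteq> dual \<and> length ws = n}"
    then obtain ws h where x: "x = Rl ws *\<^sub>V L0 h" "set ws \<subseteq> dual" "length ws = n" by blast
    have "cinner x (star X *\<^sub>V u) = cinner (Rl ws *\<^sub>V X *\<^sub>V L0 h) u"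
      unfolding x(1) cinner_star_bop_right bop_commute_apply[OF analytic_Rl[OF X x(2)]] ..
    also have "\<dots> = cinner (X *\<^sub>V L0 h) (star (Rl ws) *\<^sub>V u)" by (simp add: cinner_star_bop_right)
    also have "\<dots> = 0" using star_Rl_KS_zero[OF x(2) u] x(3) mn by simp
    finally show "cinner x (star X *\<^sub>V u) = 0" .
  qed
  then show ?thesis by (simp add: cinner_star_bop_right cinner_commute[of "X *\<^sub>V v" u])
qed

text \<open>The Toeplitz property: a block of \<open>X\<close> depends only on the first column.
  Writing \<open>v\<close> as \<open>Rl ws\<close> applied to H and moving \<open>Rl ws\<close>
  across \<open>X\<close> and past \<open>Tl xs\<close> reduces the claim to degree 0.\<close>

lemma analytic_shift:
  assumes X: "analytic X" and c: "\<And>h k. cinner (Tl xs *\<^sub>V L0 h) (X *\<^sub>V L0 k) = cinner h (\<pi> c k)"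
    and u: "u \<in> KS n" and v: "v \<in> KS n"
  shows "cinner (Tl xs *\<^sub>V u) (X *\<^sub>V v) = cinner u (F.Left c *\<^sub>V v)"
proof -
  define D where "D = star (Tl xs) * X - F.Left c"
  have "cinner v (star D *\<^sub>V u) = 0"
    using v unfolding KS_Rl[of n]
  proof (rule cinner_zero_closure_cspan[rotated])
    fix x assume "x \<in> {Rl ws *\<^sub>V L0 h | ws h. set ws \<subseteq> dual \<and> length ws = n}"
    then obtain ws k where x: "x = Rl ws *\<^sub>V L0 k" "set ws \<subseteq> dual" "length ws = n" by blast
    have u': "u \<in> KS (length ws)" using u x(3) by simp
    define z where "z = star (Rl ws) *\<^sub>V u"
    have z: "z \<in> KS 0" "star (Rl ws) *\<^sub>V Tl xs *\<^sub>V u = Tl xs *\<^sub>V z"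
      unfolding z_def using star_Rl_Tl[OF x(2) u'] by blast+
    have "cinner (Tl xs *\<^sub>V u) (X *\<^sub>V x) = cinner (Tl xs *\<^sub>V u) (Rl ws *\<^sub>V X *\<^sub>V L0 k)"
      unfolding x(1) bop_commute_apply[OF analytic_Rl[OF X x(2)]] ..
    also have "\<dots> = cinner (Tl xs *\<^sub>V z) (X *\<^sub>V L0 k)" unfolding z(2)[symmetric] cinner_star_bop ..
    also have "\<dots> = cinner (Tl xs *\<^sub>V L0 (adj L0 z)) (X *\<^sub>V L0 k)" using KS_0_L0[OF z(1)] by simp
    also have "\<dots> = cinner (L0 (adj L0 z)) (F.Left c *\<^sub>V L0 k)" unfolding c Left_L0 cinner_L0 ..
    also have "\<dots> = cinner z (F.Left c *\<^sub>V L0 k)" using KS_0_L0[OF z(1)] by simp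
    also have "\<dots> = cinner u (Rl ws *\<^sub>V F.Left c *\<^sub>V L0 k)" unfolding z_def cinner_star_bop ..
    also have "\<dots> = cinner u (F.Left c *\<^sub>V x)"
      unfolding x(1) bop_commute_apply[OF analytic_Rl[OF analytic_Left x(2)]] ..
    finally have "cinner u (D *\<^sub>V x) = 0"
      unfolding D_def by (simp add: bop_apply_simps cinner_diff_right cinner_star_bop_right)
    then show "cinner x (star D *\<^sub>V u) = 0"
      by (simp add: cinner_star_bop_right cinner_commute[of "D *\<^sub>V x" u])
  qed
  then have "cinner u (D *\<^sub>V v) = 0" by (simp add: cinner_star_bop_right cinner_commute[of "D *\<^sub>V v" u])
  then show ?thesis unfolding D_def by (simp add: bop_apply_simps cinner_diff_right cinner_star_bop_right)
qed

text \<open>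
  Commutation with \<open>R\<^sub>w\<close> is not visibly an ultraweakly closed condition on elements of \<open>\<L>(F)\<close>, but the
  following equivalent conditions are, since they only involve inner products of elements of \<open>F\<close>.
\<close>

lemma analyticI:
  assumes up: "\<And>m n u v. m < n \<Longrightarrow> u \<in> KS m \<Longrightarrow> v \<in> KS n \<Longrightarrow> cinner u (X *\<^sub>V v) = 0"
    and sh: "\<And>xs n u v. u \<in> KS n \<Longrightarrow> v \<in> KS n \<Longrightarrow> cinner (Tl xs *\<^sub>V u) (X *\<^sub>V v) = cinner u (F.Left (c xs) *\<^sub>V v)"
  shows "analytic X"
  unfolding analytic_def
proof (intro ballI KS_bop_eqI KS_ext)
  fix w n u m y assume w: "w \<in> dual" and u: "u \<in> KS n" and y: "y \<in> KS m"
  note Rd_u = Rd_KS[OF w u]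
  have "cinner y (X *\<^sub>V Rd w *\<^sub>V u) = cinner (star (Rd w) *\<^sub>V y) (X *\<^sub>V u)"
  proof (cases "m \<le> n")
    case True
    have "cinner (star (Rd w) *\<^sub>V y) (X *\<^sub>V u) = 0"
    proof (cases m)
      case 0
      then show ?thesis using star_Rd_KS_0[OF w] y by simp
    next
      case (Suc k)
      then show ?thesis using up[OF _ star_Rd_KS[OF w] u, of k y] y True by simp
    qed
    then show ?thesis using up[OF _ y Rd_u] True by simp
  next
    case False
    have "cinner y ((X * Rd w - Rd w * X) *\<^sub>V u) = 0"
      using y unfolding KS_def
    proof (rule cinner_zero_closure_cspan[rotated])
      fix x assume "x \<in> {Tl xs *\<^sub>V L0 h | xs h. length xs = m}"
      then obtain zs h where x: "x = Tl zs *\<^sub>V L0 h" "length zs = m" by blast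
      \<comment> \<open>Keeping \<open>Suc n\<close> letters in \<open>y'\<close> places it on the
        level of \<open>Rd w u\<close>, and leaves one letter that the adjoint of
        \<open>Rd w\<close> can remove without touching \<open>xs\<close>.\<close>
      define xs ys where "xs = take (m - Suc n) zs" "ys = drop (m - Suc n) zs"
      define y' where "y' = Tl ys *\<^sub>V L0 h"
      have y': "y' \<in> KS (Suc n)" unfolding y'_def by (rule KS_I) (use x(2) False in \<open>simp add: xs_ys_def\<close>)
      have xy: "x = Tl xs *\<^sub>V y'"
        unfolding x(1) y'_def xs_ys_def by (metis append_take_drop_id Tl_append bop_apply_simps(6))
      have "cinner x (X *\<^sub>V Rd w *\<^sub>V u) = cinner y' (F.Left (c xs) *\<^sub>V Rd w *\<^sub>V u)"
        unfolding xy by (rule sh[OF y' Rd_u])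
      also have "\<dots> = cinner y' (Rd w *\<^sub>V F.Left (c xs) *\<^sub>V u)"
        unfolding bop_commute_apply[OF Rd_Left[OF w]] ..
      also have "\<dots> = cinner (star (Rd w) *\<^sub>V y') (F.Left (c xs) *\<^sub>V u)" unfolding cinner_star_bop ..
      also have "\<dots> = cinner (Tl xs *\<^sub>V star (Rd w) *\<^sub>V y') (X *\<^sub>V u)"
        by (rule sh[OF star_Rd_KS[OF w y'] u, symmetric])
      also have "\<dots> = cinner (star (Rd w) *\<^sub>V x) (X *\<^sub>V u)" unfolding xy star_Rd_Tl[OF w y'] ..
      finally show "cinner x ((X * Rd w - Rd w * X) *\<^sub>V u) = 0"
        by (simp add: bop_apply_simps cinner_diff_right cinner_star_bop)
    qed
    then show ?thesis by (simp add: bop_apply_simps cinner_diff_right cinner_star_bop)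
  qed
  then show "cinner y ((X * Rd w) *\<^sub>V u) = cinner y ((Rd w * X) *\<^sub>V u)"
    by (simp add: bop_apply_simps cinner_star_bop)
qed

lemma elem_tensor_KS: "tF (elem_tensor ten vac xs a) h \<in> KS (length xs)"
  unfolding elem_tensor_tensor by (rule KS_I) simp

lemma Tl_L0: "Tl xs *\<^sub>V L0 h = tF (elem_tensor ten vac xs 1) h"
  by (simp add: elem_tensor_tensor rep_one)

lemma foldr_ten_tensor: "tF (foldr ten xs \<zeta>) h = Tl xs *\<^sub>V tF \<zeta> h"
  by (induction xs) (simp_all add: Tl_simps bop_apply_simps flip: T_tensor)

lemma topspace_ultraweak: "topspace (ultraweak_topology P ipF) = adjointable ipF"
proof -
  have "adjointable_functionals P ipF \<noteq> {}" using F.adjointable_functional_single[OF predual_zero] by blast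
  then show ?thesis unfolding ultraweak_topology_def by (simp add: topspace_weak_topology)
qed

lemma continuous_ultraweak: "\<omega> \<in> P \<Longrightarrow> continuous_map (ultraweak_topology P ipF) euclidean (\<lambda>Y. \<omega> (ipF x (Y y)))"
  unfolding ultraweak_topology_def
  by (intro continuous_map_from_subtopology continuous_map_weak_topology F.adjointable_functional_single)

lemma hardy_adjointable: "Y \<in> Hardy \<Longrightarrow> Y \<in> adjointable ipF"
  unfolding hardy_algebra_def topspace_ultraweak[symmetric] by (rule in_mono[THEN mp, OF closure_of_subset_topspace])

lemma hardy_functional_eq:
  fixes f g :: "('f \<Rightarrow> 'f) \<Rightarrow> complex"
  assumes Y: "Y \<in> Hardy"
    and f: "continuous_map (ultraweak_topology P ipF) euclidean f" and g: "continuous_map (ultraweak_topology P ipF) euclidean g"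
    and eq: "\<And>Z. Z \<in> Gen \<Longrightarrow> f Z = g Z"
  shows "f Y = g Y"
proof -
  let ?C = "{Z \<in> topspace (ultraweak_topology P ipF). f Z - g Z \<in> {0}}"
  have "closedin (ultraweak_topology P ipF) ?C"
    by (rule closedin_continuous_map_preimage[OF continuous_map_diff[OF f g]]) simp
  moreover have "Gen \<subseteq> ?C"
    using generated_adjointable eq by (auto simp: topspace_ultraweak)
  ultimately have "Y \<in> ?C" using Y closure_of_minimal unfolding hardy_algebra_def by blast
  then show ?thesis by simp
qed

lemma hardy_upper:
  assumes Y: "Y \<in> Hardy" and l: "length xs < length ys"
  shows "ipF (elem_tensor ten vac xs a) (Y (elem_tensor ten vac ys b)) = 0"
proof (rule predual_separates)
  fix \<omega> assume \<omega>: "\<omega> \<in> P"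
  have "\<omega> (ipF (elem_tensor ten vac xs a) (Y (elem_tensor ten vac ys b))) = (\<lambda>_. \<omega> 0) Y"
  proof (rule hardy_functional_eq[OF Y continuous_ultraweak[OF \<omega>]])
    fix Z assume "Z \<in> Gen"
    note Z = generated_adjointable[OF this]
    have "ipF (elem_tensor ten vac xs a) (Z (elem_tensor ten vac ys b)) = 0"
    proof (rule rep_eqI)
      fix h k
      show "cinner h (\<pi> (ipF (elem_tensor ten vac xs a) (Z (elem_tensor ten vac ys b))) k) = cinner h (\<pi> 0 k)"
        using analytic_upper[OF conjunct2[OF Z] elem_tensor_KS elem_tensor_KS l, of a h b k]
        unfolding F.amp_tensor[OF conjunct1[OF Z]] F.cinner_tensor
        by (simp add: R.psi_zero bop_apply_simps flip: Rep_apply)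
    qed
    then show "\<omega> (ipF (elem_tensor ten vac xs a) (Z (elem_tensor ten vac ys b))) = \<omega> 0" by simp
  qed simp
  then show "\<omega> (ipF (elem_tensor ten vac xs a) (Y (elem_tensor ten vac ys b))) = \<omega> 0" .
qed

text \<open>On the right \<open>Y\<close> enters only through the coefficient inside the left
  action; normality of that action makes the right side a weak* continuous functional of
  \<open>Y\<close> too, so the identity extends from the generated algebra to its closure.\<close>

lemma hardy_shift:
  assumes Y: "Y \<in> Hardy" and l: "length ys = length zs"
  shows "ipF (foldr ten xs (elem_tensor ten vac ys a)) (Y (elem_tensor ten vac zs b))
    = ipF (elem_tensor ten vac ys a) (\<phi>F (ipF (foldr ten xs (vac 1)) (Y (vac 1))) (elem_tensor ten vac zs b))"
proof (rule predual_separates)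
  fix \<omega> assume \<omega>: "\<omega> \<in> P"
  show "\<omega> (ipF (foldr ten xs (elem_tensor ten vac ys a)) (Y (elem_tensor ten vac zs b)))
    = \<omega> (ipF (elem_tensor ten vac ys a) (\<phi>F (ipF (foldr ten xs (vac 1)) (Y (vac 1))) (elem_tensor ten vac zs b)))"
  proof (rule hardy_functional_eq[OF Y continuous_ultraweak[OF \<omega>] continuous_ultraweak[OF F.left_functional_in_predual[OF \<omega>]]])
    fix Z assume "Z \<in> Gen"
    note Z = generated_adjointable[OF this]
    define c where "c = ipF (foldr ten xs (vac 1)) (Z (vac 1))"
    have c: "cinner (Tl xs *\<^sub>V L0 h) (F.amp Z *\<^sub>V L0 k) = cinner h (\<pi> c k)" for h k
      unfolding L0_def foldr_ten_tensor[symmetric] F.amp_tensor[OF conjunct1[OF Z]] F.cinner_tensor c_def ..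
    have "ipF (foldr ten xs (elem_tensor ten vac ys a)) (Z (elem_tensor ten vac zs b))
      = ipF (elem_tensor ten vac ys a) (\<phi>F c (elem_tensor ten vac zs b))"
    proof (rule rep_eqI)
      fix h k
      show "cinner h (\<pi> (ipF (foldr ten xs (elem_tensor ten vac ys a)) (Z (elem_tensor ten vac zs b))) k)
        = cinner h (\<pi> (ipF (elem_tensor ten vac ys a) (\<phi>F c (elem_tensor ten vac zs b))) k)"
        using analytic_shift[OF conjunct2[OF Z] c elem_tensor_KS elem_tensor_KS[of zs b k, folded l], of a h]
        unfolding F.amp_tensor[OF conjunct1[OF Z]] foldr_ten_tensor[symmetric] F.Left_tensor F.cinner_tensor .
    qed
    then show "\<omega> (ipF (foldr ten xs (elem_tensor ten vac ys a)) (Z (elem_tensor ten vac zs b)))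
      = \<omega> (ipF (elem_tensor ten vac ys a) (\<phi>F (ipF (foldr ten xs (vac 1)) (Z (vac 1))) (elem_tensor ten vac zs b)))"
      unfolding c_def by simp
  qed
qed

theorem hardy_analytic:
  assumes Y: "Y \<in> Hardy"
  shows "analytic (F.amp Y)"
proof (rule analyticI)
  note aY = F.amp_tensor[OF hardy_adjointable[OF Y]]
  have bi: "cinner u (D *\<^sub>V v) = 0"
    if D: "\<And>xs ys h k. length xs = m \<Longrightarrow> length ys = n \<Longrightarrow> cinner (Tl xs *\<^sub>V L0 h) (D *\<^sub>V Tl ys *\<^sub>V L0 k) = 0"
      and u: "u \<in> KS m" and v: "v \<in> KS n" for D :: "'k bop" and m n u v
    using u unfolding KS_def
  proof (rule cinner_zero_closure_cspan[rotated])
    fix x assume "x \<in> {Tl xs *\<^sub>V L0 h | xs h. length xs = m}"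
    then obtain xs h where x: "x = Tl xs *\<^sub>V L0 h" "length xs = m" by blast
    have "cinner v (star D *\<^sub>V x) = 0"
      using v unfolding KS_def
    proof (rule cinner_zero_closure_cspan[rotated])
      fix y assume "y \<in> {Tl xs *\<^sub>V L0 h | xs h. length xs = n}"
      then obtain ys k where y: "y = Tl ys *\<^sub>V L0 k" "length ys = n" by blast
      show "cinner y (star D *\<^sub>V x) = 0"
        using D[OF x(2) y(2), of h k] unfolding x y cinner_star_bop_right
        by (simp add: cinner_commute[of "D *\<^sub>V Tl ys *\<^sub>V L0 k"])
    qed
    then show "cinner x (D *\<^sub>V v) = 0" by (simp add: cinner_star_bop_right cinner_commute[of "D *\<^sub>V v" x])
  qed
  show "cinner u (F.amp Y *\<^sub>V v) = 0" if "m < n" and u: "u \<in> KS m" and v: "v \<in> KS n" for m n u v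
  proof (rule bi[OF _ u v])
    fix xs ys h k assume l: "length (xs::'e list) = m" "length (ys::'e list) = n"
    show "cinner (Tl xs *\<^sub>V L0 h) (F.amp Y *\<^sub>V Tl ys *\<^sub>V L0 k) = 0"
      using hardy_upper[OF Y, of xs ys 1 1] \<open>m < n\<close> l unfolding Tl_L0 aY F.cinner_tensor
      by (simp add: R.psi_zero bop_apply_simps flip: Rep_apply)
  qed
  show "cinner (Tl xs *\<^sub>V u) (F.amp Y *\<^sub>V v) = cinner u (F.Left (ipF (foldr ten xs (vac 1)) (Y (vac 1))) *\<^sub>V v)"
    if u: "u \<in> KS n" and v: "v \<in> KS n" for xs n u v
  proof -
    let ?c = "ipF (foldr ten xs (vac 1)) (Y (vac 1))"
    have "cinner u ((star (Tl xs) * F.amp Y - F.Left ?c) *\<^sub>V v) = 0"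
    proof (rule bi[OF _ u v])
      fix ys zs h k assume l: "length (ys::'e list) = n" "length (zs::'e list) = n"
      have "cinner (Tl xs *\<^sub>V Tl ys *\<^sub>V L0 h) (F.amp Y *\<^sub>V Tl zs *\<^sub>V L0 k)
        = cinner (Tl ys *\<^sub>V L0 h) (F.Left ?c *\<^sub>V Tl zs *\<^sub>V L0 k)"
        using hardy_shift[OF Y, of ys zs xs 1 1] l
        unfolding Tl_L0 foldr_ten_tensor[symmetric] aY F.Left_tensor F.cinner_tensor by simp
      then show "cinner (Tl ys *\<^sub>V L0 h) ((star (Tl xs) * F.amp Y - F.Left ?c) *\<^sub>V Tl zs *\<^sub>V L0 k) = 0"
        by (simp add: bop_apply_simps cinner_diff_right cinner_star_bop_right)
    qed
    then show ?thesis by (simp add: bop_apply_simps cinner_diff_right cinner_star_bop_right)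
  qed
qed

end

section \<open>Bounded weak operator limits\<close>

lemma tendsto_zero_total:
  fixes f :: "'i \<Rightarrow> 'a::complex_normed_vector \<Rightarrow> 'b::complex_normed_vector"
  assumes X: "closure (cspan X) = UNIV" and f: "\<And>i. bounded_clinear (f i)" "\<And>i u. norm (f i u) \<le> r * norm u"
    and z: "\<And>x. x \<in> X \<Longrightarrow> ((\<lambda>i. f i x) \<longlongrightarrow> 0) F"
  shows "((\<lambda>i. f i u) \<longlongrightarrow> 0) F"
proof -
  let ?S = "{u. ((\<lambda>i. f i u) \<longlongrightarrow> 0) F}"
  have "csubspace ?S"
  proof (rule complex_vector.subspaceI; unfold mem_Collect_eq)
    show "((\<lambda>i. f i 0) \<longlongrightarrow> 0) F" by (simp add: bounded_clinearD(4)[OF f(1)])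
    show "((\<lambda>i. f i (x + y)) \<longlongrightarrow> 0) F" if "((\<lambda>i. f i x) \<longlongrightarrow> 0) F" "((\<lambda>i. f i y) \<longlongrightarrow> 0) F" for x y
      using tendsto_add[OF that] by (simp add: bounded_clinearD(2)[OF f(1)])
    show "((\<lambda>i. f i (c *\<^sub>C x)) \<longlongrightarrow> 0) F" if "((\<lambda>i. f i x) \<longlongrightarrow> 0) F" for c x
      using tendsto_scaleC[OF that, of c] linear_0[OF bounded_linear.linear[OF bounded_linear_scaleC]]
      by (simp add: bounded_clinearD(3)[OF f(1)])
  qed
  moreover have "closed ?S"
    unfolding closed_limpt islimpt_approachable
  proof (intro allI impI CollectI)
    fix u assume u: "\<forall>e>0. \<exists>x'\<in>?S. x' \<noteq> u \<and> dist x' u < e"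
    show "((\<lambda>i. f i u) \<longlongrightarrow> 0) F"
    proof (rule tendstoI)
      fix e :: real assume e: "e > 0"
      define d where "d = e / (2 * (\<bar>r\<bar> + 1))"
      have "d > 0" unfolding d_def using e by simp
      then obtain x where x: "((\<lambda>i. f i x) \<longlongrightarrow> 0) F" "dist x u < d" using u by blast
      have small: "norm (f i (u - x)) \<le> e / 2" for i
      proof -
        have "norm (f i (u - x)) \<le> (\<bar>r\<bar> + 1) * norm (u - x)"
          by (rule order_trans[OF f(2) mult_right_mono]) auto
        also have "\<dots> \<le> (\<bar>r\<bar> + 1) * d"
          by (rule mult_left_mono) (use x(2) in \<open>simp_all add: dist_norm norm_minus_commute\<close>)
        also have "\<dots> = e / 2" unfolding d_def by (simp add: field_simps)
        finally show ?thesis .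
      qed
      have split: "f i u = f i (u - x) + f i x" for i by (simp add: bounded_clinearD(5)[OF f(1)])
      have "\<forall>\<^sub>F i in F. dist (f i x) 0 < e / 2" by (rule tendstoD[OF x(1)]) (use e in simp)
      then show "\<forall>\<^sub>F i in F. dist (f i u) 0 < e"
      proof (elim eventually_mono)
        fix i assume "dist (f i x) 0 < e / 2"
        then have "norm (f i (u - x) + f i x) < e"
          using norm_triangle_ineq[of "f i (u - x)" "f i x"] small[of i] by simp
        then show "dist (f i u) 0 < e" using split[of i] by simp
      qed
    qed
  qed
  ultimately have "closure (cspan X) \<subseteq> ?S" using z by (intro closure_cspan_subset) auto
  then show ?thesis using X by blast
qed

lemma weak_tendsto_total:
  fixes A :: "'i \<Rightarrow> 'a::chilbert_space bop"
  assumes X: "closure (cspan X) = UNIV" and Y: "closure (cspan Y) = UNIV" and r: "\<And>i. norm (A i) \<le> r"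
    and lim: "\<And>x y. x \<in> X \<Longrightarrow> y \<in> Y \<Longrightarrow> ((\<lambda>i. cinner x (A i *\<^sub>V y)) \<longlongrightarrow> cinner x (B *\<^sub>V y)) F"
  shows "((\<lambda>i. cinner u (A i *\<^sub>V v)) \<longlongrightarrow> cinner u (B *\<^sub>V v)) F"
proof -
  define D where "D i = A i - B" for i
  have D: "norm (D i *\<^sub>V x) \<le> (r + norm B) * norm x" for i x
    unfolding D_def
    by (intro order_trans[OF norm_bop_apply] mult_right_mono order_trans[OF norm_triangle_ineq4] add_right_mono r) simp
  have "((\<lambda>i. cinner x (D i *\<^sub>V v)) \<longlongrightarrow> 0) F" if x: "x \<in> X" for x
  proof (rule tendsto_zero_total[OF Y])
    show "bounded_clinear (\<lambda>v. cinner x (D i *\<^sub>V v))" for i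
      by (rule bounded_clinear_compose[OF bounded_clinear_cinner_right bounded_clinear_bop])
    show "norm (cinner x (D i *\<^sub>V u)) \<le> norm x * (r + norm B) * norm u" for i u
      using order_trans[OF norm_cinner_le mult_left_mono[OF D norm_ge_zero]] by (simp add: mult.assoc)
    show "((\<lambda>i. cinner x (D i *\<^sub>V y)) \<longlongrightarrow> 0) F" if "y \<in> Y" for y
      using tendsto_diff[OF lim[OF x that] tendsto_const[of "cinner x (B *\<^sub>V y)"]]
      by (simp add: D_def bop_apply_simps cinner_diff_right)
  qed
  then have 1: "((\<lambda>i. cinner v (star (D i) *\<^sub>V x)) \<longlongrightarrow> 0) F" if "x \<in> X" for x
    using tendsto_cnj[of "\<lambda>i. cinner x (D i *\<^sub>V v)" 0 F] that
    by (simp add: cinner_star_bop_right flip: cinner_commute)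
  have "((\<lambda>i. cinner v (star (D i) *\<^sub>V u)) \<longlongrightarrow> 0) F"
  proof (rule tendsto_zero_total[OF X _ _ 1])
    show "bounded_clinear (\<lambda>u. cinner v (star (D i) *\<^sub>V u))" for i
      by (rule bounded_clinear_compose[OF bounded_clinear_cinner_right bounded_clinear_bop])
    show "norm (cinner v (star (D i) *\<^sub>V u)) \<le> (r + norm B) * norm v * norm u" for i u
      unfolding cinner_star_bop_right
      by (intro order_trans[OF norm_cinner_le] mult_right_mono D) simp
  qed
  then have "((\<lambda>i. cinner u (D i *\<^sub>V v)) \<longlongrightarrow> 0) F"
    using tendsto_cnj[of "\<lambda>i. cinner v (star (D i) *\<^sub>V u)" 0 F]
    by (simp add: cinner_star_bop_right flip: cinner_commute)
  from tendsto_add[OF this tendsto_const[of "cinner u (B *\<^sub>V v)"]] show ?thesis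
    by (simp add: D_def bop_apply_simps cinner_diff_right)
qed

lemma norm_ell2_map_le: "norm (ell2_map (T :: 'a::chilbert_space bop)) \<le> norm T"
proof (rule norm_bop_bound)
  fix x :: "'a ell2"
  show "norm (ell2_map T *\<^sub>V x) \<le> norm T * norm x"
  proof (rule norm_ell2_le)
    fix N
    have "L2_set (\<lambda>n. norm (ell2_nth (ell2_map T *\<^sub>V x) n)) {..<N} \<le> L2_set (\<lambda>n. norm T * norm (ell2_nth x n)) {..<N}"
      by (rule L2_set_mono) (simp_all add: ell2_nth_map norm_bop_apply)
    also have "\<dots> = norm T * L2_set (\<lambda>n. norm (ell2_nth x n)) {..<N}" by (rule L2_set_right_distrib[symmetric]) simp
    also have "\<dots> \<le> norm T * norm x" by (intro mult_left_mono norm_ell2_ge) simp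
    finally show "L2_set (\<lambda>n. norm (ell2_nth (ell2_map T *\<^sub>V x) n)) {..<N} \<le> norm T * norm x" .
  qed
qed simp

context rep_fock
begin

lemma hardy_amp_commute: "X \<in> F.amp ` Hardy \<Longrightarrow> b \<in> RC \<Longrightarrow> X * F.cB b = F.cB b * X"
  using F.amp_cB hardy_adjointable by blast

lemma norm_adjointable_le:
  assumes Y: "Y \<in> adjointable ipF"
  shows "norm (Y x) \<le> norm (F.amp Y) * norm x"
proof (rule F.norm_le_tensor)
  show "norm (tF (Y x) h) \<le> norm (F.amp Y) * norm x * norm h" for h
    unfolding F.amp_tensor[OF Y, symmetric] mult.assoc
    by (intro order_trans[OF norm_bop_apply] mult_left_mono F.norm_tensor_le) auto
qed simp

text \<open>Each term of the series converges because the elements of M involved form a bounded net;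
  the bound by \<open>r\<close> times a summable sequence allows limit and sum to be
  exchanged.\<close>

lemma adjointable_functional_tendsto:
  assumes Y: "\<And>i. Y i \<in> adjointable ipF" "Z \<in> adjointable ipF" and r: "\<And>i. norm (F.amp (Y i)) \<le> r" and F: "F \<noteq> bot"
    and lim: "\<And>u v. ((\<lambda>i. cinner u (F.amp (Y i) *\<^sub>V v)) \<longlongrightarrow> cinner u (F.amp Z *\<^sub>V v)) F"
    and g: "g \<in> adjointable_functionals P ipF"
  shows "((\<lambda>i. g (Y i)) \<longlongrightarrow> g Z) F"
proof -
  obtain \<omega> x y where g_eq: "g = (\<lambda>T. \<Sum>n. \<omega> n (ipF (x n) (T (y n))))" and \<omega>: "\<And>n. \<omega> n \<in> P"
    and sm: "summable (\<lambda>n::nat. onorm (\<omega> n) * norm (x n) * norm (y n))"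
    using g unfolding adjointable_functionals_def by blast
  have bd: "norm (ipF (x n) (Y i (y n))) \<le> r * (norm (x n) * norm (y n))" for n i
  proof -
    have "norm (ipF (x n) (Y i (y n))) \<le> norm (x n) * (r * norm (y n))"
      by (intro order_trans[OF F.norm_ip_le] mult_left_mono order_trans[OF norm_adjointable_le[OF Y(1)]] mult_right_mono r) auto
    then show ?thesis by (simp add: mult_ac)
  qed
  have "((\<lambda>i. \<omega> n (ipF (x n) (Y i (y n)))) \<longlongrightarrow> \<omega> n (ipF (x n) (Z (y n)))) F" for n
  proof (rule R.predual_tendsto[OF bd _ \<omega>])
    fix h k
    show "((\<lambda>i. cinner h (Rep (ipF (x n) (Y i (y n))) *\<^sub>V k)) \<longlongrightarrow> cinner h (Rep (ipF (x n) (Z (y n))) *\<^sub>V k)) F"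
      using lim[of "tF (x n) h" "tF (y n) k"]
      unfolding Rep_apply F.amp_tensor[OF Y(1)] F.amp_tensor[OF Y(2)] F.cinner_tensor .
  qed
  moreover have "cmod (\<omega> n (ipF (x n) (Y i (y n)))) \<le> r * (onorm (\<omega> n) * norm (x n) * norm (y n))" for n i
  proof -
    have "cmod (\<omega> n (ipF (x n) (Y i (y n)))) \<le> onorm (\<omega> n) * (r * (norm (x n) * norm (y n)))"
      by (intro order_trans[OF predual_linear(3)[OF \<omega>]] mult_left_mono bd predual_linear(4)[OF \<omega>])
    then show ?thesis by (simp add: mult_ac)
  qed
  ultimately show ?thesis
    unfolding g_eq
    by (intro tannerys_theorem[OF _ _ summable_mult[OF sm, of r] F, THEN conjunct2, THEN conjunct2] always_eventually)
       auto
qed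

text \<open>The limit commutes with I \<otimes> \<pi>(M)', so it comes from an adjointable
  \<open>Z\<close>. Boundedness then upgrades weak operator convergence to convergence in the
  topology that defines the Hardy algebra. The limit needs to be checked on total sets only.\<close>

lemma hardy_limit:
  assumes A: "\<And>i. A i \<in> F.amp ` Hardy" and r: "\<And>i. norm (A i) \<le> r" and F: "F \<noteq> bot"
    and X: "closure (cspan X) = UNIV" and Y: "closure (cspan Y) = UNIV"
    and lim: "\<And>x y. x \<in> X \<Longrightarrow> y \<in> Y \<Longrightarrow> ((\<lambda>i. cinner x (A i *\<^sub>V y)) \<longlongrightarrow> cinner x (B *\<^sub>V y)) F"
  shows "B \<in> F.amp ` Hardy"
proof -
  note wot = weak_tendsto_total[OF X Y r lim]
  have "B * F.cB b = F.cB b * B" if b: "b \<in> RC" for b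
  proof (rule bop_eqI_cinner)
    fix u v
    have "((\<lambda>i. cinner u (A i *\<^sub>V F.cB b *\<^sub>V v)) \<longlongrightarrow> cinner u (F.cB b *\<^sub>V B *\<^sub>V v)) F"
      using wot[of "star (F.cB b) *\<^sub>V u" v] unfolding bop_commute_apply[OF hardy_amp_commute[OF A b]] cinner_star_bop .
    from tendsto_unique[OF F wot this] show "cinner u ((B * F.cB b) *\<^sub>V v) = cinner u ((F.cB b * B) *\<^sub>V v)"
      by (simp add: bop_apply_simps cinner_star_bop)
  qed
  then obtain Z where Z: "Z \<in> adjointable ipF" "F.amp Z = B" by (rule F.commutant_cB) blast
  obtain W where W: "\<And>i. W i \<in> Hardy" "\<And>i. A i = F.amp (W i)"
    using A unfolding image_iff by metis
  have "limitin (weak_topology (adjointable_functionals P ipF)) W Z F"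
  proof (rule limitin_weak_topology)
    show "adjointable_functionals P ipF \<noteq> {}" using F.adjointable_functional_single[OF predual_zero] by blast
    show "((\<lambda>i. g (W i)) \<longlongrightarrow> g Z) F" if "g \<in> adjointable_functionals P ipF" for g
      by (rule adjointable_functional_tendsto[OF hardy_adjointable[OF W(1)] Z(1) _ F _ that])
         (use r wot in \<open>simp_all add: Z(2) flip: W(2)\<close>)
  qed
  then have "limitin (ultraweak_topology P ipF) W Z F"
    unfolding ultraweak_topology_def limitin_subtopology using Z(1) hardy_adjointable[OF W(1)] by simp
  then have "Z \<in> Hardy"
    unfolding hardy_algebra_def
    by (rule limitin_closedin[OF _ closedin_closure_of _ F])
       (use W(1) in \<open>simp add: hardy_algebra_def\<close>)
  then show ?thesis using Z(2) by blast
qed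

end

section \<open>Cesaro means and their approximation by polynomials\<close>

lemma star_sum: "star (\<Sum>i\<in>A. f i) = (\<Sum>i\<in>A. star (f i :: 'a::cstar_algebra))"
  by (induction A rule: infinite_finite_induct) (simp_all add: star_add)

lemma sum_bop_apply: "(\<Sum>i\<in>A. f i) *\<^sub>V (x :: 'a::chilbert_space) = (\<Sum>i\<in>A. f i *\<^sub>V x)"
  by (rule linear_sum[OF bounded_linear.linear[OF bounded_linear_bop_left]])

lemma bop_apply_sum: "T *\<^sub>V (\<Sum>i\<in>A. f i) = (\<Sum>i\<in>A. T *\<^sub>V (f i :: 'a::chilbert_space))"
  by (rule bounded_clinear_sum[OF bounded_clinear_bop])

context rep_fock
begin

lemma generated_amp:
  defines "G \<equiv> F.amp ` Gen"
  shows gen_T: "T \<xi> \<in> G" and gen_Left: "F.Left a \<in> G" and gen_add: "X \<in> G \<Longrightarrow> Y \<in> G \<Longrightarrow> X + Y \<in> G"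
    and gen_scaleC: "X \<in> G \<Longrightarrow> c *\<^sub>C X \<in> G" and gen_mult: "X \<in> G \<Longrightarrow> Y \<in> G \<Longrightarrow> X * Y \<in> G"
proof -
  show "T \<xi> \<in> G" unfolding G_def T_def by (intro imageI generated_algebra.generator) blast
  show "F.Left a \<in> G" unfolding G_def F.Left_def by (intro imageI generated_algebra.generator) blast
  note ad = conjunct1[OF generated_adjointable]
  show "X + Y \<in> G" if "X \<in> G" "Y \<in> G"
    using that unfolding G_def
    by (elim imageE) (simp add: F.amp_add[OF ad ad, symmetric] imageI generated_algebra.add)
  show "c *\<^sub>C X \<in> G" if "X \<in> G"
    using that unfolding G_def
    by (elim imageE) (simp add: F.amp_scaleC[OF ad, symmetric] imageI generated_algebra.scale)
  show "X * Y \<in> G" if "X \<in> G" "Y \<in> G"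
    using that unfolding G_def
    by (elim imageE) (simp only: F.amp_comp[OF ad ad, symmetric] imageI generated_algebra.mult)
qed

lemma gen_Tl: "Tl xs \<in> F.amp ` Gen"
proof (induction xs)
  case Nil
  show ?case using gen_Left[of 1] by (simp add: Tl_simps F.L.psi_one)
qed (simp add: Tl_simps gen_mult gen_T)

lemma gen_sum:
  assumes "\<And>i. i \<in> A \<Longrightarrow> f i \<in> F.amp ` Gen"
  shows "(\<Sum>i\<in>A. f i) \<in> F.amp ` Gen"
  using assms
proof (induction A rule: infinite_finite_induct)
  case (insert i A)
  then show ?case by (simp add: gen_add)
qed (use gen_Left[of 0] in \<open>simp_all add: F.L.psi_zero\<close>)

lemma gen_hardy:
  assumes "X \<in> F.amp ` Gen"
  shows "X \<in> F.amp ` Hardy"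
proof -
  have "Gen \<subseteq> Hardy"
    unfolding hardy_algebra_def
    by (rule closure_of_subset) (use generated_adjointable in \<open>auto simp: topspace_ultraweak\<close>)
  then show ?thesis using assms by blast
qed

lemma proj_KS_0: "proj (KS 0) *\<^sub>V u = L0 (adj L0 u)"
proof -
  have "adj L0 (proj (KS 0) *\<^sub>V u) = adj L0 u"
  proof (rule cinner_ext)
    fix h
    have "cinner (L0 h) (u - proj (KS 0) *\<^sub>V u) = 0" by (rule proj_orthogonal[OF KS L0_KS])
    then show "cinner h (adj L0 (proj (KS 0) *\<^sub>V u)) = cinner h (adj L0 u)"
      by (simp add: cinner_adj_right[OF bounded_clinear_L0] cinner_diff_right)
  qed
  then show ?thesis using KS_0_L0[OF proj_mem[OF KS], of u] by simp
qed

lemma adj_L0_cB: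
  assumes b: "b \<in> RC"
  shows "adj L0 (F.cB b *\<^sub>V u) = b *\<^sub>V adj L0 u"
proof (rule cinner_ext)
  fix h
  have "cinner h (adj L0 (F.cB b *\<^sub>V u)) = cinner (F.cB (star b) *\<^sub>V L0 h) u"
    by (simp add: cinner_adj_right[OF bounded_clinear_L0] F.cB_star[OF b] cinner_star_bop)
  also have "\<dots> = cinner h (b *\<^sub>V adj L0 u)"
    by (simp add: cB_L0[OF RC_star[OF b]] cinner_star_bop flip: cinner_adj_right[OF bounded_clinear_L0])
  finally show "cinner h (adj L0 (F.cB b *\<^sub>V u)) = cinner h (b *\<^sub>V adj L0 u)" .
qed

lemma norm_L0: "norm (L0 h) = norm h"
proof -
  have "(norm (L0 h))\<^sup>2 = (norm h)\<^sup>2" using cinner_L0[of h h] by (simp flip: Re_cinner_self)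
  then show ?thesis by simp
qed

lemma cB_star_Tl: "b \<in> RC \<Longrightarrow> F.cB b * star (Tl xs) = star (Tl xs) * F.cB b"
  using arg_cong[where f = star, OF cB_Tl[OF RC_star, of b xs]] by (simp add: star_mult F.cB_star star_star)

lemma cB_proj_KS: "b \<in> RC \<Longrightarrow> F.cB b * proj (KS n) = proj (KS n) * F.cB b"
  by (rule proj_commute[OF KS]) (use cB_KS RC_star in \<open>auto simp flip: F.cB_star\<close>)

lemma star_Rl_KS: "set ws \<subseteq> dual \<Longrightarrow> u \<in> KS (length ws + j) \<Longrightarrow> star (Rl ws) *\<^sub>V u \<in> KS j"
proof (induction ws arbitrary: u)
  case (Cons w ws)
  then show ?case using star_Rd_KS[of w u "length ws + j"] by (simp add: Rl_simps star_mult bop_apply_simps)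
qed (simp add: Rl_simps bop_apply_simps)

text \<open>The Fejer weights are a positive definite kernel: they are the inner products of
  normalized indicator functions of windows of length \<open>N\<close>. Sending \<open>u\<close> of
  degree \<open>n\<close> to copies of \<open>u\<close> in the window at \<open>n\<close> defines an
  isometry \<open>V\<close>, and the mean is the compression of the diagonal operator of
  \<open>X\<close> by \<open>V\<close>, hence no larger in norm.\<close>

lemma cesaro_operator:
  assumes N: "N > 0"
  obtains S where "norm S \<le> norm X"
    "\<And>m n u v. u \<in> KS n \<Longrightarrow> v \<in> KS m \<Longrightarrow>
      cinner v (S *\<^sub>V u) = of_real (real (card ({m..<m + N} \<inter> {n..<n + N})) / real N) * cinner v (X *\<^sub>V u)"
proof -
  define c where "c = complex_of_real (1 / sqrt (real N))"
  have c: "cnj c * c = of_real (1 / real N)" unfolding c_def using N by (simp flip: of_real_mult)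
  define g' where "g' i = (case i of (n, u) \<Rightarrow> c *\<^sub>C (\<Sum>k\<in>{n..<n + N}. ell2_single k (u :: 'k)))" for i
  have single: "cinner (ell2_single k v) (ell2_single l w) = (if k = l then cinner v w else 0)" for k l and v w :: 'k
    by (simp add: cinner_ell2_single ell2_nth_single)
  have g': "cinner (g' (m, v)) (ell2_map D *\<^sub>V g' (n, u))
      = of_real (real (card ({m..<m + N} \<inter> {n..<n + N})) / real N) * cinner v (D *\<^sub>V u)" for m n u v D
  proof -
    have "cinner (g' (m, v)) (ell2_map D *\<^sub>V g' (n, u))
      = cnj c * c * (\<Sum>k\<in>{m..<m + N}. \<Sum>l\<in>{n..<n + N}. if k = l then cinner v (D *\<^sub>V u) else 0)"
      unfolding g'_def prod.case bop_simps bop_apply_sum ell2_map_single cinner_scaleC_left cinner_scaleC_right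
        cinner_sum_left[of _ _ "sum _ _"] unfolding cinner_sum_right single
      by (simp only: mult_ac)
    also have "(\<Sum>k\<in>{m..<m + N}. \<Sum>l\<in>{n..<n + N}. if k = l then cinner v (D *\<^sub>V u) else 0)
      = (\<Sum>k\<in>{m..<m + N}. if k \<in> {n..<n + N} then cinner v (D *\<^sub>V u) else 0)"
      by (intro sum.cong refl sum.delta) simp
    also have "\<dots> = of_nat (card ({m..<m + N} \<inter> {n..<n + N})) * cinner v (D *\<^sub>V u)"
      unfolding sum.inter_restrict[OF finite_atLeastLessThan, symmetric] by (simp only: sum_constant)
    finally show ?thesis unfolding c by simp
  qed
  obtain V where V: "bounded_clinear V" "\<And>i. i \<in> {(n, u). u \<in> KS n} \<Longrightarrow> V (snd i) = g' i" "\<And>x. norm (V x) \<le> 1 * norm x"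
  proof (rule extend_operator_gram[of "{(n, u). u \<in> KS n}" g' snd "\<lambda>u. u" 1])
    fix i j assume "i \<in> {(n, u). u \<in> KS n}" "j \<in> {(n, u). u \<in> KS n}"
    then obtain m n u v where ij: "i = (m, v)" "j = (n, u)" "v \<in> KS m" "u \<in> KS n" by blast
    show "cinner (g' i) (g' j) = cinner (snd i) (snd j)"
      using g'[of m v 1 n u] KS_orthogonal[OF ij(3,4)] N unfolding ij
      by (cases "m = n") (simp_all add: ell2_map_simps bop_apply_simps)
  qed (simp_all add: bounded_clinearI[where K = 1])
  have bc: "bounded_clinear (\<lambda>u. adj V (ell2_map X *\<^sub>V V u))"
    by (rule bounded_clinear_compose[OF bounded_clinear_adj[OF V(1)] bounded_clinear_compose[OF bounded_clinear_bop V(1)]])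
  define S where "S = Bop (\<lambda>u. adj V (ell2_map X *\<^sub>V V u))"
  have S: "cinner v (S *\<^sub>V u) = cinner (V v) (ell2_map X *\<^sub>V V u)" for u v
    unfolding S_def Bop_apply[OF bc] by (rule cinner_adj_right[OF V(1)])
  show ?thesis
  proof (rule that)
    show "norm S \<le> norm X"
    proof (rule norm_bop_bound)
      fix u
      show "norm (S *\<^sub>V u) \<le> norm X * norm u"
      proof (rule norm_bound_cinner)
        fix z
        have "cmod (cinner z (S *\<^sub>V u)) \<le> norm (V z) * norm (ell2_map X *\<^sub>V V u)"
          unfolding S by (rule norm_cinner_le)
        also have "\<dots> \<le> norm z * (norm X * norm u)"
          using V(3) by (intro mult_mono order_trans[OF norm_bop_apply] norm_ell2_map_le) simp_all
        finally show "cmod (cinner z (S *\<^sub>V u)) \<le> norm X * norm u * norm z" by (simp add: mult_ac)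
      qed simp
    qed simp
    show "cinner v (S *\<^sub>V u) = of_real (real (card ({m..<m + N} \<inter> {n..<n + N})) / real N) * cinner v (X *\<^sub>V u)"
      if "u \<in> KS n" "v \<in> KS m" for m n u v
      unfolding S using g'[of m v X n u] V(2)[of "(m, v)"] V(2)[of "(n, u)"] that by simp
  qed
qed

text \<open>
  With \<open>\<Theta> = \<Sum>\<^sub>A T\<^sub>x P\<^sub>0 T\<^sub>x\<^sup>*\<close> and \<open>D = (1 + \<Theta>\<^sup>2)\<^sup>-\<^sup>1\<close>, the operator \<open>1 - D = \<Theta> \<Theta> D\<close> has a left factor \<open>\<Theta>\<close>, so
  that \<open>(1 - D) X\<close> sends \<open>H\<close> to finite combinations of the \<open>T\<^sub>x H\<close>, while \<open>D\<close> is small on \<open>T\<^sub>x H\<close> if \<open>x\<close> occurs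
  often in \<open>A\<close>. The second component of the index only serves to allow such repetitions.
\<close>

lemma tail_operator:
  assumes X: "\<And>b. b \<in> RC \<Longrightarrow> X * F.cB b = F.cB b * X" and A: "finite A"
  obtains D c where "norm D \<le> 1" "star D = D"
    "\<And>xs m h. {xs} \<times> {..<m} \<subseteq> A \<Longrightarrow> norm (D *\<^sub>V Tl xs *\<^sub>V L0 h) * sqrt (real m) \<le> norm h"
    "\<And>h. (\<Sum>i\<in>A. Tl (fst i) *\<^sub>V L0 (\<pi> (c (fst i)) h)) = X *\<^sub>V L0 h - D *\<^sub>V X *\<^sub>V L0 h"
proof -
  define P0 where "P0 = proj (KS 0)"
  have P0: "star P0 = P0" "P0 * P0 = P0" unfolding P0_def by (rule star_proj[OF KS], rule proj_idem[OF KS])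
  have P0_apply: "P0 *\<^sub>V P0 *\<^sub>V u = P0 *\<^sub>V u" for u using P0(2) by (metis bop_apply_simps(6))
  define S where "S xs = Tl xs * P0 * star (Tl xs)" for xs
  define \<Theta> :: "'k bop" where "\<Theta> = (\<Sum>i\<in>A. S (fst (i :: 'e list \<times> nat)))"
  have sS: "star (S xs) = S xs" for xs by (simp add: S_def star_mult star_star P0 mult.assoc)
  have sT: "star \<Theta> = \<Theta>" by (simp add: \<Theta>_def star_sum sS)
  obtain D where D: "is_inverse (1 + \<Theta> * \<Theta>) D" "norm D \<le> 1" "norm (\<Theta> * D) \<le> 1" "star D = D"
    by (rule inverse_one_plus_square[OF sT])
  have cB_S: "F.cB b * S xs = S xs * F.cB b" if b: "b \<in> RC" for b xs
  proof -
    have "F.cB b * (Tl xs * P0 * star (Tl xs)) = Tl xs * (F.cB b * P0) * star (Tl xs)"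
      using cB_Tl[OF b, of xs] by (simp flip: mult.assoc)
    also have "\<dots> = Tl xs * P0 * (F.cB b * star (Tl xs))"
      unfolding P0_def cB_proj_KS[OF b] by (simp add: mult.assoc)
    finally show ?thesis unfolding S_def cB_star_Tl[OF b] by (simp add: mult.assoc)
  qed
  have cB_T: "F.cB b * \<Theta> = \<Theta> * F.cB b" if "b \<in> RC" for b
    unfolding \<Theta>_def sum_distrib_left sum_distrib_right cB_S[OF that] ..
  have cB_D: "F.cB b * D = D * F.cB b" if "b \<in> RC" for b
  proof (rule is_inverse_commute[OF D(1)])
    have "F.cB b * (\<Theta> * \<Theta>) = \<Theta> * \<Theta> * F.cB b" using cB_T[OF that] by (metis mult.assoc)
    then show "F.cB b * (1 + \<Theta> * \<Theta>) = (1 + \<Theta> * \<Theta>) * F.cB b" by (simp add: distrib_left distrib_right)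
  qed
  \<comment> \<open>\<open>Q xs\<close>, compressed to H, commutes with \<pi>(M)', since \<Theta>,
    \<open>D\<close> and \<open>X\<close> do; by the double commutant theorem it is the action of an
    element of M. These elements become the coefficients.\<close>
  define Q where "Q xs = star (Tl xs) * (\<Theta> * D) * X" for xs
  define R where "R xs = Bop (\<lambda>h. adj L0 (Q xs *\<^sub>V L0 h))" for xs
  have R: "R xs *\<^sub>V h = adj L0 (Q xs *\<^sub>V L0 h)" for xs h
    unfolding R_def
    by (rule Bop_apply, rule bounded_clinear_compose[OF bounded_clinear_adj[OF bounded_clinear_L0]
          bounded_clinear_compose[OF bounded_clinear_bop bounded_clinear_L0]])
  have "\<exists>a. \<forall>h. R xs *\<^sub>V h = \<pi> a h" for xs
  proof -
    have "z * R xs = R xs * z" if z: "z \<in> RC" for z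
    proof (rule bop_ext)
      fix h
      have "F.cB z * Q xs = star (Tl xs) * (F.cB z * \<Theta> * D) * X"
        unfolding Q_def using cB_star_Tl[OF z, of xs] by (simp flip: mult.assoc)
      also have "F.cB z * \<Theta> * D = \<Theta> * D * F.cB z"
        using cB_T[OF z] cB_D[OF z] by (metis mult.assoc)
      finally have Q: "F.cB z * Q xs = Q xs * F.cB z" unfolding Q_def using X[OF z] by (simp add: mult.assoc)
      show "(z * R xs) *\<^sub>V h = (R xs * z) *\<^sub>V h"
        unfolding bop_apply_simps R adj_L0_cB[OF z, symmetric] cB_L0[OF z, symmetric] bop_commute_apply[OF Q] ..
    qed
    from bicommutant_rep[OF this] show ?thesis by blast
  qed
  then obtain c where c: "\<And>xs h. R xs *\<^sub>V h = \<pi> (c xs) h" by metis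
  show ?thesis
  proof (rule that[OF D(2,4)])
    fix h
    have "Tl xs *\<^sub>V L0 (\<pi> (c xs) h) = (S xs * (\<Theta> * D) * X) *\<^sub>V L0 h" for xs
      unfolding c[symmetric] R proj_KS_0[symmetric] Q_def S_def P0_def by (simp add: bop_apply_simps)
    then have "(\<Sum>i\<in>A. Tl (fst i) *\<^sub>V L0 (\<pi> (c (fst i)) h)) = (\<Theta> * (\<Theta> * D) * X) *\<^sub>V L0 h"
      unfolding \<Theta>_def sum_distrib_right sum_bop_apply by simp
    also have "\<Theta> * (\<Theta> * D) = 1 - D"
      using D(1) unfolding is_inverse_def by (simp add: distrib_right mult.assoc eq_diff_eq add.commute)
    finally show "(\<Sum>i\<in>A. Tl (fst i) *\<^sub>V L0 (\<pi> (c (fst i)) h)) = X *\<^sub>V L0 h - D *\<^sub>V X *\<^sub>V L0 h"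
      by (simp add: bop_apply_simps)
  next
    fix xs m h assume m: "{xs} \<times> {..<m} \<subseteq> A"
    \<comment> \<open>The \<open>m\<close> copies of the summand for \<open>xs\<close> are dominated
      by \<Theta>, so m times the squared norm is at most <D z, \<Theta> D z>, which is bounded by
      the square of the norm of \<open>z\<close>.\<close>
    have key: "norm (P0 *\<^sub>V star (Tl xs) *\<^sub>V D *\<^sub>V z) * sqrt (real m) \<le> norm z" for z
    proof (rule power2_le_imp_le)
      let ?y = "D *\<^sub>V z"
      have S: "Re (cinner ?y (S ys *\<^sub>V ?y)) = (norm (P0 *\<^sub>V star (Tl ys) *\<^sub>V ?y))\<^sup>2" for ys
      proof -
        have "cinner ?y (S ys *\<^sub>V ?y) = cinner (star (Tl ys) *\<^sub>V ?y) (P0 *\<^sub>V P0 *\<^sub>V star (Tl ys) *\<^sub>V ?y)"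
          by (simp add: P0_apply S_def bop_apply_simps cinner_star_bop)
        also have "\<dots> = cinner (P0 *\<^sub>V star (Tl ys) *\<^sub>V ?y) (P0 *\<^sub>V star (Tl ys) *\<^sub>V ?y)"
          by (simp add: P0(1) flip: cinner_star_bop)
        finally show ?thesis by (simp add: Re_cinner_self)
      qed
      have "real m * (norm (P0 *\<^sub>V star (Tl xs) *\<^sub>V ?y))\<^sup>2
        = (\<Sum>i\<in>{xs} \<times> {..<m}. (norm (P0 *\<^sub>V star (Tl (fst i)) *\<^sub>V ?y))\<^sup>2)"
      proof -
        have "(\<Sum>i\<in>{xs} \<times> {..<m}. (norm (P0 *\<^sub>V star (Tl (fst i)) *\<^sub>V ?y))\<^sup>2)
          = (\<Sum>i\<in>{xs} \<times> {..<m}. (norm (P0 *\<^sub>V star (Tl xs) *\<^sub>V ?y))\<^sup>2)"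
          by (rule sum.cong) auto
        then show ?thesis by (simp add: card_cartesian_product)
      qed
      also have "\<dots> \<le> (\<Sum>i\<in>A. (norm (P0 *\<^sub>V star (Tl (fst i)) *\<^sub>V ?y))\<^sup>2)"
        by (rule sum_mono2[OF A m]) simp
      also have "\<dots> = Re (cinner ?y (\<Theta> *\<^sub>V ?y))"
        by (simp add: \<Theta>_def sum_bop_apply cinner_sum_right S)
      also have "\<dots> \<le> norm ?y * norm ((\<Theta> * D) *\<^sub>V z)"
        using norm_cinner_le[of ?y "\<Theta> *\<^sub>V ?y"] complex_Re_le_cmod[of "cinner ?y (\<Theta> *\<^sub>V ?y)"] by (simp add: bop_apply_simps)
      also have "\<dots> \<le> (1 * norm z) * (1 * norm z)"
        by (intro mult_mono order_trans[OF norm_bop_apply] mult_right_mono D) auto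
      finally show "(norm (P0 *\<^sub>V star (Tl xs) *\<^sub>V ?y) * sqrt (real m))\<^sup>2 \<le> (norm z)\<^sup>2"
        by (simp add: power_mult_distrib mult.commute power2_eq_square[of "norm z"])
    qed simp
    let ?z = "D *\<^sub>V Tl xs *\<^sub>V L0 h"
    have P0L: "P0 *\<^sub>V L0 h = L0 h" unfolding P0_def by (rule proj_eq[OF KS L0_KS])
    \<comment> \<open>Since \<open>D\<close> is selfadjoint, the squared norm of \<open>?z\<close>
      is an inner product of the vector in \<open>key\<close>, taken at \<open>?z\<close> itself,
      with \<open>L0 h\<close>; one factor of the norm then cancels.\<close>
    have "cinner ?z ?z = cinner (star (Tl xs) *\<^sub>V D *\<^sub>V ?z) (L0 h)"
      using cinner_star_bop[of D ?z "Tl xs *\<^sub>V L0 h"] D(4) by (simp add: cinner_star_bop)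
    also have "\<dots> = cinner (P0 *\<^sub>V star (Tl xs) *\<^sub>V D *\<^sub>V ?z) (L0 h)"
      using cinner_star_bop[of P0 "star (Tl xs) *\<^sub>V D *\<^sub>V ?z" "L0 h"] unfolding P0(1) P0L ..
    finally have z: "cinner ?z ?z = cinner (P0 *\<^sub>V star (Tl xs) *\<^sub>V D *\<^sub>V ?z) (L0 h)" .
    have "(norm ?z)\<^sup>2 \<le> norm (P0 *\<^sub>V star (Tl xs) *\<^sub>V D *\<^sub>V ?z) * norm h"
      unfolding Re_cinner_self[symmetric] z
      using order_trans[OF complex_Re_le_cmod norm_cinner_le[of "P0 *\<^sub>V star (Tl xs) *\<^sub>V D *\<^sub>V ?z" "L0 h"]]
      unfolding norm_L0 .
    then have "(norm ?z)\<^sup>2 * sqrt (real m) \<le> norm (P0 *\<^sub>V star (Tl xs) *\<^sub>V D *\<^sub>V ?z) * norm h * sqrt (real m)"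
      by (rule mult_right_mono) simp
    also have "\<dots> = norm (P0 *\<^sub>V star (Tl xs) *\<^sub>V D *\<^sub>V ?z) * sqrt (real m) * norm h" by (simp only: mult_ac)
    also have "\<dots> \<le> norm ?z * norm h" by (rule mult_right_mono[OF key]) simp
    finally have "(norm ?z)\<^sup>2 * sqrt (real m) \<le> norm ?z * norm h" .
    then show "norm ?z * sqrt (real m) \<le> norm h"
    proof (cases "norm ?z = 0")
      case False
      have "norm ?z * (norm ?z * sqrt (real m)) \<le> norm ?z * norm h"
        using \<open>(norm ?z)\<^sup>2 * sqrt (real m) \<le> norm ?z * norm h\<close> by (simp only: power2_eq_square mult.assoc)
      then show ?thesis by (rule mult_left_le_imp_le) (use False in simp)
    qed simp
  qed
qed

end

context rep_fock
begin

text \<open>For a homogeneous polynomial \<open>Y\<close> the product \<open>star Y * Y\<close> is a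
  left action \<open>F.Left d\<close>. The norm of \<open>d\<close> is seen on H because \<pi> is
  isometric, and the left action is contractive, so a bound of \<open>Y\<close> on H is a bound
  everywhere.\<close>

lemma norm_homogeneous_le:
  fixes c :: "'e list \<Rightarrow> 'm" and B :: "('e list \<times> nat) set"
  assumes B: "\<And>i. i \<in> B \<Longrightarrow> length (fst i) = j"
    and r: "\<And>h. norm (\<Sum>i\<in>B. Tl (fst i) *\<^sub>V L0 (\<pi> (c (fst i)) h)) \<le> r * norm h" "r \<ge> 0"
  shows "norm (\<Sum>i\<in>B. Tl (fst i) * F.Left (c (fst i))) \<le> r"
proof -
  define Y where "Y = (\<Sum>i\<in>B. Tl (fst i) * F.Left (c (fst i)))"
  have L: "csubspace (range F.Left)" using F.L.star_subalgebra_range unfolding star_subalgebra_def by blast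
  have "star Y * Y \<in> range F.Left"
    unfolding Y_def star_sum sum_distrib_left sum_distrib_right
  proof (intro complex_vector.subspace_sum[OF L])
    fix i k assume ik: "i \<in> B" "k \<in> B"
    obtain d where d: "star (Tl (fst k)) * Tl (fst i) = F.Left d"
      using star_Tl_Tl[of "fst k" "fst i"] B ik by metis
    have "star (Tl (fst k) * F.Left (c (fst k))) * (Tl (fst i) * F.Left (c (fst i)))
      = F.Left (star (c (fst k))) * (star (Tl (fst k)) * Tl (fst i)) * F.Left (c (fst i))"
      by (simp add: star_mult F.L.psi_star mult.assoc)
    also have "\<dots> = F.Left (star (c (fst k)) * d * c (fst i))" unfolding d by (simp add: F.L.psi_mult)
    finally show "star (Tl (fst k) * F.Left (c (fst k))) * (Tl (fst i) * F.Left (c (fst i))) \<in> range F.Left" by simp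
  qed
  then obtain d where d: "star Y * Y = F.Left d" by blast
  have Y0: "norm (Y *\<^sub>V L0 h) \<le> r * norm h" for h
    using r(1)[of h] by (simp add: Y_def sum_bop_apply bop_apply_simps Left_L0)
  have "norm d \<le> r * r"
  proof (rule F.norm_le_rep)
    fix h k
    have "cinner h (\<pi> d k) = cinner (L0 h) (F.Left d *\<^sub>V L0 k)" by (simp add: Left_L0 cinner_L0)
    also have "\<dots> = cinner (Y *\<^sub>V L0 h) (Y *\<^sub>V L0 k)" unfolding d[symmetric] by (simp add: bop_apply_simps cinner_star_bop_right)
    finally have "cmod (cinner h (\<pi> d k)) \<le> norm (Y *\<^sub>V L0 h) * norm (Y *\<^sub>V L0 k)" using norm_cinner_le by simp
    also have "\<dots> \<le> (r * norm h) * (r * norm k)" by (intro mult_mono Y0) (use r(2) in simp_all)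
    finally show "cmod (cinner h (\<pi> d k)) \<le> r * r * norm h * norm k" by (simp add: mult_ac)
  qed (use r(2) in simp)
  then have "(norm Y)\<^sup>2 \<le> r\<^sup>2"
    unfolding cstar_identity[symmetric] d unfolding power2_eq_square by (rule order_trans[OF F.L.norm_psi_le])
  then show ?thesis unfolding Y_def[symmetric] by (rule power2_le_imp_le) (rule r(2))
qed

text \<open>A large finite index set contains any prescribed number \<open>m\<close> of copies of a
  word, which makes \<open>D A\<close> smaller than 1/sqrt m times the norm of \<open>h\<close>
  there; the uniform bound extends convergence from words to all vectors.\<close>

lemma tail_tendsto_zero:
  fixes D :: "('e list \<times> nat) set \<Rightarrow> 'k bop"
  assumes D: "\<And>A. norm (D A) \<le> 1"
    and bd: "\<And>A xs m h. finite A \<Longrightarrow> {xs} \<times> {..<m} \<subseteq> A \<Longrightarrow> norm (D A *\<^sub>V Tl xs *\<^sub>V L0 h) * sqrt (real m) \<le> norm h"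
  shows "((\<lambda>A. D A *\<^sub>V u) \<longlongrightarrow> 0) (finite_subsets_at_top UNIV)"
proof (rule tendsto_zero_total[OF Tl_total])
  show "bounded_clinear ((*\<^sub>V) (D A))" for A by (rule bounded_clinear_bop)
  show "norm (D A *\<^sub>V u) \<le> 1 * norm u" for A u by (rule order_trans[OF norm_bop_apply mult_right_mono[OF D]]) simp
  fix x assume "x \<in> {Tl xs *\<^sub>V L0 h | xs h. True}"
  then obtain xs h where x: "x = Tl xs *\<^sub>V L0 h" by blast
  show "((\<lambda>A. D A *\<^sub>V x) \<longlongrightarrow> 0) (finite_subsets_at_top UNIV)"
  proof (rule tendstoI)
    fix e :: real assume e: "e > 0"
    obtain m where m: "(norm h / e)\<^sup>2 < real m" using reals_Archimedean2 by blast
    have "norm h / e < sqrt (real m)" by (rule real_less_rsqrt[OF m])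
    then have h: "norm h < e * sqrt (real m)" using e by (simp add: pos_divide_less_eq mult.commute)
    have "dist (D A *\<^sub>V x) 0 < e" if "finite A" "{xs} \<times> {..<m} \<subseteq> A" for A
    proof -
      have "norm (D A *\<^sub>V x) * sqrt (real m) < e * sqrt (real m)"
        using bd[OF that, of h] h unfolding x by simp
      then show ?thesis by (simp add: mult_less_cancel_right)
    qed
    then show "\<forall>\<^sub>F A in finite_subsets_at_top UNIV. dist (D A *\<^sub>V x) 0 < e"
      unfolding eventually_finite_subsets_at_top by (intro exI[of _ "{xs} \<times> {..<m}"]) simp
  qed
qed

text \<open>
  The polynomial obtained by applying \<open>1 - D\<close> to the coefficients of the \<open>N\<close>-th Cesaro mean of \<open>X\<close>;
  this approximates the Cesaro mean with a bound not depending on \<open>A\<close>.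
\<close>

lemma cesaro_approximant:
  assumes X: "analytic X" and cB: "\<And>b. b \<in> RC \<Longrightarrow> X * F.cB b = F.cB b * X" and A: "finite A" and N: "N > 0"
  obtains D Y where "norm D \<le> 1" "star D = D"
    "\<And>xs m h. {xs} \<times> {..<m} \<subseteq> A \<Longrightarrow> norm (D *\<^sub>V Tl xs *\<^sub>V L0 h) * sqrt (real m) \<le> norm h"
    "Y \<in> F.amp ` Hardy" "analytic Y" "norm Y \<le> real N * (2 * norm X)"
    "\<And>j z h. z \<in> KS j \<Longrightarrow> cinner z (Y *\<^sub>V L0 h)
      = of_real (real (N - j) / real N) * (cinner z (X *\<^sub>V L0 h) - cinner (D *\<^sub>V z) (X *\<^sub>V L0 h))"
proof -
  obtain D c where D: "norm D \<le> 1" "star D = D"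
    "\<And>xs m h. {xs} \<times> {..<m} \<subseteq> A \<Longrightarrow> norm (D *\<^sub>V Tl xs *\<^sub>V L0 h) * sqrt (real m) \<le> norm h"
    and c: "\<And>h. (\<Sum>i\<in>A. Tl (fst i) *\<^sub>V L0 (\<pi> (c (fst i)) h)) = X *\<^sub>V L0 h - D *\<^sub>V X *\<^sub>V L0 h"
  proof (rule tail_operator[OF cB A], goal_cases)
    case (2 D c)
    show ?case by (rule 2(1)[of D c]) (fact 2)+
  qed
  \<comment> \<open>Natural subtraction makes the weight 0 from degree \<open>N\<close> on, so that
    restricting to words shorter than \<open>N\<close> changes nothing.\<close>
  define f where "f j = complex_of_real (real (N - j) / real N)" for j
  define Z where "Z i = Tl (fst i) * F.Left (c (fst i))" for i :: "'e list \<times> nat"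
  define B where "B j = {i \<in> {i \<in> A. length (fst i) < N}. length (fst i) = j}" for j
  define Y where "Y = (\<Sum>i\<in>{i \<in> A. length (fst i) < N}. f (length (fst i)) *\<^sub>C Z i)"
  have Z0: "Z i *\<^sub>V L0 h = Tl (fst i) *\<^sub>V L0 (\<pi> (c (fst i)) h)" for i h
    by (simp add: Z_def bop_apply_simps Left_L0)
  have ZK: "Z i *\<^sub>V L0 h \<in> KS (length (fst i))" for i h unfolding Z0 by (rule KS_I) simp
  have Zs: "(\<Sum>i\<in>A. cinner z (Z i *\<^sub>V L0 h)) = cinner z (X *\<^sub>V L0 h) - cinner (D *\<^sub>V z) (X *\<^sub>V L0 h)" for z h
    unfolding Z0 cinner_sum_right[symmetric] c cinner_diff_right
    using cinner_star_bop[of D z "X *\<^sub>V L0 h"] unfolding D(2) by simp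
  \<comment> \<open>The part of degree \<open>j\<close> acts on H as the projection to
    \<open>KS j\<close> after (1 - D) X; the constant 2 bounds 1 - D.\<close>
  have Bn: "norm (\<Sum>i\<in>B j. Z i) \<le> 2 * norm X" if j: "j < N" for j
    unfolding Z_def
  proof (rule norm_homogeneous_le)
    fix h
    have "(\<Sum>i\<in>B j. Z i *\<^sub>V L0 h) = proj (KS j) *\<^sub>V (X *\<^sub>V L0 h - D *\<^sub>V X *\<^sub>V L0 h)"
    proof -
      have "proj (KS j) *\<^sub>V Z i *\<^sub>V L0 h = (if i \<in> B j then Z i *\<^sub>V L0 h else 0)" if "i \<in> A" for i
      proof (cases "length (fst i) = j")
        case True
        then show ?thesis using that j proj_eq[OF KS ZK[of i h, unfolded True]] by (simp add: B_def)
      next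
        case False
        have "proj (KS j) *\<^sub>V Z i *\<^sub>V L0 h = 0"
          using False by (intro proj_zero[OF KS] KS_orthogonal[OF _ ZK]) auto
        then show ?thesis using False by (simp add: B_def)
      qed
      then have "proj (KS j) *\<^sub>V (\<Sum>i\<in>A. Z i *\<^sub>V L0 h) = (\<Sum>i\<in>A. if i \<in> B j then Z i *\<^sub>V L0 h else 0)"
        unfolding bop_apply_sum by (intro sum.cong) auto
      also have "\<dots> = (\<Sum>i\<in>A \<inter> B j. Z i *\<^sub>V L0 h)" by (rule sum.inter_restrict[OF A, symmetric])
      also have "A \<inter> B j = B j" unfolding B_def by blast
      finally show ?thesis unfolding Z0 c by simp
    qed
    moreover have "norm (proj (KS j) *\<^sub>V (X *\<^sub>V L0 h - D *\<^sub>V X *\<^sub>V L0 h)) \<le> 1 * norm (X *\<^sub>V L0 h - D *\<^sub>V X *\<^sub>V L0 h)"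
      by (rule order_trans[OF norm_bop_apply mult_right_mono[OF norm_proj_le[OF KS]]]) simp
    moreover have "norm (X *\<^sub>V L0 h - D *\<^sub>V X *\<^sub>V L0 h) \<le> norm (X *\<^sub>V L0 h) + 1 * norm (X *\<^sub>V L0 h)"
      by (intro order_trans[OF norm_triangle_ineq4] add_left_mono order_trans[OF norm_bop_apply] mult_right_mono D(1)) simp
    moreover have "norm (X *\<^sub>V L0 h) \<le> norm X * norm h" using norm_bop_apply[of X "L0 h"] by (simp add: norm_L0)
    ultimately show "norm (\<Sum>i\<in>B j. Tl (fst i) *\<^sub>V L0 (\<pi> (c (fst i)) h)) \<le> 2 * norm X * norm h"
      unfolding Z0 by simp
  qed (simp_all add: B_def)
  have fn: "norm (f j) \<le> 1" for j unfolding f_def norm_of_real using N by simp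
  have "Y \<in> F.amp ` Gen"
    unfolding Y_def Z_def by (intro gen_sum gen_scaleC gen_mult gen_Tl gen_Left)
  note Y = gen_hardy[OF this]
  have aY: "analytic Y" using hardy_analytic Y by blast
  have "Y = (\<Sum>j\<in>{..<N}. \<Sum>i\<in>B j. f (length (fst i)) *\<^sub>C Z i)"
    unfolding Y_def B_def by (rule sum.group[symmetric]) (use A in auto)
  also have "\<dots> = (\<Sum>j\<in>{..<N}. f j *\<^sub>C (\<Sum>i\<in>B j. Z i))"
    unfolding complex_vector.scale_sum_right by (intro sum.cong) (auto simp: B_def)
  finally have "norm Y \<le> (\<Sum>j\<in>{..<N}. norm (f j *\<^sub>C (\<Sum>i\<in>B j. Z i)))" by (simp add: norm_sum)
  also have "\<dots> \<le> (\<Sum>j\<in>{..<N}. 1 * (2 * norm X))"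
    unfolding norm_scaleC by (intro sum_mono mult_mono fn Bn) auto
  finally have nY: "norm Y \<le> real N * (2 * norm X)" by simp
  have "cinner z (Y *\<^sub>V L0 h) = f j * (cinner z (X *\<^sub>V L0 h) - cinner (D *\<^sub>V z) (X *\<^sub>V L0 h))" if z: "z \<in> KS j" for j z h
  proof -
    have zero: "f (length (fst i)) * cinner z (Z i *\<^sub>V L0 h) = f j * cinner z (Z i *\<^sub>V L0 h)" for i
      using KS_orthogonal[OF z ZK, of i h] by (cases "length (fst i) = j") auto
    have "cinner z (Y *\<^sub>V L0 h) = (\<Sum>i\<in>{i \<in> A. length (fst i) < N}. f (length (fst i)) * cinner z (Z i *\<^sub>V L0 h))"
      unfolding Y_def sum_bop_apply scaleC_bop_apply cinner_sum_right cinner_scaleC_right ..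
    also have "\<dots> = (\<Sum>i\<in>A. f (length (fst i)) * cinner z (Z i *\<^sub>V L0 h))"
      by (rule sum.mono_neutral_left[OF A]) (auto simp: f_def)
    also have "\<dots> = f j * (\<Sum>i\<in>A. cinner z (Z i *\<^sub>V L0 h))" unfolding zero sum_distrib_left ..
    finally show ?thesis unfolding Zs .
  qed
  from that[OF D Y aY nY this[unfolded f_def]] show ?thesis by blast
qed

text \<open>For \<open>u = Rl ws L0 h\<close>, analyticity moves \<open>Rl ws\<close> to the other
  side, so only the action on H matters, where the approximants are explicit. If \<open>v\<close>
  has degree \<open>j\<close> above that of \<open>u\<close>, the two windows of length
  \<open>N\<close> overlap in \<open>N - j\<close> points, which matches the weight of the
  approximant.\<close>

lemma cesaro_hardy:
  assumes X: "analytic X" and cB: "\<And>b. b \<in> RC \<Longrightarrow> X * F.cB b = F.cB b * X" and N: "N > 0"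
    and S: "\<And>m n u v. u \<in> KS n \<Longrightarrow> v \<in> KS m \<Longrightarrow>
      cinner v (S *\<^sub>V u) = of_real (real (card ({m..<m + N} \<inter> {n..<n + N})) / real N) * cinner v (X *\<^sub>V u)"
  shows "S \<in> F.amp ` Hardy"
proof -
  \<comment> \<open>The filter lives on all sets, whereas approximants exist for finite ones;
    infinite sets are sent to the empty set so that the choice is total.\<close>
  define fin :: "('e list \<times> nat) set \<Rightarrow> ('e list \<times> nat) set" where "fin A = (if finite A then A else {})" for A
  have fin: "finite (fin A)" for A by (simp add: fin_def)
  have "\<forall>A. \<exists>D Y. norm D \<le> 1 \<and> star D = D \<and>
    (\<forall>xs m h. {xs} \<times> {..<m} \<subseteq> fin A \<longrightarrow> norm (D *\<^sub>V Tl xs *\<^sub>V L0 h) * sqrt (real m) \<le> norm h) \<and>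
    Y \<in> F.amp ` Hardy \<and> analytic Y \<and> norm Y \<le> real N * (2 * norm X) \<and>
    (\<forall>j z h. z \<in> KS j \<longrightarrow> cinner z (Y *\<^sub>V L0 h)
      = of_real (real (N - j) / real N) * (cinner z (X *\<^sub>V L0 h) - cinner (D *\<^sub>V z) (X *\<^sub>V L0 h)))"
    (is "\<forall>A. \<exists>D Y. ?Q A D Y")
  proof
    fix A
    show "\<exists>D Y. ?Q A D Y" by (rule cesaro_approximant[OF X cB fin[of A] N]) blast+
  qed
  then obtain D Y where DY: "\<And>A. ?Q A (D A) (Y A)" by (metis (no_types))
  have D0: "((\<lambda>A. D A *\<^sub>V u) \<longlongrightarrow> 0) (finite_subsets_at_top UNIV)" for u
  proof (rule tail_tendsto_zero)
    show "norm (D A) \<le> 1" for A using DY[of A] by blast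
    show "norm (D A *\<^sub>V Tl xs *\<^sub>V L0 h) * sqrt (real m) \<le> norm h" if "finite A" "{xs} \<times> {..<m} \<subseteq> A" for A xs m h
      using DY[of A] that unfolding fin_def by simp
  qed
  show ?thesis
  proof (rule hardy_limit[where A = Y and F = "finite_subsets_at_top UNIV", OF _ _ _ KS_total Rl_total])
    show "Y A \<in> F.amp ` Hardy" "norm (Y A) \<le> real N * (2 * norm X)" for A using DY[of A] by blast+
    show "finite_subsets_at_top UNIV \<noteq> bot" by (rule finite_subsets_at_top_neq_bot)
    fix v u assume "v \<in> (\<Union>n. KS n)" "u \<in> {Rl ws *\<^sub>V L0 h | ws h. set ws \<subseteq> dual}"
    then obtain m ws h where v: "v \<in> KS m" and u: "u = Rl ws *\<^sub>V L0 h" and ws: "set ws \<subseteq> dual" by blast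
    have uK: "u \<in> KS (length ws)" using Rl_KS[OF ws L0_KS] unfolding u by simp
    have Yu: "cinner v (Y A *\<^sub>V u) = cinner (star (Rl ws) *\<^sub>V v) (Y A *\<^sub>V L0 h)" for A
    proof -
      have a: "analytic (Y A)" using DY[of A] by blast
      show ?thesis unfolding u bop_commute_apply[OF analytic_Rl[OF a ws]] cinner_star_bop ..
    qed
    have Xu: "cinner v (X *\<^sub>V u) = cinner (star (Rl ws) *\<^sub>V v) (X *\<^sub>V L0 h)"
      unfolding u bop_commute_apply[OF analytic_Rl[OF X ws]] cinner_star_bop ..
    show "((\<lambda>A. cinner v (Y A *\<^sub>V u)) \<longlongrightarrow> cinner v (S *\<^sub>V u)) (finite_subsets_at_top UNIV)"
    proof (cases "m < length ws")
      case True
      then have "star (Rl ws) *\<^sub>V v = 0" by (rule star_Rl_KS_zero[OF ws v])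
      then show ?thesis unfolding Yu S[OF uK v] Xu by simp
    next
      case False
      then obtain j where m: "m = length ws + j" using le_Suc_ex not_less by blast
      define z where "z = star (Rl ws) *\<^sub>V v"
      have z: "z \<in> KS j" unfolding z_def by (rule star_Rl_KS[OF ws v[unfolded m]])
      have Y': "cinner v (Y A *\<^sub>V u)
        = of_real (real (N - j) / real N) * (cinner z (X *\<^sub>V L0 h) - cinner (D A *\<^sub>V z) (X *\<^sub>V L0 h))" for A
        unfolding Yu z_def[symmetric] using DY[of A] z by blast
      have "{m..<m + N} \<inter> {length ws..<length ws + N} = {m..<length ws + N}" unfolding m by auto
      then have S': "cinner v (S *\<^sub>V u) = of_real (real (N - j) / real N) * (cinner z (X *\<^sub>V L0 h) - cinner 0 (X *\<^sub>V L0 h))"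
        unfolding S[OF uK v] Xu z_def by (simp add: m)
      show ?thesis unfolding Y' S' by (intro tendsto_intros tendsto_cinner D0)
    qed
  qed
qed

text \<open>The Cesaro means belong to the Hardy algebra and are bounded by the norm of
  \<open>X\<close>. Between two fixed levels the overlap weights tend to 1, so the means converge
  weakly to \<open>X\<close>.\<close>

theorem analytic_hardy:
  assumes X: "analytic X" and cB: "\<And>b. b \<in> RC \<Longrightarrow> X * F.cB b = F.cB b * X"
  shows "X \<in> F.amp ` Hardy"
proof -
  have "\<forall>N. \<exists>S. norm S \<le> norm X \<and> (\<forall>m n u v. u \<in> KS n \<longrightarrow> v \<in> KS m \<longrightarrow> cinner v (S *\<^sub>V u)
      = of_real (real (card ({m..<m + Suc N} \<inter> {n..<n + Suc N})) / real (Suc N)) * cinner v (X *\<^sub>V u))"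
    (is "\<forall>N. \<exists>S. ?Q N S")
  proof
    fix N
    show "\<exists>S. ?Q N S" by (rule cesaro_operator[of "Suc N" X]) blast+
  qed
  then obtain S where S: "\<And>N. ?Q N (S N)" by (metis (no_types))
  show ?thesis
  proof (rule hardy_limit[where A = S and F = sequentially, OF _ _ _ KS_total KS_total])
    show "S N \<in> F.amp ` Hardy" for N
      by (rule cesaro_hardy[OF X cB zero_less_Suc[of N]]) (use S[of N] in blast)+
    show "norm (S N) \<le> norm X" for N using S[of N] by blast
    fix v u assume "v \<in> (\<Union>n. KS n)" "u \<in> (\<Union>n. KS n)"
    then obtain m n where v: "v \<in> KS m" and u: "u \<in> KS n" by blast
    define d where "d = max m n - min m n"
    have "{m..<m + Suc N} \<inter> {n..<n + Suc N} = {max m n..<min m n + Suc N}" for N by auto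
    then have "card ({m..<m + Suc N} \<inter> {n..<n + Suc N}) = Suc N - d" for N unfolding d_def by simp
    then have eq: "cinner v (S N *\<^sub>V u) = of_real (real (Suc N - d) / real (Suc N)) * cinner v (X *\<^sub>V u)" for N
      using S[of N] u v by metis
    have "(\<lambda>N. real (Suc N - d) / real (Suc N)) \<longlonglongrightarrow> 1"
    proof (rule Lim_transform_eventually)
      show "(\<lambda>N. 1 - real d / real (Suc N)) \<longlonglongrightarrow> 1"
        using tendsto_diff[OF tendsto_const[of 1] LIMSEQ_Suc[OF lim_const_over_n[of "real d"]]] by simp
      show "\<forall>\<^sub>F N in sequentially. 1 - real d / real (Suc N) = real (Suc N - d) / real (Suc N)"
        using eventually_ge_at_top[of d] by eventually_elim (simp add: of_nat_diff field_simps)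
    qed
    then have "(\<lambda>N. complex_of_real (real (Suc N - d) / real (Suc N)) * cinner v (X *\<^sub>V u))
      \<longlonglongrightarrow> complex_of_real 1 * cinner v (X *\<^sub>V u)"
      by (intro tendsto_mult tendsto_of_real tendsto_const)
    then show "(\<lambda>N. cinner v (S N *\<^sub>V u)) \<longlonglongrightarrow> cinner v (X *\<^sub>V u)" unfolding eq by simp
  qed simp
qed

end

context rep_fock
begin

section \<open>Lifting from coinvariant subspaces\<close>

text \<open>Containing \<open>KS 0\<close> starts the induction by which the iterates of
  \<open>up\<close> absorb all levels.\<close>

definition coinvariant :: "'k set \<Rightarrow> bool" where
  "coinvariant S \<longleftrightarrow> csubspace S \<and> closed S \<and> KS 0 \<subseteq> S \<and> (\<forall>b\<in>RC. \<forall>u\<in>S. F.cB b *\<^sub>V u \<in> S) \<and>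
    (\<forall>w\<in>dual. \<forall>u\<in>S. star (Rd w) *\<^sub>V u \<in> S)"

definition intertwines :: "'k set \<Rightarrow> 'k bop \<Rightarrow> bool" where
  "intertwines S Z \<longleftrightarrow> (\<forall>u\<in>S. Z *\<^sub>V u \<in> S) \<and> (\<forall>b\<in>RC. \<forall>u\<in>S. Z *\<^sub>V F.cB b *\<^sub>V u = F.cB b *\<^sub>V Z *\<^sub>V u) \<and>
    (\<forall>w\<in>dual. \<forall>u\<in>S. Z *\<^sub>V star (Rd w) *\<^sub>V u = star (Rd w) *\<^sub>V Z *\<^sub>V u)"

text \<open>The largest set that all right annihilators send into \<open>S\<close>. Each application
  gains one level.\<close>

definition up :: "'k set \<Rightarrow> 'k set" where
  "up S = {u. \<forall>w\<in>dual. star (Rd w) *\<^sub>V u \<in> S}"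

lemma coinvariantD:
  assumes "coinvariant S"
  shows "csubspace S" "closed S" "KS 0 \<subseteq> S" "b \<in> RC \<Longrightarrow> u \<in> S \<Longrightarrow> F.cB b *\<^sub>V u \<in> S"
    "w \<in> dual \<Longrightarrow> u \<in> S \<Longrightarrow> star (Rd w) *\<^sub>V u \<in> S"
  using assms by (auto simp: coinvariant_def)

lemma intertwinesD:
  assumes "intertwines S Z"
  shows "u \<in> S \<Longrightarrow> Z *\<^sub>V u \<in> S" "b \<in> RC \<Longrightarrow> u \<in> S \<Longrightarrow> Z *\<^sub>V F.cB b *\<^sub>V u = F.cB b *\<^sub>V Z *\<^sub>V u"
    "w \<in> dual \<Longrightarrow> u \<in> S \<Longrightarrow> Z *\<^sub>V star (Rd w) *\<^sub>V u = star (Rd w) *\<^sub>V Z *\<^sub>V u"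
  using assms by (auto simp: intertwines_def)

lemma star_Rd_cB:
  assumes w: "w \<in> dual" and b: "b \<in> RC"
  shows "star (Rd w) *\<^sub>V F.cB b *\<^sub>V u = star (Rd (\<lambda>h. F.cB (star b) *\<^sub>V w h)) *\<^sub>V u"
  using arg_cong[where f = "\<lambda>A. star A *\<^sub>V u", OF cB_Rd[OF w RC_star[OF b]]]
  by (simp add: star_mult F.cB_star[OF b] star_star bop_apply_simps)

lemma up_mono: "coinvariant S \<Longrightarrow> S \<subseteq> up S"
  unfolding up_def using coinvariantD(5) by blast

lemma up_KS: "KS n \<subseteq> S \<Longrightarrow> KS (Suc n) \<subseteq> up S"
  unfolding up_def using star_Rd_KS by blast

lemma coinvariant_up:
  assumes S: "coinvariant S"
  shows "coinvariant (up S)"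
proof -
  have up: "up S = (\<Inter>w\<in>dual. {u. star (Rd w) *\<^sub>V u \<in> S})" unfolding up_def by blast
  have "csubspace (up S)"
    unfolding up by (intro complex_vector.subspace_Inter) (use bop_image_closed[OF coinvariantD(1,2)[OF S]] in blast)
  moreover have "closed (up S)"
    unfolding up by (intro closed_INT) (use bop_image_closed[OF coinvariantD(1,2)[OF S]] in blast)
  moreover have "F.cB b *\<^sub>V u \<in> up S" if b: "b \<in> RC" and u: "u \<in> up S" for b u
    using u dual_cB[OF _ RC_star[OF b]] unfolding up_def by (simp add: star_Rd_cB[OF _ b])
  moreover have "star (Rd w) *\<^sub>V u \<in> up S" if "w \<in> dual" "u \<in> up S" for w u
    using that up_mono[OF S] unfolding up_def by blast
  ultimately show ?thesis
    unfolding coinvariant_def using up_mono[OF S] coinvariantD(3)[OF S] by blast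
qed

text \<open>This is I \<otimes> Z on the vectors R_w u with \<open>u\<close> in \<open>S\<close>,
  and 0 on their complement. The Gram matrix involves only I \<otimes> b, which \<open>Z\<close>
  commutes with on \<open>S\<close>; hence the adjoint of \<open>Z\<close>, compressed to
  \<open>S\<close>, provides a formal adjoint and the bound does not grow.\<close>

lemma creation_extension:
  assumes S: "coinvariant S" and Z: "intertwines S Z"
  obtains W where "\<And>w u. w \<in> dual \<Longrightarrow> u \<in> S \<Longrightarrow> W *\<^sub>V Rd w *\<^sub>V u = Rd w *\<^sub>V Z *\<^sub>V u"
    "\<And>x. norm (W *\<^sub>V x) \<le> norm Z * norm x"
    "\<And>x. (\<And>w u. w \<in> dual \<Longrightarrow> u \<in> S \<Longrightarrow> cinner (Rd w *\<^sub>V u) x = 0) \<Longrightarrow> W *\<^sub>V x = 0"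
proof -
  define p where "p = proj S"
  define Zs where "Zs = p * star Z"
  define g where "g i = (case i of (w, u) \<Rightarrow> Rd w *\<^sub>V (u :: 'k))" for i
  define \<tau> where "\<tau> i = (case i of (w :: 'h \<Rightarrow> 'k, u) \<Rightarrow> (w, Z *\<^sub>V u))" for i
  define \<tau>s where "\<tau>s i = (case i of (w :: 'h \<Rightarrow> 'k, u) \<Rightarrow> (w, Zs *\<^sub>V u))" for i
  have p: "p *\<^sub>V u \<in> S" "u \<in> S \<Longrightarrow> p *\<^sub>V u = u" "star p = p" for u
    unfolding p_def using proj_mem[OF coinvariantD(1,2)[OF S]] proj_eq[OF coinvariantD(1,2)[OF S]] star_proj[OF coinvariantD(1,2)[OF S]]
    by auto
  have Zs_S: "Zs *\<^sub>V u \<in> S" for u unfolding Zs_def by (simp add: bop_apply_simps p(1))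
  have adj: "cinner (Zs *\<^sub>V v) u = cinner v (Z *\<^sub>V u)" if u: "u \<in> S" for u v
  proof -
    have "cinner (Zs *\<^sub>V v) u = cinner (star Z *\<^sub>V v) (p *\<^sub>V u)"
      unfolding Zs_def using cinner_star_bop[of p "star Z *\<^sub>V v" u] by (simp add: bop_apply_simps p(3))
    then show ?thesis by (simp add: p(2)[OF u] cinner_star_bop)
  qed
  have gram: "cinner (Rd w *\<^sub>V v) (Rd w' *\<^sub>V u) = cinner v (F.cB (dip w w') *\<^sub>V u)" if "w \<in> dual" "w' \<in> dual" for w w' u v
    unfolding star_Rd_Rd[OF that, symmetric] by (simp add: bop_apply_simps cinner_star_bop_right)
  let ?I = "{(w, u). w \<in> dual \<and> u \<in> S}"
  obtain W where W: "bounded_clinear W" "\<And>i. i \<in> ?I \<Longrightarrow> W (g i) = g (\<tau> i)" "\<And>x. norm (W x) \<le> norm Z * norm x"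
    "\<And>x. (\<And>i. i \<in> ?I \<Longrightarrow> cinner (g i) x = 0) \<Longrightarrow> W x = 0"
  proof (rule extend_operator_formal_adjoint[of ?I g \<tau>s \<tau> "norm Z"])
    fix i j assume "i \<in> ?I" "j \<in> ?I"
    then obtain w v w' u where ij: "i = (w, v)" "j = (w', u)" "w \<in> dual" "w' \<in> dual" "v \<in> S" "u \<in> S" by blast
    show "cinner (g (\<tau>s i)) (g j) = cinner (g i) (g (\<tau> j))"
      using adj[OF coinvariantD(4)[OF S dip_RC[OF ij(3,4)] ij(6)]] intertwinesD(2)[OF Z dip_RC[OF ij(3,4)] ij(6)]
      unfolding ij(1,2) g_def \<tau>_def \<tau>s_def prod.case gram[OF ij(3,4)] by simp
  next
    fix i assume "i \<in> ?I"
    then obtain w u where i: "i = (w, u)" "w \<in> dual" "u \<in> S" by blast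
    show "\<tau> i \<in> ?I" "\<tau>s i \<in> ?I" using i intertwinesD(1)[OF Z] Zs_S unfolding \<tau>_def \<tau>s_def by auto
    have pow: "((\<tau>s \<circ> \<tau>) ^^ n) i = (w, ((Zs * Z) ^ n) *\<^sub>V u)" for n
      by (induction n) (simp_all add: i \<tau>_def \<tau>s_def bop_apply_simps)
    have "norm (g (((\<tau>s \<circ> \<tau>) ^^ n) i)) \<le> norm (Rd w) * norm u * ((norm Z)\<^sup>2) ^ n" for n
    proof -
      have "norm Zs \<le> norm p * norm (star Z)" unfolding Zs_def by (rule norm_mult_ineq)
      also have "\<dots> \<le> 1 * norm Z"
        unfolding norm_star p_def by (rule mult_right_mono[OF norm_proj_le[OF coinvariantD(1,2)[OF S]]]) simp
      finally have "norm (Zs * Z) \<le> norm Z * norm Z"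
        by (intro order_trans[OF norm_mult_ineq] mult_right_mono) simp_all
      then have "norm ((Zs * Z) ^ n) \<le> ((norm Z)\<^sup>2) ^ n"
        unfolding power2_eq_square by (intro order_trans[OF norm_power_le] power_mono) simp_all
      then have "norm (g (((\<tau>s \<circ> \<tau>) ^^ n) i)) \<le> norm (Rd w) * (((norm Z)\<^sup>2) ^ n * norm u)"
        unfolding pow g_def prod.case
        by (intro order_trans[OF norm_bop_apply] mult_left_mono mult_right_mono) simp_all
      then show ?thesis by (simp only: mult_ac)
    qed
    then show "\<exists>K. \<forall>n. norm (g (((\<tau>s \<circ> \<tau>) ^^ n) i)) \<le> K * ((norm Z)\<^sup>2) ^ n" by blast
  qed simp_all
  show ?thesis
  proof (rule that[of "Bop W"]; unfold Bop_apply[OF W(1)])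
    show "W (Rd w *\<^sub>V u) = Rd w *\<^sub>V Z *\<^sub>V u" if "w \<in> dual" "u \<in> S" for w u
      using W(2)[of "(w, u)"] that by (simp add: g_def \<tau>_def)
    show "norm (W x) \<le> norm Z * norm x" for x by (rule W(3))
    show "W x = 0" if "\<And>w u. w \<in> dual \<Longrightarrow> u \<in> S \<Longrightarrow> cinner (Rd w *\<^sub>V u) x = 0" for x
      by (rule W(4)) (use that in \<open>auto simp: g_def\<close>)
  qed
qed

text \<open>The strict inequality between \<open>r\<close> and \<open>r'\<close> makes the form
  coercive, so a projection onto \<open>S\<close> orthogonal for this form exists. The last claim is
  Pythagoras for the form. Commutation with I \<otimes> b comes from uniqueness, since the form is
  invariant under the commutant.\<close>

lemma coercive_projection:
  fixes W :: "'k bop"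
  assumes S: "coinvariant S" and W: "\<And>x. norm (W *\<^sub>V x) \<le> r * norm x" "\<And>b. b \<in> RC \<Longrightarrow> W * F.cB b = F.cB b * W"
    and r: "0 \<le> r" "r < r'"
  obtains e :: "'k bop" where "\<And>u. u \<in> S \<Longrightarrow> e *\<^sub>V u = u" "\<And>u. e *\<^sub>V u \<in> S" "\<And>b. b \<in> RC \<Longrightarrow> e * F.cB b = F.cB b * e"
    "\<And>u. r'\<^sup>2 * (norm (e *\<^sub>V u))\<^sup>2 - (norm (W *\<^sub>V e *\<^sub>V u))\<^sup>2 \<le> r'\<^sup>2 * (norm u)\<^sup>2 - (norm (W *\<^sub>V u))\<^sup>2"
proof -
  define q where "q u v = of_real (r'\<^sup>2) * cinner u v - cinner (W *\<^sub>V u) (W *\<^sub>V v)" for u v :: 'k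
  have q_add: "q x (y + z) = q x y + q x z" for x y z by (simp add: q_def bop_simps cinner_add_right algebra_simps)
  have q_scale: "q x (c *\<^sub>C y) = c * q x y" for x y c by (simp add: q_def bop_simps cinner_scaleC_right algebra_simps)
  have q_sym: "q y x = cnj (q x y)" for x y by (simp add: q_def flip: cinner_commute)
  have q_self: "Re (q u u) = r'\<^sup>2 * (norm u)\<^sup>2 - (norm (W *\<^sub>V u))\<^sup>2" for u by (simp add: q_def Re_cinner_self)
  have W2: "(norm (W *\<^sub>V x))\<^sup>2 \<le> r\<^sup>2 * (norm x)\<^sup>2" for x
    using power_mono[OF W(1)[of x] norm_ge_zero, of 2] by (simp add: power_mult_distrib)
  have coercive: "(r'\<^sup>2 - r\<^sup>2) * (norm x)\<^sup>2 \<le> Re (q x x)" for x unfolding q_self using W2[of x] by (simp add: left_diff_distrib)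
  have pos: "0 < r'\<^sup>2 - r\<^sup>2" using power_strict_mono[OF r(2,1), of 2] by simp
  have q_bound: "cmod (q x y) \<le> (r'\<^sup>2 + r * r) * norm x * norm y" for x y
  proof -
    have "cmod (q x y) \<le> r'\<^sup>2 * cmod (cinner x y) + cmod (cinner (W *\<^sub>V x) (W *\<^sub>V y))"
      unfolding q_def by (rule order_trans[OF norm_triangle_ineq4]) (simp add: norm_mult norm_power)
    also have "\<dots> \<le> r'\<^sup>2 * (norm x * norm y) + (r * norm x) * (r * norm y)"
      by (intro add_mono mult_left_mono norm_cinner_le order_trans[OF norm_cinner_le] mult_mono W(1)) (use r in simp_all)
    finally show ?thesis by (simp add: algebra_simps)
  qed
  obtain e where e: "bounded_clinear e" "\<And>u. e u \<in> S" "\<And>u w. w \<in> S \<Longrightarrow> q w (u - e u) = 0"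
    "\<And>u v. v \<in> S \<Longrightarrow> (\<And>w. w \<in> S \<Longrightarrow> q w (u - v) = 0) \<Longrightarrow> e u = v"
    by (rule projection_sesquilinear_form[where q = q, OF q_add q_scale q_sym q_bound pos coercive coinvariantD(1,2)[OF S]]) blast
  have q0: "q w 0 = 0" for w by (simp add: q_def bop_simps)
  show ?thesis
  proof (rule that[of "Bop e"]; (unfold Bop_apply[OF e(1)])?)
    show "e u = u" if "u \<in> S" for u by (rule e(4)[OF that]) (simp add: q0)
    show "e u \<in> S" for u by (rule e(2))
    show "Bop e * F.cB b = F.cB b * Bop e" if b: "b \<in> RC" for b
    proof (rule bop_ext)
      fix u
      have "e (F.cB b *\<^sub>V u) = F.cB b *\<^sub>V e u"
      proof (rule e(4)[OF coinvariantD(4)[OF S b e(2)]])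
        fix w assume w: "w \<in> S"
        have "W *\<^sub>V F.cB b *\<^sub>V x = F.cB b *\<^sub>V W *\<^sub>V x" for x by (rule bop_commute_apply[OF W(2)[OF b]])
        moreover have "W *\<^sub>V F.cB (star b) *\<^sub>V x = F.cB (star b) *\<^sub>V W *\<^sub>V x" for x
          by (rule bop_commute_apply[OF W(2)[OF RC_star[OF b]]])
        ultimately have "q w (F.cB b *\<^sub>V (u - e u)) = q (F.cB (star b) *\<^sub>V w) (u - e u)"
          unfolding q_def by (simp add: F.cB_star[OF b] cinner_star_bop)
        also have "\<dots> = 0" by (rule e(3)[OF coinvariantD(4)[OF S RC_star[OF b] w]])
        finally show "q w (F.cB b *\<^sub>V u - F.cB b *\<^sub>V e u) = 0" by (simp add: bop_simps)
      qed
      then show "(Bop e * F.cB b) *\<^sub>V u = (F.cB b * Bop e) *\<^sub>V u" by (simp add: bop_apply_simps Bop_apply[OF e(1)])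
    qed
    show "r'\<^sup>2 * (norm (e u))\<^sup>2 - (norm (W *\<^sub>V e u))\<^sup>2 \<le> r'\<^sup>2 * (norm u)\<^sup>2 - (norm (W *\<^sub>V u))\<^sup>2" for u
    proof -
      define v where "v = u - e u"
      have z: "q (e u) v = 0" unfolding v_def by (rule e(3)[OF e(2)])
      then have z': "q v (e u) = 0" using q_sym[of v "e u"] by simp
      have "q u u = cnj (q u (e u)) + cnj (q u v)" using q_add[of u "e u" v] q_sym[of u u] unfolding v_def by simp
      also have "\<dots> = q (e u) (e u + v) + q v (e u + v)" unfolding v_def by (simp flip: q_sym)
      also have "\<dots> = q (e u) (e u) + q v v" unfolding q_add z z' by simp
      finally have "Re (q u u) = Re (q (e u) (e u)) + Re (q v v)" by simp
      moreover have "0 \<le> Re (q v v)" using order_trans[OF mult_nonneg_nonneg coercive] pos by simp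
      ultimately show ?thesis unfolding q_self by simp
    qed
  qed
qed

text \<open>
  On \<open>up S\<close> the lift has to be \<open>W = I \<otimes> Z\<close> up to a component in \<open>H\<close>. The latter is \<open>P\<^sub>0 Z e\<close> for a projection
  \<open>e\<close> onto \<open>S\<close>; orthogonality of \<open>e\<close> for the form \<open>r\<^sup>2\<langle>u, v\<rangle> - \<langle>W u, W v\<rangle>\<close> is what bounds the sum by \<open>r\<close>.
\<close>

lemma lift_step:
  assumes S: "coinvariant S" and Z: "intertwines S Z" and r: "norm Z < r"
  obtains Z' where "norm Z' \<le> r" "intertwines (up S) Z'" "\<And>u. u \<in> S \<Longrightarrow> Z' *\<^sub>V u = Z *\<^sub>V u"
proof -
  obtain W where W: "\<And>w u. w \<in> dual \<Longrightarrow> u \<in> S \<Longrightarrow> W *\<^sub>V Rd w *\<^sub>V u = Rd w *\<^sub>V Z *\<^sub>V u"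
    and nW: "\<And>x. norm (W *\<^sub>V x) \<le> norm Z * norm x"
    and W0: "\<And>x. (\<And>w u. w \<in> dual \<Longrightarrow> u \<in> S \<Longrightarrow> cinner (Rd w *\<^sub>V u) x = 0) \<Longrightarrow> W *\<^sub>V x = 0"
    by (rule creation_extension[OF S Z]) blast
  define V where "V = closure (cspan {Rd w *\<^sub>V u | w u. w \<in> dual \<and> u \<in> S})"
  have V: "csubspace V" "closed V" unfolding V_def by (simp_all add: csubspace_closure_cspan)
  have V_I: "Rd w *\<^sub>V u \<in> V" if "w \<in> dual" "u \<in> S" for w u
    unfolding V_def by (rule closure_cspan_superset) (use that in blast)
  have V_eq: "A *\<^sub>V x = B *\<^sub>V x"
    if "\<And>w u. w \<in> dual \<Longrightarrow> u \<in> S \<Longrightarrow> A *\<^sub>V Rd w *\<^sub>V u = B *\<^sub>V Rd w *\<^sub>V u" "x \<in> V" for A B :: "'k bop" and x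
  proof -
    have "(A - B) *\<^sub>V x \<in> {0}"
      using that(2) unfolding V_def
      by (rule bop_image_closure_cspan[rotated 3]) (use that(1) in \<open>auto simp: bop_apply_simps complex_vector.subspace_single_0\<close>)
    then show ?thesis by (simp add: bop_apply_simps)
  qed
  define p where "p = proj V"
  have p: "p *\<^sub>V x \<in> V" for x unfolding p_def by (rule proj_mem[OF V])
  have p_perp: "cinner (Rd w *\<^sub>V u) (x - p *\<^sub>V x) = 0" if "w \<in> dual" "u \<in> S" for w u x
    unfolding p_def by (rule proj_orthogonal[OF V V_I[OF that]])
  have Wp: "W *\<^sub>V x = W *\<^sub>V p *\<^sub>V x" for x using W0[of "x - p *\<^sub>V x", OF p_perp] by (simp add: bop_simps)
  have W_cB: "W * F.cB b = F.cB b * W" if b: "b \<in> RC" for b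
  proof (rule bop_ext)
    fix x
    have "W *\<^sub>V F.cB b *\<^sub>V (x - p *\<^sub>V x) = 0"
    proof (rule W0)
      fix w u assume wu: "w \<in> dual" "u \<in> S"
      have "cinner (Rd w *\<^sub>V u) (F.cB b *\<^sub>V (x - p *\<^sub>V x)) = cinner ((F.cB (star b) * Rd w) *\<^sub>V u) (x - p *\<^sub>V x)"
        by (simp add: bop_apply_simps F.cB_star[OF b] cinner_star_bop)
      then show "cinner (Rd w *\<^sub>V u) (F.cB b *\<^sub>V (x - p *\<^sub>V x)) = 0"
        unfolding cB_Rd[OF wu(1) RC_star[OF b]] using p_perp[OF dual_cB[OF wu(1) RC_star[OF b]] wu(2)] by simp
    qed
    then have "W *\<^sub>V F.cB b *\<^sub>V x = (W * F.cB b) *\<^sub>V p *\<^sub>V x" by (simp add: bop_simps bop_apply_simps)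
    also have "\<dots> = (F.cB b * W) *\<^sub>V p *\<^sub>V x"
    proof (rule V_eq[OF _ p])
      fix w u assume wu: "w \<in> dual" "u \<in> S"
      have cR: "F.cB b *\<^sub>V Rd w *\<^sub>V y = Rd (\<lambda>h. F.cB b *\<^sub>V w h) *\<^sub>V y" for y
        unfolding cB_Rd[OF wu(1) b, symmetric] by (simp add: bop_apply_simps)
      show "(W * F.cB b) *\<^sub>V Rd w *\<^sub>V u = (F.cB b * W) *\<^sub>V Rd w *\<^sub>V u"
        unfolding bop_apply_simps W[OF wu] cR by (rule W[OF dual_cB[OF wu(1) b] wu(2)])
    qed
    also have "\<dots> = (F.cB b * W) *\<^sub>V x" using Wp[of x] by (simp add: bop_apply_simps)
    finally show "(W * F.cB b) *\<^sub>V x = (F.cB b * W) *\<^sub>V x" by (simp add: bop_apply_simps)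
  qed
  have Rd_S: "star (Rd w) *\<^sub>V Rd v *\<^sub>V u = F.cB (dip w v) *\<^sub>V u" if "w \<in> dual" "v \<in> dual" for w v u
    unfolding star_Rd_Rd[OF that, symmetric] by (simp add: bop_apply_simps)
  have star_W: "star (Rd w) *\<^sub>V W *\<^sub>V u = Z *\<^sub>V star (Rd w) *\<^sub>V u" if w: "w \<in> dual" and u: "u \<in> up S" for w u
  proof -
    have 1: "star (Rd w) *\<^sub>V p *\<^sub>V u \<in> S"
      using p[of u] unfolding V_def
      by (rule bop_image_closure_cspan[rotated 3])
         (use S coinvariantD(1,2,4)[OF S] dip_RC[OF w] in \<open>auto simp: Rd_S[OF w]\<close>)
    have "star (Rd w) *\<^sub>V u \<in> S" using u w unfolding up_def by blast
    then have 2: "star (Rd w) *\<^sub>V (u - p *\<^sub>V u) \<in> S"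
      using 1 coinvariantD(1)[OF S] by (simp add: bop_simps complex_vector.subspace_diff)
    \<comment> \<open>The vector \<open>u - p u\<close> is orthogonal to all R_w y with
      \<open>y\<close> in \<open>S\<close>, and its image under the adjoint of \<open>Rd w\<close>
      is itself such a \<open>y\<close>; so the image is orthogonal to itself.\<close>
    have "cinner (star (Rd w) *\<^sub>V (u - p *\<^sub>V u)) (star (Rd w) *\<^sub>V (u - p *\<^sub>V u)) = 0"
      unfolding cinner_star_bop_right by (rule p_perp[OF w 2])
    then have eq: "star (Rd w) *\<^sub>V u = star (Rd w) *\<^sub>V p *\<^sub>V u" by (simp add: cinner_eq_zero_iff bop_simps)
    have "(star (Rd w) * W) *\<^sub>V p *\<^sub>V u = (Z * star (Rd w)) *\<^sub>V p *\<^sub>V u"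
    proof (rule V_eq[OF _ p])
      fix v y assume vy: "v \<in> dual" "y \<in> S"
      show "(star (Rd w) * W) *\<^sub>V Rd v *\<^sub>V y = (Z * star (Rd w)) *\<^sub>V Rd v *\<^sub>V y"
        unfolding bop_apply_simps W[OF vy] Rd_S[OF w vy(1)] by (rule intertwinesD(2)[OF Z dip_RC[OF w vy(1)] vy(2), symmetric])
    qed
    then show ?thesis using Wp[of u] eq by (simp add: bop_apply_simps)
  qed
  obtain e where e: "\<And>u. u \<in> S \<Longrightarrow> e *\<^sub>V u = u" "\<And>u. e *\<^sub>V u \<in> S" "\<And>b. b \<in> RC \<Longrightarrow> e * F.cB b = F.cB b * e"
    and e_le: "\<And>u. r\<^sup>2 * (norm (e *\<^sub>V u))\<^sup>2 - (norm (W *\<^sub>V e *\<^sub>V u))\<^sup>2 \<le> r\<^sup>2 * (norm u)\<^sup>2 - (norm (W *\<^sub>V u))\<^sup>2"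
    by (rule coercive_projection[OF S nW W_cB norm_ge_zero r]) blast+
  define P0 where "P0 = proj (KS 0)"
  \<comment> \<open>The adjoints of the \<open>Rd w\<close> annihilate the first term, so it is free
    for the intertwining relation; it only has to restore the component of \<open>Z\<close> in H on
    \<open>S\<close>.\<close>
  define Z' where "Z' = P0 * Z * e + W"
  have Z': "Z' *\<^sub>V u = P0 *\<^sub>V Z *\<^sub>V e *\<^sub>V u + W *\<^sub>V u" for u by (simp add: Z'_def bop_apply_simps)
  have star_P0: "star (Rd w) *\<^sub>V P0 *\<^sub>V u = 0" if "w \<in> dual" for w u
    unfolding P0_def by (rule star_Rd_KS_0[OF that proj_mem[OF KS]])
  have P0_W: "cinner (P0 *\<^sub>V x) (W *\<^sub>V y) = 0" for x y
  proof -
    have "(star W) *\<^sub>V P0 *\<^sub>V x = 0"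
    proof (rule cinner_ext)
      fix y
      have "cinner (P0 *\<^sub>V x) (W *\<^sub>V p *\<^sub>V y) = 0"
      proof -
        have "W *\<^sub>V p *\<^sub>V y \<in> {z. cinner (P0 *\<^sub>V x) z = 0}"
          using p[of y] unfolding V_def
        proof (rule bop_image_closure_cspan[rotated 3])
          show "csubspace {z. cinner (P0 *\<^sub>V x) z = 0}" using csubspace_cinner_zero[of "{P0 *\<^sub>V x}"] by simp
          show "closed {z. cinner (P0 *\<^sub>V x) z = 0}" by (rule closed_cinner_zero)
          show "W *\<^sub>V z \<in> {z. cinner (P0 *\<^sub>V x) z = 0}" if z': "z \<in> {Rd w *\<^sub>V u | w u. w \<in> dual \<and> u \<in> S}" for z
          proof -
            obtain w u where z: "z = Rd w *\<^sub>V u" "w \<in> dual" "u \<in> S" using z' by blast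
            have "cinner (star (Rd w) *\<^sub>V P0 *\<^sub>V x) (Z *\<^sub>V u) = 0" unfolding star_P0[OF z(2)] by simp
            then show ?thesis unfolding z(1) mem_Collect_eq W[OF z(2,3)] by (simp add: cinner_star_bop)
          qed
        qed
        then show ?thesis by simp
      qed
      then have "cinner (P0 *\<^sub>V x) (W *\<^sub>V y) = 0" using Wp[of y] by simp
      then show "cinner y (star W *\<^sub>V P0 *\<^sub>V x) = cinner y 0"
        by (simp add: cinner_star_bop_right cinner_commute[of "W *\<^sub>V y"])
    qed
    then show ?thesis by (simp flip: cinner_star_bop)
  qed
  \<comment> \<open>On \<open>S\<close> the operators \<open>Z\<close> and \<open>W\<close> have
    equal images under all right annihilators, hence differ by a vector of H.\<close>
  have ZS: "Z *\<^sub>V u = P0 *\<^sub>V Z *\<^sub>V u + W *\<^sub>V u" if u: "u \<in> S" for u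
  proof -
    have "Z *\<^sub>V u - W *\<^sub>V u \<in> KS 0"
    proof (rule star_Rd_all_zero)
      fix w assume w: "w \<in> dual"
      show "star (Rd w) *\<^sub>V (Z *\<^sub>V u - W *\<^sub>V u) = 0"
        using star_W[OF w] up_mono[OF S] u by (auto simp: bop_simps intertwinesD(3)[OF Z w u])
    qed
    then have "Z *\<^sub>V u - W *\<^sub>V u = P0 *\<^sub>V (Z *\<^sub>V u - W *\<^sub>V u)" unfolding P0_def by (rule proj_eq[OF KS, symmetric])
    moreover have "P0 *\<^sub>V W *\<^sub>V u = 0"
    proof -
      have "cinner (P0 *\<^sub>V W *\<^sub>V u) (P0 *\<^sub>V W *\<^sub>V u) = cinner (P0 *\<^sub>V P0 *\<^sub>V W *\<^sub>V u) (W *\<^sub>V u)"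
        using cinner_star_bop_right[of "P0 *\<^sub>V W *\<^sub>V u" P0 "W *\<^sub>V u"] star_proj[OF KS, of 0] unfolding P0_def by simp
      then show ?thesis unfolding P0_W by (simp add: cinner_eq_zero_iff)
    qed
    ultimately have "Z *\<^sub>V u - W *\<^sub>V u = P0 *\<^sub>V Z *\<^sub>V u" by (simp add: bop_simps)
    then show ?thesis by (simp add: eq_diff_eq diff_eq_eq)
  qed
  have ext: "Z' *\<^sub>V u = Z *\<^sub>V u" if "u \<in> S" for u unfolding Z' e(1)[OF that] by (rule ZS[OF that, symmetric])
  have star_Z': "star (Rd w) *\<^sub>V Z' *\<^sub>V u = Z *\<^sub>V star (Rd w) *\<^sub>V u" if "w \<in> dual" "u \<in> up S" for w u
    unfolding Z' bop_simps star_P0[OF that(1)] star_W[OF that] by simp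
  show ?thesis
  proof (rule that[OF _ _ ext])
    show "norm Z' \<le> r"
    proof (rule norm_bop_bound)
      fix u
      let ?v = "e *\<^sub>V u"
      \<comment> \<open>The two components are orthogonal. As \<open>Z\<close> is bounded by
        \<open>r\<close>, the square of the H-component is at most r^2 |v|^2 - |W v|^2 for v = e u,
        and by \<open>e_le\<close> this is at most r^2 |u|^2 - |W u|^2.\<close>
      have "(norm (Z *\<^sub>V ?v))\<^sup>2 = (norm (P0 *\<^sub>V Z *\<^sub>V ?v))\<^sup>2 + (norm (W *\<^sub>V ?v))\<^sup>2"
        using norm_sq_add_orthogonal[OF P0_W[of "Z *\<^sub>V ?v" ?v]] ZS[OF e(2)[of u]] by simp
      moreover have "(norm (Z *\<^sub>V ?v))\<^sup>2 \<le> r\<^sup>2 * (norm ?v)\<^sup>2"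
        unfolding power_mult_distrib[symmetric]
        by (intro power_mono order_trans[OF norm_bop_apply] mult_right_mono less_imp_le[OF r]) auto
      moreover have "(norm (Z' *\<^sub>V u))\<^sup>2 = (norm (P0 *\<^sub>V Z *\<^sub>V ?v))\<^sup>2 + (norm (W *\<^sub>V u))\<^sup>2"
        unfolding Z' by (rule norm_sq_add_orthogonal[OF P0_W])
      ultimately have "(norm (Z' *\<^sub>V u))\<^sup>2 \<le> (r * norm u)\<^sup>2" using e_le[of u] by (simp add: power_mult_distrib)
      then show "norm (Z' *\<^sub>V u) \<le> r * norm u"
        by (rule power2_le_imp_le) (use order_trans[OF norm_ge_zero less_imp_le[OF r]] in simp)
    qed (use order_trans[OF norm_ge_zero less_imp_le[OF r]] in simp)
    show "intertwines (up S) Z'"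
      unfolding intertwines_def
    proof (intro conjI ballI)
      fix u assume u: "u \<in> up S"
      show "Z' *\<^sub>V u \<in> up S"
        using star_Z'[OF _ u] u intertwinesD(1)[OF Z] unfolding up_def by simp
      show "Z' *\<^sub>V star (Rd w) *\<^sub>V u = star (Rd w) *\<^sub>V Z' *\<^sub>V u" if w: "w \<in> dual" for w
        unfolding star_Z'[OF w u] by (rule ext) (use u w in \<open>simp add: up_def\<close>)
      show "Z' *\<^sub>V F.cB b *\<^sub>V u = F.cB b *\<^sub>V Z' *\<^sub>V u" if b: "b \<in> RC" for b
        unfolding Z' bop_commute_apply[OF e(3)[OF b]] intertwinesD(2)[OF Z b e(2)] P0_def
          bop_commute_apply[OF cB_proj_KS[OF b], symmetric] bop_commute_apply[OF W_cB[OF b]] bop_simps ..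
    qed
  qed
qed

text \<open>A commutant lifting theorem. The \<open>n\<close>-th iterate of \<open>up\<close>
  contains \<open>KS n\<close>, so the successive lifts are consistent operators on an increasing
  family with dense union, and a common bound allows them to be glued.\<close>

theorem lift_operator:
  assumes S: "coinvariant S" and Z: "intertwines S Z"
  obtains Y where "\<And>u. u \<in> S \<Longrightarrow> Y *\<^sub>V u = Z *\<^sub>V u" "\<And>b. b \<in> RC \<Longrightarrow> Y * F.cB b = F.cB b * Y"
    "\<And>w. w \<in> dual \<Longrightarrow> Y * star (Rd w) = star (Rd w) * Y"
proof -
  define R where "R = norm Z + 1"
  \<comment> \<open>Each lift needs a strictly larger bound, yet all bounds must stay below a
    constant: the sequence increases strictly from the norm of \<open>Z\<close> towards that norm
    plus 1.\<close>
  define r where "r n = R - 1 / real (Suc n)" for n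
  define SS where "SS n = (up ^^ n) S" for n
  have SS: "coinvariant (SS n)" for n unfolding SS_def by (induction n) (simp_all add: S coinvariant_up)
  have SS_Suc: "SS (Suc n) = up (SS n)" for n by (simp add: SS_def)
  have mono: "SS m \<subseteq> SS n" if "m \<le> n" for m n
    using that by (rule lift_Suc_mono_le[of SS, rotated]) (simp add: SS_Suc up_mono[OF SS])
  have KS_SS: "KS n \<subseteq> SS n" for n
  proof (induction n)
    case 0
    show ?case using coinvariantD(3)[OF SS] .
  next
    case (Suc n)
    then show ?case unfolding SS_Suc by (rule up_KS)
  qed
  have "\<exists>f. \<forall>n. (norm (f n) \<le> r n \<and> intertwines (SS n) (f n) \<and> (n = 0 \<longrightarrow> f n = Z)) \<and> (\<forall>u\<in>SS n. f (Suc n) *\<^sub>V u = f n *\<^sub>V u)"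
  proof (rule dependent_nat_choice)
    show "\<exists>x. norm x \<le> r 0 \<and> intertwines (SS 0) x \<and> (0 = (0::nat) \<longrightarrow> x = Z)"
      using Z by (intro exI[of _ Z]) (simp add: r_def R_def SS_def)
    fix x n assume x: "norm x \<le> r n \<and> intertwines (SS n) x \<and> (n = 0 \<longrightarrow> x = Z)"
    have "r n < r (Suc n)" unfolding r_def by (simp add: field_simps)
    then have "norm x < r (Suc n)" using x by simp
    then obtain y where "norm y \<le> r (Suc n)" "intertwines (up (SS n)) y" "\<And>u. u \<in> SS n \<Longrightarrow> y *\<^sub>V u = x *\<^sub>V u"
      using lift_step[OF SS[of n], of x "r (Suc n)"] x by blast
    then show "\<exists>y. (norm y \<le> r (Suc n) \<and> intertwines (SS (Suc n)) y \<and> (Suc n = 0 \<longrightarrow> y = Z)) \<and> (\<forall>u\<in>SS n. y *\<^sub>V u = x *\<^sub>V u)"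
      unfolding SS_Suc by auto
  qed
  then obtain f where f: "\<And>n. norm (f n) \<le> r n" "\<And>n. intertwines (SS n) (f n)" "f 0 = Z"
    and f_Suc: "\<And>n u. u \<in> SS n \<Longrightarrow> f (Suc n) *\<^sub>V u = f n *\<^sub>V u"
    by blast
  have f_ext: "f n *\<^sub>V u = f m *\<^sub>V u" if mn: "m \<le> n" and u: "u \<in> SS m" for m n u
    using mn
  proof (induction n rule: dec_induct)
    case (step n)
    then show ?case using f_Suc[of u n] mono[of m n] u by auto
  qed simp
  let ?I = "{(n, u). u \<in> SS n}"
  have fR: "norm (f n) \<le> R" for n by (rule order_trans[OF f(1)]) (simp add: r_def)
  define g where "g i = f (fst i) *\<^sub>V snd i" for i
  obtain W where W: "bounded_clinear W" "\<And>i. i \<in> ?I \<Longrightarrow> W (snd i) = g i"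
  proof (rule extend_operator[of ?I g R snd])
    fix A :: "(nat \<times> 'k) set" and c assume A: "finite A" "A \<subseteq> ?I"
    define N where "N = Max (insert 0 (fst ` A))"
    \<comment> \<open>Finitely many vectors lie in one common member of the increasing family, where
      a single lift \<open>f N\<close> represents all the images.\<close>
    have "g i = f N *\<^sub>V snd i" if i: "i \<in> A" for i
    proof -
      have "fst i \<le> N" unfolding N_def using A(1) i by (intro Max_ge) auto
      then show ?thesis using f_ext[of "fst i" N "snd i"] A(2) i by (auto simp: g_def)
    qed
    then have "(\<Sum>i\<in>A. c i *\<^sub>C g i) = f N *\<^sub>V (\<Sum>i\<in>A. c i *\<^sub>C snd i)"
      unfolding bop_apply_sum bop_simps by (intro sum.cong) auto
    then show "norm (\<Sum>i\<in>A. c i *\<^sub>C g i) \<le> R * norm (\<Sum>i\<in>A. c i *\<^sub>C snd i)"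
      using order_trans[OF norm_bop_apply mult_right_mono[OF fR norm_ge_zero]] by simp
  qed blast
  define Y where "Y = Bop W"
  have Y: "Y *\<^sub>V u = f n *\<^sub>V u" if "u \<in> SS n" for n u
    using W(2)[of "(n, u)"] that by (simp add: Y_def g_def Bop_apply[OF W(1)])
  show ?thesis
  proof (rule that[of Y])
    show "Y *\<^sub>V u = Z *\<^sub>V u" if "u \<in> S" for u using Y[of u 0] that by (simp add: SS_def f(3))
    show "Y * F.cB b = F.cB b * Y" if b: "b \<in> RC" for b
    proof (rule KS_bop_eqI)
      fix n u assume "u \<in> KS n"
      then have u: "u \<in> SS n" using KS_SS by blast
      show "(Y * F.cB b) *\<^sub>V u = (F.cB b * Y) *\<^sub>V u"
        by (simp add: bop_apply_simps Y[OF u] Y[OF coinvariantD(4)[OF SS b u]] intertwinesD(2)[OF f(2) b u])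
    qed
    show "Y * star (Rd w) = star (Rd w) * Y" if w: "w \<in> dual" for w
    proof (rule KS_bop_eqI)
      fix n u assume "u \<in> KS n"
      then have u: "u \<in> SS n" using KS_SS by blast
      show "(Y * star (Rd w)) *\<^sub>V u = (star (Rd w) * Y) *\<^sub>V u"
        by (simp add: bop_apply_simps Y[OF u] Y[OF coinvariantD(5)[OF SS w u]] intertwinesD(3)[OF f(2) w u])
    qed
  qed
qed

end

lemma orthogonal_projection_eq:
  assumes S: "csubspace S" "closed S"
  shows "orthogonal_projection S x = proj S *\<^sub>V x"
  unfolding orthogonal_projection_def
proof (rule the_equality)
  show "proj S *\<^sub>V x \<in> S \<and> (\<forall>z\<in>S. cinner z (x - proj S *\<^sub>V x) = 0)"
    using proj_mem[OF S] proj_orthogonal[OF S] by blast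
  fix y assume y: "y \<in> S \<and> (\<forall>z\<in>S. cinner z (x - y) = 0)"
  have "proj S *\<^sub>V (x - y) = 0" by (rule proj_zero[OF S]) (use y in blast)
  then show "y = proj S *\<^sub>V x" using proj_eq[OF S, of y] y by (simp add: bop_simps)
qed

lemma scaleC_power: "(c *\<^sub>C (A :: 'a::cstar_algebra)) ^ n = c ^ n *\<^sub>C A ^ n"
  by (induction n) (simp_all add: scaleC_one scaleC_mult_left scaleC_mult_right scaleC_scaleC)

text \<open>The constant term is the limit at 0; having shown that it vanishes, one divides by
  \<open>x\<close>, which is why the assumption concerns nonzero \<open>x\<close> only.\<close>

lemma powser_zero:
  fixes a :: "nat \<Rightarrow> complex"
  assumes r: "r > 0" and s: "\<And>x. x \<noteq> 0 \<Longrightarrow> cmod x < r \<Longrightarrow> (\<lambda>n. a n * x ^ n) sums 0"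
  shows "a n = 0"
  using s
proof (induction n arbitrary: a)
  case 0
  have "((\<lambda>_. 0) \<longlongrightarrow> a 0) (at (0::complex))" by (rule powser_limit_0_strong[OF r 0])
  then show ?case by (metis LIM_const_eq)
next
  case (Suc n)
  have a0: "a 0 = 0"
  proof -
    have "((\<lambda>_. 0) \<longlongrightarrow> a 0) (at (0::complex))" by (rule powser_limit_0_strong[OF r Suc.prems])
    then show ?thesis by (metis LIM_const_eq)
  qed
  have "(\<lambda>n. a (Suc n) * x ^ n) sums 0" if x: "x \<noteq> 0" "cmod x < r" for x
  proof -
    have "(\<lambda>n. a (Suc n) * x ^ Suc n) sums 0"
      using sums_Suc_iff[of "\<lambda>n. a n * x ^ n" 0] Suc.prems[OF x] a0 by simp
    from sums_mult[OF this, of "1 / x"] show ?thesis using x(1) by (simp add: mult_ac)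
  qed
  then show ?case by (rule Suc.IH)
qed

context rep_fock
begin

section \<open>Reflexivity\<close>

definition MM :: "'k set" where
  "MM = closure (cspan {(Rd w ^ s) *\<^sub>V L0 h | w s h. w \<in> dual})"

lemma symmetric_subspace_eq: "symmetric_subspace \<phi> \<pi> vac ten tE tF = MM"
proof -
  define G where "G s = {(Rd w ^ s) *\<^sub>V L0 h | w h. w \<in> dual}" for s
  have "{dual_power \<pi> vac ten tE tF \<eta> s h | \<eta> h. \<eta> \<in> pi_dual \<phi> \<pi> tE} = G s" for s
    unfolding G_def dual_eq
  proof (intro equalityI subsetI)
    fix x assume "x \<in> {dual_power \<pi> vac ten tE tF \<eta> s h | \<eta> h. \<eta> \<in> pi_dual \<phi> \<pi> tE}"
    then obtain \<eta> h where "x = dual_power \<pi> vac ten tE tF \<eta> s h" "\<eta> \<in> pi_dual \<phi> \<pi> tE" by blast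
    then show "x \<in> {(Rd w ^ s) *\<^sub>V L0 h | w h. w \<in> (\<lambda>\<eta> h. J (\<eta> h)) ` pi_dual \<phi> \<pi> tE}"
      using dual_power_eq by blast
  next
    fix x assume "x \<in> {(Rd w ^ s) *\<^sub>V L0 h | w h. w \<in> (\<lambda>\<eta> h. J (\<eta> h)) ` pi_dual \<phi> \<pi> tE}"
    then obtain \<eta> h where "x = (Rd (\<lambda>h. J (\<eta> h)) ^ s) *\<^sub>V L0 h" "\<eta> \<in> pi_dual \<phi> \<pi> tE" by blast
    then show "x \<in> {dual_power \<pi> vac ten tE tF \<eta> s h | \<eta> h. \<eta> \<in> pi_dual \<phi> \<pi> tE}"
      using dual_power_eq[symmetric] by blast
  qed
  then have "symmetric_subspace \<phi> \<pi> vac ten tE tF = closure (cspan (\<Union>s. closure (cspan (G s))))"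
    unfolding symmetric_subspace_def symmetric_summand_def by simp
  also have "\<dots> = closure (cspan (\<Union>s. G s))"
  proof
    have "closure (cspan (G s)) \<subseteq> closure (cspan (\<Union>s. G s))" for s
      by (intro closure_mono complex_vector.span_mono) blast
    then show "closure (cspan (\<Union>s. closure (cspan (G s)))) \<subseteq> closure (cspan (\<Union>s. G s))"
      by (intro closure_cspan_subset csubspace_closure_cspan) auto
    show "closure (cspan (\<Union>s. G s)) \<subseteq> closure (cspan (\<Union>s. closure (cspan (G s))))"
      by (intro closure_mono complex_vector.span_mono) (use closure_cspan_superset in blast)
  qed
  also have "(\<Union>s. G s) = {(Rd w ^ s) *\<^sub>V L0 h | w s h. w \<in> dual}" unfolding G_def by blast
  finally show ?thesis unfolding MM_def .
qed

lemma MM: "csubspace MM" "closed MM"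
  unfolding MM_def by (simp_all add: csubspace_closure_cspan)

lemma MM_I: "w \<in> dual \<Longrightarrow> (Rd w ^ s) *\<^sub>V L0 h \<in> MM"
  unfolding MM_def by (rule closure_cspan_superset) blast

lemma zero_dual: "(\<lambda>_. 0) \<in> dual"
  unfolding dual_def using complex_vector.subspace_0[OF KS(1)]
  by (simp add: bop_simps bounded_clinearI[where K = 0])

lemma KS_0_MM: "KS 0 \<subseteq> MM"
proof
  fix u assume "u \<in> KS 0"
  then show "u \<in> MM" using KS_0_L0[of u] MM_I[OF zero_dual, of 0 "adj L0 u"] by (simp add: bop_apply_simps)
qed

text \<open>
  For invertible \<open>d\<close> in the commutant, \<open>I \<otimes> d\<close> maps \<open>w\<^bsup>(s)\<^esup>(h)\<close> to \<open>v\<^bsup>(s)\<^esup>(d h)\<close> where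
  \<open>v = (I \<otimes> d) w d\<^sup>-\<^sup>1\<close>, and every element of the commutant is a combination of \<open>1\<close> and an invertible one.
\<close>

lemma cB_MM:
  assumes b: "b \<in> RC" and u: "u \<in> MM"
  shows "F.cB b *\<^sub>V u \<in> MM"
proof -
  \<comment> \<open>The scale makes t b smaller than 1, so that 1 - t b is invertible by a Neumann
    series; \<open>b\<close> is recovered from 1 and this element.\<close>
  define t where "t = 1 / (norm b + 1)"
  define x where "x = of_real t *\<^sub>C b"
  define d where "d = (\<Sum>n. x ^ n)"
  have t: "0 < t" unfolding t_def by (simp add: add_nonneg_pos)
  have "norm x = t * norm b" unfolding x_def norm_scaleC using t by simp
  also have "\<dots> < 1" unfolding t_def by (simp add: pos_divide_less_eq add_nonneg_pos)
  finally have d: "is_inverse (1 - x) d" unfolding d_def by (rule neumann)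
  have x: "x \<in> RC" unfolding x_def by (rule RC_scaleC[OF b])
  have x1: "1 - x \<in> RC" by (rule RC_diff[OF RC_one x])
  have dRC: "d \<in> RC"
    unfolding RC_def
  proof (intro CollectI allI)
    fix a
    have "Rep a * (1 - x) = (1 - x) * Rep a" using x1 unfolding RC_def by simp
    from is_inverse_commute[OF d this] show "d * Rep a = Rep a * d" by (rule sym)
  qed
  have inv: "F.cB d * F.cB (1 - x) = 1"
    using d unfolding is_inverse_def by (simp add: F.cB_one flip: F.cB_mult[OF dRC x1])
  have "F.cB (1 - x) *\<^sub>V u \<in> MM"
    using u unfolding MM_def
  proof (rule bop_image_closure_cspan[rotated 3, OF _ csubspace_closure_cspan closed_closure])
    fix y assume "y \<in> {(Rd w ^ s) *\<^sub>V L0 h | w s h. w \<in> dual}"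
    then obtain w s h where y: "y = (Rd w ^ s) *\<^sub>V L0 h" "w \<in> dual" by blast
    define v where "v h = F.cB (1 - x) *\<^sub>V w (d *\<^sub>V h)" for h
    have v: "v \<in> dual" unfolding v_def using dual_cB[OF dual_RC[OF y(2) dRC] x1] .
    have Rv: "F.cB (1 - x) * Rd w = Rd v * F.cB (1 - x)"
    proof -
      have "Rd v = F.cB (1 - x) * (Rd w * F.cB d)"
        unfolding v_def Rd_cB[OF y(2) dRC] cB_Rd[OF dual_RC[OF y(2) dRC] x1] ..
      then show ?thesis by (simp add: mult.assoc inv)
    qed
    have "F.cB (1 - x) * Rd w ^ s = Rd v ^ s * F.cB (1 - x)"
    proof (induction s)
      case (Suc s)
      have "F.cB (1 - x) * (Rd w * Rd w ^ s) = Rd v * (F.cB (1 - x) * Rd w ^ s)"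
        unfolding mult.assoc[symmetric] Rv ..
      then show ?case unfolding Suc power_Suc mult.assoc .
    qed simp
    then have "F.cB (1 - x) *\<^sub>V y = (Rd v ^ s) *\<^sub>V F.cB (1 - x) *\<^sub>V L0 h"
      unfolding y(1) bop_apply_simps(6)[symmetric] by (rule arg_cong)
    then show "F.cB (1 - x) *\<^sub>V y \<in> closure (cspan {(Rd w ^ s) *\<^sub>V L0 h | w s h. w \<in> dual})"
      using MM_I[OF v] unfolding MM_def cB_L0[OF x1] by simp
  qed
  then have "u - F.cB (1 - x) *\<^sub>V u \<in> MM" by (rule complex_vector.subspace_diff[OF MM(1) u])
  then have "of_real t *\<^sub>C F.cB b *\<^sub>V u \<in> MM"
    unfolding F.cB_diff[OF RC_one x] F.cB_one bop_apply_simps unfolding x_def F.cB_scaleC[OF b] scaleC_bop_apply by simp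
  then have "(1 / of_real t) *\<^sub>C of_real t *\<^sub>C F.cB b *\<^sub>V u \<in> MM" by (rule complex_vector.subspace_scale[OF MM(1)])
  then show ?thesis using t by (simp add: scaleC_scaleC scaleC_one)
qed

text \<open>The adjoint of \<open>Rd v\<close> turns the power \<open>s\<close> of
  \<open>Rd w\<close> into I \<otimes> b times the power s - 1, with \<open>b\<close> in the
  commutant; hence invariance under the commutant comes first.\<close>

lemma coinvariant_MM: "coinvariant MM"
  unfolding coinvariant_def
proof (intro conjI ballI MM KS_0_MM cB_MM)
  fix v u assume v: "v \<in> dual" and u: "u \<in> MM"
  show "star (Rd v) *\<^sub>V u \<in> MM"
    using u unfolding MM_def
  proof (rule bop_image_closure_cspan[rotated 3, OF _ csubspace_closure_cspan closed_closure], fold MM_def)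
    fix y assume "y \<in> {(Rd w ^ s) *\<^sub>V L0 h | w s h. w \<in> dual}"
    then obtain w s h where y: "y = (Rd w ^ s) *\<^sub>V L0 h" "w \<in> dual" by blast
    show "star (Rd v) *\<^sub>V y \<in> MM"
    proof (cases s)
      case 0
      then show ?thesis unfolding y(1) using star_Rd_KS_0[OF v L0_KS] complex_vector.subspace_0[OF MM(1)] by (simp add: bop_apply_simps)
    next
      case (Suc k)
      have "star (Rd v) *\<^sub>V y = (star (Rd v) * Rd w) *\<^sub>V (Rd w ^ k) *\<^sub>V L0 h" unfolding y(1) Suc by (simp add: bop_apply_simps)
      then show ?thesis unfolding star_Rd_Rd[OF v y(2)] using cB_MM[OF dip_RC[OF v y(2)] MM_I[OF y(2)]] by simp
    qed
  qed
qed

text \<open>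
  The joint eigenspace of the \<open>R\<^sub>\<zeta>\<^sup>*\<close> that belongs to \<open>\<eta>\<close>, which for small \<open>\<eta>\<close> is \<open>(1 - R\<^sub>\<eta>)\<^sup>-\<^sup>1 H\<close>.
\<close>

definition eigen :: "('h \<Rightarrow> 'k) \<Rightarrow> 'k set" where
  "eigen \<eta> = {u. \<forall>\<zeta>\<in>dual. star (Rd \<zeta>) *\<^sub>V u = F.cB (dip \<zeta> \<eta>) *\<^sub>V u}"

text \<open>By the Fock relation the eigenvalue equation says that u - R_\<eta> u is annihilated by
  all right annihilators, whose joint kernel is H.\<close>

lemma eigen_iff:
  assumes \<eta>: "\<eta> \<in> dual"
  shows "u \<in> eigen \<eta> \<longleftrightarrow> u - Rd \<eta> *\<^sub>V u \<in> KS 0"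
proof -
  have eq: "star (Rd \<zeta>) *\<^sub>V (u - Rd \<eta> *\<^sub>V u) = star (Rd \<zeta>) *\<^sub>V u - F.cB (dip \<zeta> \<eta>) *\<^sub>V u" if "\<zeta> \<in> dual" for \<zeta>
    unfolding star_Rd_Rd[OF that \<eta>, symmetric] by (simp add: bop_simps bop_apply_simps)
  show ?thesis
  proof
    assume "u \<in> eigen \<eta>"
    then show "u - Rd \<eta> *\<^sub>V u \<in> KS 0" by (intro star_Rd_all_zero) (simp add: eq eigen_def)
  next
    assume "u - Rd \<eta> *\<^sub>V u \<in> KS 0"
    then show "u \<in> eigen \<eta>" unfolding eigen_def using star_Rd_KS_0 eq by auto
  qed
qed

lemma eigen_neumann:
  assumes \<eta>: "\<eta> \<in> dual" "norm (Rd \<eta>) < 1"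
  shows "(\<Sum>n. Rd \<eta> ^ n) *\<^sub>V L0 h \<in> eigen \<eta>"
proof -
  have "((1 - Rd \<eta>) * (\<Sum>n. Rd \<eta> ^ n)) *\<^sub>V L0 h = L0 h"
    using neumann[OF \<eta>(2)] unfolding is_inverse_def by (simp add: bop_apply_simps)
  then show ?thesis unfolding eigen_iff[OF \<eta>(1)] using L0_KS[of h] by (simp add: bop_apply_simps)
qed

lemma eigen_MM:
  assumes \<eta>: "\<eta> \<in> dual" "norm (Rd \<eta>) < 1" and u: "u \<in> eigen \<eta>"
  shows "u \<in> MM"
proof -
  define h where "h = adj L0 (u - Rd \<eta> *\<^sub>V u)"
  have h: "u - Rd \<eta> *\<^sub>V u = L0 h" unfolding h_def using u unfolding eigen_iff[OF \<eta>(1)] by (rule KS_0_L0)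
  have "u = ((\<Sum>n. Rd \<eta> ^ n) * (1 - Rd \<eta>)) *\<^sub>V u"
    using neumann[OF \<eta>(2)] unfolding is_inverse_def by (simp add: bop_apply_simps)
  also have "\<dots> = (\<Sum>n. Rd \<eta> ^ n) *\<^sub>V L0 h" by (simp add: h bop_apply_simps)
  finally have u_eq: "u = (\<Sum>n. Rd \<eta> ^ n) *\<^sub>V L0 h" .
  have "(\<lambda>N. (\<Sum>n<N. Rd \<eta> ^ n) *\<^sub>V L0 h) \<longlonglongrightarrow> u"
    unfolding u_eq by (intro tendsto_bop_left summable_LIMSEQ summable_power \<eta>(2))
  then show ?thesis
    by (rule closed_sequentially[OF MM(2), rotated])
       (simp add: sum_bop_apply complex_vector.subspace_sum[OF MM(1)] MM_I[OF \<eta>(1)])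
qed

text \<open>Replacing \<eta> by x w with a small scalar \<open>x\<close> makes the Neumann series a
  power series in \<open>x\<close>. If \<open>E\<close> kills its values, it kills each coefficient,
  and the coefficients are the generators of \<open>MM\<close>.\<close>

lemma eigen_total:
  fixes E :: "'k bop"
  assumes E: "\<And>\<eta> u. \<eta> \<in> dual \<Longrightarrow> norm (Rd \<eta>) < 1 \<Longrightarrow> u \<in> eigen \<eta> \<Longrightarrow> E *\<^sub>V u = 0" and u: "u \<in> MM"
  shows "E *\<^sub>V u = 0"
proof -
  have "E *\<^sub>V u \<in> {0}"
    using u unfolding MM_def
  proof (rule bop_image_closure_cspan[rotated 3])
    fix y assume "y \<in> {(Rd w ^ s) *\<^sub>V L0 h | w s h. w \<in> dual}"
    then obtain w s h where y: "y = (Rd w ^ s) *\<^sub>V L0 h" and w: "w \<in> dual" by blast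
    have "cinner v (E *\<^sub>V (Rd w ^ n) *\<^sub>V L0 h) = 0" for v n
    proof (rule powser_zero[where a = "\<lambda>n. cinner v (E *\<^sub>V (Rd w ^ n) *\<^sub>V L0 h)"])
      show "0 < 1 / (norm (Rd w) + 1)" by (simp add: add_nonneg_pos)
      fix x assume x: "cmod x < 1 / (norm (Rd w) + 1)"
      define \<eta> where "\<eta> h = x *\<^sub>C w h" for h
      have \<eta>: "\<eta> \<in> dual" unfolding \<eta>_def by (rule dual_scaleC[OF w])
      have R: "Rd \<eta> = x *\<^sub>C Rd w" unfolding \<eta>_def by (rule Rd_scaleC[OF w])
      have "cmod x * (norm (Rd w) + 1) < 1" using x by (simp add: pos_less_divide_eq add_nonneg_pos)
      then have n: "norm (Rd \<eta>) < 1" unfolding R norm_scaleC distrib_left using norm_ge_zero[of x] by linarith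
      have bl: "bounded_linear (\<lambda>A. cinner v (E *\<^sub>V A *\<^sub>V L0 h))"
        by (intro bounded_linear_compose[OF bounded_clinearD(1)[OF bounded_clinear_cinner_right]]
              bounded_linear_compose[OF bounded_clinearD(1)[OF bounded_clinear_bop]] bounded_linear_bop_left)
      have "(\<lambda>n. cinner v (E *\<^sub>V (Rd \<eta> ^ n) *\<^sub>V L0 h)) sums cinner v (E *\<^sub>V (\<Sum>n. Rd \<eta> ^ n) *\<^sub>V L0 h)"
        by (rule bounded_linear.sums[OF bl summable_sums[OF summable_power(2)[OF n]]])
      moreover have "cinner v (E *\<^sub>V (Rd \<eta> ^ n) *\<^sub>V L0 h) = cinner v (E *\<^sub>V (Rd w ^ n) *\<^sub>V L0 h) * x ^ n" for n
        unfolding R scaleC_power scaleC_bop_apply bop_simps cinner_scaleC_right by (rule mult.commute)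
      ultimately show "(\<lambda>n. cinner v (E *\<^sub>V (Rd w ^ n) *\<^sub>V L0 h) * x ^ n) sums 0"
        using E[OF \<eta> n eigen_neumann[OF \<eta> n]] by simp
    qed
    then have "E *\<^sub>V y = 0" unfolding y by (intro cinner_ext) simp
    then show "E *\<^sub>V y \<in> {0}" by simp
  qed (simp_all add: complex_vector.subspace_single_0)
  then show ?thesis by simp
qed

text \<open>
  The norm of the derivation \<open>\<delta>\<close> on selfadjoint elements is halved by subtracting multiples of symmetries, on which
  \<open>\<delta>\<close> vanishes. This avoids the spectral theorem.
\<close>

lemma commute_cB_of_projections:
  fixes A :: "'k bop"
  assumes A: "\<And>q. q \<in> RC \<Longrightarrow> q * q = q \<Longrightarrow> star q = q \<Longrightarrow> A * F.cB q = F.cB q * A" and b: "b \<in> RC"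
  shows "A * F.cB b = F.cB b * A"
proof -
  define \<delta> where "\<delta> b = A * F.cB b - F.cB b * A" for b
  have add: "\<delta> (x + y) = \<delta> x + \<delta> y" if "x \<in> RC" "y \<in> RC" for x y
    unfolding \<delta>_def F.cB_add[OF that] by (simp add: distrib_left distrib_right)
  have scale: "\<delta> (c *\<^sub>C x) = c *\<^sub>C \<delta> x" if "x \<in> RC" for c x
    unfolding \<delta>_def F.cB_scaleC[OF that] scaleC_mult_left scaleC_mult_right complex_vector.scale_right_diff_distrib ..
  have diff: "\<delta> (x - y) = \<delta> x - \<delta> y" if "x \<in> RC" "y \<in> RC" for x y
    unfolding \<delta>_def F.cB_diff[OF that] by (simp add: left_diff_distrib right_diff_distrib)
  have one: "\<delta> 1 = 0" unfolding \<delta>_def F.cB_one by simp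
  have bound: "norm (\<delta> x) \<le> 2 * norm A * norm x / 2 ^ n" if "x \<in> RC" "star x = x" for n x
    using that
  proof (induction n arbitrary: x)
    case 0
    have "norm (\<delta> x) \<le> norm A * norm x + norm x * norm A"
      unfolding \<delta>_def
      by (intro order_trans[OF norm_triangle_ineq4] add_mono order_trans[OF norm_mult_ineq] mult_mono F.norm_cB_le 0) auto
    then show ?case by (simp add: mult.commute)
  next
    case (Suc n)
    show ?case
    proof (cases "norm x = 0")
      case True
      then show ?thesis using Suc.IH[OF Suc.prems] by simp
    next
      case False
      then have pos: "norm x > 0" by simp
      obtain q where q: "q * q = q" "star q = q" "\<And>z. z * x = x * z \<Longrightarrow> z * q = q * z"
        "norm (x - of_real (norm x / 2) *\<^sub>C (q + q - 1)) \<le> norm x / 2"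
        by (rule symmetry_approximation[OF Suc.prems(2) order_refl pos]) blast
      have qRC: "q \<in> RC" using q(3) Suc.prems(1) unfolding RC_def by auto
      define s where "s = q + q - 1"
      have s: "s \<in> RC" unfolding s_def by (intro RC_diff RC_add RC_one qRC)
      have "\<delta> q = 0" unfolding \<delta>_def using A[OF qRC q(1,2)] by simp
      then have "\<delta> s = 0" unfolding s_def by (simp add: diff add one RC_add RC_one qRC)
      then have eq: "\<delta> (x - of_real (norm x / 2) *\<^sub>C s) = \<delta> x"
        by (simp add: diff Suc.prems(1) RC_scaleC s scale complex_vector.scale_zero_right)
      have "star s = s" unfolding s_def by (simp add: star_diff star_add q(2))
      then have sa: "star (x - of_real (norm x / 2) *\<^sub>C s) = x - of_real (norm x / 2) *\<^sub>C s"
        by (simp add: star_diff star_scaleC Suc.prems(2))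
      have "norm (\<delta> x) \<le> 2 * norm A * norm (x - of_real (norm x / 2) *\<^sub>C s) / 2 ^ n"
        using Suc.IH[OF RC_diff[OF Suc.prems(1) RC_scaleC[OF s]] sa] unfolding eq .
      also have "\<dots> \<le> 2 * norm A * (norm x / 2) / 2 ^ n"
        using q(4) unfolding s_def by (intro divide_right_mono mult_left_mono) simp_all
      finally show ?thesis by (simp add: mult_ac)
    qed
  qed
  have sa0: "\<delta> x = 0" if "x \<in> RC" "star x = x" for x
  proof -
    have "(\<lambda>n. 2 * norm A * norm x * (1 / 2) ^ n) \<longlonglongrightarrow> 2 * norm A * norm x * 0"
      by (intro tendsto_mult tendsto_const LIMSEQ_power_zero) simp
    then have "norm (\<delta> x) \<le> 0"
      using LIMSEQ_le_const[of "\<lambda>n. 2 * norm A * norm x * (1 / 2) ^ n" 0 "norm (\<delta> x)"] bound[OF that]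
      by (simp add: power_divide)
    then show ?thesis by simp
  qed
  define h k where "h = b + star b" and "k = \<i> *\<^sub>C (b - star b)"
  have h: "h \<in> RC" "star h = h" unfolding h_def by (auto simp: RC_add RC_star b star_add star_star add.commute)
  have k: "k \<in> RC" unfolding k_def by (intro RC_scaleC RC_diff RC_star b)
  have "star k = (- \<i>) *\<^sub>C (star b - b)" unfolding k_def by (simp add: star_scaleC star_diff star_star)
  also have "\<dots> = k" unfolding k_def by (metis complex_vector.scale_minus_left complex_vector.scale_minus_right minus_diff_eq)
  finally have k': "star k = k" .
  have "b = (1 / 2) *\<^sub>C h + (- \<i> / 2) *\<^sub>C k"
  proof -
    have "(1 / 2) *\<^sub>C h + (- \<i> / 2) *\<^sub>C k = (1 / 2) *\<^sub>C (b + star b) + (1 / 2) *\<^sub>C (b - star b)"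
      unfolding h_def k_def by (simp add: scaleC_scaleC)
    also have "\<dots> = (1 / 2) *\<^sub>C b + (1 / 2) *\<^sub>C b"
      by (simp add: scaleC_add_right complex_vector.scale_right_diff_distrib)
    also have "\<dots> = b" by (simp flip: scaleC_add_left add: scaleC_one)
    finally show ?thesis by simp
  qed
  then have "\<delta> b = (1 / 2) *\<^sub>C \<delta> h + (- \<i> / 2) *\<^sub>C \<delta> k"
    by (metis add scale RC_scaleC h(1) k)
  then show ?thesis unfolding sa0[OF h] sa0[OF k k'] by (simp add: \<delta>_def complex_vector.scale_zero_right)
qed

end

context rep_fock
begin

section \<open>The lattice of the compressed algebra and reflexivity\<close>

abbreviation compressions :: "('k \<Rightarrow> 'k) set" where
  "compressions \<equiv> {compression MM (ampliation tF X) | X. X \<in> Hardy}"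

lemma compression_apply:
  assumes "X \<in> Hardy" "x \<in> MM"
  shows "compression MM (ampliation tF X) x = proj MM *\<^sub>V F.amp X *\<^sub>V x"
  using assms by (simp add: compression_def orthogonal_projection_eq[OF MM] F.ampliation_eq[OF hardy_adjointable])

lemma compressions_subset: "compressions \<subseteq> Alg_on MM (Lat_on MM compressions)"
proof
  fix T assume T: "T \<in> compressions"
  then obtain X where X: "X \<in> Hardy" "T = compression MM (ampliation tF X)" by blast
  have T_eq: "T x = proj MM *\<^sub>V F.amp X *\<^sub>V x" if "x \<in> MM" for x
    unfolding X(2) by (rule compression_apply[OF X(1) that])
  have "T \<in> bounded_operators_on MM"
    unfolding bounded_operators_on_def
  proof (intro CollectI conjI ballI allI)
    show "T \<in> extensional MM" unfolding X(2) compression_def by simp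
    show "T ` MM \<subseteq> MM" using T_eq proj_mem[OF MM] by auto
    show "T (x + y) = T x + T y" if "x \<in> MM" "y \<in> MM" for x y
      by (simp add: T_eq that complex_vector.subspace_add[OF MM(1)] bop_simps)
    show "T (c *\<^sub>C x) = c *\<^sub>C T x" if "x \<in> MM" for c x
      by (simp add: T_eq that complex_vector.subspace_scale[OF MM(1)] bop_simps)
    show "\<exists>B. \<forall>x\<in>MM. norm (T x) \<le> B * norm x"
    proof (intro exI ballI)
      fix x assume "x \<in> MM"
      then show "norm (T x) \<le> norm (proj MM * F.amp X) * norm x"
        using norm_bop_apply[of "proj MM * F.amp X" x] by (simp add: T_eq bop_apply_simps)
    qed
  qed
  then show "T \<in> Alg_on MM (Lat_on MM compressions)" using T unfolding Alg_on_def Lat_on_def by blast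
qed

lemma Lat_I:
  assumes "N \<subseteq> MM" "csubspace N" "closed N"
    and inv: "\<And>X u. X \<in> F.amp ` Hardy \<Longrightarrow> u \<in> N \<Longrightarrow> proj MM *\<^sub>V X *\<^sub>V u \<in> N"
  shows "N \<in> Lat_on MM compressions"
  unfolding Lat_on_def
proof (intro CollectI conjI assms(1-3) ballI)
  fix T assume "T \<in> compressions"
  then obtain X where X: "X \<in> Hardy" "T = compression MM (ampliation tF X)" by blast
  show "T ` N \<subseteq> N"
  proof
    fix y assume "y \<in> T ` N"
    then obtain u where u: "u \<in> N" "y = T u" by blast
    have "T u = proj MM *\<^sub>V F.amp X *\<^sub>V u"
      unfolding X(2) by (rule compression_apply[OF X(1)]) (use u assms(1) in blast)
    then show "y \<in> N" using inv[OF imageI[OF X(1)] u(1)] u(2) by simp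
  qed
qed

lemma Alg_on_bop:
  fixes T :: "'k \<Rightarrow> 'k"
  assumes T: "T \<in> Alg_on MM \<L>"
  obtains A :: "'k bop" where "A * proj MM = A" "\<And>x. A *\<^sub>V x \<in> MM" "\<And>x. x \<in> MM \<Longrightarrow> A *\<^sub>V x = T x"
proof -
  have T': "T ` MM \<subseteq> MM" "\<And>x y. x \<in> MM \<Longrightarrow> y \<in> MM \<Longrightarrow> T (x + y) = T x + T y"
    "\<And>c x. x \<in> MM \<Longrightarrow> T (c *\<^sub>C x) = c *\<^sub>C T x"
    using T unfolding Alg_on_def bounded_operators_on_def by auto
  obtain B where B: "\<And>x. x \<in> MM \<Longrightarrow> norm (T x) \<le> B * norm x"
    using T unfolding Alg_on_def bounded_operators_on_def by blast
  note p = proj_mem[OF MM]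
  have bc: "bounded_clinear (\<lambda>x. T (proj MM *\<^sub>V x))"
  proof (rule bounded_clinearI[where K = "\<bar>B\<bar> * norm (proj MM)"])
    fix x
    have "norm (T (proj MM *\<^sub>V x)) \<le> \<bar>B\<bar> * norm (proj MM *\<^sub>V x)"
      by (rule order_trans[OF B[OF p] mult_right_mono]) auto
    also have "\<dots> \<le> \<bar>B\<bar> * (norm (proj MM) * norm x)" by (intro mult_left_mono norm_bop_apply) simp
    finally show "norm (T (proj MM *\<^sub>V x)) \<le> \<bar>B\<bar> * norm (proj MM) * norm x" by (simp only: mult.assoc)
  qed (simp_all add: bop_simps T' p)
  show ?thesis
  proof (rule that[of "Bop (\<lambda>x. T (proj MM *\<^sub>V x))"])
    show "Bop (\<lambda>x. T (proj MM *\<^sub>V x)) * proj MM = Bop (\<lambda>x. T (proj MM *\<^sub>V x))"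
      by (rule bop_ext) (simp add: bop_apply_simps Bop_apply[OF bc] proj_eq[OF MM p])
    show "Bop (\<lambda>x. T (proj MM *\<^sub>V x)) *\<^sub>V x \<in> MM" for x unfolding Bop_apply[OF bc] using T'(1) p by blast
    show "Bop (\<lambda>x. T (proj MM *\<^sub>V x)) *\<^sub>V x = T x" if "x \<in> MM" for x
      unfolding Bop_apply[OF bc] proj_eq[OF MM that] ..
  qed
qed

lemma cB_proj_MM: "b \<in> RC \<Longrightarrow> F.cB b * proj MM = proj MM * F.cB b"
  by (rule proj_commute[OF MM]) (auto intro: cB_MM RC_star simp flip: F.cB_star)

text \<open>I \<otimes> b commutes with the Hardy algebra and with the projection onto
  \<open>MM\<close>. Taken for a projection and for its complement, these kernels split
  \<open>MM\<close> into two invariant parts.\<close>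

lemma Lat_cB:
  assumes b: "b \<in> RC"
  shows "{u \<in> MM. F.cB b *\<^sub>V u = 0} \<in> Lat_on MM compressions"
proof (rule Lat_I)
  have eq: "{u \<in> MM. F.cB b *\<^sub>V u = 0} = MM \<inter> {u. F.cB b *\<^sub>V u \<in> {0}}" by blast
  have z: "csubspace {0 :: 'k}" "closed {0 :: 'k}" by (simp_all add: complex_vector.subspace_single_0)
  show "csubspace {u \<in> MM. F.cB b *\<^sub>V u = 0}"
    unfolding eq by (intro complex_vector.subspace_inter MM(1) bop_image_closed(1)[OF z])
  show "closed {u \<in> MM. F.cB b *\<^sub>V u = 0}" unfolding eq by (intro closed_Int MM(2) bop_image_closed(2)[OF z])
  fix X u assume X: "X \<in> F.amp ` Hardy" and u: "u \<in> {u \<in> MM. F.cB b *\<^sub>V u = 0}"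
  have "F.cB b *\<^sub>V proj MM *\<^sub>V X *\<^sub>V u = proj MM *\<^sub>V X *\<^sub>V F.cB b *\<^sub>V u"
    unfolding bop_commute_apply[OF cB_proj_MM[OF b]] bop_commute_apply[OF hardy_amp_commute[OF X b]] ..
  then show "proj MM *\<^sub>V X *\<^sub>V u \<in> {u \<in> MM. F.cB b *\<^sub>V u = 0}" using u proj_mem[OF MM] by (simp add: bop_simps)
qed blast

text \<open>Adjoints of Hardy operators preserve the eigenspace, because they commute with the right
  annihilators and with I \<otimes> b. The eigenspace lies in \<open>MM\<close>, so the projection
  onto \<open>MM\<close> may be dropped in inner products with it.\<close>

lemma Lat_eigen:
  assumes \<eta>: "\<eta> \<in> dual" "norm (Rd \<eta>) < 1"
  shows "{x \<in> MM. \<forall>u\<in>eigen \<eta>. cinner u x = 0} \<in> Lat_on MM compressions"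
proof (rule Lat_I)
  have eq: "{x \<in> MM. \<forall>u\<in>eigen \<eta>. cinner u x = 0} = MM \<inter> {x. \<forall>u\<in>eigen \<eta>. cinner u x = 0}" by blast
  show "csubspace {x \<in> MM. \<forall>u\<in>eigen \<eta>. cinner u x = 0}"
    unfolding eq by (intro complex_vector.subspace_inter MM(1) csubspace_cinner_zero)
  show "closed {x \<in> MM. \<forall>u\<in>eigen \<eta>. cinner u x = 0}" unfolding eq by (intro closed_Int MM(2) closed_orthogonal)
  fix X x assume X: "X \<in> F.amp ` Hardy" and x: "x \<in> {x \<in> MM. \<forall>u\<in>eigen \<eta>. cinner u x = 0}"
  have aX: "analytic X" using X hardy_analytic by blast
  have "cinner u (proj MM *\<^sub>V X *\<^sub>V x) = 0" if u: "u \<in> eigen \<eta>" for u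
  proof -
    have "star X *\<^sub>V u \<in> eigen \<eta>"
      unfolding eigen_def
    proof (intro CollectI ballI)
      fix \<zeta> assume \<zeta>: "\<zeta> \<in> dual"
      have 1: "star (Rd \<zeta>) * star X = star X * star (Rd \<zeta>)"
        using arg_cong[where f = star, OF analyticD[OF aX \<zeta>]] by (simp add: star_mult)
      have 2: "star X * F.cB (dip \<zeta> \<eta>) = F.cB (dip \<zeta> \<eta>) * star X"
        using arg_cong[where f = star, OF hardy_amp_commute[OF X RC_star[OF dip_RC[OF \<zeta> \<eta>(1)]]]]
        by (simp add: star_mult F.cB_star dip_RC[OF \<zeta> \<eta>(1)] star_star)
      have "star (Rd \<zeta>) *\<^sub>V star X *\<^sub>V u = star X *\<^sub>V star (Rd \<zeta>) *\<^sub>V u" by (rule bop_commute_apply[OF 1])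
      also have "star (Rd \<zeta>) *\<^sub>V u = F.cB (dip \<zeta> \<eta>) *\<^sub>V u" using u \<zeta> unfolding eigen_def by blast
      finally show "star (Rd \<zeta>) *\<^sub>V star X *\<^sub>V u = F.cB (dip \<zeta> \<eta>) *\<^sub>V star X *\<^sub>V u"
        unfolding bop_commute_apply[OF 2] .
    qed
    then have "cinner (star X *\<^sub>V u) x = 0" using x by blast
    moreover have "cinner u (proj MM *\<^sub>V X *\<^sub>V x) = cinner u (X *\<^sub>V x)"
      using cinner_star_bop[of "proj MM" u "X *\<^sub>V x"] unfolding star_proj[OF MM] proj_eq[OF MM eigen_MM[OF \<eta> u]] by simp
    ultimately show ?thesis by (simp add: cinner_star_bop)
  qed
  then show "proj MM *\<^sub>V X *\<^sub>V x \<in> {x \<in> MM. \<forall>u\<in>eigen \<eta>. cinner u x = 0}" using proj_mem[OF MM] by simp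
qed blast

lemma eigen_closed:
  assumes "\<eta> \<in> dual"
  shows "csubspace (eigen \<eta>)" "closed (eigen \<eta>)"
proof -
  have eq: "eigen \<eta> = {u. (1 - Rd \<eta>) *\<^sub>V u \<in> KS 0}" using eigen_iff[OF assms] by (auto simp: bop_apply_simps)
  show "csubspace (eigen \<eta>)" "closed (eigen \<eta>)" unfolding eq by (rule bop_image_closed[OF KS])+
qed

theorem reflexive_MM: "reflexive_on MM compressions"
  unfolding reflexive_on_def
proof (intro equalityI compressions_subset subsetI)
  fix T assume T: "T \<in> Alg_on MM (Lat_on MM compressions)"
  obtain A :: "'k bop" where A: "A * proj MM = A" "\<And>x. A *\<^sub>V x \<in> MM" "\<And>x. x \<in> MM \<Longrightarrow> A *\<^sub>V x = T x"
    by (rule Alg_on_bop[OF T]) blast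
  have inv: "A *\<^sub>V x \<in> N" if N: "N \<in> Lat_on MM compressions" and x: "x \<in> N" for N x
  proof -
    have "x \<in> MM" using N x unfolding Lat_on_def by blast
    then show ?thesis using T N x A(3) unfolding Alg_on_def by auto
  qed
  have comm_q: "A * F.cB q = F.cB q * A" if q: "q \<in> RC" "q * q = q" "star q = q" for q
  proof -
    have q': "1 - q \<in> RC" by (rule RC_diff[OF RC_one q(1)])
    have qq: "F.cB q * F.cB q = F.cB q" by (simp add: q(2) flip: F.cB_mult[OF q(1) q(1)])
    have c1: "F.cB (1 - q) = 1 - F.cB q" by (simp add: F.cB_diff[OF RC_one q(1)] F.cB_one)
    \<comment> \<open>\<open>u1\<close> and \<open>u0\<close> are the parts of \<open>u\<close> in
      the kernels of I \<otimes> (1 - q) and I \<otimes> q. Both kernels are in the lattice, so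
      \<open>A\<close> respects the decomposition.\<close>
    have on_MM: "A *\<^sub>V F.cB q *\<^sub>V u = F.cB q *\<^sub>V A *\<^sub>V u" if u: "u \<in> MM" for u
    proof -
      define u1 u0 where "u1 = F.cB q *\<^sub>V u" and "u0 = F.cB (1 - q) *\<^sub>V u"
      have u10: "u1 \<in> MM" "u0 \<in> MM" unfolding u1_def u0_def by (intro cB_MM q(1) q' u)+
      have cq: "F.cB q *\<^sub>V F.cB q *\<^sub>V u = F.cB q *\<^sub>V u" using qq by (metis bop_apply_simps(6))
      have "F.cB (1 - q) *\<^sub>V u1 = 0" "F.cB q *\<^sub>V u0 = 0" unfolding u1_def u0_def c1 by (simp_all add: bop_apply_simps bop_simps cq)
      then have "F.cB (1 - q) *\<^sub>V A *\<^sub>V u1 = 0" "F.cB q *\<^sub>V A *\<^sub>V u0 = 0"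
        using inv[OF Lat_cB[OF q'], of u1] inv[OF Lat_cB[OF q(1)], of u0] u10 by auto
      then have "F.cB q *\<^sub>V A *\<^sub>V (u1 + u0) = A *\<^sub>V u1" unfolding c1 by (simp add: bop_apply_simps bop_simps)
      moreover have "u1 + u0 = u" unfolding u1_def u0_def c1 by (simp add: bop_apply_simps)
      ultimately show ?thesis unfolding u1_def by simp
    qed
    show ?thesis
    proof (rule bop_ext)
      fix u
      have "(A * F.cB q) *\<^sub>V u = (A * (proj MM * F.cB q)) *\<^sub>V u" using A(1) by (simp flip: mult.assoc)
      also have "\<dots> = F.cB q *\<^sub>V A *\<^sub>V proj MM *\<^sub>V u"
        unfolding cB_proj_MM[OF q(1), symmetric] using on_MM[OF proj_mem[OF MM], of u] by (simp add: bop_apply_simps)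
      also have "A *\<^sub>V proj MM *\<^sub>V u = A *\<^sub>V u" using A(1) by (metis bop_apply_simps(6))
      finally show "(A * F.cB q) *\<^sub>V u = (F.cB q * A) *\<^sub>V u" by (simp add: bop_apply_simps)
    qed
  qed
  have comm: "A * F.cB b = F.cB b * A" if "b \<in> RC" for b by (rule commute_cB_of_projections[OF comm_q that])
  define Z where "Z = star A"
  have Z_MM: "Z *\<^sub>V u \<in> MM" for u
  proof -
    have "proj MM * Z = Z" unfolding Z_def using arg_cong[where f = star, OF A(1)] by (simp add: star_mult star_proj[OF MM])
    then show ?thesis using proj_mem[OF MM, of "Z *\<^sub>V u"] by (metis bop_apply_simps(6))
  qed
  have Z_cB: "Z * F.cB b = F.cB b * Z" if b: "b \<in> RC" for b
    unfolding Z_def using arg_cong[where f = star, OF comm[OF RC_star[OF b]]] by (simp add: star_mult F.cB_star[OF b] star_star)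
  have Z_eigen: "Z *\<^sub>V u \<in> eigen \<eta>" if \<eta>: "\<eta> \<in> dual" "norm (Rd \<eta>) < 1" and u: "u \<in> eigen \<eta>" for \<eta> u
  proof -
    note e = eigen_closed[OF \<eta>(1)]
    \<comment> \<open>\<open>A\<close> preserves the complement of the eigenspace in
      \<open>MM\<close>. For the component \<open>x\<close> of Z u in that complement, <Z u, x> =
      <u, A x> = 0, and therefore \<open>x\<close> vanishes.\<close>
    define y where "y = proj (eigen \<eta>) *\<^sub>V Z *\<^sub>V u"
    have y: "y \<in> eigen \<eta>" unfolding y_def by (rule proj_mem[OF e])
    define x where "x = Z *\<^sub>V u - y"
    have xN: "x \<in> {x \<in> MM. \<forall>u\<in>eigen \<eta>. cinner u x = 0}"
      using proj_orthogonal[OF e, of _ "Z *\<^sub>V u"] complex_vector.subspace_diff[OF MM(1) Z_MM eigen_MM[OF \<eta> y]]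
      unfolding x_def y_def by blast
    have "cinner u (A *\<^sub>V x) = 0" using inv[OF Lat_eigen[OF \<eta>] xN] u by blast
    then have "cinner (Z *\<^sub>V u) x = 0" unfolding Z_def cinner_star_bop .
    moreover have "cinner y x = 0" using xN y by blast
    ultimately have "cinner x x = 0" by (metis x_def cinner_diff_left diff_zero)
    then show ?thesis using y unfolding x_def by (simp add: cinner_eq_zero_iff)
  qed
  have "intertwines MM Z"
    unfolding intertwines_def
  proof (intro conjI ballI Z_MM bop_commute_apply[OF Z_cB])
    fix \<zeta> u assume \<zeta>: "\<zeta> \<in> dual" and u: "u \<in> MM"
    have "(Z * star (Rd \<zeta>) - star (Rd \<zeta>) * Z) *\<^sub>V u = 0"
    proof (rule eigen_total[OF _ u])
      fix \<eta> u assume \<eta>: "\<eta> \<in> dual" "norm (Rd \<eta>) < 1" and u: "u \<in> eigen \<eta>"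
      have "star (Rd \<zeta>) *\<^sub>V u = F.cB (dip \<zeta> \<eta>) *\<^sub>V u" "star (Rd \<zeta>) *\<^sub>V Z *\<^sub>V u = F.cB (dip \<zeta> \<eta>) *\<^sub>V Z *\<^sub>V u"
        using u Z_eigen[OF \<eta> u] \<zeta> unfolding eigen_def by blast+
      then show "(Z * star (Rd \<zeta>) - star (Rd \<zeta>) * Z) *\<^sub>V u = 0"
        by (simp add: bop_apply_simps bop_commute_apply[OF Z_cB[OF dip_RC[OF \<zeta> \<eta>(1)]]])
    qed
    then show "Z *\<^sub>V star (Rd \<zeta>) *\<^sub>V u = star (Rd \<zeta>) *\<^sub>V Z *\<^sub>V u" by (simp add: bop_apply_simps)
  qed
  from lift_operator[OF coinvariant_MM this]
  obtain Y where Y: "\<And>u. u \<in> MM \<Longrightarrow> Y *\<^sub>V u = Z *\<^sub>V u" "\<And>b. b \<in> RC \<Longrightarrow> Y * F.cB b = F.cB b * Y"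
    "\<And>w. w \<in> dual \<Longrightarrow> Y * star (Rd w) = star (Rd w) * Y" by blast
  have "analytic (star Y)"
    unfolding analytic_def
  proof
    fix w assume "w \<in> dual"
    from arg_cong[where f = star, OF Y(3)[OF this]] show "star Y * Rd w = Rd w * star Y" by (simp add: star_mult star_star)
  qed
  moreover have "star Y * F.cB b = F.cB b * star Y" if b: "b \<in> RC" for b
    using arg_cong[where f = star, OF Y(2)[OF RC_star[OF b]]] by (simp add: star_mult F.cB_star[OF b] star_star)
  ultimately have "star Y \<in> F.amp ` Hardy" by (rule analytic_hardy)
  then obtain X where X: "X \<in> Hardy" "F.amp X = star Y" by auto
  have "T x = compression MM (ampliation tF X) x" for x
  proof (cases "x \<in> MM")
    case True
    have "cinner v (A *\<^sub>V x) = cinner v (proj MM *\<^sub>V star Y *\<^sub>V x)" for v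
    proof -
      have p: "proj MM *\<^sub>V A *\<^sub>V x = A *\<^sub>V x" by (rule proj_eq[OF MM A(2)])
      have "cinner v (proj MM *\<^sub>V star Y *\<^sub>V x) = cinner (Y *\<^sub>V proj MM *\<^sub>V v) x"
        using cinner_star_bop[of "proj MM" v "star Y *\<^sub>V x"] by (simp add: star_proj[OF MM] cinner_star_bop_right)
      also have "\<dots> = cinner (proj MM *\<^sub>V v) (A *\<^sub>V x)" unfolding Y(1)[OF proj_mem[OF MM]] Z_def by (rule cinner_star_bop)
      also have "\<dots> = cinner v (A *\<^sub>V x)"
        using cinner_star_bop[of "proj MM" v "A *\<^sub>V x"] by (simp add: star_proj[OF MM] p)
      finally show ?thesis by simp
    qed
    then have "A *\<^sub>V x = proj MM *\<^sub>V star Y *\<^sub>V x" by (rule cinner_ext)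
    then show ?thesis unfolding compression_apply[OF X(1) True] X(2) using A(3)[OF True] by simp
  next
    case False
    have "T \<in> extensional MM" using T unfolding Alg_on_def bounded_operators_on_def by blast
    then show ?thesis using False by (simp add: compression_def extensional_def)
  qed
  then have "T = compression MM (ampliation tF X)" by blast
  then show "T \<in> compressions" using X(1) by blast
qed

end

theorem theorem4p4:
  fixes P :: "('m::cstar_algebra \<Rightarrow> complex) set"
    and ipE :: "'e::cbanach \<Rightarrow> 'e \<Rightarrow> 'm" and actE :: "'e \<Rightarrow> 'm \<Rightarrow> 'e" and \<phi> :: "'m \<Rightarrow> 'e \<Rightarrow> 'e"
    and ipF :: "'f::cbanach \<Rightarrow> 'f \<Rightarrow> 'm" and actF :: "'f \<Rightarrow> 'm \<Rightarrow> 'f" and \<phi>F :: "'m \<Rightarrow> 'f \<Rightarrow> 'f"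
    and vac :: "'m \<Rightarrow> 'f" and ten :: "'e \<Rightarrow> 'f \<Rightarrow> 'f"
    and \<pi> :: "'m \<Rightarrow> 'h::chilbert_space \<Rightarrow> 'h"
    and tE :: "'e \<Rightarrow> 'h \<Rightarrow> 'p::chilbert_space"
    and tF :: "'f \<Rightarrow> 'h \<Rightarrow> 'k::chilbert_space"
  assumes "wstar_algebra P"
    and "wstar_correspondence P ipE actE \<phi>"
    and "fock_space P ipE \<phi> ipF actF \<phi>F vac ten"
    and "normal_representation P \<pi>" and "inj \<pi>"
    and "induced_space ipE \<pi> tE"
    and "induced_space ipF \<pi> tF"
  defines "\<MM> \<equiv> symmetric_subspace \<phi> \<pi> vac ten tE tF"
  shows "reflexive_on \<MM>
    {compression \<MM> (ampliation tF X) | X. X \<in> hardy_algebra P ipF \<phi>F ten}"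
proof -
  note ax = wstar_correspondence.axioms(1)[OF assms(2)] wstar_correspondence.axioms(1)[OF fock_space.axioms(1)[OF assms(3)]]
  interpret rep_fock P \<pi> ipE actE \<phi> ipF actF \<phi>F vac ten tE tF
    by (intro rep_fock.intro rep_correspondence.intro rep_module.intro faithful_representation.intro
        faithful_representation_axioms.intro assms ax fock_space.axioms(1)[OF assms(3)])
  show ?thesis unfolding assms(8) symmetric_subspace_eq by (rule reflexive_MM)
qed

end
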